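(* Let $N\in\mathbb{N}$, let $C(\mathbb{P}^N(\mathcal{T}))\subset\prod_{i=0}^N\mathcal{T}^{\otimes N}$ be the C*-algebra of the Toeplitz quantum projective space, and let $$\pi_i\colon C(\mathbb{P}^N(\mathcal{T}))\longrightarrow\mathcal{T}^{\otimes N},\qquad i\in\{0,\ldots,N\},$$ be the restrictions to $C(\mathbb{P}^N(\mathcal{T}))$ of the canonical projections onto the components. Then the family of ideals $\{\ker\pi_i\}_{i\in\{0,\ldots,N\}}$ generates a free distributive lattice (with respect to the operations of sum and intersection of ideals).
   Context: All tensor products are completed tensor products of (nuclear) C*-algebras; $\mathcal{T}^{\otimes 0}=\mathbb{C}$. **Toeplitz algebra.** $\mathcal{T}$ is the universal unital C*-algebra generated by $z,z^*$ with $z^*z=1$. Let $u$ be the standard unitary generator of $C(S^1)$, $S^1=U(1)$. The symbol map $\sigma:\mathcal{T}\to C(S^1)$ is the surjective $*$-homomorphism with $\sigma(z)=u$; its kernel is the algebra $\mathcal{K}$ of compact operators. **Coaction.** Let $S:C(S^1)\to C(S^1)$ be the $*$-homomorphism with $S(u)=u^{-1}$, i.e. $S(f)(\lambda)=f(\lambda^{-1})$, and let $m:C(S^1)\otimes C(S^1)\to C(S^1)$ be the multiplication. Let $\rho:\mathcal{T}\to\mathcal{T}\otimes C(S^1)$ be the unital $*$-homomorphism with $\rho(z)=z\otimes u$. Let $\tau_n:C(S^1)\otimes\mathcal{T}^{\otimes n}\to\mathcal{T}^{\otimes n}\otimes C(S^1)$ be the flip $f\otimes t_1\otimes\cdots\otimes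 t_n\mapsto t_1\otimes\cdots\otimes t_n\otimes f$. The diagonal coactions $\rho_n:\mathcal{T}^{\otimes n}\to\mathcal{T}^{\otimes n}\otimes C(S^1)$ are defined inductively by $\rho_1=\rho$ and $$\rho_{n+1}=(\mathrm{id}_{\mathcal{T}^{\otimes(n+1)}}\otimes m)\circ(\mathrm{id}_{\mathcal{T}}\otimes\tau_n\otimes\mathrm{id}_{C(S^1)})\circ(\rho\otimes\rho_n),$$ with $\rho_0:\mathbb{C}\to C(S^1)$, $1\mapsto 1$. **Gluing maps.** For $N\geq1$ put $$\Psi:=(\mathrm{id}_{\mathcal{T}^{\otimes(N-1)}}\otimes(S\circ m))\circ(\rho_{N-1}\otimes\mathrm{id}_{C(S^1)}):\mathcal{T}^{\otimes(N-1)}\otimes C(S^1)\to\mathcal{T}^{\otimes(N-1)}\otimes C(S^1),$$ $$\chi_j:=\mathrm{id}_{\mathcal{T}^{\otimes(j-1)}}\otimes\tau_{N-j}^{-1}:\mathcal{T}^{\otimes(N-1)}\otimes C(S^1)\to\mathcal{T}^{\otimes(j-1)}\otimes C(S^1)\otimes\mathcal{T}^{\otimes(N-j)},\quad 1\le j\le N,$$ and, for $0\le i<j\le N$, $\Psi_{ij}:=\chi_j\circ\Psi\circ\chi_{i+1}^{-1}:\mathcal{T}^{\otimes i}\otimes C(S^1)\otimes\mathcal{T}^{\otimes(N-i-1)}\to\mathcal{T}^{\otimes(j-1)}\otimes C(S^1)\otimes\mathcal{T}^{\otimes(N-j)}$. For $k\in\{1,\ldots,N\}$ put $\sigma_k:=\mathrm{id}_{\mathcal{T}^{\otimes(k-1)}}\otimes\sigma\otimes\mathrm{id}_{\mathcal{T}^{\otimes(N-k)}}$.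 **The algebra.** $C(\mathbb{P}^N(\mathcal{T}))$ is the multipullback C*-algebra $$C(\mathbb{P}^N(\mathcal{T})):=\Big\{(t_0,\ldots,t_N)\in\prod_{i=0}^N\mathcal{T}^{\otimes N}\ \Big|\ \sigma_j(t_i)=\Psi_{ij}(\sigma_{i+1}(t_j))\ \text{ for all } 0\le i<j\le N\Big\}.$$ **Lattices.** The lattice generated by the ideals $\ker\pi_i$ is the smallest family of closed two-sided ideals of $C(\mathbb{P}^N(\mathcal{T}))$ containing all $\ker\pi_i$ and closed under binary sums and binary intersections (sum is the meet, intersection is the join; it is automatically distributive). A distributive lattice $\Lambda$ generated by elements $\lambda_0,\ldots,\lambda_N$ is free (on these generators) if for every distributive lattice $L$ and all $l_0,\ldots,l_N\in L$ there is a lattice homomorphism $\Lambda\to L$ with $\lambda_i\mapsto l_i$ for all $i$; lattices are not required to have a top or bottom, and homomorphisms preserve only binary joins and meets. Equivalently, $\Lambda$ is (via its generators) the lattice of non-empty upper sets of the poset of non-empty subsets of $\{0,\ldots,N\}$ ordered by inclusion. *)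

theory Defs
  imports "HOL-Analysis.Analysis" "HOL-Algebra.QuotRing" "HOL-Algebra.Module"
begin

section \<open>Star-algebras and C*-seminorms\<close>

record 'a star_algebra = "(complex, 'a) module" +
  star :: "'a \<Rightarrow> 'a"

record 'a cstar = "'a star_algebra" +
  cnorm :: "'a \<Rightarrow> real"

text \<open>Unital star-homomorphisms; \<open>ring_hom\<close> already requires preservation of the unit.
  Continuity is automatic between C*-algebras.\<close>

definition star_hom ::
    "('a, 'm) star_algebra_scheme \<Rightarrow> ('b, 'n) star_algebra_scheme \<Rightarrow> ('a \<Rightarrow> 'b) set" where
  "star_hom A B = {h \<in> ring_hom A B.
     (\<forall>c. \<forall>x\<in>carrier A. h (c \<odot>\<^bsub>A\<^esub> x) = c \<odot>\<^bsub>B\<^esub> h x) \<and>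
     (\<forall>x\<in>carrier A. h (star A x) = star B (h x))}"

definition cstar_seminorm :: "('a, 'm) star_algebra_scheme \<Rightarrow> ('a \<Rightarrow> real) \<Rightarrow> bool" where
  "cstar_seminorm P p \<longleftrightarrow>
     (\<forall>x\<in>carrier P. 0 \<le> p x) \<and>
     (\<forall>x\<in>carrier P. \<forall>y\<in>carrier P. p (x \<oplus>\<^bsub>P\<^esub> y) \<le> p x + p y) \<and>
     (\<forall>c. \<forall>x\<in>carrier P. p (c \<odot>\<^bsub>P\<^esub> x) = cmod c * p x) \<and>
     (\<forall>x\<in>carrier P. \<forall>y\<in>carrier P. p (x \<otimes>\<^bsub>P\<^esub> y) \<le> p x * p y) \<and>
     (\<forall>x\<in>carrier P. p (star P x \<otimes>\<^bsub>P\<^esub> x) = (p x)\<^sup>2)"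

text \<open>The largest C*-seminorm on \<open>P\<close> annihilating the relators \<open>R\<close>. As the null space of a
  C*-seminorm is a star-ideal, the seminorms considered here are exactly those of the quotient of
  \<open>P\<close> by the star-ideal generated by \<open>R\<close>.\<close>

definition env_seminorm :: "('a, 'm) star_algebra_scheme \<Rightarrow> 'a set \<Rightarrow> 'a \<Rightarrow> real" where
  "env_seminorm P R x = (SUP p \<in> {p. cstar_seminorm P p \<and> (\<forall>r\<in>R. p r = 0)}. p x)"

subsection \<open>Separated completion\<close>

definition cauchy_algebra ::
    "('a, 'm) star_algebra_scheme \<Rightarrow> ('a \<Rightarrow> real) \<Rightarrow> (nat \<Rightarrow> 'a) star_algebra" where
  "cauchy_algebra P p =
     \<lparr>carrier = {s. (\<forall>n. s n \<in> carrier P) \<and>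
        (\<forall>e>0. \<exists>K. \<forall>m\<ge>K. \<forall>n\<ge>K. p (s m \<ominus>\<^bsub>P\<^esub> s n) < e)},
      monoid.mult = (\<lambda>s t n. s n \<otimes>\<^bsub>P\<^esub> t n), one = (\<lambda>n. \<one>\<^bsub>P\<^esub>),
      zero = (\<lambda>n. \<zero>\<^bsub>P\<^esub>), add = (\<lambda>s t n. s n \<oplus>\<^bsub>P\<^esub> t n),
      smult = (\<lambda>c s n. c \<odot>\<^bsub>P\<^esub> s n), star = (\<lambda>s n. star P (s n))\<rparr>"

definition null_sequences ::
    "('a, 'm) star_algebra_scheme \<Rightarrow> ('a \<Rightarrow> real) \<Rightarrow> (nat \<Rightarrow> 'a) set" where
  "null_sequences P p =
     {s \<in> carrier (cauchy_algebra P p). (\<lambda>n. p (s n)) \<longlonglongrightarrow> 0}"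

definition completion ::
    "('a, 'm) star_algebra_scheme \<Rightarrow> ('a \<Rightarrow> real) \<Rightarrow> (nat \<Rightarrow> 'a) set cstar" where
  "completion P p =
     (let Q = cauchy_algebra P p; I = null_sequences P p in
      \<lparr>carrier = carrier (Q Quot I), monoid.mult = monoid.mult (Q Quot I), one = \<one>\<^bsub>Q Quot I\<^esub>,
       zero = \<zero>\<^bsub>Q Quot I\<^esub>, add = add (Q Quot I),
       smult = (\<lambda>c X. \<Union>s\<in>X. I +>\<^bsub>Q\<^esub> (c \<odot>\<^bsub>Q\<^esub> s)),
       star = (\<lambda>X. \<Union>s\<in>X. I +>\<^bsub>Q\<^esub> star Q s),
       cnorm = (\<lambda>X. THE r. \<forall>s\<in>X. (\<lambda>n. p (s n)) \<longlonglongrightarrow> r)\<rparr>)"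

definition completion_of ::
    "('a, 'm) star_algebra_scheme \<Rightarrow> ('a \<Rightarrow> real) \<Rightarrow> 'a \<Rightarrow> (nat \<Rightarrow> 'a) set" where
  "completion_of P p x = null_sequences P p +>\<^bsub>cauchy_algebra P p\<^esub> (\<lambda>n. x)"

text \<open>The enveloping C*-algebra of the star-algebra with generators \<open>P\<close> and relators \<open>R\<close>, and the
  canonical map from \<open>P\<close>.\<close>

definition cstar_env :: "('a, 'm) star_algebra_scheme \<Rightarrow> 'a set \<Rightarrow> (nat \<Rightarrow> 'a) set cstar" where
  "cstar_env P R = completion P (env_seminorm P R)"

definition env_of :: "('a, 'm) star_algebra_scheme \<Rightarrow> 'a set \<Rightarrow> 'a \<Rightarrow> (nat \<Rightarrow> 'a) set" where
  "env_of P R = completion_of P (env_seminorm P R)"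

subsection \<open>The star-algebra of a monoid with involution\<close>

record 'a star_monoid = "'a monoid" +
  invol :: "'a \<Rightarrow> 'a"

definition delta :: "'a \<Rightarrow> 'a \<Rightarrow> complex" where
  "delta a = (\<lambda>b. if b = a then 1 else 0)"

definition monoid_algebra :: "'a star_monoid \<Rightarrow> ('a \<Rightarrow> complex) star_algebra" where
  "monoid_algebra M =
     \<lparr>carrier = {f. finite {m. f m \<noteq> 0} \<and> {m. f m \<noteq> 0} \<subseteq> carrier M},
      monoid.mult = (\<lambda>f g m. \<Sum>(a, b) \<in> {(a, b). f a \<noteq> 0 \<and> g b \<noteq> 0 \<and> a \<otimes>\<^bsub>M\<^esub> b = m}. f a * g b),
      one = delta \<one>\<^bsub>M\<^esub>,
      zero = (\<lambda>m. 0), add = (\<lambda>f g m. f m + g m), smult = (\<lambda>c f m. c * f m),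
      star = (\<lambda>f m. if m \<in> carrier M then cnj (f (invol M m)) else 0)\<rparr>"

section \<open>The Toeplitz algebra and the circle\<close>

datatype letter = Gen | Gen_adj

definition words :: "letter list star_monoid" where
  "words = \<lparr>carrier = UNIV, monoid.mult = (@), one = [],
     invol = (\<lambda>w. rev (map (\<lambda>x. case x of Gen \<Rightarrow> Gen_adj | Gen_adj \<Rightarrow> Gen) w))\<rparr>"

definition isometry_relator :: "(letter list \<Rightarrow> complex) set" where
  "isometry_relator = {\<lambda>w. delta [Gen_adj, Gen] w - delta [] w}"

type_synonym toep = "(nat \<Rightarrow> letter list \<Rightarrow> complex) set"

definition toeplitz :: "toep cstar" where
  "toeplitz = cstar_env (monoid_algebra words) isometry_relator"

definition toeplitz_z :: toep where
  "toeplitz_z = env_of (monoid_algebra words) isometry_relator (delta [Gen])"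

abbreviation circle :: "complex set" where
  "circle \<equiv> sphere 0 1"

definition circle_algebra :: "(complex \<Rightarrow> complex) cstar" where
  "circle_algebra =
     \<lparr>carrier = {f \<in> extensional circle. continuous_on circle f},
      monoid.mult = (\<lambda>f g. \<lambda>x\<in>circle. f x * g x), one = (\<lambda>x\<in>circle. 1),
      zero = (\<lambda>x\<in>circle. 0), add = (\<lambda>f g. \<lambda>x\<in>circle. f x + g x),
      smult = (\<lambda>c f. \<lambda>x\<in>circle. c * f x), star = (\<lambda>f. \<lambda>x\<in>circle. cnj (f x)),
      cnorm = (\<lambda>f. SUP x\<in>circle. cmod (f x))\<rparr>"

definition circle_u :: "complex \<Rightarrow> complex" where
  "circle_u = (\<lambda>x\<in>circle. x)"

text \<open>Tensor words mix factors of both kinds, so both algebras are copied into one sum type.\<close>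

definition copy_along :: "('a \<Rightarrow> 'b) \<Rightarrow> 'a cstar \<Rightarrow> 'b cstar" where
  "copy_along j A =
     \<lparr>carrier = j ` carrier A,
      monoid.mult = (\<lambda>x y. j (inv_into UNIV j x \<otimes>\<^bsub>A\<^esub> inv_into UNIV j y)), one = j \<one>\<^bsub>A\<^esub>,
      zero = j \<zero>\<^bsub>A\<^esub>, add = (\<lambda>x y. j (inv_into UNIV j x \<oplus>\<^bsub>A\<^esub> inv_into UNIV j y)),
      smult = (\<lambda>c x. j (c \<odot>\<^bsub>A\<^esub> inv_into UNIV j x)), star = (\<lambda>x. j (star A (inv_into UNIV j x))),
      cnorm = (\<lambda>x. cnorm A (inv_into UNIV j x))\<rparr>"

type_synonym factor = "toep + (complex \<Rightarrow> complex)"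

definition Toep :: "factor cstar" where
  "Toep = copy_along Inl toeplitz"

definition Circ :: "factor cstar" where
  "Circ = copy_along Inr circle_algebra"

section \<open>Completed tensor products\<close>

text \<open>\<open>tensor [A\<^sub>1, \<dots>, A\<^sub>n]\<close> is the completion of the algebraic tensor product in its largest
  C*-seminorm, i.e.\ the maximal tensor product, which is the only one for nuclear algebras. The
  algebraic tensor product is presented as the star-algebra of the multiplicative monoid
  \<open>A\<^sub>1 \<times> \<dots> \<times> A\<^sub>n\<close> modulo multilinearity. Being \<open>n\<close>-ary, it makes the associativity
  identifications equalities of lists; \<open>tensor []\<close> is a copy of the complex numbers and
  \<open>tensor [A]\<close> a copy of \<open>A\<close>.\<close>

definition prod_monoid :: "'a cstar list \<Rightarrow> 'a list star_monoid" where
  "prod_monoid As =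
     \<lparr>carrier = {as. list_all2 (\<lambda>a A. a \<in> carrier A) as As},
      monoid.mult = (\<lambda>as bs. map (\<lambda>i. as ! i \<otimes>\<^bsub>As ! i\<^esub> bs ! i) [0..<length As]),
      one = map (\<lambda>A. \<one>\<^bsub>A\<^esub>) As,
      invol = (\<lambda>as. map (\<lambda>i. star (As ! i) (as ! i)) [0..<length As])\<rparr>"

definition multilinear_relators :: "'a cstar list \<Rightarrow> ('a list \<Rightarrow> complex) set" where
  "multilinear_relators As =
     {(\<lambda>m. delta (as[i := x \<oplus>\<^bsub>As ! i\<^esub> y]) m - delta (as[i := x]) m - delta (as[i := y]) m)
       | as i x y. as \<in> carrier (prod_monoid As) \<and> i < length As \<and>
           x \<in> carrier (As ! i) \<and> y \<in> carrier (As ! i)} \<union>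
     {(\<lambda>m. delta (as[i := c \<odot>\<^bsub>As ! i\<^esub> x]) m - c * delta (as[i := x]) m)
       | as i c x. as \<in> carrier (prod_monoid As) \<and> i < length As \<and> x \<in> carrier (As ! i)}"

type_synonym 'a tens = "(nat \<Rightarrow> 'a list \<Rightarrow> complex) set"

definition tensor :: "'a cstar list \<Rightarrow> 'a tens cstar" where
  "tensor As = cstar_env (monoid_algebra (prod_monoid As)) (multilinear_relators As)"

definition elem_tensor :: "'a cstar list \<Rightarrow> 'a list \<Rightarrow> 'a tens" where
  "elem_tensor As as =
     env_of (monoid_algebra (prod_monoid As)) (multilinear_relators As) (delta as)"

definition the_hom ::
    "'a cstar list \<Rightarrow> 'a cstar list \<Rightarrow> (('a tens \<Rightarrow> 'a tens) \<Rightarrow> bool) \<Rightarrow> 'a tens \<Rightarrow> 'a tens" where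
  "the_hom As Bs Q = (THE h. h \<in> star_hom (tensor As) (tensor Bs) \<and>
     h \<in> extensional (carrier (tensor As)) \<and> Q h)"

text \<open>The canonical bilinear map from \<open>tensor As\<close> and \<open>tensor Bs\<close> to \<open>tensor (As @ Bs)\<close>:
  \<open>x \<otimes> y = (x \<otimes> 1) (1 \<otimes> y)\<close>.\<close>

definition tensor_join :: "'a cstar list \<Rightarrow> 'a cstar list \<Rightarrow> 'a tens \<Rightarrow> 'a tens \<Rightarrow> 'a tens" where
  "tensor_join As Bs x y =
     the_hom As (As @ Bs) (\<lambda>h. \<forall>as\<in>carrier (prod_monoid As).
       h (elem_tensor As as) = elem_tensor (As @ Bs) (as @ \<one>\<^bsub>prod_monoid Bs\<^esub>)) x
     \<otimes>\<^bsub>tensor (As @ Bs)\<^esub>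
     the_hom Bs (As @ Bs) (\<lambda>h. \<forall>bs\<in>carrier (prod_monoid Bs).
       h (elem_tensor Bs bs) = elem_tensor (As @ Bs) (\<one>\<^bsub>prod_monoid As\<^esub> @ bs)) y"

subsection \<open>Maps between tensor products\<close>

record 'a tmor =
  src :: "'a cstar list"
  tgt :: "'a cstar list"
  app :: "'a tens \<Rightarrow> 'a tens"

definition hom_where ::
    "'a cstar list \<Rightarrow> 'a cstar list \<Rightarrow> (('a tens \<Rightarrow> 'a tens) \<Rightarrow> bool) \<Rightarrow> 'a tmor" where
  "hom_where As Bs Q = \<lparr>src = As, tgt = Bs, app = the_hom As Bs Q\<rparr>"

definition tid :: "'a cstar list \<Rightarrow> 'a tmor" where
  "tid As = \<lparr>src = As, tgt = As, app = (\<lambda>x\<in>carrier (tensor As). x)\<rparr>"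

definition tcomp :: "'a tmor \<Rightarrow> 'a tmor \<Rightarrow> 'a tmor"  (infixr \<open>\<bullet>\<^sub>t\<close> 55) where
  "g \<bullet>\<^sub>t f = \<lparr>src = src f, tgt = tgt g, app = compose (carrier (tensor (src f))) (app g) (app f)\<rparr>"

definition tmap :: "'a tmor \<Rightarrow> 'a tmor \<Rightarrow> 'a tmor"  (infixr \<open>\<otimes>\<^sub>t\<close> 65) where
  "f \<otimes>\<^sub>t g = hom_where (src f @ src g) (tgt f @ tgt g)
     (\<lambda>h. \<forall>x\<in>carrier (tensor (src f)). \<forall>y\<in>carrier (tensor (src g)).
        h (tensor_join (src f) (src g) x y) = tensor_join (tgt f) (tgt g) (app f x) (app g y))"

definition tinv :: "'a tmor \<Rightarrow> 'a tmor" where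
  "tinv f = \<lparr>src = tgt f, tgt = src f,
     app = (\<lambda>y\<in>carrier (tensor (tgt f)). inv_into (carrier (tensor (src f))) (app f) y)\<rparr>"

section \<open>Structure maps of the Toeplitz algebra\<close>

abbreviation Toeps :: "nat \<Rightarrow> factor cstar list" where
  "Toeps n \<equiv> replicate n Toep"

definition sigma :: "factor tmor" where
  "sigma = hom_where [Toep] [Circ]
     (\<lambda>h. h (elem_tensor [Toep] [Inl toeplitz_z]) = elem_tensor [Circ] [Inr circle_u])"

definition coaction :: "factor tmor" where
  "coaction = hom_where [Toep] [Toep, Circ]
     (\<lambda>h. h (elem_tensor [Toep] [Inl toeplitz_z]) =
          elem_tensor [Toep, Circ] [Inl toeplitz_z, Inr circle_u])"

definition antipode :: "factor tmor" where
  "antipode = hom_where [Circ] [Circ]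
     (\<lambda>h. \<forall>f\<in>carrier circle_algebra.
        h (elem_tensor [Circ] [Inr f]) = elem_tensor [Circ] [Inr (\<lambda>x\<in>circle. f (inverse x))])"

definition circ_mult :: "factor tmor" where
  "circ_mult = hom_where [Circ, Circ] [Circ]
     (\<lambda>h. \<forall>f\<in>carrier circle_algebra. \<forall>g\<in>carrier circle_algebra.
        h (elem_tensor [Circ, Circ] [Inr f, Inr g]) =
        elem_tensor [Circ] [Inr (f \<otimes>\<^bsub>circle_algebra\<^esub> g)])"

definition tau :: "nat \<Rightarrow> factor tmor" where
  "tau n = hom_where (Circ # Toeps n) (Toeps n @ [Circ])
     (\<lambda>h. \<forall>f\<in>carrier Circ. \<forall>ts\<in>carrier (prod_monoid (Toeps n)).
        h (elem_tensor (Circ # Toeps n) (f # ts)) = elem_tensor (Toeps n @ [Circ]) (ts @ [f]))"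

fun rho :: "nat \<Rightarrow> factor tmor" where
  "rho 0 = hom_where [] [Circ] (\<lambda>h. h \<one>\<^bsub>tensor []\<^esub> = \<one>\<^bsub>tensor [Circ]\<^esub>)"
| "rho (Suc 0) = coaction"
| "rho (Suc (Suc n)) =
     (tid (Toeps (Suc (Suc n))) \<otimes>\<^sub>t circ_mult) \<bullet>\<^sub>t
     (tid (Toeps 1) \<otimes>\<^sub>t tau (Suc n) \<otimes>\<^sub>t tid [Circ]) \<bullet>\<^sub>t
     (coaction \<otimes>\<^sub>t rho (Suc n))"

section \<open>The Toeplitz quantum projective space\<close>

definition Psi :: "nat \<Rightarrow> factor tmor" where
  "Psi N = (tid (Toeps (N - 1)) \<otimes>\<^sub>t (antipode \<bullet>\<^sub>t circ_mult)) \<bullet>\<^sub>t (rho (N - 1) \<otimes>\<^sub>t tid [Circ])"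

definition chi :: "nat \<Rightarrow> nat \<Rightarrow> factor tmor" where
  "chi N j = tid (Toeps (j - 1)) \<otimes>\<^sub>t tinv (tau (N - j))"

definition Psi_ij :: "nat \<Rightarrow> nat \<Rightarrow> nat \<Rightarrow> factor tmor" where
  "Psi_ij N i j = chi N j \<bullet>\<^sub>t Psi N \<bullet>\<^sub>t tinv (chi N (i + 1))"

definition sigma_k :: "nat \<Rightarrow> nat \<Rightarrow> factor tmor" where
  "sigma_k N k = tid (Toeps (k - 1)) \<otimes>\<^sub>t sigma \<otimes>\<^sub>t tid (Toeps (N - k))"

definition finite_product :: "'i set \<Rightarrow> 'a cstar \<Rightarrow> ('i \<Rightarrow> 'a) cstar" where
  "finite_product I A =
     \<lparr>carrier = I \<rightarrow>\<^sub>E carrier A,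
      monoid.mult = (\<lambda>s t. \<lambda>i\<in>I. s i \<otimes>\<^bsub>A\<^esub> t i), one = (\<lambda>i\<in>I. \<one>\<^bsub>A\<^esub>),
      zero = (\<lambda>i\<in>I. \<zero>\<^bsub>A\<^esub>), add = (\<lambda>s t. \<lambda>i\<in>I. s i \<oplus>\<^bsub>A\<^esub> t i),
      smult = (\<lambda>c s. \<lambda>i\<in>I. c \<odot>\<^bsub>A\<^esub> s i), star = (\<lambda>s. \<lambda>i\<in>I. star A (s i)),
      cnorm = (\<lambda>s. MAX i\<in>I. cnorm A (s i))\<rparr>"

text \<open>For \<open>N = 0\<close> there are no gluing conditions and the algebra is that of the complex numbers.\<close>

definition CP :: "nat \<Rightarrow> (nat \<Rightarrow> factor tens) cstar" where
  "CP N = (finite_product {0..N} (tensor (Toeps N)))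
     \<lparr>carrier := {t \<in> {0..N} \<rightarrow>\<^sub>E carrier (tensor (Toeps N)).
        \<forall>i j. i < j \<and> j \<le> N \<longrightarrow>
          app (sigma_k N j) (t i) = app (Psi_ij N i j) (app (sigma_k N (i + 1)) (t j))}\<rparr>"

definition CP_proj :: "nat \<Rightarrow> nat \<Rightarrow> (nat \<Rightarrow> factor tens) \<Rightarrow> factor tens" where
  "CP_proj N i = (\<lambda>t\<in>carrier (CP N). t i)"

definition ker_proj :: "nat \<Rightarrow> nat \<Rightarrow> (nat \<Rightarrow> factor tens) set" where
  "ker_proj N i = a_kernel (CP N) (tensor (Toeps N)) (CP_proj N i)"

section \<open>Lattices of ideals and free distributive lattices\<close>

definition closed_ideals :: "'a cstar \<Rightarrow> 'a set set" where
  "closed_ideals A = {I. ideal I A \<and>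
     (\<forall>s. \<forall>x\<in>carrier A. (\<forall>n. s n \<in> I) \<and> (\<lambda>n. cnorm A (s n \<ominus>\<^bsub>A\<^esub> x)) \<longlonglongrightarrow> 0 \<longrightarrow> x \<in> I)}"

definition ideal_lattice :: "'a cstar \<Rightarrow> 'a set set \<Rightarrow> 'a set set" where
  "ideal_lattice A G = \<Inter>{F. F \<subseteq> closed_ideals A \<and> G \<subseteq> F \<and>
     (\<forall>I\<in>F. \<forall>J\<in>F. I <+>\<^bsub>A\<^esub> J \<in> F \<and> I \<inter> J \<in> F)}"

text \<open>Distributive lattices with explicit carrier, given by join and meet, without bounds.\<close>

definition distrib_lattice_on :: "'a set \<Rightarrow> ('a \<Rightarrow> 'a \<Rightarrow> 'a) \<Rightarrow> ('a \<Rightarrow> 'a \<Rightarrow> 'a) \<Rightarrow> bool" where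
  "distrib_lattice_on L j m \<longleftrightarrow>
     (\<forall>x\<in>L. \<forall>y\<in>L. j x y \<in> L \<and> m x y \<in> L) \<and>
     (\<forall>x\<in>L. \<forall>y\<in>L. j x y = j y x \<and> m x y = m y x) \<and>
     (\<forall>x\<in>L. \<forall>y\<in>L. \<forall>z\<in>L. j (j x y) z = j x (j y z) \<and> m (m x y) z = m x (m y z)) \<and>
     (\<forall>x\<in>L. \<forall>y\<in>L. j x (m x y) = x \<and> m x (j x y) = x) \<and>
     (\<forall>x\<in>L. \<forall>y\<in>L. \<forall>z\<in>L. m x (j y z) = j (m x y) (m x z) \<and> j x (m y z) = m (j x y) (j x z))"

definition lattice_hom_on ::
    "'a set \<Rightarrow> ('a \<Rightarrow> 'a \<Rightarrow> 'a) \<Rightarrow> ('a \<Rightarrow> 'a \<Rightarrow> 'a) \<Rightarrow>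
     'l set \<Rightarrow> ('l \<Rightarrow> 'l \<Rightarrow> 'l) \<Rightarrow> ('l \<Rightarrow> 'l \<Rightarrow> 'l) \<Rightarrow> ('a \<Rightarrow> 'l) \<Rightarrow> bool" where
  "lattice_hom_on L j m L' j' m' h \<longleftrightarrow> h \<in> L \<rightarrow> L' \<and>
     (\<forall>x\<in>L. \<forall>y\<in>L. h (j x y) = j' (h x) (h y) \<and> h (m x y) = m' (h x) (h y))"

text \<open>The type \<open>'l\<close> is where the test lattices live. It is a parameter because HOL does not
  quantify over types inside a formula; theorems should leave it as a type variable.\<close>

definition free_distrib_lattice_on ::
    "'l itself \<Rightarrow> 'a set \<Rightarrow> ('a \<Rightarrow> 'a \<Rightarrow> 'a) \<Rightarrow> ('a \<Rightarrow> 'a \<Rightarrow> 'a) \<Rightarrow> 'i set \<Rightarrow> ('i \<Rightarrow> 'a) \<Rightarrow> bool" where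
  "free_distrib_lattice_on TYPE('l) L j m I g \<longleftrightarrow>
     distrib_lattice_on L j m \<and>
     g ` I \<subseteq> L \<and>
     (\<forall>M\<subseteq>L. g ` I \<subseteq> M \<and> (\<forall>x\<in>M. \<forall>y\<in>M. j x y \<in> M \<and> m x y \<in> M) \<longrightarrow> M = L) \<and>
     (\<forall>(L' :: 'l set) j' m' l. distrib_lattice_on L' j' m' \<and> l ` I \<subseteq> L' \<longrightarrow>
        (\<exists>h. lattice_hom_on L j m L' j' m' h \<and> (\<forall>i\<in>I. h (g i) = l i)))"

end

theory Submission
  imports Defs
begin

text \<open>Closed ideals of a C*-algebra are stable under sums and form a distributive lattice: both follow
  from approximate units, obtained here by a fixed point argument. For freeness it suffices to detect,
  for each non-empty \<open>S \<subseteq> {0..N}\<close>, membership of \<open>S\<close> in the upper set belonging to an ideal. Let \<open>e\<close> be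
  the rank-one projection \<open>1 - z z\<^sup>*\<close>, which the symbol map kills, and let \<open>v\<close> be the element whose
  \<open>j\<close>-th component, for \<open>j \<in> S\<close>, is the elementary tensor with \<open>e\<close> in the slots labelled by
  coordinates outside \<open>S\<close> and \<open>1\<close> elsewhere, the other components being \<open>0\<close>. As \<open>1\<close> and \<open>e\<close> are
  gauge invariant, \<open>v\<close> satisfies the gluing conditions, and \<open>v \<in> ker \<pi>\<^sub>i\<close> for \<open>i \<notin> S\<close>. On the component
  of the least element of \<open>S\<close>, evaluate the symbol at \<open>1\<close> in the slots labelled by \<open>S\<close> and represent the
  other slots by commuting shifts: the gluing conditions make the resulting homomorphism vanish on
  \<open>ker \<pi>\<^sub>j\<close> for \<open>j \<in> S\<close>, while the vacuum vector shows that it does not vanish on \<open>v\<close>. By induction over the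
  lattice, every ideal \<open>K\<close> in it either is annihilated by this homomorphism or contains \<open>v\<close>, and not
  both; hence annihilation turns intersections into disjunctions and sums into conjunctions.\<close>

section \<open>C*-algebras\<close>

text \<open>Each structure map is described as the unique homomorphism with prescribed values, so
  nothing can be evaluated before existence, from a universal property, and uniqueness, from
  generating elements, are settled. Uniqueness rests on continuity of star-homomorphisms. A bound by
  twice the norm is enough for it, and this bound comes from exhibiting a small self-adjoint
  \<open>h\<close> as the real part of the unitary \<open>h + i s\<close>, where \<open>s\<close>
  solves \<open>s^2 = 1 - h^2\<close> and is found as a fixed point. The obstacle to freeness is
  that intersections must become disjunctions: annihilating \<open>K \<inter> J\<close> does not in
  general force a homomorphism to annihilate \<open>K\<close> or \<open>J\<close>. The fixed element
  \<open>v\<close> removes it, since an ideal of the lattice is annihilated exactly when it misses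
  \<open>v\<close>. The least element of \<open>S\<close> is chosen because the gluing condition for
  \<open>i < j\<close> expresses the symbol of \<open>t_i\<close> in slot \<open>j\<close> through
  \<open>t_j\<close>; vanishing of \<open>t_j\<close> thus reaches \<open>t_i\<close> in the
  direction in which the gluing map is applied.\<close>

locale star_alg = ring P for P :: "('a, 'm) star_algebra_scheme" (structure) +
  assumes smult_closed [simp, intro]: "x \<in> carrier P \<Longrightarrow> c \<odot> x \<in> carrier P"
    and smult_add: "\<lbrakk>x \<in> carrier P; y \<in> carrier P\<rbrakk> \<Longrightarrow> c \<odot> (x \<oplus> y) = c \<odot> x \<oplus> c \<odot> y"
    and add_smult: "x \<in> carrier P \<Longrightarrow> (c + d) \<odot> x = c \<odot> x \<oplus> d \<odot> x"
    and smult_smult [simp]: "x \<in> carrier P \<Longrightarrow> c \<odot> (d \<odot> x) = (c * d) \<odot> x"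
    and one_smult [simp]: "x \<in> carrier P \<Longrightarrow> 1 \<odot> x = x"
    and smult_mult_left [simp]:
      "\<lbrakk>x \<in> carrier P; y \<in> carrier P\<rbrakk> \<Longrightarrow> (c \<odot> x) \<otimes> y = c \<odot> (x \<otimes> y)"
    and smult_mult_right [simp]:
      "\<lbrakk>x \<in> carrier P; y \<in> carrier P\<rbrakk> \<Longrightarrow> x \<otimes> (c \<odot> y) = c \<odot> (x \<otimes> y)"
    and star_closed [simp, intro]: "x \<in> carrier P \<Longrightarrow> star P x \<in> carrier P"
    and star_add [simp]:
      "\<lbrakk>x \<in> carrier P; y \<in> carrier P\<rbrakk> \<Longrightarrow> star P (x \<oplus> y) = star P x \<oplus> star P y"
    and star_smult [simp]: "x \<in> carrier P \<Longrightarrow> star P (c \<odot> x) = cnj c \<odot> star P x"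
    and star_mult [simp]:
      "\<lbrakk>x \<in> carrier P; y \<in> carrier P\<rbrakk> \<Longrightarrow> star P (x \<otimes> y) = star P y \<otimes> star P x"
    and star_star [simp]: "x \<in> carrier P \<Longrightarrow> star P (star P x) = x"
begin

lemma zero_smult [simp]:
  assumes "x \<in> carrier P"
  shows "0 \<odot> x = \<zero>"
proof -
  have "0 \<odot> x \<oplus> 0 \<odot> x = 0 \<odot> x \<oplus> \<zero>"
    using assms add_smult[of x 0 0] by simp
  then show ?thesis
    using assms by (simp add: add.l_cancel_one)
qed

lemma smult_zero [simp]: "c \<odot> \<zero> = \<zero>"
  using zero_smult[of \<zero>] smult_smult[of \<zero> c 0] by simp

lemma a_inv_smult:
  assumes "x \<in> carrier P"
  shows "\<ominus> x = (-1) \<odot> x"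
proof -
  have "x \<oplus> (-1) \<odot> x = \<zero>"
    using add_smult[of x 1 "-1"] assms by simp
  then show ?thesis
    using assms by (metis a_comm minus_equality smult_closed)
qed

lemma minus_smult_eq: "\<lbrakk>x \<in> carrier P; y \<in> carrier P\<rbrakk> \<Longrightarrow> x \<ominus> y = x \<oplus> (-1) \<odot> y"
  by (simp add: a_minus_def a_inv_smult)

lemma star_zero [simp]: "star P \<zero> = \<zero>"
  using star_smult[of \<zero> 0] by simp

lemma star_one [simp]: "star P \<one> = \<one>"
proof -
  have "star P \<one> = star P \<one> \<otimes> star P (star P \<one>)"
    by simp
  also have "\<dots> = star P (star P \<one> \<otimes> \<one>)"
    by (subst star_mult) auto
  also have "\<dots> = \<one>" by simp
  finally show ?thesis .
qed

lemma star_minus [simp]: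
  "\<lbrakk>x \<in> carrier P; y \<in> carrier P\<rbrakk> \<Longrightarrow> star P (x \<ominus> y) = star P x \<ominus> star P y"
  by (simp add: minus_smult_eq)

lemma minus_telescope:
  "\<lbrakk>x \<in> carrier P; y \<in> carrier P; z \<in> carrier P\<rbrakk> \<Longrightarrow> (x \<ominus> y) \<oplus> (y \<ominus> z) = x \<ominus> z"
  by (simp add: a_minus_def a_assoc r_neg1)

lemma add_minus_add:
  "\<lbrakk>x \<in> carrier P; y \<in> carrier P; z \<in> carrier P; w \<in> carrier P\<rbrakk>
    \<Longrightarrow> (x \<oplus> y) \<ominus> (z \<oplus> w) = (x \<ominus> z) \<oplus> (y \<ominus> w)"
  by (simp add: minus_smult_eq smult_add a_ac)

lemma mult_minus_mult:
  "\<lbrakk>x \<in> carrier P; y \<in> carrier P; z \<in> carrier P; w \<in> carrier P\<rbrakk>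
    \<Longrightarrow> (x \<otimes> y) \<ominus> (z \<otimes> w) = (x \<ominus> z) \<otimes> y \<oplus> z \<otimes> (y \<ominus> w)"
proof -
  assume c: "x \<in> carrier P" "y \<in> carrier P" "z \<in> carrier P" "w \<in> carrier P"
  have "(x \<ominus> z) \<otimes> y \<oplus> z \<otimes> (y \<ominus> w) = (x \<otimes> y \<ominus> z \<otimes> y) \<oplus> (z \<otimes> y \<ominus> z \<otimes> w)"
    using c by (simp add: minus_smult_eq l_distr r_distr)
  then show ?thesis
    using c by (simp add: minus_telescope)
qed

lemma smult_minus:
  "\<lbrakk>x \<in> carrier P; y \<in> carrier P\<rbrakk> \<Longrightarrow> c \<odot> (x \<ominus> y) = c \<odot> x \<ominus> c \<odot> y"
  by (simp add: minus_smult_eq smult_add mult.commute)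

lemma minus_eq_zeroD: "\<lbrakk>x \<in> carrier P; y \<in> carrier P; x \<ominus> y = \<zero>\<rbrakk> \<Longrightarrow> x = y"
  by (metis a_minus_def minus_closed minus_equality minus_minus a_inv_closed)

lemma minus_self [simp]: "x \<in> carrier P \<Longrightarrow> x \<ominus> x = \<zero>"
  by (simp add: a_minus_def r_neg)

lemma minus_zero_right [simp]: "x \<in> carrier P \<Longrightarrow> x \<ominus> \<zero> = x"
  by (simp add: a_minus_def)

lemma add_minus_cancel:
  assumes "x \<in> carrier P" "y \<in> carrier P"
  shows "(x \<oplus> y) \<ominus> x = y" "(x \<oplus> y) \<ominus> y = x"
proof -
  show "(x \<oplus> y) \<ominus> y = x"
    using assms by (simp add: a_minus_def a_assoc r_neg)
  then show "(x \<oplus> y) \<ominus> x = y"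
    using assms by (simp add: a_minus_def a_comm[of x y] a_assoc r_neg)
qed

lemma minus_add_cancel: "\<lbrakk>x \<in> carrier P; y \<in> carrier P\<rbrakk> \<Longrightarrow> (x \<ominus> y) \<oplus> y = x"
  by (simp add: a_minus_def a_assoc l_neg)

end

text \<open>Seminorms instead of norms: the algebras given by generators and relators become
  separated only after completion.\<close>

locale cstar_semi = star_alg P for P :: "('a, 'm) star_algebra_scheme" (structure) +
  fixes p :: "'a \<Rightarrow> real"
  assumes seminorm: "cstar_seminorm P p"
begin

lemma p_nonneg [simp]: "x \<in> carrier P \<Longrightarrow> 0 \<le> p x"
  and p_triangle: "\<lbrakk>x \<in> carrier P; y \<in> carrier P\<rbrakk> \<Longrightarrow> p (x \<oplus> y) \<le> p x + p y"
  and p_smult [simp]: "x \<in> carrier P \<Longrightarrow> p (c \<odot> x) = cmod c * p x"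
  and p_mult: "\<lbrakk>x \<in> carrier P; y \<in> carrier P\<rbrakk> \<Longrightarrow> p (x \<otimes> y) \<le> p x * p y"
  and p_star_mult: "x \<in> carrier P \<Longrightarrow> p (star P x \<otimes> x) = (p x)\<^sup>2"
  using seminorm unfolding cstar_seminorm_def by blast+

lemma p_zero [simp]: "p \<zero> = 0"
  using p_smult[of \<zero> 0] by simp

lemma p_a_inv [simp]: "x \<in> carrier P \<Longrightarrow> p (\<ominus> x) = p x"
  by (simp add: a_inv_smult)

lemma p_minus_triangle: "\<lbrakk>x \<in> carrier P; y \<in> carrier P\<rbrakk> \<Longrightarrow> p (x \<ominus> y) \<le> p x + p y"
  using p_triangle[of x "\<ominus> y"] by (simp add: a_minus_def)

lemma p_minus_commute: "\<lbrakk>x \<in> carrier P; y \<in> carrier P\<rbrakk> \<Longrightarrow> p (x \<ominus> y) = p (y \<ominus> x)"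
proof -
  assume "x \<in> carrier P" "y \<in> carrier P"
  then have "(-1) \<odot> (x \<ominus> y) = y \<ominus> x"
    by (simp add: minus_smult_eq smult_add a_comm)
  then show ?thesis
    by (metis \<open>x \<in> carrier P\<close> \<open>y \<in> carrier P\<close> minus_closed mult_1 norm_minus_cancel norm_one p_smult)
qed

lemma p_dist_triangle:
  "\<lbrakk>x \<in> carrier P; y \<in> carrier P; z \<in> carrier P\<rbrakk> \<Longrightarrow> p (x \<ominus> z) \<le> p (x \<ominus> y) + p (y \<ominus> z)"
  using p_triangle[of "x \<ominus> y" "y \<ominus> z"] by (simp add: minus_telescope)

lemma p_le_add_dist: "\<lbrakk>x \<in> carrier P; y \<in> carrier P\<rbrakk> \<Longrightarrow> p x \<le> p (x \<ominus> y) + p y"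
  using p_triangle[of "x \<ominus> y" y] by (simp add: minus_add_cancel)

lemma p_abs_diff: "\<lbrakk>x \<in> carrier P; y \<in> carrier P\<rbrakk> \<Longrightarrow> \<bar>p x - p y\<bar> \<le> p (x \<ominus> y)"
  using p_le_add_dist[of x y] p_le_add_dist[of y x] p_minus_commute[of x y] by simp

text \<open>The C*-identity gives \<open>p(x)^2 \<le> p(star x) p(x)\<close>, and one factor
  cancels. Applied to \<open>x\<close> and to its adjoint this makes the involution
  isometric.\<close>

lemma p_le_p_star:
  assumes x: "x \<in> carrier P"
  shows "p x \<le> p (star P x)"
proof (cases "p x = 0")
  case False
  have "p x * p x \<le> p (star P x) * p x"
    using x p_star_mult[of x] p_mult[of "star P x" x] by (simp add: power2_eq_square)
  then show ?thesis
    using False x p_nonneg[OF x] by simp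
qed (use x in simp)

lemma p_star [simp]: "x \<in> carrier P \<Longrightarrow> p (star P x) = p x"
  using p_le_p_star[of x] p_le_p_star[of "star P x"] by simp

lemma p_mult_star: "x \<in> carrier P \<Longrightarrow> p (x \<otimes> star P x) = (p x)\<^sup>2"
  using p_star_mult[of "star P x"] by simp

text \<open>\<open>p \<one>\<close> equals its own square, so it is 0 or 1; the value 0 does occur,
  for the zero seminorm.\<close>

lemma p_one_le: "p \<one> \<le> 1"
proof -
  have "p \<one> = (p \<one>)\<^sup>2"
    using p_star_mult[of \<one>] by simp
  then have "p \<one> * (p \<one> - 1) = 0"
    by (simp add: power2_eq_square algebra_simps)
  then show ?thesis
    by auto
qed

lemma p_add_dist:
  "\<lbrakk>x \<in> carrier P; y \<in> carrier P; z \<in> carrier P; w \<in> carrier P\<rbrakk>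
    \<Longrightarrow> p ((x \<oplus> y) \<ominus> (z \<oplus> w)) \<le> p (x \<ominus> z) + p (y \<ominus> w)"
  by (simp add: add_minus_add p_triangle)

lemma p_mult_dist:
  "\<lbrakk>x \<in> carrier P; y \<in> carrier P; z \<in> carrier P; w \<in> carrier P\<rbrakk>
    \<Longrightarrow> p ((x \<otimes> y) \<ominus> (z \<otimes> w)) \<le> p (x \<ominus> z) * p y + p z * p (y \<ominus> w)"
  by (subst mult_minus_mult)
    (auto intro!: order_trans[OF p_triangle] add_mono p_mult)

lemma p_smult_dist:
  "\<lbrakk>x \<in> carrier P; y \<in> carrier P\<rbrakk> \<Longrightarrow> p (c \<odot> x \<ominus> c \<odot> y) = cmod c * p (x \<ominus> y)"
  by (simp flip: smult_minus)

lemma p_star_dist: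
  "\<lbrakk>x \<in> carrier P; y \<in> carrier P\<rbrakk> \<Longrightarrow> p (star P x \<ominus> star P y) = p (x \<ominus> y)"
  by (simp flip: star_minus)

end

text \<open>The algebra is a carrier set with explicit operations and norm, hence completeness is
  stated through sequences rather than through a type class.\<close>

locale calg = star_alg A for A :: "'a cstar" (structure) +
  assumes cstar_norm: "cstar_seminorm A (cnorm A)"
    and definite: "\<lbrakk>x \<in> carrier A; cnorm A x = 0\<rbrakk> \<Longrightarrow> x = \<zero>"
    and complete: "\<lbrakk>\<And>n. s n \<in> carrier A;
        \<And>e. e > 0 \<Longrightarrow> \<exists>K. \<forall>m\<ge>K. \<forall>n\<ge>K. cnorm A (s m \<ominus> s n) < e\<rbrakk>
      \<Longrightarrow> \<exists>x\<in>carrier A. (\<lambda>n. cnorm A (s n \<ominus> x)) \<longlonglongrightarrow> 0"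

sublocale calg \<subseteq> cstar_semi A "cnorm A"
  by unfold_locales (rule cstar_norm)

definition limit_closed :: "'a cstar \<Rightarrow> 'a set \<Rightarrow> bool" where
  "limit_closed A S \<longleftrightarrow>
     (\<forall>s. \<forall>x\<in>carrier A. (\<forall>n. s n \<in> S) \<and> (\<lambda>n. cnorm A (s n \<ominus>\<^bsub>A\<^esub> x)) \<longlonglongrightarrow> 0 \<longrightarrow> x \<in> S)"

lemma limit_closedD:
  "\<lbrakk>limit_closed A S; x \<in> carrier A; \<And>n. s n \<in> S; (\<lambda>n. cnorm A (s n \<ominus>\<^bsub>A\<^esub> x)) \<longlonglongrightarrow> 0\<rbrakk> \<Longrightarrow> x \<in> S"
  unfolding limit_closed_def by blast

context calg
begin

lemma limit_unique:
  assumes "\<And>n. s n \<in> carrier A" "x \<in> carrier A" "y \<in> carrier A"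
    and "(\<lambda>n. cnorm A (s n \<ominus> x)) \<longlonglongrightarrow> 0" "(\<lambda>n. cnorm A (s n \<ominus> y)) \<longlonglongrightarrow> 0"
  shows "x = y"
proof -
  have "(\<lambda>n. cnorm A (s n \<ominus> x) + cnorm A (s n \<ominus> y)) \<longlonglongrightarrow> 0"
    using tendsto_add[OF assms(4,5)] by simp
  moreover have "cnorm A (x \<ominus> y) \<le> cnorm A (s n \<ominus> x) + cnorm A (s n \<ominus> y)" for n
    using p_dist_triangle[of x "s n" y] p_minus_commute[of x "s n"] assms by simp
  ultimately have "cnorm A (x \<ominus> y) \<le> 0"
    by (intro LIMSEQ_le_const) auto
  then show ?thesis
    using assms definite minus_eq_zeroD p_nonneg[of "x \<ominus> y"] by (metis minus_closed order_antisym)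
qed

text \<open>Source of the square root and of the resolvent below: both are fixed points of affine or
  quadratic maps on a closed set, so completeness of the norm suffices to produce them.\<close>

lemma contraction:
  assumes S: "S \<subseteq> carrier A" "limit_closed A S" "S \<noteq> {}" and f: "\<And>x. x \<in> S \<Longrightarrow> f x \<in> S"
    and k: "k < 1" "\<And>x y. \<lbrakk>x \<in> S; y \<in> S\<rbrakk> \<Longrightarrow> cnorm A (f x \<ominus> f y) \<le> k * cnorm A (x \<ominus> y)"
  shows "\<exists>x\<in>S. f x = x"
proof -
  \<comment> \<open>The value 0 off \<open>S\<close> keeps nonnegativity and symmetry valid for all
    arguments, which \<open>Metric_space\<close> demands outside its carrier as well.\<close>
  define d where "d x y = (if x \<in> S \<and> y \<in> S then cnorm A (x \<ominus> y) else 0)" for x y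
  have c: "\<And>x. x \<in> S \<Longrightarrow> x \<in> carrier A"
    using S by blast
  interpret M: Metric_space S d
  proof
    show "0 \<le> d x y" for x y
      using c by (simp add: d_def)
    show "d x y = d y x" for x y
      using c p_minus_commute by (simp add: d_def)
    show "d x y = 0 \<longleftrightarrow> x = y" if "x \<in> S" "y \<in> S" for x y
      using c that definite[of "x \<ominus> y"] minus_eq_zeroD[of x y] by (auto simp: d_def)
    show "d x z \<le> d x y + d y z" if "x \<in> S" "y \<in> S" "z \<in> S" for x y z
      using c that p_dist_triangle by (simp add: d_def)
  qed
  have "M.mcomplete"
    unfolding M.mcomplete_def
  proof (intro allI impI)
    fix s assume s: "M.MCauchy s"
    then have sS: "s n \<in> S" for n
      by (auto simp: M.MCauchy_def)
    have "\<exists>x\<in>carrier A. (\<lambda>n. cnorm A (s n \<ominus> x)) \<longlonglongrightarrow> 0"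
    proof (rule complete)
      show "s n \<in> carrier A" for n
        using sS c by blast
      show "\<exists>K. \<forall>m\<ge>K. \<forall>n\<ge>K. cnorm A (s m \<ominus> s n) < e" if "e > 0" for e
        using s that sS unfolding M.MCauchy_def d_def by simp
    qed
    then obtain x where x: "x \<in> carrier A" "(\<lambda>n. cnorm A (s n \<ominus> x)) \<longlonglongrightarrow> 0"
      by blast
    then have "x \<in> S"
      using limit_closedD[OF S(2), of x s] sS by blast
    then show "\<exists>x. limitin M.mtopology s x sequentially"
      unfolding M.limit_metric_sequentially
      using x(2) x(1) sS c unfolding LIMSEQ_iff d_def by (intro exI[of _ x]) simp
  qed
  then obtain x where "x \<in> S" "f x = x"
    by (rule M.Banach_fixedpoint_thm[of f k]) (use S f k in \<open>auto simp: d_def\<close>)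
  then show ?thesis
    by blast
qed

lemma limit_closed_Int: "\<lbrakk>limit_closed A S; limit_closed A T\<rbrakk> \<Longrightarrow> limit_closed A (S \<inter> T)"
  unfolding limit_closed_def by blast

lemma limit_closed_norm_le: "limit_closed A {y \<in> carrier A. cnorm A y \<le> r}"
  unfolding limit_closed_def
proof (intro allI ballI impI, elim conjE)
  fix s x assume x: "x \<in> carrier A" and s: "\<forall>n. s n \<in> {y \<in> carrier A. cnorm A y \<le> r}"
    and lim: "(\<lambda>n. cnorm A (s n \<ominus> x)) \<longlonglongrightarrow> 0"
  have "(\<lambda>n. cnorm A (s n \<ominus> x) + r) \<longlonglongrightarrow> 0 + r"
    by (intro tendsto_add lim tendsto_const)
  moreover have "cnorm A x \<le> cnorm A (s n \<ominus> x) + r" for n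
    using p_le_add_dist[of x "s n"] p_minus_commute[of x "s n"] x s
    by (metis (mono_tags, lifting) add_left_mono dual_order.trans mem_Collect_eq)
  ultimately have "cnorm A x \<le> r"
    by (intro LIMSEQ_le_const) auto
  then show "x \<in> {y \<in> carrier A. cnorm A y \<le> r}"
    using x by simp
qed

end

text \<open>Two Lipschitz maps that agree along a convergent sequence have the same limit value.
  Closedness of every equationally defined set is reduced to this.\<close>

lemma limit_closed_eq:
  assumes "calg A" "calg B"
    and f: "\<And>x. x \<in> carrier A \<Longrightarrow> f x \<in> carrier B" "\<And>x. x \<in> carrier A \<Longrightarrow> g x \<in> carrier B"
    and C: "\<And>x y. \<lbrakk>x \<in> carrier A; y \<in> carrier A\<rbrakk>
        \<Longrightarrow> cnorm B (f x \<ominus>\<^bsub>B\<^esub> f y) \<le> C * cnorm A (x \<ominus>\<^bsub>A\<^esub> y)"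
      "\<And>x y. \<lbrakk>x \<in> carrier A; y \<in> carrier A\<rbrakk>
        \<Longrightarrow> cnorm B (g x \<ominus>\<^bsub>B\<^esub> g y) \<le> C * cnorm A (x \<ominus>\<^bsub>A\<^esub> y)"
  shows "limit_closed A {x \<in> carrier A. f x = g x}"
  unfolding limit_closed_def
proof (intro allI ballI impI, elim conjE)
  interpret A: calg A by fact
  interpret B: calg B by fact
  fix s x assume x: "x \<in> carrier A" and s: "\<forall>n. s n \<in> {x \<in> carrier A. f x = g x}"
    and lim: "(\<lambda>n. cnorm A (s n \<ominus>\<^bsub>A\<^esub> x)) \<longlonglongrightarrow> 0"
  have lim': "(\<lambda>n. C * cnorm A (s n \<ominus>\<^bsub>A\<^esub> x)) \<longlonglongrightarrow> 0"
    using tendsto_mult_right_zero[OF lim] .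
  have "norm (cnorm B (f (s n) \<ominus>\<^bsub>B\<^esub> f x)) \<le> C * cnorm A (s n \<ominus>\<^bsub>A\<^esub> x)"
    "norm (cnorm B (f (s n) \<ominus>\<^bsub>B\<^esub> g x)) \<le> C * cnorm A (s n \<ominus>\<^bsub>A\<^esub> x)" for n
    using C(1)[of "s n" x] C(2)[of "s n" x] f s x by auto
  then have "(\<lambda>n. cnorm B (f (s n) \<ominus>\<^bsub>B\<^esub> f x)) \<longlonglongrightarrow> 0"
    "(\<lambda>n. cnorm B (f (s n) \<ominus>\<^bsub>B\<^esub> g x)) \<longlonglongrightarrow> 0"
    by (auto intro: Lim_null_comparison[OF _ lim'])
  then have "f x = g x"
    using s x f by (intro B.limit_unique[of "\<lambda>n. f (s n)"]) auto
  then show "x \<in> {x \<in> carrier A. f x = g x}"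
    using x by simp
qed

subsection \<open>Self-adjoint elements as real parts of unitaries\<close>

context calg
begin

text \<open>With \<open>s = 1 - y\<close> the equation \<open>s^2 = 1 - h^2\<close> becomes
  \<open>y = (h^2 + y^2) / 2\<close>. On the ball of radius 1/2 the right-hand side is a contraction
  with constant 1/2. Restricting to self-adjoint elements commuting with \<open>h\<close>, a closed
  set that the map preserves, hands these properties to the fixed point.\<close>

lemma exists_sqrt_one_minus_square:
  assumes h: "h \<in> carrier A" "star A h = h" "cnorm A h \<le> 1/2"
  shows "\<exists>s\<in>carrier A. star A s = s \<and> h \<otimes> s = s \<otimes> h \<and> s \<otimes> s = \<one> \<ominus> h \<otimes> h"
proof -
  define f where "f y = (1/2) \<odot> (h \<otimes> h \<oplus> y \<otimes> y)" for y
  define S where "S = {y \<in> carrier A. cnorm A y \<le> 1/2} \<inter> {y \<in> carrier A. star A y = y}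
    \<inter> {y \<in> carrier A. h \<otimes> y = y \<otimes> h}"
  have SD: "y \<in> carrier A" "cnorm A y \<le> 1/2" "star A y = y" "h \<otimes> y = y \<otimes> h" if "y \<in> S" for y
    using that by (auto simp: S_def)
  have "limit_closed A {y \<in> carrier A. star A y = y}"
    by (rule limit_closed_eq[OF calg_axioms calg_axioms, where C = 1]) (auto simp: p_star_dist)
  moreover have "limit_closed A {y \<in> carrier A. h \<otimes> y = y \<otimes> h}"
  proof (rule limit_closed_eq[OF calg_axioms calg_axioms, where C = "cnorm A h"])
    fix x y assume xy: "x \<in> carrier A" "y \<in> carrier A"
    show "cnorm A (h \<otimes> x \<ominus> h \<otimes> y) \<le> cnorm A h * cnorm A (x \<ominus> y)"
      using p_mult_dist[of h x h y] h xy by simp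
    show "cnorm A (x \<otimes> h \<ominus> y \<otimes> h) \<le> cnorm A h * cnorm A (x \<ominus> y)"
      using p_mult_dist[of x h y h] h xy by (simp add: mult.commute)
  qed (use h in auto)
  ultimately have "limit_closed A S"
    unfolding S_def by (intro limit_closed_Int limit_closed_norm_le)
  moreover have "\<zero> \<in> S"
    using h by (simp add: S_def)
  then have "S \<noteq> {}"
    by blast
  moreover have hh: "cnorm A (h \<otimes> h) \<le> 1/4"
    using p_mult[of h h] mult_mono[OF h(3) h(3)] h by simp
  have "f y \<in> S" if y: "y \<in> S" for y
  proof -
    have "cnorm A (y \<otimes> y) \<le> 1/4"
      using p_mult[of y y] mult_mono[OF SD(2)[OF y] SD(2)[OF y]] SD[OF y] by simp
    then have "cnorm A (h \<otimes> h \<oplus> y \<otimes> y) \<le> 1/2"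
      using p_triangle[of "h \<otimes> h" "y \<otimes> y"] hh h SD[OF y] by simp
    moreover have "h \<otimes> (y \<otimes> y) = (y \<otimes> y) \<otimes> h"
      using SD[OF y] h by (metis m_assoc)
    ultimately show ?thesis
      using SD[OF y] h unfolding S_def f_def by (auto simp: l_distr r_distr m_assoc)
  qed
  moreover have "cnorm A (f x \<ominus> f y) \<le> 1/2 * cnorm A (x \<ominus> y)" if x: "x \<in> S" and y: "y \<in> S" for x y
  proof -
    have "cnorm A (f x \<ominus> f y) = 1/2 * cnorm A ((h \<otimes> h \<oplus> x \<otimes> x) \<ominus> (h \<otimes> h \<oplus> y \<otimes> y))"
      using SD[OF x] SD[OF y] h by (simp add: f_def p_smult_dist)
    also have "\<dots> \<le> 1/2 * cnorm A (x \<otimes> x \<ominus> y \<otimes> y)"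
      using p_add_dist[of "h \<otimes> h" "x \<otimes> x" "h \<otimes> h" "y \<otimes> y"] SD[OF x] SD[OF y] h by simp
    also have "\<dots> \<le> 1/2 * (cnorm A (x \<ominus> y) * cnorm A x + cnorm A y * cnorm A (x \<ominus> y))"
      using p_mult_dist[of x x y y] SD[OF x] SD[OF y] by simp
    also have "\<dots> \<le> 1/2 * (cnorm A (x \<ominus> y) * (1/2) + 1/2 * cnorm A (x \<ominus> y))"
      using SD[OF x] SD[OF y] by (intro mult_left_mono add_mono mult_right_mono) auto
    finally show ?thesis by simp
  qed
  moreover have "S \<subseteq> carrier A"
    using SD by blast
  ultimately have "\<exists>y\<in>S. f y = y"
    by (intro contraction[of S f "1/2"]) auto
  then obtain y where y: "y \<in> S" "f y = y"
    by blast
  note yD = SD[OF y(1)]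
  \<comment> \<open>From here the fixed point equation is read back as
    \<open>(1 - y)^2 = 1 - h^2\<close>.\<close>
  have "2 \<odot> y = h \<otimes> h \<oplus> y \<otimes> y"
    using arg_cong[OF y(2), of "\<lambda>z. 2 \<odot> z"] yD h by (simp add: f_def)
  moreover have "(-1) \<odot> y \<oplus> (-1) \<odot> y = (-1) \<odot> (2 \<odot> y)"
    using yD(1) by (simp flip: add_smult)
  moreover have "(\<one> \<ominus> y) \<otimes> (\<one> \<ominus> y) = \<one> \<oplus> y \<otimes> y \<oplus> ((-1) \<odot> y \<oplus> (-1) \<odot> y)"
    using yD(1) by (simp add: minus_smult_eq smult_add l_distr r_distr a_ac)
  ultimately have "(\<one> \<ominus> y) \<otimes> (\<one> \<ominus> y) = \<one> \<oplus> y \<otimes> y \<oplus> (-1) \<odot> (h \<otimes> h \<oplus> y \<otimes> y)"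
    by simp
  also have "\<dots> = \<one> \<ominus> h \<otimes> h"
  proof -
    have "y \<otimes> y \<oplus> (-1) \<odot> (y \<otimes> y) = \<zero>"
      using yD by (simp flip: minus_smult_eq)
    then have "\<one> \<oplus> (y \<otimes> y \<oplus> (-1) \<odot> (y \<otimes> y)) \<oplus> (-1) \<odot> (h \<otimes> h) = \<one> \<oplus> (-1) \<odot> (h \<otimes> h)"
      using h by simp
    then show ?thesis
      using yD h by (simp add: minus_smult_eq smult_add a_ac)
  qed
  finally have "(\<one> \<ominus> y) \<otimes> (\<one> \<ominus> y) = \<one> \<ominus> h \<otimes> h" .
  moreover have "h \<otimes> (\<one> \<ominus> y) = (\<one> \<ominus> y) \<otimes> h"
    using yD h by (simp add: minus_smult_eq l_distr r_distr)
  ultimately show ?thesis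
    using yD by (intro bexI[of _ "\<one> \<ominus> y"]) auto
qed

text \<open>For the square root \<open>s\<close> of \<open>1 - h^2\<close>, the element
  \<open>u = h + i s\<close> satisfies \<open>star u u = 1\<close>, so every C*-seminorm is at most
  1 on it. Now \<open>h\<close> and \<open>s\<close> are its real and imaginary parts, and
  \<open>1 - h^2\<close> is the square of \<open>s\<close>.\<close>

lemma seminorm_selfadjoint_le:
  assumes p: "cstar_seminorm A p" and h: "h \<in> carrier A" "star A h = h" "cnorm A h \<le> 1/2"
  shows "p h \<le> 1" and "p (\<one> \<ominus> h \<otimes> h) \<le> 1"
proof -
  interpret p: cstar_semi A p
    using p by unfold_locales
  obtain s where s: "s \<in> carrier A" "star A s = s" "h \<otimes> s = s \<otimes> h" "s \<otimes> s = \<one> \<ominus> h \<otimes> h"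
    using exists_sqrt_one_minus_square[OF h] by blast
  define u where "u = h \<oplus> \<i> \<odot> s"
  have u: "u \<in> carrier A" "star A u = h \<oplus> (-\<i>) \<odot> s"
    using h s by (auto simp: u_def)
  have "star A u \<otimes> u = h \<otimes> h \<oplus> s \<otimes> s \<oplus> (\<i> \<odot> (s \<otimes> h) \<oplus> (-\<i>) \<odot> (s \<otimes> h))"
    using h s(1,2,3) unfolding u u_def by (simp add: l_distr r_distr smult_add a_ac)
  also have "\<i> \<odot> (s \<otimes> h) \<oplus> (-\<i>) \<odot> (s \<otimes> h) = \<zero>"
    using h s(1) by (simp flip: add_smult)
  also have "h \<otimes> h \<oplus> s \<otimes> s \<oplus> \<zero> = \<one>"
    unfolding s(4) using h by (simp add: a_comm[of "h \<otimes> h"] minus_add_cancel)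
  finally have "(p u)\<^sup>2 = p \<one>"
    using p.p_star_mult[of u] u by simp
  then have pu: "p u \<le> 1"
    using p.p_one_le by (metis power2_le_imp_le one_power2 zero_le_one)
  have "h = (1/2) \<odot> (u \<oplus> star A u)"
  proof -
    have "u \<oplus> star A u = (h \<oplus> h) \<oplus> (\<i> \<odot> s \<oplus> (-\<i>) \<odot> s)"
      using h s unfolding u unfolding u_def by (simp add: a_ac)
    also have "\<dots> = 2 \<odot> h"
      using h s add_smult[of h 1 1] by (simp flip: add_smult)
    finally show ?thesis using h by simp
  qed
  then have "p h \<le> 1/2 * (p u + p (star A u))"
    using p.p_triangle[of u "star A u"] u(1)
    p.p_smult[of "u \<oplus> star A u" "1/2"] by (simp add: norm_divide)
  then show "p h \<le> 1"
    using pu u(1) by simp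
  have "s = (-\<i>/2) \<odot> (u \<ominus> star A u)"
  proof -
    have "u \<ominus> star A u = (h \<oplus> (-1) \<odot> h) \<oplus> (\<i> \<odot> s \<oplus> \<i> \<odot> s)"
      using h s unfolding u unfolding u_def by (simp add: minus_smult_eq smult_add a_ac)
    also have "\<dots> = (2*\<i>) \<odot> s"
      using h s add_smult[of s \<i> \<i>] by (simp flip: minus_smult_eq)
    finally show ?thesis using s by simp
  qed
  then have "p s \<le> 1/2 * (p u + p (star A u))"
    using p.p_minus_triangle[of u "star A u"] p.p_smult[of "u \<ominus> star A u" "-\<i>/2"] u(1)
    by (simp add: norm_divide)
  then have ps: "p s \<le> 1"
    using pu u(1) by simp
  have "p (\<one> \<ominus> h \<otimes> h) \<le> p s * p s"
    using p.p_mult[of s s] s by simp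
  also have "\<dots> \<le> 1"
    using ps s by (simp add: mult_le_one)
  finally show "p (\<one> \<ominus> h \<otimes> h) \<le> 1" .
qed

text \<open>Scaling \<open>star x x\<close> to norm 1/2 gives \<open>p(x)^2 \<le> 2 ||x||^2\<close>,
  and the constant is rounded up to 2. The sharp constant is 1, but continuity is all that is drawn
  from this bound.\<close>

lemma seminorm_bounded:
  assumes p: "cstar_seminorm A p" and x: "x \<in> carrier A"
  shows "p x \<le> 2 * cnorm A x"
proof (cases "cnorm A x = 0")
  case True
  interpret p: cstar_semi A p
    using p by unfold_locales
  show ?thesis
    using definite[OF x True] by simp
next
  case False
  interpret p: cstar_semi A p
    using p by unfold_locales
  define N where "N = cnorm A x"
  have N: "N > 0"
    using False p_nonneg[OF x] unfolding N_def by linarith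
  define h where "h = complex_of_real (1 / (2 * N\<^sup>2)) \<odot> (star A x \<otimes> x)"
  have "cnorm A h = 1/2"
    using x N p_star_mult[OF x] unfolding h_def
    by (simp add: norm_divide norm_mult norm_power N_def[symmetric] del: of_real_divide)
  moreover have "h \<in> carrier A" "star A h = h"
    using x by (auto simp: h_def)
  ultimately have "p h \<le> 1"
    using seminorm_selfadjoint_le(1)[OF p] by simp
  then have "(p x)\<^sup>2 \<le> 2 * N\<^sup>2"
    using x N p.p_star_mult[OF x] unfolding h_def
    by (simp add: norm_divide norm_mult norm_power divide_simps del: of_real_divide)
  also have "\<dots> \<le> (2 * N)\<^sup>2"
    by (simp add: power2_eq_square)
  finally show ?thesis
    using N power2_le_imp_le[of "p x" "2 * N"] by (simp add: N_def)
qed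

end

subsection \<open>Approximate units and sums of closed ideals\<close>

lemma closed_ideals_iff: "I \<in> closed_ideals A \<longleftrightarrow> ideal I A \<and> limit_closed A I"
  by (simp add: closed_ideals_def limit_closed_def)

lemma set_add_iff: "x \<in> I <+>\<^bsub>A\<^esub> J \<longleftrightarrow> (\<exists>i\<in>I. \<exists>j\<in>J. x = i \<oplus>\<^bsub>A\<^esub> j)"
  by (auto simp: set_add_def set_mult_def)

context calg
begin

text \<open>A ring ideal of a unital algebra is a complex subspace, because
  \<open>c x = (c 1) x\<close>.\<close>

lemma ideal_smult:
  assumes "ideal I A" "x \<in> I"
  shows "c \<odot> x \<in> I"
proof -
  interpret ideal I A by fact
  have "(c \<odot> \<one>) \<otimes> x \<in> I"
    using assms by (intro I_l_closed) auto
  then show ?thesis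
    using assms Icarr by simp
qed

text \<open>For \<open>k = (x x\<^sup>*)\<^sup>2\<close> the resolvent \<open>y = (1 + t k)\<^sup>-\<^sup>1\<close> is obtained as a fixed point,
  so that no spectral theory is involved; \<open>e = t k y = 1 - y\<close>.\<close>

lemma approx_unit_small:
  assumes I: "ideal I A" and x: "x \<in> I" "cnorm A x \<le> 1/2" and t: "t > 0"
  shows "\<exists>e\<in>I. cnorm A e \<le> 2 \<and> cnorm A (x \<ominus> e \<otimes> x) ^ 4 \<le> 2 / t"
proof -
  interpret I: ideal I A by fact
  have xc: "x \<in> carrier A"
    using x I.Icarr by simp
  define h where "h = x \<otimes> star A x"
  define k where "k = h \<otimes> h"
  define g where "g = \<one> \<ominus> k"
  have h: "h \<in> carrier A" "star A h = h"
    using xc by (auto simp: h_def)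
  have hI: "h \<in> I"
    using x xc unfolding h_def by (intro I.I_r_closed) auto
  have kI: "k \<in> I"
    using hI h unfolding k_def by (intro I.I_r_closed) auto
  have k: "k \<in> carrier A" "star A k = k"
    using h by (auto simp: k_def)
  have "cnorm A h \<le> (1/2)\<^sup>2"
    using p_mult_star[OF xc] x(2) xc power_mono[of "cnorm A x" "1/2" 2] by (simp add: h_def)
  then have h2: "cnorm A h \<le> 1/2"
    by (simp add: power2_eq_square)
  \<comment> \<open>\<open>g = 1 - h^2\<close> is exactly the element bounded by the second part of
    \<open>seminorm_selfadjoint_le\<close>, here applied to the norm itself.\<close>
  have g: "g \<in> carrier A" "cnorm A g \<le> 1"
    using seminorm_selfadjoint_le(2)[OF seminorm h h2] k h by (auto simp: g_def k_def)
  define S where "S = {y \<in> carrier A. cnorm A y \<le> 1}"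
  \<comment> \<open>Since \<open>k = 1 - g\<close>, the equation \<open>(1 + t k) y = 1\<close>
    reads \<open>(1 + t) y = 1 + t g y\<close>. Division by \<open>1 + t\<close> gives a contraction
    with constant \<open>t / (1 + t)\<close>; it preserves the unit ball because its two weights add
    up to 1.\<close>
  define f where "f y = complex_of_real (1/(1+t)) \<odot> \<one> \<oplus> complex_of_real (t/(1+t)) \<odot> (g \<otimes> y)" for y
  have n1: "norm (complex_of_real (1/(1+t))) = 1/(1+t)" "norm (complex_of_real (t/(1+t))) = t/(1+t)"
    using t by (simp_all only: norm_of_real) auto
  have "\<exists>y\<in>S. f y = y"
  proof (rule contraction)
    show "limit_closed A S" "S \<subseteq> carrier A"
      unfolding S_def by (auto intro: limit_closed_norm_le)
    have "\<zero> \<in> S"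
      by (simp add: S_def)
    then show "S \<noteq> {}" by blast
    show "t/(1+t) < 1"
      using t by simp
    show "f y \<in> S" if "y \<in> S" for y
    proof -
      have y: "y \<in> carrier A" "cnorm A y \<le> 1"
        using that by (auto simp: S_def)
      have "cnorm A (g \<otimes> y) \<le> 1"
        using p_mult[of g y] g y mult_le_one[of "cnorm A g" "cnorm A y"] by simp
      then have "t/(1+t) * cnorm A (g \<otimes> y) \<le> t/(1+t) * 1"
        using t by (intro mult_left_mono) auto
      moreover have "1/(1+t) * cnorm A \<one> \<le> 1/(1+t) * 1"
        using t p_one_le by (intro mult_left_mono) auto
      moreover have "1/(1+t) + t/(1+t) = 1"
        using t by (simp flip: add_divide_distrib)
      moreover have "cnorm A (f y) \<le> 1/(1+t) * cnorm A \<one> + t/(1+t) * cnorm A (g \<otimes> y)"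
        unfolding f_def using t g y p_triangle[of "complex_of_real (1/(1+t)) \<odot> \<one>" "complex_of_real (t/(1+t)) \<odot> (g \<otimes> y)"]
        by (simp del: of_real_divide add: n1)
      ultimately have "cnorm A (f y) \<le> 1"
        by linarith
      then show ?thesis
        using g y by (simp add: S_def f_def)
    qed
    show "cnorm A (f y \<ominus> f z) \<le> t/(1+t) * cnorm A (y \<ominus> z)" if "y \<in> S" "z \<in> S" for y z
    proof -
      have y: "y \<in> carrier A" "z \<in> carrier A"
        using that by (auto simp: S_def)
      have "cnorm A (f y \<ominus> f z) \<le> t/(1+t) * cnorm A (g \<otimes> y \<ominus> g \<otimes> z)"
        unfolding f_def
        by (rule order_trans[OF p_add_dist]) (use t g y in \<open>auto simp del: of_real_divide simp: n1 p_smult_dist\<close>)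
      moreover have "cnorm A (g \<otimes> y \<ominus> g \<otimes> z) \<le> 1 * cnorm A (y \<ominus> z)"
        using p_mult_dist[of g y g z] g y mult_right_mono[OF g(2), of "cnorm A (y \<ominus> z)"] by simp
      then have "t/(1+t) * cnorm A (g \<otimes> y \<ominus> g \<otimes> z) \<le> t/(1+t) * (1 * cnorm A (y \<ominus> z))"
        using t by (intro mult_left_mono) auto
      ultimately show ?thesis by simp
    qed
  qed
  then obtain y where y: "y \<in> carrier A" "cnorm A y \<le> 1" "f y = y"
    by (auto simp: S_def)
  define T where "T = complex_of_real t"
  have T: "1 + T \<noteq> 0"
  proof -
    have "1 + T = complex_of_real (1 + t)" by (simp add: T_def)
    then show ?thesis using t by (simp only: of_real_eq_0_iff)
  qed
  have "(1 + T) \<odot> y = \<one> \<oplus> T \<odot> (g \<otimes> y)"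
    using arg_cong[OF y(3), of "\<lambda>z. (1 + T) \<odot> z"] y(1) g T
    by (simp add: f_def T_def[symmetric] smult_add)
  also have "\<dots> = \<one> \<oplus> (T \<odot> y \<oplus> (-T) \<odot> (k \<otimes> y))"
    using y(1) k by (simp add: g_def minus_smult_eq l_distr smult_add)
  finally have *: "y \<oplus> T \<odot> y = \<one> \<oplus> (T \<odot> y \<oplus> (-T) \<odot> (k \<otimes> y))"
    using y(1) by (simp add: add_smult)
  define e where "e = T \<odot> (k \<otimes> y)"
  have e: "e \<in> carrier A"
    using k y by (simp add: e_def)
  have ye: "y \<oplus> e = \<one>"
  proof -
    have "(y \<oplus> T \<odot> y) \<oplus> ((-T) \<odot> y \<oplus> e) = (\<one> \<oplus> (T \<odot> y \<oplus> (-T) \<odot> (k \<otimes> y))) \<oplus> ((-T) \<odot> y \<oplus> e)"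
      using * by simp
    moreover have "(y \<oplus> T \<odot> y) \<oplus> ((-T) \<odot> y \<oplus> e) = (y \<oplus> e) \<oplus> (T \<odot> y \<oplus> (-T) \<odot> y)"
      using y e by (simp add: a_ac)
    moreover have "(\<one> \<oplus> (T \<odot> y \<oplus> (-T) \<odot> (k \<otimes> y))) \<oplus> ((-T) \<odot> y \<oplus> e)
        = \<one> \<oplus> (T \<odot> y \<oplus> (-T) \<odot> y) \<oplus> (T \<odot> (k \<otimes> y) \<oplus> (-T) \<odot> (k \<otimes> y))"
      using y k by (simp add: a_ac e_def)
    moreover have "T \<odot> y \<oplus> (-T) \<odot> y = \<zero>" "T \<odot> (k \<otimes> y) \<oplus> (-T) \<odot> (k \<otimes> y) = \<zero>"
      using y k by (simp_all flip: add_smult)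
    ultimately show ?thesis
      using y e by simp
  qed
  then have ey: "y = \<one> \<ominus> e" "e = \<one> \<ominus> y"
    using add_minus_cancel[OF y(1) e] by (simp_all add: ye)
  \<comment> \<open>The adjoint of \<open>y\<close> is a left inverse and \<open>y\<close> a right
    inverse of the self-adjoint element \<open>1 + t k\<close>, so they coincide.\<close>
  have ysa: "star A y = y"
  proof -
    have 1: "star A y \<otimes> (\<one> \<oplus> T \<odot> k) = \<one>"
      using arg_cong[OF ye, of "star A"] y k by (simp add: e_def T_def r_distr)
    have 2: "(\<one> \<oplus> T \<odot> k) \<otimes> y = \<one>"
      using ye y k by (simp add: e_def l_distr)
    have "star A y = star A y \<otimes> ((\<one> \<oplus> T \<odot> k) \<otimes> y)"
      using 2 y by simp
    also have "\<dots> = y"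
      using 1 y k by (simp flip: m_assoc)
    finally show ?thesis .
  qed
  have eI: "e \<in> I"
    unfolding e_def using kI y by (intro ideal_smult I I.I_r_closed)
  have e2: "cnorm A e \<le> 2"
    using p_minus_triangle[of \<one> y] p_one_le y ey(2) by simp
  \<comment> \<open>\<open>t k y = e\<close> has norm at most 2. The C*-identity is then used twice,
    descending from \<open>k = h h\<close> to \<open>h\<close> and from \<open>h = x star x\<close>
    to \<open>x\<close>; each descent squares the norm, whence the fourth power.\<close>
  have ky: "cnorm A (k \<otimes> y) \<le> 2 / t"
    using e2 t k y by (simp add: e_def T_def field_simps)
  have "(cnorm A (h \<otimes> y))\<^sup>2 = cnorm A (y \<otimes> (k \<otimes> y))"
    using p_star_mult[of "h \<otimes> y"] h y(1) ysa by (simp add: k_def m_assoc)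
  also have "\<dots> \<le> 1 * cnorm A (k \<otimes> y)"
    using k y by (intro order_trans[OF p_mult] mult_right_mono) auto
  finally have hy: "(cnorm A (h \<otimes> y))\<^sup>2 \<le> 2 / t"
    using ky by simp
  have "(cnorm A (y \<otimes> x))\<^sup>2 = cnorm A (y \<otimes> (h \<otimes> y))"
    using p_mult_star[of "y \<otimes> x"] xc y(1) ysa by (simp add: h_def m_assoc)
  also have "\<dots> \<le> 1 * cnorm A (h \<otimes> y)"
    using h y by (intro order_trans[OF p_mult] mult_right_mono) auto
  finally have "((cnorm A (y \<otimes> x))\<^sup>2)\<^sup>2 \<le> (cnorm A (h \<otimes> y))\<^sup>2"
    using h y by (intro power_mono) auto
  then have "cnorm A (y \<otimes> x) ^ 4 \<le> 2 / t"
    using hy by simp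
  moreover have "y \<otimes> x = x \<ominus> e \<otimes> x"
    using ey(1) xc e by (simp add: minus_smult_eq l_distr)
  ultimately show ?thesis
    using eI e2 by auto
qed

text \<open>The factor \<open>c\<close> shrinks \<open>x\<close> into the range of
  \<open>approx_unit_small\<close>; the defect \<open>x - e x\<close> is linear in \<open>x\<close>,
  so the scaling can be undone with the same \<open>e\<close>.\<close>

lemma approx_unit:
  assumes I: "ideal I A" and x: "x \<in> I" and eps: "\<epsilon> > 0"
  shows "\<exists>e\<in>I. cnorm A e \<le> 2 \<and> cnorm A (x \<ominus> e \<otimes> x) < \<epsilon>"
proof -
  interpret I: ideal I A by fact
  have xc: "x \<in> carrier A"
    using x I.Icarr by simp
  define c where "c = 1 / (2 * (cnorm A x + 1))"
  have c: "c > 0" "c * cnorm A x \<le> 1/2"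
    using p_nonneg[OF xc] by (auto simp: c_def field_simps)
  \<comment> \<open>Makes the bound \<open>2 / t\<close> half of \<open>(c \<epsilon>)^4\<close>,
    hence strictly smaller than it.\<close>
  define t where "t = 4 / (c * \<epsilon>) ^ 4"
  have "t > 0"
    using c eps by (simp add: t_def)
  then obtain e where e: "e \<in> I" "cnorm A e \<le> 2"
      "cnorm A (complex_of_real c \<odot> x \<ominus> e \<otimes> (complex_of_real c \<odot> x)) ^ 4 \<le> 2 / t"
    using approx_unit_small[OF I ideal_smult[OF I x], of "complex_of_real c" t] c xc by auto
  have ec: "e \<in> carrier A"
    using e I.Icarr by simp
  have "(c * cnorm A (x \<ominus> e \<otimes> x)) ^ 4 \<le> 2 / t"
    using e(3) ec xc c by (simp add: p_smult_dist)
  also have "\<dots> < (c * \<epsilon>) ^ 4"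
    using c eps by (simp add: t_def)
  finally have "c * cnorm A (x \<ominus> e \<otimes> x) < c * \<epsilon>"
    by (rule power_less_imp_less_base) (use c eps in simp)
  then show ?thesis
    using e c by auto
qed

text \<open>An arbitrary decomposition \<open>i0 + j0\<close> has no norm control. With
  \<open>e\<close> in \<open>I\<close> an approximate unit for \<open>i0\<close>, the summand
  \<open>e x + (i0 - e i0)\<close> still lies in \<open>I\<close> and has norm at most
  \<open>2 \<delta> + \<delta>\<close>; what remains is \<open>j0 - e j0\<close>, which lies in
  \<open>J\<close> and has norm at most \<open>\<delta> + 3 \<delta>\<close>.\<close>

lemma set_add_decompose:
  assumes I: "ideal I A" and J: "ideal J A" and x: "x \<in> I <+>\<^bsub>A\<^esub> J" "cnorm A x < \<delta>"
  shows "\<exists>i\<in>I. \<exists>j\<in>J. x = i \<oplus> j \<and> cnorm A i \<le> 3 * \<delta> \<and> cnorm A j \<le> 4 * \<delta>"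
proof -
  interpret I: ideal I A by fact
  interpret J: ideal J A by fact
  obtain i0 j0 where ij: "i0 \<in> I" "j0 \<in> J" "x = i0 \<oplus> j0"
    using x by (auto simp: set_add_iff)
  have c: "i0 \<in> carrier A" "j0 \<in> carrier A" "x \<in> carrier A"
    using ij I.Icarr J.Icarr by auto
  have "\<delta> > 0"
    using x(2) p_nonneg[OF c(3)] by linarith
  then obtain e where e: "e \<in> I" "cnorm A e \<le> 2" "cnorm A (i0 \<ominus> e \<otimes> i0) < \<delta>"
    using approx_unit[OF I ij(1)] by blast
  have ec: "e \<in> carrier A"
    using e I.Icarr by simp
  define i where "i = e \<otimes> x \<oplus> (i0 \<ominus> e \<otimes> i0)"
  define j where "j = j0 \<ominus> e \<otimes> j0"
  have "i \<in> I"
    unfolding i_def using e ij ec c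
    by (auto intro!: I.a_closed I.I_r_closed I.a_inv_closed simp: a_minus_def)
  moreover have "j \<in> J"
    unfolding j_def using ij ec by (auto intro!: J.a_closed J.I_l_closed J.a_inv_closed simp: a_minus_def)
  moreover have eq: "x = i \<oplus> j"
  proof -
    have "i \<oplus> j = i0 \<oplus> j0 \<oplus> (e \<otimes> x \<oplus> (-1) \<odot> (e \<otimes> x))"
      using c ec ij(3) by (simp add: i_def j_def minus_smult_eq r_distr smult_add a_ac)
    also have "e \<otimes> x \<oplus> (-1) \<odot> (e \<otimes> x) = \<zero>"
      using c ec by (simp flip: minus_smult_eq)
    finally show ?thesis
      using c ij(3) by simp
  qed
  moreover have ni: "cnorm A i \<le> 3 * \<delta>"
  proof -
    have "cnorm A (e \<otimes> x) \<le> cnorm A e * cnorm A x"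
      using ec c by (simp add: p_mult)
    also have "\<dots> \<le> 2 * \<delta>"
      using e x c ec by (intro mult_mono) auto
    finally show ?thesis
      using p_triangle[of "e \<otimes> x" "i0 \<ominus> e \<otimes> i0"] e(3) c ec unfolding i_def by simp
  qed
  moreover have "cnorm A j \<le> 4 * \<delta>"
  proof -
    have c': "i \<in> carrier A" "j \<in> carrier A"
      using c ec by (auto simp: i_def j_def)
    have "j = x \<ominus> i"
      using c' unfolding eq by (simp add: add_minus_cancel)
    then show ?thesis
      using p_minus_triangle[of x i] c c' ni x(2) by simp
  qed
  ultimately show ?thesis
    by blast
qed

lemma geometric_converges:
  assumes s: "\<And>n. s n \<in> carrier A" and C: "\<And>n. cnorm A (s (Suc n) \<ominus> s n) \<le> C * (1/2) ^ n"
  shows "\<exists>x\<in>carrier A. (\<lambda>n. cnorm A (s n \<ominus> x)) \<longlonglongrightarrow> 0"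
proof (rule complete[OF s])
  have C0: "0 \<le> C"
    using C[of 0] p_nonneg[OF minus_closed[OF s s], of 1 0] by simp
  \<comment> \<open>Keeping the difference of powers, instead of bounding it by
    \<open>(1/2)^m\<close> at once, is what lets the induction on \<open>d\<close> close.\<close>
  have step: "cnorm A (s (m + d) \<ominus> s m) \<le> 2 * C * ((1/2) ^ m - (1/2) ^ (m + d))" for m d
  proof (induction d)
    case 0
    then show ?case using s by simp
  next
    case (Suc d)
    have "cnorm A (s (m + Suc d) \<ominus> s m)
        \<le> cnorm A (s (Suc (m + d)) \<ominus> s (m + d)) + cnorm A (s (m + d) \<ominus> s m)"
      using p_dist_triangle[of "s (m + Suc d)" "s (m + d)" "s m"] s by simp
    also have "\<dots> \<le> C * (1/2) ^ (m + d) + 2 * C * ((1/2) ^ m - (1/2) ^ (m + d))"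
      using C Suc by (intro add_mono)
    also have "\<dots> = 2 * C * ((1/2) ^ m - (1/2) ^ (m + Suc d))"
      by (simp add: algebra_simps)
    finally show ?case .
  qed
  have step': "cnorm A (s n \<ominus> s m) \<le> 2 * C * (1/2) ^ m" if "m \<le> n" for m n
  proof -
    have "cnorm A (s n \<ominus> s m) \<le> 2 * C * ((1/2) ^ m - (1/2) ^ n)"
      using step[of m "n - m"] that by simp
    also have "\<dots> \<le> 2 * C * (1/2) ^ m"
      using C0 by (intro mult_left_mono) auto
    finally show ?thesis .
  qed
  fix e :: real assume "e > 0"
  have "(\<lambda>n. 2 * C * (1/2) ^ n) \<longlonglongrightarrow> 2 * C * 0"
    by (intro tendsto_mult tendsto_const LIMSEQ_power_zero) auto
  then have "\<forall>\<^sub>F n in sequentially. 2 * C * (1/2) ^ n < e"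
    using \<open>e > 0\<close> by (auto dest: order_tendstoD)
  then obtain K where K: "\<And>n. n \<ge> K \<Longrightarrow> 2 * C * (1/2) ^ n < e"
    by (auto simp: eventually_sequentially)
  have "cnorm A (s m \<ominus> s n) < e" if "m \<ge> K" "n \<ge> K" for m n
  proof (cases "m \<le> n")
    case True
    then show ?thesis
      using step'[OF True] K[OF that(1)] p_minus_commute[OF s s, of m n] by linarith
  next
    case False
    then show ?thesis
      using step'[of n m] K[OF that(2)] by simp
  qed
  then show "\<exists>K. \<forall>m\<ge>K. \<forall>n\<ge>K. cnorm A (s m \<ominus> s n) < e"
    by blast
qed

text \<open>A sequence of sums may converge while its summands do not. The approximations are
  therefore rebuilt recursively: each increment is decomposed with norm control by
  \<open>set_add_decompose\<close>, so that both sequences of summands converge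
  geometrically.\<close>

lemma closed_ideals_set_add:
  assumes "I \<in> closed_ideals A" "J \<in> closed_ideals A"
  shows "I <+>\<^bsub>A\<^esub> J \<in> closed_ideals A"
proof -
  have I: "ideal I A" "limit_closed A I" and J: "ideal J A" "limit_closed A J"
    using assms by (auto simp: closed_ideals_iff)
  interpret I: ideal I A by fact
  interpret J: ideal J A by fact
  interpret IJ: ideal "I <+>\<^bsub>A\<^esub> J" A
    using I J by (rule_tac add_ideals)
  have "limit_closed A (I <+>\<^bsub>A\<^esub> J)"
    unfolding limit_closed_def
  proof (intro allI ballI impI, elim conjE)
    fix s x assume x: "x \<in> carrier A" and s: "\<forall>n. s n \<in> I <+>\<^bsub>A\<^esub> J"
      and lim: "(\<lambda>n. cnorm A (s n \<ominus> x)) \<longlonglongrightarrow> 0"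
    have near: "\<exists>z\<in>I <+>\<^bsub>A\<^esub> J. cnorm A (z \<ominus> x) < \<epsilon>" if "\<epsilon> > 0" for \<epsilon>
    proof -
      have "\<forall>\<^sub>F n in sequentially. cnorm A (s n \<ominus> x) < \<epsilon>"
        using lim that by (rule order_tendstoD)
      then show ?thesis
        using s by (meson eventually_happens' sequentially_bot)
    qed
    define P where "P n ij \<longleftrightarrow> fst ij \<in> I \<and> snd ij \<in> J \<and> cnorm A ((fst ij \<oplus> snd ij) \<ominus> x) < (1/2) ^ n"
      for n and ij :: "'a \<times> 'a"
    \<comment> \<open>Consecutive approximations differ by less than \<open>2 (1/2)^n\<close>; the
      constants 3 and 4 of \<open>set_add_decompose\<close> turn this into 6 and 8.\<close>
    define Q where "Q n ij ij' \<longleftrightarrow> cnorm A (fst ij' \<ominus> fst ij) \<le> 8 * (1/2) ^ n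
        \<and> cnorm A (snd ij' \<ominus> snd ij) \<le> 8 * (1/2) ^ n"
      for n :: nat and ij ij' :: "'a \<times> 'a"
    have "\<exists>f. \<forall>n. P n (f n) \<and> Q n (f n) (f (Suc n))"
    proof (rule dependent_nat_choice)
      obtain z where "z \<in> I <+>\<^bsub>A\<^esub> J" "cnorm A (z \<ominus> x) < 1"
        using near[of 1] by auto
      then show "\<exists>ij. P 0 ij"
        by (auto simp: P_def set_add_iff)
      fix ij n assume P: "P n ij"
      obtain z where z: "z \<in> I <+>\<^bsub>A\<^esub> J" "cnorm A (z \<ominus> x) < (1/2) ^ Suc n"
        using near[of "(1/2) ^ Suc n"] by auto
      obtain i j where [simp]: "ij = (i, j)" by (cases ij)
      have ij: "i \<in> I" "j \<in> J" "cnorm A ((i \<oplus> j) \<ominus> x) < (1/2) ^ n"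
        using P by (auto simp: P_def)
      have c: "i \<in> carrier A" "j \<in> carrier A" "z \<in> carrier A"
        using ij z I.Icarr J.Icarr IJ.Icarr by auto
      have "i \<oplus> j \<in> I <+>\<^bsub>A\<^esub> J"
        using ij by (auto simp: set_add_iff)
      then have "z \<ominus> (i \<oplus> j) \<in> I <+>\<^bsub>A\<^esub> J"
        using IJ.a_closed[OF z(1) IJ.a_inv_closed] by (simp add: a_minus_def)
      moreover have "cnorm A (z \<ominus> (i \<oplus> j)) \<le> cnorm A (z \<ominus> x) + cnorm A ((i \<oplus> j) \<ominus> x)"
        using p_dist_triangle[of z x "i \<oplus> j"] p_minus_commute[of x "i \<oplus> j"] c x by simp
      then have "cnorm A (z \<ominus> (i \<oplus> j)) < 2 * (1/2) ^ n"
        using z(2)[unfolded power_Suc] ij(3) zero_le_power[of "1/2::real" n] by linarith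
      ultimately obtain a b where ab: "a \<in> I" "b \<in> J" "z \<ominus> (i \<oplus> j) = a \<oplus> b"
          "cnorm A a \<le> 3 * (2 * (1/2) ^ n)" "cnorm A b \<le> 4 * (2 * (1/2) ^ n)"
        using set_add_decompose[OF I(1) J(1)] by blast
      have abc: "a \<in> carrier A" "b \<in> carrier A"
        using ab I.Icarr J.Icarr by auto
      have "(i \<oplus> a) \<oplus> (j \<oplus> b) = (z \<ominus> (i \<oplus> j)) \<oplus> (i \<oplus> j)"
        using c abc unfolding ab(3) by (simp add: a_ac)
      also have "\<dots> = z"
        using c by (simp add: minus_add_cancel)
      finally have "P (Suc n) (i \<oplus> a, j \<oplus> b)"
        using z ij ab by (simp add: P_def)
      moreover have "(i \<oplus> a) \<ominus> i = a" "(j \<oplus> b) \<ominus> j = b"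
        using c abc by (simp_all add: add_minus_cancel)
      then have "Q n ij (i \<oplus> a, j \<oplus> b)"
        using ab(4,5) order_trans[OF ab(4), of "8 * (1/2) ^ n"] by (simp add: Q_def)
      ultimately show "\<exists>ij'. P (Suc n) ij' \<and> Q n ij ij'"
        by blast
    qed
    then obtain f where f: "\<And>n. P n (f n)" "\<And>n. Q n (f n) (f (Suc n))"
      by blast
    define i j where "i n = fst (f n)" and "j n = snd (f n)" for n
    have ij: "i n \<in> I" "j n \<in> J" "cnorm A ((i n \<oplus> j n) \<ominus> x) < (1/2) ^ n"
        "cnorm A (i (Suc n) \<ominus> i n) \<le> 8 * (1/2) ^ n" "cnorm A (j (Suc n) \<ominus> j n) \<le> 8 * (1/2) ^ n" for n
      using f by (auto simp: P_def Q_def i_def j_def)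
    have c: "i n \<in> carrier A" "j n \<in> carrier A" for n
      using ij I.Icarr J.Icarr by auto
    obtain a where a: "a \<in> carrier A" "(\<lambda>n. cnorm A (i n \<ominus> a)) \<longlonglongrightarrow> 0"
      using geometric_converges[OF c(1) ij(4)] by blast
    obtain b where b: "b \<in> carrier A" "(\<lambda>n. cnorm A (j n \<ominus> b)) \<longlonglongrightarrow> 0"
      using geometric_converges[OF c(2) ij(5)] by blast
    have "a \<in> I" "b \<in> J"
      using limit_closedD[OF I(2) a(1) ij(1) a(2)] limit_closedD[OF J(2) b(1) ij(2) b(2)] by auto
    moreover have "x = a \<oplus> b"
    proof (rule limit_unique)
      show "i n \<oplus> j n \<in> carrier A" for n using c by simp
      show "(\<lambda>n. cnorm A (i n \<oplus> j n \<ominus> x)) \<longlonglongrightarrow> 0"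
        by (rule Lim_null_comparison[of _ "\<lambda>n. (1/2) ^ n"])
          (use ij(3) c x in \<open>auto intro!: always_eventually LIMSEQ_power_zero less_imp_le\<close>)
      show "(\<lambda>n. cnorm A (i n \<oplus> j n \<ominus> (a \<oplus> b))) \<longlonglongrightarrow> 0"
        by (rule Lim_null_comparison[of _ "\<lambda>n. cnorm A (i n \<ominus> a) + cnorm A (j n \<ominus> b)"])
          (use c a b tendsto_add[OF a(2) b(2)] in \<open>auto intro!: always_eventually p_add_dist\<close>)
    qed (use x a b in auto)
    ultimately show "x \<in> I <+>\<^bsub>A\<^esub> J"
      by (auto simp: set_add_iff)
  qed
  then show ?thesis
    using IJ.is_ideal by (simp add: closed_ideals_iff)
qed

section \<open>Lattice laws for closed ideals\<close>

lemma closed_ideals_Int: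
  "\<lbrakk>I \<in> closed_ideals A; J \<in> closed_ideals A\<rbrakk> \<Longrightarrow> I \<inter> J \<in> closed_ideals A"
  by (simp add: closed_ideals_iff i_intersect limit_closed_Int)

lemma closed_ideals_set_add_commute:
  assumes "I \<in> closed_ideals A" "J \<in> closed_ideals A"
  shows "I <+>\<^bsub>A\<^esub> J = J <+>\<^bsub>A\<^esub> I"
  using assms by (intro set_add_comm) (auto simp: closed_ideals_iff ideal_def additive_subgroup.a_subset)

lemma closed_ideals_set_add_assoc:
  assumes "I \<in> closed_ideals A" "J \<in> closed_ideals A" "K \<in> closed_ideals A"
  shows "(I <+>\<^bsub>A\<^esub> J) <+>\<^bsub>A\<^esub> K = I <+>\<^bsub>A\<^esub> (J <+>\<^bsub>A\<^esub> K)"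
proof -
  have c: "\<And>x. x \<in> I \<Longrightarrow> x \<in> carrier A" "\<And>x. x \<in> J \<Longrightarrow> x \<in> carrier A" "\<And>x. x \<in> K \<Longrightarrow> x \<in> carrier A"
    using assms by (auto simp: closed_ideals_iff intro: ideal.Icarr)
  have "x \<in> (I <+>\<^bsub>A\<^esub> J) <+>\<^bsub>A\<^esub> K \<longleftrightarrow> (\<exists>i\<in>I. \<exists>j\<in>J. \<exists>k\<in>K. x = (i \<oplus> j) \<oplus> k)" for x
    unfolding set_add_iff Bex_def by blast
  moreover have "x \<in> I <+>\<^bsub>A\<^esub> (J <+>\<^bsub>A\<^esub> K) \<longleftrightarrow> (\<exists>i\<in>I. \<exists>j\<in>J. \<exists>k\<in>K. x = i \<oplus> (j \<oplus> k))" for x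
    unfolding set_add_iff Bex_def by blast
  ultimately show ?thesis
    using c by (simp add: set_eq_iff a_assoc)
qed

lemma closed_ideals_absorb:
  assumes "I \<in> closed_ideals A" "J \<in> closed_ideals A"
  shows "I \<inter> (I <+>\<^bsub>A\<^esub> J) = I" "I <+>\<^bsub>A\<^esub> (I \<inter> J) = I"
proof -
  interpret I: ideal I A using assms by (simp add: closed_ideals_iff)
  interpret J: ideal J A using assms by (simp add: closed_ideals_iff)
  have *: "I \<subseteq> I <+>\<^bsub>A\<^esub> K" if "\<zero> \<in> K" for K
  proof
    fix x assume "x \<in> I"
    then show "x \<in> I <+>\<^bsub>A\<^esub> K"
      using that I.Icarr unfolding set_add_iff by (intro bexI[of _ x] bexI[of _ \<zero>]) auto
  qed
  show "I \<inter> (I <+>\<^bsub>A\<^esub> J) = I"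
    using *[OF J.zero_closed] by blast
  have "I <+>\<^bsub>A\<^esub> (I \<inter> J) \<subseteq> I"
    by (auto simp: set_add_iff intro: I.a_closed)
  then show "I <+>\<^bsub>A\<^esub> (I \<inter> J) = I"
    using *[of "I \<inter> J"] I.zero_closed J.zero_closed by blast
qed

text \<open>If \<open>x = j + k\<close> lies in \<open>I\<close> and \<open>e\<close> is in
  \<open>I\<close>, then \<open>e x = e j + e k\<close> lies in the right-hand side. An approximate
  unit lets \<open>e x\<close> tend to \<open>x\<close>, and the right-hand side is closed as a sum
  of closed ideals.\<close>

lemma closed_ideals_Int_distrib:
  assumes "I \<in> closed_ideals A" "J \<in> closed_ideals A" "K \<in> closed_ideals A"
  shows "I \<inter> (J <+>\<^bsub>A\<^esub> K) = (I \<inter> J) <+>\<^bsub>A\<^esub> (I \<inter> K)"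
proof
  interpret I: ideal I A using assms by (simp add: closed_ideals_iff)
  interpret J: ideal J A using assms by (simp add: closed_ideals_iff)
  interpret K: ideal K A using assms by (simp add: closed_ideals_iff)
  show "(I \<inter> J) <+>\<^bsub>A\<^esub> (I \<inter> K) \<subseteq> I \<inter> (J <+>\<^bsub>A\<^esub> K)"
    unfolding subset_iff Int_iff set_add_iff by blast
  have "(I \<inter> J) <+>\<^bsub>A\<^esub> (I \<inter> K) \<in> closed_ideals A"
    using assms by (intro closed_ideals_set_add closed_ideals_Int)
  then have lc: "limit_closed A ((I \<inter> J) <+>\<^bsub>A\<^esub> (I \<inter> K))"
    by (simp add: closed_ideals_iff)
  show "I \<inter> (J <+>\<^bsub>A\<^esub> K) \<subseteq> (I \<inter> J) <+>\<^bsub>A\<^esub> (I \<inter> K)"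
  proof
    fix x assume "x \<in> I \<inter> (J <+>\<^bsub>A\<^esub> K)"
    then obtain j k where x: "x \<in> I" "j \<in> J" "k \<in> K" "x = j \<oplus> k"
      by (auto simp: set_add_iff)
    have c: "x \<in> carrier A" "j \<in> carrier A" "k \<in> carrier A"
      using x I.Icarr J.Icarr K.Icarr by auto
    have "\<exists>e\<in>I. cnorm A (x \<ominus> e \<otimes> x) < (1/2) ^ n" for n :: nat
      using approx_unit[OF I.is_ideal x(1), of "(1/2) ^ n"] by auto
    then obtain e where e: "\<And>n. e n \<in> I" "\<And>n :: nat. cnorm A (x \<ominus> e n \<otimes> x) < (1/2) ^ n"
      by metis
    have ec: "e n \<in> carrier A" for n
      using e I.Icarr by simp
    have "e n \<otimes> j \<in> I \<inter> J" "e n \<otimes> k \<in> I \<inter> K" for n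
      using e ec c x by (auto intro: I.I_r_closed J.I_l_closed K.I_l_closed)
    moreover have "e n \<otimes> x = e n \<otimes> j \<oplus> e n \<otimes> k" for n
      using ec c x by (simp add: r_distr)
    ultimately have "e n \<otimes> x \<in> (I \<inter> J) <+>\<^bsub>A\<^esub> (I \<inter> K)" for n
      unfolding set_add_iff Bex_def by blast
    moreover have "(\<lambda>n. cnorm A (e n \<otimes> x \<ominus> x)) \<longlonglongrightarrow> 0"
    proof (rule Lim_null_comparison[of _ "\<lambda>n. (1/2) ^ n"])
      have "norm (cnorm A (e n \<otimes> x \<ominus> x)) \<le> (1/2) ^ n" for n
        using e(2)[of n] p_minus_commute[of x "e n \<otimes> x"] ec c by simp
      then show "\<forall>\<^sub>F n in sequentially. norm (cnorm A (e n \<otimes> x \<ominus> x)) \<le> (1/2) ^ n"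
        by simp
    qed (auto intro: LIMSEQ_power_zero)
    ultimately show "x \<in> (I \<inter> J) <+>\<^bsub>A\<^esub> (I \<inter> K)"
      by (rule limit_closedD[OF lc c(1)])
  qed
qed

text \<open>In any lattice one distributive law follows from the other by absorption; this is that
  computation.\<close>

lemma closed_ideals_set_add_distrib:
  assumes "I \<in> closed_ideals A" "J \<in> closed_ideals A" "K \<in> closed_ideals A"
  shows "I <+>\<^bsub>A\<^esub> (J \<inter> K) = (I <+>\<^bsub>A\<^esub> J) \<inter> (I <+>\<^bsub>A\<^esub> K)"
proof -
  note c = assms closed_ideals_set_add closed_ideals_Int
  have "(I <+>\<^bsub>A\<^esub> J) \<inter> (I <+>\<^bsub>A\<^esub> K) = ((I <+>\<^bsub>A\<^esub> J) \<inter> I) <+>\<^bsub>A\<^esub> ((I <+>\<^bsub>A\<^esub> J) \<inter> K)"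
    by (intro closed_ideals_Int_distrib c)
  also have "(I <+>\<^bsub>A\<^esub> J) \<inter> I = I"
    using closed_ideals_absorb(1)[OF assms(1,2)] by (simp add: Int_commute)
  also have "(I <+>\<^bsub>A\<^esub> J) \<inter> K = (I \<inter> K) <+>\<^bsub>A\<^esub> (J \<inter> K)"
    using closed_ideals_Int_distrib[of K I J] assms by (simp add: Int_commute)
  also have "I <+>\<^bsub>A\<^esub> ((I \<inter> K) <+>\<^bsub>A\<^esub> (J \<inter> K)) = (I <+>\<^bsub>A\<^esub> (I \<inter> K)) <+>\<^bsub>A\<^esub> (J \<inter> K)"
    by (intro closed_ideals_set_add_assoc[symmetric] c)
  also have "I <+>\<^bsub>A\<^esub> (I \<inter> K) = I"
    by (rule closed_ideals_absorb(2)[OF assms(1,3)])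
  finally show ?thesis by simp
qed

end

section \<open>Separated completions\<close>

text \<open>\<open>completion\<close> copies the ring fields of a quotient ring into a larger
  record, so the ring laws have to be carried across.\<close>

lemma ring_cong:
  fixes R :: "('a, 'm) ring_scheme" and S :: "('a, 'n) ring_scheme"
  assumes "ring R" and eq: "carrier S = carrier R" "monoid.mult S = monoid.mult R" "one S = one R"
    "zero S = zero R" "add S = add R"
  shows "ring S"
proof -
  interpret R: ring R by fact
  show ?thesis
  proof (intro ringI abelian_groupI monoidI; unfold eq)
    show "\<exists>y\<in>carrier R. y \<oplus>\<^bsub>R\<^esub> x = \<zero>\<^bsub>R\<^esub>" if "x \<in> carrier R" for x
      using that R.l_neg by blast
  qed (auto simp: R.ring_simprules)
qed

context cstar_semi
begin

abbreviation "cauchy_alg \<equiv> cauchy_algebra P p"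
abbreviation "null_seqs \<equiv> null_sequences P p"
abbreviation "compl \<equiv> completion P p"
abbreviation "cls s \<equiv> null_seqs +>\<^bsub>cauchy_alg\<^esub> s"

definition cauchy :: "(nat \<Rightarrow> 'a) \<Rightarrow> bool" where
  "cauchy s \<longleftrightarrow> (\<forall>n. s n \<in> carrier P) \<and> (\<forall>e>0. \<exists>K. \<forall>m\<ge>K. \<forall>n\<ge>K. p (s m \<ominus> s n) < e)"

lemma carrier_cauchy_alg: "s \<in> carrier cauchy_alg \<longleftrightarrow> cauchy s"
  by (simp add: cauchy_algebra_def cauchy_def)

lemma cauchy_closed [simp]: "cauchy s \<Longrightarrow> s n \<in> carrier P"
  by (simp add: cauchy_def)

lemma cauchyD:
  assumes "cauchy s" "e > 0"
  obtains K where "\<And>m n. \<lbrakk>m \<ge> K; n \<ge> K\<rbrakk> \<Longrightarrow> p (s m \<ominus> s n) < e"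
  using assms unfolding cauchy_def by blast

lemma cauchy_bounded:
  assumes "cauchy s"
  obtains B where "B > 0" "\<And>n. p (s n) \<le> B"
proof -
  obtain K where K: "\<And>m n. \<lbrakk>m \<ge> K; n \<ge> K\<rbrakk> \<Longrightarrow> p (s m \<ominus> s n) < 1"
    using cauchyD[OF assms, of 1] by auto
  define B where "B = 1 + p (s K) + (\<Sum>n<K. p (s n))"
  have S: "0 \<le> (\<Sum>n<K. p (s n))"
    using assms by (intro sum_nonneg) simp
  have K0: "0 \<le> p (s K)"
    using assms by simp
  have "p (s n) \<le> B" for n
  proof (cases "n < K")
    case True
    then have "p (s n) \<le> (\<Sum>n<K. p (s n))"
      using assms by (intro member_le_sum) auto
    then show ?thesis
      using K0 by (simp add: B_def)
  next
    case False
    then have "p (s n) \<le> 1 + p (s K)"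
      using p_le_add_dist[of "s n" "s K"] K[of n K] assms by fastforce
    then show ?thesis
      using S by (simp add: B_def)
  qed
  moreover have "B > 0"
    using S K0 by (simp add: B_def)
  ultimately show thesis
    using that by blast
qed

text \<open>Each algebra operation is Lipschitz on bounded sequences, so that this one estimate
  shows Cauchy sequences to be closed under all of them.\<close>

lemma cauchy_dominated:
  assumes s: "cauchy s" and t: "cauchy t" and r: "\<And>n. r n \<in> carrier P"
    and dom: "\<And>m n. p (r m \<ominus> r n) \<le> C * (p (s m \<ominus> s n) + p (t m \<ominus> t n))"
  shows "cauchy r"
  unfolding cauchy_def
proof (intro conjI allI impI r)
  fix e :: real assume "e > 0"
  \<comment> \<open>The absolute value and the added 1 keep the denominator positive whatever the
    sign of \<open>C\<close>.\<close>
  define d where "d = e / (2 * (\<bar>C\<bar> + 1))"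
  have d: "d > 0" "2 * d * \<bar>C\<bar> < e"
    using \<open>e > 0\<close> by (auto simp: d_def field_simps)
  obtain K where K: "\<And>m n. \<lbrakk>m \<ge> K; n \<ge> K\<rbrakk> \<Longrightarrow> p (s m \<ominus> s n) < d"
    using cauchyD[OF s d(1)] by blast
  obtain L where L: "\<And>m n. \<lbrakk>m \<ge> L; n \<ge> L\<rbrakk> \<Longrightarrow> p (t m \<ominus> t n) < d"
    using cauchyD[OF t d(1)] by blast
  have "p (r m \<ominus> r n) < e" if "m \<ge> max K L" "n \<ge> max K L" for m n
  proof -
    have "0 \<le> p (s m \<ominus> s n) + p (t m \<ominus> t n)" "p (s m \<ominus> s n) + p (t m \<ominus> t n) \<le> 2 * d"
      using K[of m n] L[of m n] that s t by auto
    then have "C * (p (s m \<ominus> s n) + p (t m \<ominus> t n)) \<le> \<bar>C\<bar> * (2 * d)"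
      by (intro mult_mono) auto
    then show ?thesis
      using dom[of m n] d(2) by (simp add: mult.commute mult.left_commute)
  qed
  then show "\<exists>K. \<forall>m\<ge>K. \<forall>n\<ge>K. p (r m \<ominus> r n) < e"
    by blast
qed

lemma cauchy_const [simp]: "x \<in> carrier P \<Longrightarrow> cauchy (\<lambda>n. x)"
  by (simp add: cauchy_def)

lemma cauchy_add: "\<lbrakk>cauchy s; cauchy t\<rbrakk> \<Longrightarrow> cauchy (\<lambda>n. s n \<oplus> t n)"
  by (rule cauchy_dominated[of s t _ 1]) (auto simp: p_add_dist)

lemma cauchy_smult: "cauchy s \<Longrightarrow> cauchy (\<lambda>n. c \<odot> s n)"
  by (rule cauchy_dominated[of s s _ "cmod c"]) (auto simp: p_smult_dist mult_left_mono)

lemma cauchy_star: "cauchy s \<Longrightarrow> cauchy (\<lambda>n. star P (s n))"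
  by (rule cauchy_dominated[of s s _ 1]) (auto simp: p_star_dist)

lemma cauchy_mult:
  assumes s: "cauchy s" and t: "cauchy t"
  shows "cauchy (\<lambda>n. s n \<otimes> t n)"
proof -
  obtain B where B: "B > 0" "\<And>n. p (s n) \<le> B"
    using cauchy_bounded[OF s] by blast
  obtain C where C: "C > 0" "\<And>n. p (t n) \<le> C"
    using cauchy_bounded[OF t] by blast
  show ?thesis
  proof (rule cauchy_dominated[OF s t, of _ "B + C"])
    fix m n
    have "p (s m \<otimes> t m \<ominus> s n \<otimes> t n) \<le> p (s m \<ominus> s n) * p (t m) + p (s n) * p (t m \<ominus> t n)"
      using s t by (intro p_mult_dist) auto
    also have "\<dots> \<le> p (s m \<ominus> s n) * (B + C) + (B + C) * p (t m \<ominus> t n)"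
      using B(1) B(2)[of n] C(1) C(2)[of m] s t
      by (intro add_mono mult_left_mono mult_right_mono) auto
    finally show "p (s m \<otimes> t m \<ominus> s n \<otimes> t n) \<le> (B + C) * (p (s m \<ominus> s n) + p (t m \<ominus> t n))"
      by (simp add: algebra_simps)
  qed (use s t in auto)
qed

lemmas cauchy_intros = cauchy_const cauchy_add cauchy_smult cauchy_star cauchy_mult

lemma cauchy_alg_simps:
  "monoid.mult cauchy_alg = (\<lambda>s t n. s n \<otimes> t n)" "one cauchy_alg = (\<lambda>n. \<one>)"
  "zero cauchy_alg = (\<lambda>n. \<zero>)" "add cauchy_alg = (\<lambda>s t n. s n \<oplus> t n)"
  "smult cauchy_alg = (\<lambda>c s n. c \<odot> s n)" "star cauchy_alg = (\<lambda>s n. star P (s n))"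
  by (simp_all add: cauchy_algebra_def)

lemma star_alg_cauchy_alg: "star_alg cauchy_alg"
proof (rule star_alg.intro)
  show "ring cauchy_alg"
  proof (intro ringI abelian_groupI monoidI; unfold carrier_cauchy_alg cauchy_alg_simps)
    show "\<exists>y\<in>carrier cauchy_alg. (\<lambda>n. y n \<oplus> x n) = (\<lambda>n. \<zero>)" if "cauchy x" for x
    proof
      show "(\<lambda>n. (-1) \<odot> x n \<oplus> x n) = (\<lambda>n. \<zero>)"
        using that by (simp flip: a_inv_smult add: l_neg)
    qed (use that in \<open>simp add: carrier_cauchy_alg cauchy_smult\<close>)
  qed (auto intro!: cauchy_intros ext simp: ring_simprules)
  show "star_alg_axioms cauchy_alg"
    by (unfold_locales; unfold carrier_cauchy_alg cauchy_alg_simps)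
      (auto intro!: cauchy_intros ext simp: smult_add add_smult)
qed

interpretation Q: star_alg cauchy_alg
  by (rule star_alg_cauchy_alg)

lemma Q_minus: "\<lbrakk>cauchy s; cauchy t\<rbrakk> \<Longrightarrow> s \<ominus>\<^bsub>cauchy_alg\<^esub> t = (\<lambda>n. s n \<ominus> t n)"
  by (simp add: Q.minus_smult_eq carrier_cauchy_alg cauchy_alg_simps minus_smult_eq)

lemma null_seqs_iff: "s \<in> null_seqs \<longleftrightarrow> cauchy s \<and> (\<lambda>n. p (s n)) \<longlonglongrightarrow> 0"
  by (simp add: null_sequences_def carrier_cauchy_alg)

lemma null_dominated:
  assumes "s \<in> null_seqs" "cauchy r" "\<And>n. p (r n) \<le> C * p (s n)"
  shows "r \<in> null_seqs"
proof -
  have "(\<lambda>n. C * p (s n)) \<longlonglongrightarrow> 0"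
    using assms by (intro tendsto_mult_right_zero) (simp add: null_seqs_iff)
  then have "(\<lambda>n. p (r n)) \<longlonglongrightarrow> 0"
    by (rule Lim_null_comparison[rotated]) (use assms in auto)
  then show ?thesis
    using assms by (simp add: null_seqs_iff)
qed

lemma ideal_null_seqs: "ideal null_seqs cauchy_alg"
proof (rule idealI)
  show "subgroup null_seqs (add_monoid cauchy_alg)"
  proof (rule Q.add.subgroupI)
    show "null_seqs \<subseteq> carrier cauchy_alg"
      by (auto simp: null_seqs_iff carrier_cauchy_alg)
    have "(\<lambda>n. \<zero>) \<in> null_seqs"
      by (simp add: null_seqs_iff)
    then show "null_seqs \<noteq> {}" by blast
    fix a assume a: "a \<in> null_seqs"
    then have ca: "cauchy a" by (simp add: null_seqs_iff)
    have "\<ominus>\<^bsub>cauchy_alg\<^esub> a = (\<lambda>n. (-1) \<odot> a n)"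
      using ca by (simp add: Q.a_inv_smult carrier_cauchy_alg cauchy_alg_simps)
    then show "\<ominus>\<^bsub>cauchy_alg\<^esub> a \<in> null_seqs"
      using null_dominated[OF a, of _ 1] ca by (simp add: cauchy_smult)
    fix b assume b: "b \<in> null_seqs"
    then have cb: "cauchy b" by (simp add: null_seqs_iff)
    have "(\<lambda>n. p (a n) + p (b n)) \<longlonglongrightarrow> 0"
      using tendsto_add[of "\<lambda>n. p (a n)" 0 _ "\<lambda>n. p (b n)" 0] a b by (simp add: null_seqs_iff)
    then have "(\<lambda>n. p (a n \<oplus> b n)) \<longlonglongrightarrow> 0"
      by (rule Lim_null_comparison[rotated]) (use ca cb in \<open>auto intro!: always_eventually p_triangle\<close>)
    then show "a \<oplus>\<^bsub>cauchy_alg\<^esub> b \<in> null_seqs"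
      using ca cb by (simp add: null_seqs_iff cauchy_alg_simps cauchy_add)
  qed
next
  fix a x assume a: "a \<in> null_seqs" and "x \<in> carrier cauchy_alg"
  then have x: "cauchy x" and ca: "cauchy a"
    by (auto simp: carrier_cauchy_alg null_seqs_iff)
  obtain B where B: "B > 0" "\<And>n. p (x n) \<le> B"
    using cauchy_bounded[OF x] by blast
  have "p (x n \<otimes> a n) \<le> B * p (a n)" "p (a n \<otimes> x n) \<le> B * p (a n)" for n
    using B(2)[of n] p_mult[of "x n" "a n"] p_mult[of "a n" "x n"] x ca
      mult_right_mono[OF B(2)[of n], of "p (a n)"] by (auto simp: mult.commute)
  then show "x \<otimes>\<^bsub>cauchy_alg\<^esub> a \<in> null_seqs" "a \<otimes>\<^bsub>cauchy_alg\<^esub> x \<in> null_seqs"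
    using x ca by (auto intro!: null_dominated[OF a] cauchy_mult simp: cauchy_alg_simps)
qed (rule Q.ring_axioms)

interpretation I: ideal null_seqs cauchy_alg
  by (rule ideal_null_seqs)

lemma cls_eq_iff:
  assumes "cauchy s" "cauchy t"
  shows "cls s = cls t \<longleftrightarrow> (\<lambda>n. p (s n \<ominus> t n)) \<longlonglongrightarrow> 0"
proof -
  have "cauchy (\<lambda>n. s n \<ominus> t n)"
    using assms Q.minus_closed[of s t] by (simp add: carrier_cauchy_alg Q_minus)
  moreover have "cls s = cls t \<longleftrightarrow> s \<ominus>\<^bsub>cauchy_alg\<^esub> t \<in> null_seqs"
    using Q.quotient_eq_iff_same_a_r_cos[OF ideal_null_seqs] assms by (simp add: carrier_cauchy_alg)
  ultimately show ?thesis
    using assms by (simp add: Q_minus null_seqs_iff)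
qed

lemma mem_cls:
  assumes "cauchy s" "t \<in> cls s"
  shows "cauchy t" "cls t = cls s"
proof -
  have "t \<in> carrier cauchy_alg"
    using assms I.a_elemrcos_carrier by (simp add: carrier_cauchy_alg)
  then show "cauchy t"
    by (simp add: carrier_cauchy_alg)
  show "cls t = cls s"
    using I.a_repr_independence'[OF assms(2)] assms by (simp add: carrier_cauchy_alg)
qed

lemma cls_self: "cauchy s \<Longrightarrow> s \<in> cls s"
  by (simp add: I.a_rcos_self carrier_cauchy_alg)

text \<open>\<open>completion\<close> defines scalar multiples and adjoints as unions over all
  representatives of a class. A Lipschitz operation sends null differences to null differences, so
  every member of the union is the same coset.\<close>

lemma UN_cls:
  assumes s: "cauchy s" and F: "\<And>t. cauchy t \<Longrightarrow> cauchy (F t)"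
    and C: "\<And>t n. cauchy t \<Longrightarrow> p (F t n \<ominus> F s n) \<le> C * p (t n \<ominus> s n)"
  shows "(\<Union>t\<in>cls s. cls (F t)) = cls (F s)"
proof -
  have "cls (F t) = cls (F s)" if t: "t \<in> cls s" for t
  proof -
    note t' = mem_cls[OF s t]
    have "(\<lambda>n. C * p (t n \<ominus> s n)) \<longlonglongrightarrow> 0"
      using t'(2) cls_eq_iff[OF t'(1) s] by (intro tendsto_mult_right_zero) simp
    then have "(\<lambda>n. p (F t n \<ominus> F s n)) \<longlonglongrightarrow> 0"
      by (rule Lim_null_comparison[rotated]) (use C F s t' in \<open>auto intro!: always_eventually\<close>)
    then show ?thesis
      using cls_eq_iff F t' s by blast
  qed
  then have "(\<Union>t\<in>cls s. cls (F t)) = (\<Union>t\<in>cls s. cls (F s))"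
    by (rule SUP_cong[OF refl])
  then show ?thesis
    using cls_self[OF s] by auto
qed

lemma carrier_compl: "carrier compl = {cls s | s. cauchy s}"
  by (auto simp: completion_def Let_def FactRing_simps A_RCOSETS_def' carrier_cauchy_alg)

lemma compl_cases:
  assumes "x \<in> carrier compl"
  obtains s where "cauchy s" "x = cls s"
  using assms by (auto simp: carrier_compl)

lemma cls_in_carrier [simp]: "cauchy s \<Longrightarrow> cls s \<in> carrier compl"
  by (auto simp: carrier_compl)

lemma compl_simps:
  shows "\<lbrakk>cauchy s; cauchy t\<rbrakk> \<Longrightarrow> cls s \<otimes>\<^bsub>compl\<^esub> cls t = cls (\<lambda>n. s n \<otimes> t n)"
    and "one compl = cls (\<lambda>n. \<one>)" "zero compl = cls (\<lambda>n. \<zero>)"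
    and "\<lbrakk>cauchy s; cauchy t\<rbrakk> \<Longrightarrow> cls s \<oplus>\<^bsub>compl\<^esub> cls t = cls (\<lambda>n. s n \<oplus> t n)"
    and "cauchy s \<Longrightarrow> c \<odot>\<^bsub>compl\<^esub> cls s = cls (\<lambda>n. c \<odot> s n)"
    and "cauchy s \<Longrightarrow> star compl (cls s) = cls (\<lambda>n. star P (s n))"
proof -
  show "cls s \<otimes>\<^bsub>compl\<^esub> cls t = cls (\<lambda>n. s n \<otimes> t n)" if "cauchy s" "cauchy t"
    using that I.rcoset_mult_add[of s t]
    by (simp add: completion_def Let_def FactRing_def carrier_cauchy_alg cauchy_alg_simps(1))
  show "one compl = cls (\<lambda>n. \<one>)"
    by (simp add: completion_def Let_def FactRing_def cauchy_alg_simps(2))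
  show "zero compl = cls (\<lambda>n. \<zero>)"
    using Q.a_rcos_zero[OF ideal_null_seqs I.zero_closed]
    by (simp add: completion_def Let_def FactRing_def cauchy_alg_simps(3))
  show "cls s \<oplus>\<^bsub>compl\<^esub> cls t = cls (\<lambda>n. s n \<oplus> t n)" if "cauchy s" "cauchy t"
    using that I.a_rcos_sum[of s t]
    by (simp add: completion_def Let_def FactRing_def carrier_cauchy_alg cauchy_alg_simps(4))
  show "c \<odot>\<^bsub>compl\<^esub> cls s = cls (\<lambda>n. c \<odot> s n)" if "cauchy s"
    using UN_cls[OF that, of "\<lambda>s n. c \<odot> s n" "cmod c"] that
    by (simp add: completion_def Let_def cauchy_alg_simps(5) cauchy_smult p_smult_dist)
  show "star compl (cls s) = cls (\<lambda>n. star P (s n))" if "cauchy s"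
    using UN_cls[OF that, of "\<lambda>s n. star P (s n)" 1] that
    by (simp add: completion_def Let_def cauchy_alg_simps(6) cauchy_star p_star_dist)
qed

lemma star_alg_compl: "star_alg compl"
proof (rule star_alg.intro)
  show "ring compl"
    by (rule ring_cong[OF I.quotient_is_ring]) (simp_all add: completion_def Let_def)
  show "star_alg_axioms compl"
    by unfold_locales
      (auto elim!: compl_cases simp: compl_simps cauchy_intros smult_add add_smult)
qed

interpretation C: star_alg compl
  by (rule star_alg_compl)

lemma compl_minus:
  "\<lbrakk>cauchy s; cauchy t\<rbrakk> \<Longrightarrow> cls s \<ominus>\<^bsub>compl\<^esub> cls t = cls (\<lambda>n. s n \<ominus> t n)"
  by (simp add: C.minus_smult_eq compl_simps cauchy_intros minus_smult_eq)

lemma cauchy_minus: "\<lbrakk>cauchy s; cauchy t\<rbrakk> \<Longrightarrow> cauchy (\<lambda>n. s n \<ominus> t n)"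
  by (simp add: minus_smult_eq cauchy_intros)

text \<open>The definite description in \<open>cnorm\<close> is meaningful: the seminorms of a
  Cauchy sequence converge in the reals, with the same limit for all representatives of the
  class.\<close>

lemma cnorm_cls:
  assumes s: "cauchy s"
  shows "(\<lambda>n. p (s n)) \<longlonglongrightarrow> cnorm compl (cls s)"
proof -
  have "Cauchy (\<lambda>n. p (s n))"
    unfolding Cauchy_def dist_real_def
  proof (intro allI impI)
    fix e :: real assume "e > 0"
    then obtain K where K: "\<And>m n. \<lbrakk>m \<ge> K; n \<ge> K\<rbrakk> \<Longrightarrow> p (s m \<ominus> s n) < e"
      using cauchyD[OF s] by blast
    have "\<bar>p (s m) - p (s n)\<bar> < e" if "m \<ge> K" "n \<ge> K" for m n
      using K[OF that] p_abs_diff[of "s m" "s n"] s by simp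
    then show "\<exists>M. \<forall>m\<ge>M. \<forall>n\<ge>M. \<bar>p (s m) - p (s n)\<bar> < e"
      by blast
  qed
  then obtain r where r: "(\<lambda>n. p (s n)) \<longlonglongrightarrow> r"
    by (auto simp: Cauchy_convergent_iff convergent_def)
  have "\<forall>t\<in>cls s. (\<lambda>n. p (t n)) \<longlonglongrightarrow> r"
  proof
    fix t assume t: "t \<in> cls s"
    note t' = mem_cls[OF s t]
    have "(\<lambda>n. p (t n \<ominus> s n)) \<longlonglongrightarrow> 0"
      using t' cls_eq_iff s by blast
    then have "(\<lambda>n. p (t n) - p (s n)) \<longlonglongrightarrow> 0"
      by (rule Lim_null_comparison[rotated]) (use p_abs_diff t' s in \<open>auto intro!: always_eventually\<close>)
    then show "(\<lambda>n. p (t n)) \<longlonglongrightarrow> r"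
      using tendsto_add[OF r] by fastforce
  qed
  then have "(THE r. \<forall>t\<in>cls s. (\<lambda>n. p (t n)) \<longlonglongrightarrow> r) = r"
    using cls_self[OF s] by (intro the_equality) (auto intro: LIMSEQ_unique)
  then show ?thesis
    using r by (simp add: completion_def Let_def)
qed

lemma cnorm_cls_le:
  assumes "cauchy s" "\<And>n. n \<ge> K \<Longrightarrow> p (s n) \<le> r"
  shows "cnorm compl (cls s) \<le> r"
  using cnorm_cls[OF assms(1)] assms(2) by (intro LIMSEQ_le_const2) auto

lemma cstar_seminorm_compl: "cstar_seminorm compl (cnorm compl)"
  unfolding cstar_seminorm_def
proof (intro conjI ballI allI)
  fix x assume "x \<in> carrier compl"
  then obtain s where s: "cauchy s" "x = cls s"
    by (auto simp: carrier_compl)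
  note ls = cnorm_cls[OF s(1)]
  show "0 \<le> cnorm compl x"
    using s ls by (auto intro!: LIMSEQ_le_const)
  show "cnorm compl (c \<odot>\<^bsub>compl\<^esub> x) = cmod c * cnorm compl x" for c
  proof (rule LIMSEQ_unique)
    show "(\<lambda>n. p (c \<odot> s n)) \<longlonglongrightarrow> cnorm compl (c \<odot>\<^bsub>compl\<^esub> x)"
      using cnorm_cls[OF cauchy_smult[OF s(1)]] s by (simp only: compl_simps)
    show "(\<lambda>n. p (c \<odot> s n)) \<longlonglongrightarrow> cmod c * cnorm compl x"
      using tendsto_mult[OF tendsto_const ls, of "cmod c"] s by simp
  qed
  show "cnorm compl (star compl x \<otimes>\<^bsub>compl\<^esub> x) = (cnorm compl x)\<^sup>2"
  proof (rule LIMSEQ_unique)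
    show "(\<lambda>n. p (star P (s n) \<otimes> s n)) \<longlonglongrightarrow> cnorm compl (star compl x \<otimes>\<^bsub>compl\<^esub> x)"
      using cnorm_cls[OF cauchy_mult[OF cauchy_star[OF s(1)] s(1)]] s
      by (simp only: compl_simps cauchy_star)
    show "(\<lambda>n. p (star P (s n) \<otimes> s n)) \<longlonglongrightarrow> (cnorm compl x)\<^sup>2"
      using tendsto_power[OF ls, of 2] s by (simp add: p_star_mult)
  qed
  fix y assume "y \<in> carrier compl"
  then obtain t where t: "cauchy t" "y = cls t"
    by (auto simp: carrier_compl)
  note lt = cnorm_cls[OF t(1)]
  show "cnorm compl (x \<oplus>\<^bsub>compl\<^esub> y) \<le> cnorm compl x + cnorm compl y"
  proof (rule LIMSEQ_le)
    show "(\<lambda>n. p (s n \<oplus> t n)) \<longlonglongrightarrow> cnorm compl (x \<oplus>\<^bsub>compl\<^esub> y)"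
      using cnorm_cls[OF cauchy_add[OF s(1) t(1)]] s t by (simp only: compl_simps)
    show "(\<lambda>n. p (s n) + p (t n)) \<longlonglongrightarrow> cnorm compl x + cnorm compl y"
      using tendsto_add[OF ls lt] s t by simp
  qed (use s t p_triangle in auto)
  show "cnorm compl (x \<otimes>\<^bsub>compl\<^esub> y) \<le> cnorm compl x * cnorm compl y"
  proof (rule LIMSEQ_le)
    show "(\<lambda>n. p (s n \<otimes> t n)) \<longlonglongrightarrow> cnorm compl (x \<otimes>\<^bsub>compl\<^esub> y)"
      using cnorm_cls[OF cauchy_mult[OF s(1) t(1)]] s t by (simp only: compl_simps)
    show "(\<lambda>n. p (s n) * p (t n)) \<longlonglongrightarrow> cnorm compl x * cnorm compl y"
      using tendsto_mult[OF ls lt] s t by simp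
  qed (use s t p_mult in auto)
qed

interpretation C: cstar_semi compl "cnorm compl"
  by unfold_locales (rule cstar_seminorm_compl)

lemma completion_of_eq: "completion_of P p x = cls (\<lambda>n. x)"
  by (simp add: completion_of_def)

lemma cnorm_completion_of [simp]: "x \<in> carrier P \<Longrightarrow> cnorm compl (completion_of P p x) = p x"
  using LIMSEQ_unique[OF cnorm_cls[of "\<lambda>n. x"] tendsto_const] by (simp add: completion_of_eq)

lemma completion_of_closed [simp]: "x \<in> carrier P \<Longrightarrow> completion_of P p x \<in> carrier compl"
  by (simp add: completion_of_eq)

lemma completion_of_star_hom: "completion_of P p \<in> star_hom P compl"
  by (auto simp: star_hom_def ring_hom_def completion_of_eq compl_simps)

lemma completion_of_dist:
  "\<lbrakk>x \<in> carrier P; y \<in> carrier P\<rbrakk>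
    \<Longrightarrow> cnorm compl (completion_of P p x \<ominus>\<^bsub>compl\<^esub> completion_of P p y) = p (x \<ominus> y)"
  using cnorm_completion_of[of "x \<ominus> y"] by (simp add: completion_of_eq compl_minus)

lemma cls_approx:
  assumes s: "cauchy s" and K: "\<And>m n. \<lbrakk>m \<ge> K; n \<ge> K\<rbrakk> \<Longrightarrow> p (s m \<ominus> s n) < e" and k: "k \<ge> K"
  shows "cnorm compl (cls s \<ominus>\<^bsub>compl\<^esub> completion_of P p (s k)) \<le> e"
proof -
  have "cnorm compl (cls (\<lambda>n. s n \<ominus> s k)) \<le> e"
    using s K k by (intro cnorm_cls_le[of _ K] cauchy_minus) (auto intro: less_imp_le)
  then show ?thesis
    using s by (simp add: completion_of_eq compl_minus)
qed

lemma completion_dense: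
  assumes "x \<in> carrier compl" "e > 0"
  shows "\<exists>y\<in>carrier P. cnorm compl (x \<ominus>\<^bsub>compl\<^esub> completion_of P p y) < e"
proof -
  obtain s where s: "cauchy s" "x = cls s"
    using assms(1) by (blast elim: compl_cases)
  obtain K where "\<And>m n. \<lbrakk>m \<ge> K; n \<ge> K\<rbrakk> \<Longrightarrow> p (s m \<ominus> s n) < e / 2"
    using cauchyD[OF s(1), of "e / 2"] assms by auto
  from cls_approx[OF s(1) this order_refl] have "cnorm compl (x \<ominus>\<^bsub>compl\<^esub> completion_of P p (s K)) \<le> e / 2"
    using s by simp
  then show ?thesis
    using s assms by (intro bexI[of _ "s K"]) auto
qed

text \<open>Diagonal argument: the \<open>k\<close>-th term of a Cauchy sequence of classes is
  approximated within \<open>1 / (k + 1)\<close> by a constant sequence \<open>t k\<close>. The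
  approximants form a Cauchy sequence in \<open>P\<close>, and its class is the limit.\<close>

theorem calg_completion: "calg compl"
proof unfold_locales
  show "x = \<zero>\<^bsub>compl\<^esub>" if "x \<in> carrier compl" "cnorm compl x = 0" for x
  proof -
    obtain s where s: "cauchy s" "x = cls s"
      using \<open>x \<in> carrier compl\<close> by (blast elim: compl_cases)
    then have "(\<lambda>n. p (s n \<ominus> \<zero>)) \<longlonglongrightarrow> 0"
      using cnorm_cls[OF s(1)] that by simp
    then show ?thesis
      using s cls_eq_iff[of s "\<lambda>n. \<zero>"] by (simp add: compl_simps)
  qed
next
  fix X assume X: "\<And>n :: nat. X n \<in> carrier compl"
    and cau: "\<And>e. e > 0 \<Longrightarrow> \<exists>K. \<forall>m\<ge>K. \<forall>n\<ge>K. cnorm compl (X m \<ominus>\<^bsub>compl\<^esub> X n) < e"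
  have "\<exists>y\<in>carrier P. cnorm compl (X k \<ominus>\<^bsub>compl\<^esub> completion_of P p y) < 1 / (1 + real k)" for k
    by (rule completion_dense[OF X]) simp
  then obtain t where t: "\<And>k. t k \<in> carrier P"
      "\<And>k. cnorm compl (X k \<ominus>\<^bsub>compl\<^esub> completion_of P p (t k)) < 1 / (1 + real k)"
    by metis
  have small: "\<exists>K. \<forall>k\<ge>K. 1 / (1 + real k) < e" if "e > 0" for e :: real
  proof -
    have "(\<lambda>k. 1 / (1 + real k)) \<longlonglongrightarrow> 0"
      using LIMSEQ_inverse_real_of_nat by (simp add: inverse_eq_divide add.commute)
    then have "\<forall>\<^sub>F k in sequentially. 1 / (1 + real k) < e"
      using that by (rule order_tendstoD)
    then show ?thesis
      by (simp add: eventually_sequentially)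
  qed
  have tc: "cauchy t"
    unfolding cauchy_def
  proof (intro conjI allI impI t(1))
    fix e :: real assume e: "e > 0"
    then obtain K where K: "\<And>m n. \<lbrakk>m \<ge> K; n \<ge> K\<rbrakk> \<Longrightarrow> cnorm compl (X m \<ominus>\<^bsub>compl\<^esub> X n) < e / 3"
      using cau[of "e / 3"] by auto
    obtain L where L: "\<And>k. k \<ge> L \<Longrightarrow> 1 / (1 + real k) < e / 3"
      using small[of "e / 3"] e by auto
    have "p (t m \<ominus> t n) < e" if m: "m \<ge> max K L" and n: "n \<ge> max K L" for m n
    proof -
      let ?o = "completion_of P p"
      have "p (t m \<ominus> t n) = cnorm compl (?o (t m) \<ominus>\<^bsub>compl\<^esub> ?o (t n))"
        using t by (simp add: completion_of_dist)
      also have "\<dots> \<le> cnorm compl (?o (t m) \<ominus>\<^bsub>compl\<^esub> X m) + cnorm compl (X m \<ominus>\<^bsub>compl\<^esub> ?o (t n))"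
        using t X by (intro C.p_dist_triangle) auto
      also have "cnorm compl (X m \<ominus>\<^bsub>compl\<^esub> ?o (t n))
          \<le> cnorm compl (X m \<ominus>\<^bsub>compl\<^esub> X n) + cnorm compl (X n \<ominus>\<^bsub>compl\<^esub> ?o (t n))"
        using t X by (intro C.p_dist_triangle) auto
      also have "cnorm compl (?o (t m) \<ominus>\<^bsub>compl\<^esub> X m) = cnorm compl (X m \<ominus>\<^bsub>compl\<^esub> ?o (t m))"
        using t X by (intro C.p_minus_commute) auto
      finally show ?thesis
        using K[of m n] L[of m] L[of n] t(2)[of m] t(2)[of n] m n by simp
    qed
    then show "\<exists>K. \<forall>m\<ge>K. \<forall>n\<ge>K. p (t m \<ominus> t n) < e"
      by blast
  qed
  have "(\<lambda>k. cnorm compl (X k \<ominus>\<^bsub>compl\<^esub> cls t)) \<longlonglongrightarrow> 0"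
    unfolding LIMSEQ_iff
  proof (intro allI impI)
    fix e :: real assume e: "e > 0"
    obtain K where K: "\<And>m n. \<lbrakk>m \<ge> K; n \<ge> K\<rbrakk> \<Longrightarrow> p (t m \<ominus> t n) < e / 2"
      using cauchyD[OF tc, of "e / 2"] e by auto
    obtain L where L: "\<And>k. k \<ge> L \<Longrightarrow> 1 / (1 + real k) < e / 2"
      using small[of "e / 2"] e by auto
    have "cnorm compl (X k \<ominus>\<^bsub>compl\<^esub> cls t) < e" if "k \<ge> max K L" for k
    proof -
      have "cnorm compl (X k \<ominus>\<^bsub>compl\<^esub> cls t) \<le> cnorm compl (X k \<ominus>\<^bsub>compl\<^esub> completion_of P p (t k))
          + cnorm compl (completion_of P p (t k) \<ominus>\<^bsub>compl\<^esub> cls t)"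
        using t X tc by (intro C.p_dist_triangle) auto
      moreover have "cnorm compl (completion_of P p (t k) \<ominus>\<^bsub>compl\<^esub> cls t) \<le> e / 2"
        using cls_approx[OF tc K, where k = k] that C.p_minus_commute[of "cls t" "completion_of P p (t k)"] tc
        by simp
      ultimately show ?thesis
        using t(2)[of k] L[of k] that by simp
    qed
    then show "\<exists>no. \<forall>n\<ge>no. norm (cnorm compl (X n \<ominus>\<^bsub>compl\<^esub> cls t) - 0) < e"
      using X tc by (intro exI[of _ "max K L"]) auto
  qed
  then show "\<exists>x\<in>carrier compl. (\<lambda>n. cnorm compl (X n \<ominus>\<^bsub>compl\<^esub> x)) \<longlonglongrightarrow> 0"
    using tc by auto
qed (rule cstar_seminorm_compl)

end

section \<open>Star-homomorphisms\<close>

lemma star_homI: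
  assumes "\<And>x. x \<in> carrier A \<Longrightarrow> h x \<in> carrier B"
    and "\<And>x y. \<lbrakk>x \<in> carrier A; y \<in> carrier A\<rbrakk> \<Longrightarrow> h (x \<oplus>\<^bsub>A\<^esub> y) = h x \<oplus>\<^bsub>B\<^esub> h y"
    and "\<And>x y. \<lbrakk>x \<in> carrier A; y \<in> carrier A\<rbrakk> \<Longrightarrow> h (x \<otimes>\<^bsub>A\<^esub> y) = h x \<otimes>\<^bsub>B\<^esub> h y"
    and "h \<one>\<^bsub>A\<^esub> = \<one>\<^bsub>B\<^esub>"
    and "\<And>c x. x \<in> carrier A \<Longrightarrow> h (c \<odot>\<^bsub>A\<^esub> x) = c \<odot>\<^bsub>B\<^esub> h x"
    and "\<And>x. x \<in> carrier A \<Longrightarrow> h (star A x) = star B (h x)"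
  shows "h \<in> star_hom A B"
  using assms by (auto simp: star_hom_def ring_hom_def)

lemma star_homD:
  assumes "h \<in> star_hom A B"
  shows star_hom_closed: "x \<in> carrier A \<Longrightarrow> h x \<in> carrier B"
    and star_hom_add: "\<lbrakk>x \<in> carrier A; y \<in> carrier A\<rbrakk> \<Longrightarrow> h (x \<oplus>\<^bsub>A\<^esub> y) = h x \<oplus>\<^bsub>B\<^esub> h y"
    and star_hom_mult: "\<lbrakk>x \<in> carrier A; y \<in> carrier A\<rbrakk> \<Longrightarrow> h (x \<otimes>\<^bsub>A\<^esub> y) = h x \<otimes>\<^bsub>B\<^esub> h y"
    and star_hom_one: "h \<one>\<^bsub>A\<^esub> = \<one>\<^bsub>B\<^esub>"
    and star_hom_smult: "x \<in> carrier A \<Longrightarrow> h (c \<odot>\<^bsub>A\<^esub> x) = c \<odot>\<^bsub>B\<^esub> h x"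
    and star_hom_star: "x \<in> carrier A \<Longrightarrow> h (star A x) = star B (h x)"
  using assms by (auto simp: star_hom_def ring_hom_def)

lemma star_hom_zero:
  assumes "star_alg A" "star_alg B" "h \<in> star_hom A B"
  shows "h \<zero>\<^bsub>A\<^esub> = \<zero>\<^bsub>B\<^esub>"
proof -
  interpret A: star_alg A by fact
  interpret B: star_alg B by fact
  show ?thesis
    using star_hom_smult[OF assms(3) A.zero_closed, of 0] star_hom_closed[OF assms(3) A.zero_closed] by simp
qed

lemma star_hom_minus:
  assumes "star_alg A" "star_alg B" "h \<in> star_hom A B" "x \<in> carrier A" "y \<in> carrier A"
  shows "h (x \<ominus>\<^bsub>A\<^esub> y) = h x \<ominus>\<^bsub>B\<^esub> h y"
proof -
  interpret A: star_alg A by fact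
  interpret B: star_alg B by fact
  show ?thesis
    using assms by (simp add: A.minus_smult_eq B.minus_smult_eq star_homD[OF assms(3)])
qed

lemma star_hom_id: "(\<lambda>x. x) \<in> star_hom A A"
  by (auto simp: star_hom_def ring_hom_def)

lemma star_hom_comp:
  assumes "f \<in> star_hom A B" "g \<in> star_hom B C"
  shows "(\<lambda>x. g (f x)) \<in> star_hom A C"
  by (rule star_homI) (simp_all add: star_homD[OF assms(1)] star_homD[OF assms(2)])

lemma star_hom_cong:
  assumes "star_alg A" "f \<in> star_hom A B" and eq: "\<And>x. x \<in> carrier A \<Longrightarrow> g x = f x"
  shows "g \<in> star_hom A B"
proof -
  interpret A: star_alg A by fact
  show ?thesis
    by (rule star_homI) (simp_all add: eq star_homD[OF assms(2)])
qed

lemma star_hom_seminorm: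
  assumes "star_alg A" "star_alg B" "h \<in> star_hom A B" "cstar_seminorm B p"
  shows "cstar_seminorm A (\<lambda>x. p (h x))"
proof -
  interpret A: star_alg A by fact
  interpret cstar_semi B p
    using assms by (simp add: cstar_semi_def cstar_semi_axioms_def)
  show ?thesis
    unfolding cstar_seminorm_def
    by (auto simp: star_homD[OF assms(3)] p_triangle p_mult p_star_mult)
qed

text \<open>The norm of \<open>B\<close> pulled back along \<open>h\<close> is a C*-seminorm on
  \<open>A\<close>, so \<open>seminorm_bounded\<close> makes \<open>h\<close> continuous.\<close>

lemma star_hom_bounded:
  assumes "calg A" "calg B" "h \<in> star_hom A B" "x \<in> carrier A"
  shows "cnorm B (h x) \<le> 2 * cnorm A x"
proof -
  interpret A: calg A by fact
  interpret B: calg B by fact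
  show ?thesis
    using A.seminorm_bounded[OF star_hom_seminorm[OF A.star_alg_axioms B.star_alg_axioms assms(3) B.seminorm] assms(4)] .
qed

lemma star_hom_dist:
  assumes "calg A" "calg B" "h \<in> star_hom A B" "x \<in> carrier A" "y \<in> carrier A"
  shows "cnorm B (h x \<ominus>\<^bsub>B\<^esub> h y) \<le> 2 * cnorm A (x \<ominus>\<^bsub>A\<^esub> y)"
proof -
  interpret A: calg A by fact
  interpret B: calg B by fact
  show ?thesis
    using star_hom_bounded[OF assms(1-3), of "x \<ominus>\<^bsub>A\<^esub> y"] assms(4,5)
    by (simp add: star_hom_minus[OF A.star_alg_axioms B.star_alg_axioms assms(3)])
qed

section \<open>C*-subalgebras and generating sets\<close>

definition cstar_sub :: "'a cstar \<Rightarrow> 'a set \<Rightarrow> bool" where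
  "cstar_sub A S \<longleftrightarrow> S \<subseteq> carrier A \<and> \<one>\<^bsub>A\<^esub> \<in> S \<and> (\<forall>x\<in>S. \<forall>y\<in>S. x \<oplus>\<^bsub>A\<^esub> y \<in> S \<and> x \<otimes>\<^bsub>A\<^esub> y \<in> S)
     \<and> (\<forall>c. \<forall>x\<in>S. c \<odot>\<^bsub>A\<^esub> x \<in> S) \<and> (\<forall>x\<in>S. star A x \<in> S) \<and> limit_closed A S"

definition generates :: "'a cstar \<Rightarrow> 'a set \<Rightarrow> bool" where
  "generates A D \<longleftrightarrow> D \<subseteq> carrier A \<and> (\<forall>S. cstar_sub A S \<and> D \<subseteq> S \<longrightarrow> S = carrier A)"

lemma generates_induct:
  assumes "generates A D" "cstar_sub A {x \<in> carrier A. Q x}" "\<And>x. x \<in> D \<Longrightarrow> Q x" "x \<in> carrier A"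
  shows "Q x"
proof -
  have "D \<subseteq> {x \<in> carrier A. Q x}"
    using assms by (auto simp: generates_def)
  then have "{x \<in> carrier A. Q x} = carrier A"
    using assms(1,2) unfolding generates_def by blast
  then show ?thesis
    using assms(4) by blast
qed

lemma cstar_sub_equalizer:
  assumes "calg A" "calg B" "f \<in> star_hom A B" "g \<in> star_hom A B"
  shows "cstar_sub A {x \<in> carrier A. f x = g x}"
proof -
  interpret A: calg A by fact
  show ?thesis
    using limit_closed_eq[OF assms(1,2) _ _ star_hom_dist[OF assms(1-3)] star_hom_dist[OF assms(1,2,4)]]
    by (auto simp: cstar_sub_def star_homD[OF assms(3)] star_homD[OF assms(4)])
qed

lemma star_hom_eqI:
  assumes "calg A" "calg B" "f \<in> star_hom A B" "g \<in> star_hom A B" "generates A D"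
    and "\<And>x. x \<in> D \<Longrightarrow> f x = g x" "x \<in> carrier A"
  shows "f x = g x"
  by (rule generates_induct[OF assms(5) cstar_sub_equalizer[OF assms(1-4)] assms(6,7)])

text \<open>Closure under the involution comes from \<open>W\<close> being star-closed:
  \<open>f x\<close> commutes with the adjoint of \<open>w\<close>, and adjoints are taken of that
  relation.\<close>

lemma cstar_sub_commutant:
  assumes "calg A" "calg B" "f \<in> star_hom A B" "W \<subseteq> carrier B" "\<And>w. w \<in> W \<Longrightarrow> star B w \<in> W"
  shows "cstar_sub A {x \<in> carrier A. \<forall>w\<in>W. f x \<otimes>\<^bsub>B\<^esub> w = w \<otimes>\<^bsub>B\<^esub> f x}"
proof -
  interpret A: calg A by fact
  interpret B: calg B by fact
  have f: "f x \<in> carrier B" if "x \<in> carrier A" for x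
    using that star_homD[OF assms(3)] by simp
  have W: "w \<in> carrier B" if "w \<in> W" for w
    using that assms by blast
  have "limit_closed A {x \<in> carrier A. f x \<otimes>\<^bsub>B\<^esub> w = w \<otimes>\<^bsub>B\<^esub> f x}" if w: "w \<in> W" for w
  proof (rule limit_closed_eq[OF assms(1,2), of _ _ "2 * cnorm B w"])
    fix x y assume xy: "x \<in> carrier A" "y \<in> carrier A"
    have *: "cnorm B (f x \<ominus>\<^bsub>B\<^esub> f y) * cnorm B w \<le> 2 * cnorm A (x \<ominus>\<^bsub>A\<^esub> y) * cnorm B w"
      using star_hom_dist[OF assms(1-3) xy] W[OF w] by (intro mult_right_mono) auto
    show "cnorm B (f x \<otimes>\<^bsub>B\<^esub> w \<ominus>\<^bsub>B\<^esub> f y \<otimes>\<^bsub>B\<^esub> w) \<le> 2 * cnorm B w * cnorm A (x \<ominus>\<^bsub>A\<^esub> y)"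
      using B.p_mult_dist[of "f x" w "f y" w] f xy W[OF w] * by (simp add: mult_ac)
    show "cnorm B (w \<otimes>\<^bsub>B\<^esub> f x \<ominus>\<^bsub>B\<^esub> w \<otimes>\<^bsub>B\<^esub> f y) \<le> 2 * cnorm B w * cnorm A (x \<ominus>\<^bsub>A\<^esub> y)"
      using B.p_mult_dist[of w "f x" w "f y"] f xy W[OF w] * by (simp add: mult_ac)
  qed (use f W w in auto)
  note lcw = this
  have lc: "limit_closed A {x \<in> carrier A. \<forall>w\<in>W. f x \<otimes>\<^bsub>B\<^esub> w = w \<otimes>\<^bsub>B\<^esub> f x}"
    unfolding limit_closed_def
  proof (intro allI ballI impI, elim conjE)
    fix s x assume x: "x \<in> carrier A" and lim: "(\<lambda>n. cnorm A (s n \<ominus>\<^bsub>A\<^esub> x)) \<longlonglongrightarrow> 0"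
      and s: "\<forall>n. s n \<in> {x \<in> carrier A. \<forall>w\<in>W. f x \<otimes>\<^bsub>B\<^esub> w = w \<otimes>\<^bsub>B\<^esub> f x}"
    have "x \<in> {x \<in> carrier A. f x \<otimes>\<^bsub>B\<^esub> w = w \<otimes>\<^bsub>B\<^esub> f x}" if "w \<in> W" for w
      by (rule limit_closedD[OF lcw[OF that] x _ lim]) (use s that in blast)
    then show "x \<in> {x \<in> carrier A. \<forall>w\<in>W. f x \<otimes>\<^bsub>B\<^esub> w = w \<otimes>\<^bsub>B\<^esub> f x}"
      using x by blast
  qed
  have st: "star B (f x) \<otimes>\<^bsub>B\<^esub> w = w \<otimes>\<^bsub>B\<^esub> star B (f x)"
    if "x \<in> carrier A" "\<forall>w\<in>W. f x \<otimes>\<^bsub>B\<^esub> w = w \<otimes>\<^bsub>B\<^esub> f x" "w \<in> W" for x w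
  proof -
    have "f x \<otimes>\<^bsub>B\<^esub> star B w = star B w \<otimes>\<^bsub>B\<^esub> f x"
      using that assms(5) by blast
    from arg_cong[OF this, of "star B"] show ?thesis
      using that f W by simp
  qed
  have mt: "f x \<otimes>\<^bsub>B\<^esub> f y \<otimes>\<^bsub>B\<^esub> w = w \<otimes>\<^bsub>B\<^esub> (f x \<otimes>\<^bsub>B\<^esub> f y)"
    if "x \<in> carrier A" "y \<in> carrier A" "w \<in> W" "\<forall>w\<in>W. f x \<otimes>\<^bsub>B\<^esub> w = w \<otimes>\<^bsub>B\<^esub> f x"
      "\<forall>w\<in>W. f y \<otimes>\<^bsub>B\<^esub> w = w \<otimes>\<^bsub>B\<^esub> f y" for x y w
    using that f W by (metis B.m_assoc)
  show ?thesis
    unfolding cstar_sub_def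
  proof (intro conjI lc)
    show "\<forall>x\<in>{x \<in> carrier A. \<forall>w\<in>W. f x \<otimes>\<^bsub>B\<^esub> w = w \<otimes>\<^bsub>B\<^esub> f x}.
        star A x \<in> {x \<in> carrier A. \<forall>w\<in>W. f x \<otimes>\<^bsub>B\<^esub> w = w \<otimes>\<^bsub>B\<^esub> f x}"
      using st by (auto simp: star_homD[OF assms(3)])
  qed (auto simp: star_homD[OF assms(3)] W f B.l_distr B.r_distr mt)
qed

text \<open>Two passes: with the images of the generators of \<open>B\<close> and their adjoints
  fixed, \<open>x\<close> varies over \<open>A\<close>; then, with the star-closed image of
  \<open>A\<close> fixed, \<open>y\<close> varies over \<open>B\<close>. The hypothesis mentions the
  adjoint of \<open>g y\<close> because commuting with an element does not imply commuting with its
  adjoint.\<close>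

lemma star_homs_commute:
  assumes A: "calg A" "generates A D" "f \<in> star_hom A C" and B: "calg B" "generates B E" "g \<in> star_hom B C"
    and C: "calg C" and comm: "\<And>x y. \<lbrakk>x \<in> D; y \<in> E\<rbrakk> \<Longrightarrow> f x \<otimes>\<^bsub>C\<^esub> g y = g y \<otimes>\<^bsub>C\<^esub> f x
      \<and> f x \<otimes>\<^bsub>C\<^esub> star C (g y) = star C (g y) \<otimes>\<^bsub>C\<^esub> f x"
    and xy: "x \<in> carrier A" "y \<in> carrier B"
  shows "f x \<otimes>\<^bsub>C\<^esub> g y = g y \<otimes>\<^bsub>C\<^esub> f x"
proof -
  interpret A: calg A by fact
  interpret B: calg B by fact
  interpret C: calg C by fact
  have D: "D \<subseteq> carrier A" and E: "E \<subseteq> carrier B"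
    using A B by (auto simp: generates_def)
  have gE: "g y \<in> carrier C" if "y \<in> E" for y
    using that E star_homD[OF B(3)] by blast
  have 1: "\<forall>w\<in>g ` E \<union> star C ` g ` E. f x \<otimes>\<^bsub>C\<^esub> w = w \<otimes>\<^bsub>C\<^esub> f x" if "x \<in> carrier A" for x
    by (rule generates_induct[OF A(2) cstar_sub_commutant[OF A(1) C A(3)] _ that])
      (use gE comm in \<open>auto simp: image_iff\<close>)
  have 2: "\<forall>w\<in>f ` carrier A. g y \<otimes>\<^bsub>C\<^esub> w = w \<otimes>\<^bsub>C\<^esub> g y" if "y \<in> carrier B" for y
  proof (rule generates_induct[OF B(2) cstar_sub_commutant[OF B(1) C B(3)] _ that])
    show "star C w \<in> f ` carrier A" if "w \<in> f ` carrier A" for w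
      using that star_hom_star[OF A(3)] by (auto simp flip: star_hom_star[OF A(3)])
  qed (use 1 star_homD[OF A(3)] in auto)
  show ?thesis
    using 2 xy by fastforce
qed

section \<open>The star-algebra of a monoid with involution\<close>

locale star_mon = monoid M for M :: "'a star_monoid" (structure) +
  assumes invol_closed [simp, intro]: "a \<in> carrier M \<Longrightarrow> invol M a \<in> carrier M"
    and invol_mult [simp]:
      "\<lbrakk>a \<in> carrier M; b \<in> carrier M\<rbrakk> \<Longrightarrow> invol M (a \<otimes> b) = invol M b \<otimes> invol M a"
    and invol_invol [simp]: "a \<in> carrier M \<Longrightarrow> invol M (invol M a) = a"
begin

abbreviation "alg \<equiv> monoid_algebra M"

definition supp :: "('a \<Rightarrow> complex) \<Rightarrow> 'a set" where
  "supp f = {m. f m \<noteq> 0}"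

lemma carrier_alg: "f \<in> carrier alg \<longleftrightarrow> finite (supp f) \<and> supp f \<subseteq> carrier M"
  by (simp add: monoid_algebra_def supp_def)

lemma alg_simps:
  "one alg = delta \<one>" "zero alg = (\<lambda>m. 0)" "add alg = (\<lambda>f g m. f m + g m)"
  "smult alg = (\<lambda>c f m. c * f m)"
  "star alg = (\<lambda>f m. if m \<in> carrier M then cnj (f (invol M m)) else 0)"
  by (simp_all add: monoid_algebra_def)

text \<open>The defining sum ranges over pairs that depend on both supports. Over a fixed finite
  rectangle, products of different elements become comparable term by term.\<close>

lemma mult_eq:
  assumes "finite F" "finite G" "supp f \<subseteq> F" "supp g \<subseteq> G"
  shows "(f \<otimes>\<^bsub>alg\<^esub> g) m = (\<Sum>a\<in>F. \<Sum>b\<in>G. if a \<otimes> b = m then f a * g b else 0)"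
proof -
  have "(f \<otimes>\<^bsub>alg\<^esub> g) m = (\<Sum>(a, b) \<in> {(a, b). f a \<noteq> 0 \<and> g b \<noteq> 0 \<and> a \<otimes> b = m}. f a * g b)"
    by (simp add: monoid_algebra_def)
  also have "\<dots> = (\<Sum>(a, b) \<in> F \<times> G. if a \<otimes> b = m then f a * g b else 0)"
    using assms by (intro sum.mono_neutral_cong_left) (auto simp: supp_def split: if_splits)
  finally show ?thesis
    by (simp add: sum.cartesian_product)
qed

lemma alg_zero_closed: "(\<lambda>m. 0) \<in> carrier alg"
  by (simp add: carrier_alg supp_def)

lemma supp_add: "supp (\<lambda>m. f m + g m) \<subseteq> supp f \<union> supp g"
  by (auto simp: supp_def)

lemma supp_smult: "supp (\<lambda>m. c * f m) \<subseteq> supp f"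
  by (auto simp: supp_def)

lemma alg_add_closed: "\<lbrakk>f \<in> carrier alg; g \<in> carrier alg\<rbrakk> \<Longrightarrow> (\<lambda>m. f m + g m) \<in> carrier alg"
  by (auto simp: carrier_alg dest: subsetD[OF supp_add] intro: finite_subset[OF supp_add])

lemma alg_smult_closed: "f \<in> carrier alg \<Longrightarrow> (\<lambda>m. c * f m) \<in> carrier alg"
  by (auto simp: carrier_alg dest: subsetD[OF supp_smult] intro: finite_subset[OF supp_smult])

lemma delta_closed [simp]: "a \<in> carrier M \<Longrightarrow> delta a \<in> carrier alg"
  by (auto simp: carrier_alg supp_def delta_def)

lemma supp_delta [simp]: "supp (delta a) = {a}"
  by (auto simp: supp_def delta_def)

lemma alg_induct [consumes 1, case_names zero delta add]:
  assumes f: "f \<in> carrier alg" and zero: "Q (\<lambda>m. 0)"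
    and delta: "\<And>a c. a \<in> carrier M \<Longrightarrow> Q (\<lambda>m. c * delta a m)"
    and add: "\<And>f g. \<lbrakk>f \<in> carrier alg; g \<in> carrier alg; Q f; Q g\<rbrakk> \<Longrightarrow> Q (\<lambda>m. f m + g m)"
  shows "Q f"
proof -
  have "Q f" if "finite F" "supp f = F" "F \<subseteq> carrier M" for F f
    using that
  proof (induction F arbitrary: f)
    case empty
    then have "f = (\<lambda>m. 0)"
      by (auto simp: supp_def)
    then show ?case
      using zero by simp
  next
    case (insert a F)
    have s: "supp (f(a := 0)) = F"
      using insert by (auto simp: supp_def)
    then have "Q (f(a := 0))"
      using insert by blast
    moreover have "f(a := 0) \<in> carrier alg"
      using s insert by (simp add: carrier_alg)
    moreover have "Q (\<lambda>m. f a * delta a m)" "(\<lambda>m. f a * delta a m) \<in> carrier alg"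
      using insert by (auto intro: delta alg_smult_closed)
    ultimately have "Q (\<lambda>m. (f(a := 0)) m + f a * delta a m)"
      using add[of "f(a := 0)" "\<lambda>m. f a * delta a m"] by blast
    also have "(\<lambda>m. (f(a := 0)) m + f a * delta a m) = f"
      by (auto simp: delta_def)
    finally show ?case .
  qed
  then show ?thesis
    using f unfolding carrier_alg by blast
qed

lemma mult_add_left:
  assumes "f \<in> carrier alg" "f' \<in> carrier alg" "g \<in> carrier alg"
  shows "(\<lambda>m. f m + f' m) \<otimes>\<^bsub>alg\<^esub> g = (\<lambda>m. (f \<otimes>\<^bsub>alg\<^esub> g) m + (f' \<otimes>\<^bsub>alg\<^esub> g) m)"
proof
  fix m
  have fin: "finite (supp f \<union> supp f')" "finite (supp g)"
    using assms by (auto simp: carrier_alg)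
  show "((\<lambda>m. f m + f' m) \<otimes>\<^bsub>alg\<^esub> g) m = (f \<otimes>\<^bsub>alg\<^esub> g) m + (f' \<otimes>\<^bsub>alg\<^esub> g) m"
    by (simp add: mult_eq[OF fin supp_add order_refl] mult_eq[OF fin _ order_refl, of f]
        mult_eq[OF fin _ order_refl, of f'] flip: sum.distrib)
      (auto intro!: sum.cong simp: algebra_simps)
qed

lemma mult_add_right:
  assumes "f \<in> carrier alg" "g \<in> carrier alg" "g' \<in> carrier alg"
  shows "f \<otimes>\<^bsub>alg\<^esub> (\<lambda>m. g m + g' m) = (\<lambda>m. (f \<otimes>\<^bsub>alg\<^esub> g) m + (f \<otimes>\<^bsub>alg\<^esub> g') m)"
proof
  fix m
  have fin: "finite (supp f)" "finite (supp g \<union> supp g')"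
    using assms by (auto simp: carrier_alg)
  show "(f \<otimes>\<^bsub>alg\<^esub> (\<lambda>m. g m + g' m)) m = (f \<otimes>\<^bsub>alg\<^esub> g) m + (f \<otimes>\<^bsub>alg\<^esub> g') m"
    by (simp add: mult_eq[OF fin order_refl supp_add] mult_eq[OF fin order_refl, of g]
        mult_eq[OF fin order_refl, of g'] flip: sum.distrib)
      (auto intro!: sum.cong simp: algebra_simps)
qed

lemma mult_smult_left:
  assumes "f \<in> carrier alg" "g \<in> carrier alg"
  shows "(\<lambda>m. c * f m) \<otimes>\<^bsub>alg\<^esub> g = (\<lambda>m. c * (f \<otimes>\<^bsub>alg\<^esub> g) m)"
proof
  fix m
  have fin: "finite (supp f)" "finite (supp g)"
    using assms by (auto simp: carrier_alg)
  show "((\<lambda>m. c * f m) \<otimes>\<^bsub>alg\<^esub> g) m = c * (f \<otimes>\<^bsub>alg\<^esub> g) m"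
    by (simp add: mult_eq[OF fin supp_smult order_refl] mult_eq[OF fin order_refl order_refl] sum_distrib_left)
      (auto intro!: sum.cong)
qed

lemma mult_smult_right:
  assumes "f \<in> carrier alg" "g \<in> carrier alg"
  shows "f \<otimes>\<^bsub>alg\<^esub> (\<lambda>m. c * g m) = (\<lambda>m. c * (f \<otimes>\<^bsub>alg\<^esub> g) m)"
proof
  fix m
  have fin: "finite (supp f)" "finite (supp g)"
    using assms by (auto simp: carrier_alg)
  show "(f \<otimes>\<^bsub>alg\<^esub> (\<lambda>m. c * g m)) m = c * (f \<otimes>\<^bsub>alg\<^esub> g) m"
    by (simp add: mult_eq[OF fin order_refl supp_smult] mult_eq[OF fin order_refl order_refl] sum_distrib_left)
      (auto intro!: sum.cong)
qed

lemma delta_mult: "delta a \<otimes>\<^bsub>alg\<^esub> delta b = delta (a \<otimes> b)"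
proof
  fix m
  have "(delta a \<otimes>\<^bsub>alg\<^esub> delta b) m = (if a \<otimes> b = m then delta a a * delta b b else 0)"
    using mult_eq[of "{a}" "{b}" "delta a" "delta b" m] by simp
  then show "(delta a \<otimes>\<^bsub>alg\<^esub> delta b) m = delta (a \<otimes> b) m"
    by (simp add: delta_def)
qed

lemma mult_zero_left: "(\<lambda>m. 0) \<otimes>\<^bsub>alg\<^esub> g = (\<lambda>m. 0)"
  and mult_zero_right: "g \<otimes>\<^bsub>alg\<^esub> (\<lambda>m. 0) = (\<lambda>m. 0)"
  by (simp_all add: monoid_algebra_def)

lemma alg_mult_closed:
  assumes "f \<in> carrier alg" "g \<in> carrier alg"
  shows "f \<otimes>\<^bsub>alg\<^esub> g \<in> carrier alg"
  using assms
proof (induction f rule: alg_induct)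
  case (delta a c)
  from this(2) show ?case
  proof (induction g rule: alg_induct)
    case (delta b d)
    then show ?case
      using \<open>a \<in> carrier M\<close>
      by (simp add: mult_smult_left mult_smult_right alg_smult_closed delta_mult)
  qed (use \<open>a \<in> carrier M\<close> in \<open>auto simp: mult_add_right mult_zero_right alg_smult_closed
      intro!: alg_zero_closed alg_add_closed\<close>)
qed (auto simp: mult_add_left mult_zero_left intro!: alg_zero_closed alg_add_closed)

lemma alg_assoc:
  assumes "f \<in> carrier alg" "g \<in> carrier alg" "h \<in> carrier alg"
  shows "(f \<otimes>\<^bsub>alg\<^esub> g) \<otimes>\<^bsub>alg\<^esub> h = f \<otimes>\<^bsub>alg\<^esub> (g \<otimes>\<^bsub>alg\<^esub> h)"
  using assms
proof (induction f rule: alg_induct)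
  case (delta a c)
  from this(2,3) have "(delta a \<otimes>\<^bsub>alg\<^esub> g) \<otimes>\<^bsub>alg\<^esub> h = delta a \<otimes>\<^bsub>alg\<^esub> (g \<otimes>\<^bsub>alg\<^esub> h)"
  proof (induction g rule: alg_induct)
    case (delta b d)
    from this(2) have "(delta a \<otimes>\<^bsub>alg\<^esub> delta b) \<otimes>\<^bsub>alg\<^esub> h = delta a \<otimes>\<^bsub>alg\<^esub> (delta b \<otimes>\<^bsub>alg\<^esub> h)"
    proof (induction h rule: alg_induct)
      case (delta k e)
      then show ?case
        using \<open>a \<in> carrier M\<close> \<open>b \<in> carrier M\<close>
        by (simp add: mult_smult_right delta_mult m_assoc)
    qed (use \<open>a \<in> carrier M\<close> \<open>b \<in> carrier M\<close> in
        \<open>simp_all add: mult_add_right mult_zero_right alg_mult_closed\<close>)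
    then show ?case
      using delta \<open>a \<in> carrier M\<close>
      by (simp add: mult_smult_left mult_smult_right alg_mult_closed)
  qed (use \<open>a \<in> carrier M\<close> in \<open>simp_all add: mult_add_left mult_add_right mult_zero_left mult_zero_right alg_mult_closed\<close>)
  then show ?case
    using delta by (simp add: mult_smult_left alg_mult_closed)
qed (simp_all add: mult_add_left mult_zero_left alg_mult_closed)

lemma alg_one_left:
  assumes "f \<in> carrier alg"
  shows "delta \<one> \<otimes>\<^bsub>alg\<^esub> f = f" "f \<otimes>\<^bsub>alg\<^esub> delta \<one> = f"
  using assms
  by (induction f rule: alg_induct)
    (simp_all add: mult_add_left mult_add_right mult_zero_left mult_zero_right
      mult_smult_left mult_smult_right delta_mult)

lemma alg_star_delta: "a \<in> carrier M \<Longrightarrow> star alg (\<lambda>m. c * delta a m) = (\<lambda>m. cnj c * delta (invol M a) m)"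
  by (rule ext) (auto simp: alg_simps delta_def)

lemma alg_star_closed:
  assumes "f \<in> carrier alg"
  shows "star alg f \<in> carrier alg"
proof -
  have "supp (star alg f) \<subseteq> invol M ` supp f"
  proof
    fix m assume "m \<in> supp (star alg f)"
    then have "m \<in> carrier M" "invol M m \<in> supp f"
      by (auto simp: supp_def alg_simps split: if_splits)
    then show "m \<in> invol M ` supp f"
      by (intro image_eqI[of _ _ "invol M m"]) auto
  qed
  moreover have "supp (star alg f) \<subseteq> carrier M"
    by (auto simp: supp_def alg_simps)
  ultimately show ?thesis
    using assms unfolding carrier_alg by (meson finite_imageI finite_subset)
qed

lemma alg_star_star:
  assumes "f \<in> carrier alg"
  shows "star alg (star alg f) = f"
proof
  fix m
  show "star alg (star alg f) m = f m"
    using assms by (cases "m \<in> carrier M") (auto simp: alg_simps carrier_alg supp_def)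
qed

lemma alg_star_mult:
  assumes "f \<in> carrier alg" "g \<in> carrier alg"
  shows "star alg (f \<otimes>\<^bsub>alg\<^esub> g) = star alg g \<otimes>\<^bsub>alg\<^esub> star alg f"
proof -
  have add: "star alg (\<lambda>m. f m + g m) = (\<lambda>m. star alg f m + star alg g m)" for f g
    by (rule ext) (simp add: alg_simps)
  have smult: "star alg (\<lambda>m. c * f m) = (\<lambda>m. cnj c * star alg f m)" for c f
    by (rule ext) (simp add: alg_simps)
  have zero: "star alg (\<lambda>m. 0) = (\<lambda>m. 0)"
    by (rule ext) (simp add: alg_simps)
  have delta1: "star alg (delta a) = delta (invol M a)" if "a \<in> carrier M" for a
    using alg_star_delta[OF that, of 1] by simp
  show ?thesis
    using assms
  proof (induction f rule: alg_induct)
    case (delta a c)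
    from this(2) show ?case
    proof (induction g rule: alg_induct)
      case (delta b d)
      then show ?case
        using \<open>a \<in> carrier M\<close>
        by (simp add: mult_smult_left mult_smult_right alg_smult_closed delta_mult alg_star_delta
            mult.left_commute smult delta1)
    qed (use \<open>a \<in> carrier M\<close> in \<open>simp_all add: add zero mult_add_left mult_add_right mult_zero_left
        mult_zero_right alg_star_closed alg_smult_closed\<close>)
  qed (simp_all add: add zero mult_add_left mult_add_right mult_zero_left mult_zero_right alg_star_closed)
qed

lemma star_alg_monoid_algebra: "star_alg alg"
proof (rule star_alg.intro)
  show "ring alg"
  proof (intro ringI abelian_groupI monoidI)
    show "\<exists>y\<in>carrier alg. y \<oplus>\<^bsub>alg\<^esub> x = \<zero>\<^bsub>alg\<^esub>" if "x \<in> carrier alg" for x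
      using alg_smult_closed[OF that, of "-1"] by (intro bexI[of _ "\<lambda>m. - 1 * x m"]) (auto simp: alg_simps)
  qed (simp_all add: alg_simps alg_zero_closed alg_add_closed alg_mult_closed alg_assoc alg_one_left
      mult_add_left mult_add_right add_ac)
  show "star_alg_axioms alg"
    by unfold_locales
      (simp_all add: alg_star_closed alg_star_mult alg_star_star,
        auto simp: alg_simps alg_smult_closed distrib_left distrib_right mult_smult_left mult_smult_right)
qed

sublocale alg: star_alg alg
  by (rule star_alg_monoid_algebra)

lemma star_delta [simp]: "a \<in> carrier M \<Longrightarrow> star alg (delta a) = delta (invol M a)"
  using alg_star_delta[of a 1] by simp

lemma alg_induct' [consumes 1, case_names delta smult add]:
  assumes "f \<in> carrier alg"
    and delta: "\<And>a. a \<in> carrier M \<Longrightarrow> Q (delta a)"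
    and smult: "\<And>f c. \<lbrakk>f \<in> carrier alg; Q f\<rbrakk> \<Longrightarrow> Q (c \<odot>\<^bsub>alg\<^esub> f)"
    and add: "\<And>f g. \<lbrakk>f \<in> carrier alg; g \<in> carrier alg; Q f; Q g\<rbrakk> \<Longrightarrow> Q (f \<oplus>\<^bsub>alg\<^esub> g)"
  shows "Q f"
  using assms(1)
proof (induction f rule: alg_induct)
  case zero
  show ?case
    using smult[OF _ delta, of \<one> 0] by (simp add: alg_simps)
next
  case (delta a c)
  then show ?case
    using smult[OF _ assms(2), of a c] by (simp add: alg_simps)
next
  case (add f g)
  then show ?case
    using assms(4)[of f g] by (simp add: alg_simps)
qed

definition lift :: "('b, 'n) star_algebra_scheme \<Rightarrow> ('a \<Rightarrow> 'b) \<Rightarrow> ('a \<Rightarrow> complex) \<Rightarrow> 'b" where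
  "lift B \<mu> f = (\<Oplus>\<^bsub>B\<^esub>a\<in>supp f. f a \<odot>\<^bsub>B\<^esub> \<mu> a)"

text \<open>Universal property of the monoid star-algebra. Summing over a common finite superset of
  the supports gives linearity; products and adjoints are then checked on \<open>delta\<close>
  only.\<close>

lemma lift_star_hom:
  assumes "star_alg B" and \<mu>: "\<And>a. a \<in> carrier M \<Longrightarrow> \<mu> a \<in> carrier B"
    "\<And>a b. \<lbrakk>a \<in> carrier M; b \<in> carrier M\<rbrakk> \<Longrightarrow> \<mu> (a \<otimes> b) = \<mu> a \<otimes>\<^bsub>B\<^esub> \<mu> b"
    "\<mu> \<one> = \<one>\<^bsub>B\<^esub>" "\<And>a. a \<in> carrier M \<Longrightarrow> \<mu> (invol M a) = star B (\<mu> a)"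
  shows "lift B \<mu> \<in> star_hom alg B" and "a \<in> carrier M \<Longrightarrow> lift B \<mu> (delta a) = \<mu> a"
proof -
  interpret B: star_alg B by fact
  have superset: "lift B \<mu> f = (\<Oplus>\<^bsub>B\<^esub>a\<in>F. f a \<odot>\<^bsub>B\<^esub> \<mu> a)"
    if "finite F" "supp f \<subseteq> F" "F \<subseteq> carrier M" for f F
    unfolding lift_def
    by (rule B.add.finprod_mono_neutral_cong_left)
      (use that \<mu> in \<open>auto simp: supp_def subset_iff\<close>)
  have lift_delta: "lift B \<mu> (delta a) = \<mu> a" if "a \<in> carrier M" for a
    using that \<mu> unfolding lift_def supp_delta by (simp add: delta_def)
  show "a \<in> carrier M \<Longrightarrow> lift B \<mu> (delta a) = \<mu> a"
    by (rule lift_delta)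
  have closed: "lift B \<mu> f \<in> carrier B" if "f \<in> carrier alg" for f
    using that \<mu> unfolding lift_def by (intro B.finsum_closed) (auto simp: carrier_alg)
  have add: "lift B \<mu> (f \<oplus>\<^bsub>alg\<^esub> g) = lift B \<mu> f \<oplus>\<^bsub>B\<^esub> lift B \<mu> g"
    if "f \<in> carrier alg" "g \<in> carrier alg" for f g
  proof -
    have F: "finite (supp f \<union> supp g)" "supp f \<union> supp g \<subseteq> carrier M"
      using that by (auto simp: carrier_alg)
    have "lift B \<mu> (f \<oplus>\<^bsub>alg\<^esub> g) = (\<Oplus>\<^bsub>B\<^esub>a\<in>supp f \<union> supp g. (f a + g a) \<odot>\<^bsub>B\<^esub> \<mu> a)"
      using supp_add[of f g] F by (subst superset[OF F(1)]) (auto simp: alg_simps)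
    also have "\<dots> = (\<Oplus>\<^bsub>B\<^esub>a\<in>supp f \<union> supp g. f a \<odot>\<^bsub>B\<^esub> \<mu> a \<oplus>\<^bsub>B\<^esub> g a \<odot>\<^bsub>B\<^esub> \<mu> a)"
      using F \<mu> by (intro B.finsum_cong') (auto simp: B.add_smult)
    also have "\<dots> = lift B \<mu> f \<oplus>\<^bsub>B\<^esub> lift B \<mu> g"
      using F \<mu> superset[OF F(1), of f] superset[OF F(1), of g] by (subst B.finsum_addf) auto
    finally show ?thesis .
  qed
  have smult: "lift B \<mu> (c \<odot>\<^bsub>alg\<^esub> f) = c \<odot>\<^bsub>B\<^esub> lift B \<mu> f" if f: "f \<in> carrier alg" for c f
  proof -
    have *: "(\<Oplus>\<^bsub>B\<^esub>a\<in>F. (c * f a) \<odot>\<^bsub>B\<^esub> \<mu> a) = c \<odot>\<^bsub>B\<^esub> (\<Oplus>\<^bsub>B\<^esub>a\<in>F. f a \<odot>\<^bsub>B\<^esub> \<mu> a)"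
      if "finite F" "F \<subseteq> carrier M" for F
      using that
    proof (induction F)
      case (insert x F)
      then show ?case
        using \<mu> by (simp add: B.finsum_insert Pi_iff subset_iff B.smult_add)
    qed simp
    have "lift B \<mu> (c \<odot>\<^bsub>alg\<^esub> f) = (\<Oplus>\<^bsub>B\<^esub>a\<in>supp f. (c * f a) \<odot>\<^bsub>B\<^esub> \<mu> a)"
      using f supp_smult[of c f] by (subst superset[of "supp f"]) (auto simp: carrier_alg alg_simps)
    then show ?thesis
      using f * by (simp add: lift_def carrier_alg)
  qed
  show "lift B \<mu> \<in> star_hom alg B"
  proof (rule star_homI)
    show "lift B \<mu> (f \<otimes>\<^bsub>alg\<^esub> g) = lift B \<mu> f \<otimes>\<^bsub>B\<^esub> lift B \<mu> g"
      if "f \<in> carrier alg" "g \<in> carrier alg" for f g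
      using that
    proof (induction f rule: alg_induct')
      case (delta a)
      from this(2) show ?case
        by (induction g rule: alg_induct')
          (use \<open>a \<in> carrier M\<close> in \<open>simp_all add: delta_mult lift_delta \<mu> closed smult add alg.r_distr B.r_distr\<close>)
    qed (simp_all add: closed smult add alg.l_distr B.l_distr)
    show "lift B \<mu> (star alg f) = star B (lift B \<mu> f)" if "f \<in> carrier alg" for f
      using that
      by (induction f rule: alg_induct') (simp_all add: lift_delta \<mu> closed smult add)
    show "lift B \<mu> \<one>\<^bsub>alg\<^esub> = \<one>\<^bsub>B\<^esub>"
      using lift_delta[of \<one>] \<mu> by (simp add: alg_simps)
  qed (use closed add smult in auto)
qed

end

section \<open>Enveloping C*-algebras\<close>

definition tends :: "'a cstar \<Rightarrow> (nat \<Rightarrow> 'a) \<Rightarrow> 'a \<Rightarrow> bool" where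
  "tends A s x \<longleftrightarrow> (\<lambda>n. cnorm A (s n \<ominus>\<^bsub>A\<^esub> x)) \<longlonglongrightarrow> 0"

context calg
begin

lemma tendsI:
  assumes "f \<longlonglongrightarrow> 0" "\<And>n. s n \<in> carrier A" "x \<in> carrier A" "\<And>n. cnorm A (s n \<ominus> x) \<le> f n"
  shows "tends A s x"
  unfolding tends_def
  by (rule Lim_null_comparison[OF _ assms(1)]) (use assms in auto)

lemma tends_unique:
  "\<lbrakk>tends A s x; tends A s y; \<And>n. s n \<in> carrier A; x \<in> carrier A; y \<in> carrier A\<rbrakk> \<Longrightarrow> x = y"
  using limit_unique unfolding tends_def by blast

lemma tends_const: "x \<in> carrier A \<Longrightarrow> tends A (\<lambda>n. x) x"
  by (simp add: tends_def)

lemma tends_add: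
  assumes "\<And>n. s n \<in> carrier A" "x \<in> carrier A" "\<And>n. t n \<in> carrier A" "y \<in> carrier A"
    and "tends A s x" "tends A t y"
  shows "tends A (\<lambda>n. s n \<oplus> t n) (x \<oplus> y)"
  by (rule tendsI[of "\<lambda>n. cnorm A (s n \<ominus> x) + cnorm A (t n \<ominus> y)"])
    (use assms tendsto_add[of _ 0 _ _ 0] in \<open>auto simp: tends_def intro: p_add_dist\<close>)

lemma tends_smult:
  assumes "\<And>n. s n \<in> carrier A" "x \<in> carrier A" "tends A s x"
  shows "tends A (\<lambda>n. c \<odot> s n) (c \<odot> x)"
  by (rule tendsI[of "\<lambda>n. cmod c * cnorm A (s n \<ominus> x)"])
    (use assms in \<open>auto simp: tends_def p_smult_dist intro: tendsto_mult_right_zero\<close>)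

lemma tends_star:
  assumes "\<And>n. s n \<in> carrier A" "x \<in> carrier A" "tends A s x"
  shows "tends A (\<lambda>n. star A (s n)) (star A x)"
  by (rule tendsI[of "\<lambda>n. cnorm A (s n \<ominus> x)"])
    (use assms in \<open>auto simp: tends_def p_star_dist\<close>)

lemma tends_mult:
  assumes s: "\<And>n. s n \<in> carrier A" "x \<in> carrier A" "\<And>n. t n \<in> carrier A" "y \<in> carrier A"
    and lim: "tends A s x" "tends A t y"
  shows "tends A (\<lambda>n. s n \<otimes> t n) (x \<otimes> y)"
proof (rule tendsI)
  let ?a = "\<lambda>n. cnorm A (s n \<ominus> x)" and ?b = "\<lambda>n. cnorm A (t n \<ominus> y)"
  have "(\<lambda>n. ?a n * (?b n + cnorm A y) + cnorm A x * ?b n) \<longlonglongrightarrow> 0 * (0 + cnorm A y) + cnorm A x * 0"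
    using lim unfolding tends_def by (intro tendsto_intros)
  then show "(\<lambda>n. ?a n * (?b n + cnorm A y) + cnorm A x * ?b n) \<longlonglongrightarrow> 0"
    by simp
  show "cnorm A (s n \<otimes> t n \<ominus> x \<otimes> y) \<le> ?a n * (?b n + cnorm A y) + cnorm A x * ?b n" for n
    by (rule order_trans[OF p_mult_dist]) (use s in \<open>auto intro!: add_mono mult_left_mono p_le_add_dist\<close>)
qed (use s in auto)

end

context cstar_semi
begin

text \<open>A bounded homomorphism takes Cauchy sequences to Cauchy sequences and null differences
  to null differences, so the limit of the images depends only on the class.\<close>

lemma extend_to_completion:
  fixes B :: "'c cstar"
  assumes "calg B" and f: "f \<in> star_hom P B" and C: "\<And>x. x \<in> carrier P \<Longrightarrow> cnorm B (f x) \<le> C * p x"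
  shows "\<exists>h\<in>star_hom compl B. h \<in> extensional (carrier compl)
    \<and> (\<forall>x\<in>carrier P. h (completion_of P p x) = f x)"
proof -
  interpret B: calg B by fact
  have fc [simp]: "f x \<in> carrier B" if "x \<in> carrier P" for x
    using that star_homD[OF f] by simp
  have fd: "cnorm B (f x \<ominus>\<^bsub>B\<^esub> f y) \<le> C * p (x \<ominus> y)" if "x \<in> carrier P" "y \<in> carrier P" for x y
    using C[of "x \<ominus> y"] that by (simp add: star_hom_minus[OF star_alg_axioms B.star_alg_axioms f])
  have "\<exists>y\<in>carrier B. tends B (\<lambda>n. f (s n)) y" if s: "cauchy s" for s
    unfolding tends_def
  proof (rule B.complete)
    fix e :: real assume e: "e > 0"
    obtain K where K: "\<And>m n. \<lbrakk>m \<ge> K; n \<ge> K\<rbrakk> \<Longrightarrow> p (s m \<ominus> s n) < e / (\<bar>C\<bar> + 1)"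
      using cauchyD[OF s, of "e / (\<bar>C\<bar> + 1)"] e by auto
    have "cnorm B (f (s m) \<ominus>\<^bsub>B\<^esub> f (s n)) < e" if "m \<ge> K" "n \<ge> K" for m n
    proof -
      have "cnorm B (f (s m) \<ominus>\<^bsub>B\<^esub> f (s n)) \<le> C * p (s m \<ominus> s n)"
        using s by (intro fd) auto
      also have "\<dots> \<le> (\<bar>C\<bar> + 1) * p (s m \<ominus> s n)"
        using s by (intro mult_right_mono) auto
      also have "\<dots> < e"
        using K[OF that] by (simp add: field_simps)
      finally show ?thesis .
    qed
    then show "\<exists>K. \<forall>m\<ge>K. \<forall>n\<ge>K. cnorm B (f (s m) \<ominus>\<^bsub>B\<^esub> f (s n)) < e"
      by blast
  qed (use s in simp)
  then obtain G where G: "\<And>s. cauchy s \<Longrightarrow> G s \<in> carrier B"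
      "\<And>s. cauchy s \<Longrightarrow> tends B (\<lambda>n. f (s n)) (G s)"
    by metis
  have G_eqI: "G s = y" if "cauchy s" "y \<in> carrier B" "tends B (\<lambda>n. f (s n)) y" for s y
    using B.tends_unique[OF G(2)[OF that(1)] that(3)] that G(1) by simp
  have G_cong: "G s = G t" if s: "cauchy s" and t: "cauchy t" and eq: "cls s = cls t" for s t
  proof (rule G_eqI[OF s G(1)[OF t]])
    have lim: "(\<lambda>n. C * p (s n \<ominus> t n)) \<longlonglongrightarrow> 0" "(\<lambda>n. cnorm B (f (t n) \<ominus>\<^bsub>B\<^esub> G t)) \<longlonglongrightarrow> 0"
      using eq cls_eq_iff[OF s t] G(2)[OF t] by (auto simp: tends_def intro: tendsto_mult_right_zero)
    show "tends B (\<lambda>n. f (s n)) (G t)"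
    proof (rule B.tendsI)
      show "(\<lambda>n. C * p (s n \<ominus> t n) + cnorm B (f (t n) \<ominus>\<^bsub>B\<^esub> G t)) \<longlonglongrightarrow> 0"
        using tendsto_add[OF lim] by simp
      show "cnorm B (f (s n) \<ominus>\<^bsub>B\<^esub> G t) \<le> C * p (s n \<ominus> t n) + cnorm B (f (t n) \<ominus>\<^bsub>B\<^esub> G t)" for n
        using B.p_dist_triangle[of "f (s n)" "f (t n)" "G t"] fd[of "s n" "t n"] s t G(1)[OF t] by simp
    qed (use s t G in auto)
  qed
  \<comment> \<open>The value \<open>undefined\<close> off the carrier makes \<open>h\<close>
    extensional, as \<open>the_hom\<close> requires of the map it selects.\<close>
  define h where "h X = (if X \<in> carrier compl then G (SOME s. cauchy s \<and> X = cls s) else undefined)" for X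
  have h: "h (cls s) = G s" if s: "cauchy s" for s
  proof -
    define t where "t = (SOME t. cauchy t \<and> cls s = cls t)"
    have t: "cauchy t \<and> cls s = cls t"
      unfolding t_def by (rule someI[of _ s]) (use s in simp)
    have "h (cls s) = G t"
      using s by (simp only: h_def t_def cls_in_carrier if_True)
    also have "\<dots> = G s"
      by (rule G_cong[OF _ s]) (use t in \<open>simp_all only:\<close>)
    finally show ?thesis .
  qed
  note fD = star_homD[OF f]
  have "h \<in> star_hom compl B"
  proof (rule star_homI)
    show "h x \<in> carrier B" if "x \<in> carrier compl" for x
      using that by (auto elim!: compl_cases simp: h G)
    show "h (x \<oplus>\<^bsub>compl\<^esub> y) = h x \<oplus>\<^bsub>B\<^esub> h y" if "x \<in> carrier compl" "y \<in> carrier compl" for x y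
      using that
    proof (elim compl_cases)
      fix s t assume st: "cauchy s" "x = cls s" "cauchy t" "y = cls t"
      have "G (\<lambda>n. s n \<oplus> t n) = G s \<oplus>\<^bsub>B\<^esub> G t"
        using B.tends_add[OF _ _ _ _ G(2)[OF st(1)] G(2)[OF st(3)]] st G(1)
        by (intro G_eqI cauchy_add) (simp_all add: fD)
      then show ?thesis
        using st by (simp add: compl_simps h cauchy_add)
    qed
    show "h (x \<otimes>\<^bsub>compl\<^esub> y) = h x \<otimes>\<^bsub>B\<^esub> h y" if "x \<in> carrier compl" "y \<in> carrier compl" for x y
      using that
    proof (elim compl_cases)
      fix s t assume st: "cauchy s" "x = cls s" "cauchy t" "y = cls t"
      have "G (\<lambda>n. s n \<otimes> t n) = G s \<otimes>\<^bsub>B\<^esub> G t"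
        using B.tends_mult[OF _ _ _ _ G(2)[OF st(1)] G(2)[OF st(3)]] st G(1)
        by (intro G_eqI cauchy_mult) (simp_all add: fD)
      then show ?thesis
        using st by (simp add: compl_simps h cauchy_mult)
    qed
    have "G (\<lambda>n. \<one>) = \<one>\<^bsub>B\<^esub>"
      by (intro G_eqI) (simp_all add: fD B.tends_const)
    then show "h \<one>\<^bsub>compl\<^esub> = \<one>\<^bsub>B\<^esub>"
      by (simp add: compl_simps h)
    show "h (c \<odot>\<^bsub>compl\<^esub> x) = c \<odot>\<^bsub>B\<^esub> h x" if "x \<in> carrier compl" for c x
      using that
    proof (elim compl_cases)
      fix s assume st: "cauchy s" "x = cls s"
      have "G (\<lambda>n. c \<odot> s n) = c \<odot>\<^bsub>B\<^esub> G s"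
        using B.tends_smult[OF _ _ G(2)[OF st(1)]] st G(1)
        by (intro G_eqI cauchy_smult) (simp_all add: fD)
      then show ?thesis
        using st by (simp add: compl_simps h cauchy_smult)
    qed
    show "h (star compl x) = star B (h x)" if "x \<in> carrier compl" for x
      using that
    proof (elim compl_cases)
      fix s assume st: "cauchy s" "x = cls s"
      have "G (\<lambda>n. star P (s n)) = star B (G s)"
        using B.tends_star[OF _ _ G(2)[OF st(1)]] st G(1)
        by (intro G_eqI cauchy_star) (simp_all add: fD)
      then show ?thesis
        using st by (simp add: compl_simps h cauchy_star)
    qed
  qed
  moreover have "h \<in> extensional (carrier compl)"
    by (simp add: h_def extensional_def)
  moreover have "h (completion_of P p x) = f x" if "x \<in> carrier P" for x
    using that G_eqI[of "\<lambda>n. x" "f x"] by (simp add: completion_of_eq h B.tends_const)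
  ultimately show ?thesis
    by blast
qed

end

text \<open>The pointwise bound keeps the real supremum in \<open>env_seminorm\<close> finite; it is
  the existence criterion for the C*-algebra with the given generators and relators.\<close>

locale cstar_rel = star_alg P for P :: "('a, 'm) star_algebra_scheme" (structure) +
  fixes R :: "'a set"
  assumes relators: "R \<subseteq> carrier P"
    and bounded: "x \<in> carrier P
      \<Longrightarrow> \<exists>C. \<forall>p. cstar_seminorm P p \<and> (\<forall>r\<in>R. p r = 0) \<longrightarrow> p x \<le> C"
begin

abbreviation "env \<equiv> env_seminorm P R"

lemma env_upper:
  assumes "cstar_seminorm P p" "\<forall>r\<in>R. p r = 0" "x \<in> carrier P"
  shows "p x \<le> env x"
  unfolding env_seminorm_def
proof (rule cSUP_upper)
  obtain C where "\<forall>p. cstar_seminorm P p \<and> (\<forall>r\<in>R. p r = 0) \<longrightarrow> p x \<le> C"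
    using bounded[OF assms(3)] by blast
  then show "bdd_above ((\<lambda>p. p x) ` {p. cstar_seminorm P p \<and> (\<forall>r\<in>R. p r = 0)})"
    by (auto simp: bdd_above_def)
qed (use assms in simp)

lemma zero_seminorm: "cstar_seminorm P (\<lambda>x. 0)"
  by (simp add: cstar_seminorm_def)

lemma env_least:
  assumes "\<And>p. \<lbrakk>cstar_seminorm P p; \<forall>r\<in>R. p r = 0\<rbrakk> \<Longrightarrow> p x \<le> c"
  shows "env x \<le> c"
  unfolding env_seminorm_def
  by (rule cSUP_least) (use assms zero_seminorm in auto)

lemma env_nonneg: "x \<in> carrier P \<Longrightarrow> 0 \<le> env x"
  using env_upper[OF zero_seminorm] by simp

lemma env_relator: "r \<in> R \<Longrightarrow> env r = 0"
  using env_least[of r 0] env_nonneg[of r] relators by fastforce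

lemma env_smult_le: "x \<in> carrier P \<Longrightarrow> env (c \<odot> x) \<le> cmod c * env x"
  by (rule env_least) (auto simp: cstar_seminorm_def intro!: mult_left_mono env_upper)

text \<open>The laws pass to the pointwise supremum. In the C*-identity one inequality holds because
  squaring is monotone on nonnegative reals, the other is obtained by bounding each
  \<open>p x\<close> by a square root.\<close>

lemma cstar_seminorm_env: "cstar_seminorm P env"
  unfolding cstar_seminorm_def
proof (intro conjI ballI allI)
  fix x assume x: "x \<in> carrier P"
  show "0 \<le> env x"
    using x by (rule env_nonneg)
  show "env (c \<odot> x) = cmod c * env x" for c
  proof (cases "c = 0")
    case True
    have "env \<zero> \<le> 0"
      using env_smult_le[of \<zero> 0] by simp
    then show ?thesis
      using True x env_nonneg[of \<zero>] by simp
  next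
    case False
    have "env x \<le> cmod (1 / c) * env (c \<odot> x)"
      using env_smult_le[of "c \<odot> x" "1 / c"] x False by simp
    then have "cmod c * env x \<le> env (c \<odot> x)"
      using False by (simp add: norm_divide field_simps)
    then show ?thesis
      using env_smult_le[OF x, of c] by simp
  qed
  show "env (star P x \<otimes> x) = (env x)\<^sup>2"
  proof (rule antisym)
    show "env (star P x \<otimes> x) \<le> (env x)\<^sup>2"
    proof (rule env_least)
      fix p assume p: "cstar_seminorm P p" "\<forall>r\<in>R. p r = 0"
      then have "p (star P x \<otimes> x) = (p x)\<^sup>2" "0 \<le> p x"
        using x by (auto simp: cstar_seminorm_def)
      then show "p (star P x \<otimes> x) \<le> (env x)\<^sup>2"
        using env_upper[OF p x] by (simp add: power_mono)
    qed
    have "env x \<le> sqrt (env (star P x \<otimes> x))"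
    proof (rule env_least)
      fix p assume p: "cstar_seminorm P p" "\<forall>r\<in>R. p r = 0"
      have "(p x)\<^sup>2 = p (star P x \<otimes> x)"
        using x p by (auto simp: cstar_seminorm_def)
      also have "\<dots> \<le> env (star P x \<otimes> x)"
        using x by (intro env_upper p) auto
      finally show "p x \<le> sqrt (env (star P x \<otimes> x))"
        by (rule real_le_rsqrt)
    qed
    then have "(env x)\<^sup>2 \<le> (sqrt (env (star P x \<otimes> x)))\<^sup>2"
      using env_nonneg[OF x] by (intro power_mono)
    then show "(env x)\<^sup>2 \<le> env (star P x \<otimes> x)"
      using env_nonneg[of "star P x \<otimes> x"] x by simp
  qed
  fix y assume y: "y \<in> carrier P"
  show "env (x \<oplus> y) \<le> env x + env y"
  proof (rule env_least)
    fix p assume p: "cstar_seminorm P p" "\<forall>r\<in>R. p r = 0"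
    then have "p (x \<oplus> y) \<le> p x + p y"
      using x y by (auto simp: cstar_seminorm_def)
    then show "p (x \<oplus> y) \<le> env x + env y"
      using env_upper[OF p x] env_upper[OF p y] by linarith
  qed
  show "env (x \<otimes> y) \<le> env x * env y"
  proof (rule env_least)
    fix p assume p: "cstar_seminorm P p" "\<forall>r\<in>R. p r = 0"
    then have "p (x \<otimes> y) \<le> p x * p y" "0 \<le> p x" "0 \<le> p y"
      using x y by (auto simp: cstar_seminorm_def)
    then show "p (x \<otimes> y) \<le> env x * env y"
      using env_upper[OF p x] env_upper[OF p y] by (meson mult_mono order_trans)
  qed
qed

sublocale E: cstar_semi P env
  by unfold_locales (rule cstar_seminorm_env)

lemma calg_env: "calg (cstar_env P R)"
  unfolding cstar_env_def by (rule E.calg_completion)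

lemma env_of_star_hom: "env_of P R \<in> star_hom P (cstar_env P R)"
  unfolding cstar_env_def env_of_def by (rule E.completion_of_star_hom)

lemma env_of_relator:
  assumes "r \<in> R"
  shows "env_of P R r = \<zero>\<^bsub>cstar_env P R\<^esub>"
proof -
  interpret C: calg "cstar_env P R" by (rule calg_env)
  have r: "r \<in> carrier P"
    using assms relators by blast
  have "cnorm (cstar_env P R) (env_of P R r) = 0"
    using r assms by (simp add: cstar_env_def env_of_def env_relator)
  then show ?thesis
    using r star_homD[OF env_of_star_hom] by (intro C.definite) auto
qed

text \<open>The norm of \<open>B\<close> composed with \<open>f\<close> is one of the seminorms
  under the supremum, so \<open>f\<close> is contractive for \<open>env\<close> and extends to the
  completion.\<close>

lemma env_extend:
  fixes B :: "'c cstar"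
  assumes "calg B" "f \<in> star_hom P B" "\<And>r. r \<in> R \<Longrightarrow> f r = \<zero>\<^bsub>B\<^esub>"
  obtains h where "h \<in> star_hom (cstar_env P R) B" "h \<in> extensional (carrier (cstar_env P R))"
    "\<And>x. x \<in> carrier P \<Longrightarrow> h (env_of P R x) = f x"
proof -
  interpret B: calg B by fact
  have "cstar_seminorm P (\<lambda>x. cnorm B (f x))"
    by (rule star_hom_seminorm[OF star_alg_axioms B.star_alg_axioms assms(2) B.seminorm])
  then have "cnorm B (f x) \<le> 1 * env x" if "x \<in> carrier P" for x
    using that assms(3) by (auto intro!: env_upper)
  from E.extend_to_completion[OF assms(1,2) this] show thesis
    using that by (auto simp: cstar_env_def env_of_def)
qed

lemma generates_envI:
  assumes D: "D \<subseteq> carrier (cstar_env P R)"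
    and S: "\<And>S x. \<lbrakk>cstar_sub (cstar_env P R) S; D \<subseteq> S; x \<in> carrier P\<rbrakk> \<Longrightarrow> env_of P R x \<in> S"
  shows "generates (cstar_env P R) D"
  unfolding generates_def
proof (intro conjI allI impI D, elim conjE)
  interpret C: calg "cstar_env P R" by (rule calg_env)
  fix S assume S': "cstar_sub (cstar_env P R) S" "D \<subseteq> S"
  have "x \<in> S" if x: "x \<in> carrier (cstar_env P R)" for x
  proof -
    have "\<exists>y\<in>carrier P. cnorm (cstar_env P R) (x \<ominus>\<^bsub>cstar_env P R\<^esub> env_of P R y) < (1/2) ^ n" for n :: nat
      unfolding cstar_env_def env_of_def
      by (rule E.completion_dense) (use x in \<open>simp_all add: cstar_env_def\<close>)
    then obtain y where y: "\<And>n. y n \<in> carrier P"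
        "\<And>n :: nat. cnorm (cstar_env P R) (x \<ominus>\<^bsub>cstar_env P R\<^esub> env_of P R (y n)) < (1/2) ^ n"
      by metis
    have yS: "env_of P R (y n) \<in> S" for n
      using S[OF S' y(1)] .
    have yc: "env_of P R (y n) \<in> carrier (cstar_env P R)" for n
      using star_homD[OF env_of_star_hom] y by simp
    have "tends (cstar_env P R) (\<lambda>n. env_of P R (y n)) x"
    proof (rule C.tendsI)
      show "(\<lambda>n. (1/2) ^ n :: real) \<longlonglongrightarrow> 0"
        by (rule LIMSEQ_power_zero) simp
      show "cnorm (cstar_env P R) (env_of P R (y n) \<ominus>\<^bsub>cstar_env P R\<^esub> x) \<le> (1/2) ^ n" for n
        using y(2)[of n] C.p_minus_commute[OF x yc, of n] by simp
    qed (use x yc in auto)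
    moreover have "limit_closed (cstar_env P R) S"
      using S'(1) by (simp add: cstar_sub_def)
    ultimately show "x \<in> S"
      using limit_closedD[of "cstar_env P R" S x, OF _ x yS] by (simp add: tends_def)
  qed
  then show "S = carrier (cstar_env P R)"
    using S'(1) by (auto simp: cstar_sub_def)
qed

end

lemma (in star_mon) generates_env_delta:
  assumes "cstar_rel alg R"
  shows "generates (cstar_env alg R) ((\<lambda>a. env_of alg R (delta a)) ` carrier M)"
proof -
  interpret cstar_rel alg R by fact
  show ?thesis
  proof (rule generates_envI)
    show "(\<lambda>a. env_of alg R (delta a)) ` carrier M \<subseteq> carrier (cstar_env alg R)"
      using star_homD[OF env_of_star_hom] by auto
    fix S x assume "cstar_sub (cstar_env alg R) S"
      "(\<lambda>a. env_of alg R (delta a)) ` carrier M \<subseteq> S" "x \<in> carrier alg"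
    from this(3,1,2) show "env_of alg R x \<in> S"
      by (induction x rule: alg_induct') (auto simp: star_homD[OF env_of_star_hom] cstar_sub_def)
  qed
qed

section \<open>The Toeplitz algebra and the circle\<close>

text \<open>Subadditivity and homogeneity spread a bound on the monoid elements to their linear
  combinations.\<close>

lemma (in star_mon) cstar_relI:
  assumes R: "R \<subseteq> carrier alg"
    and bound: "\<And>a. a \<in> carrier M
      \<Longrightarrow> \<exists>C. \<forall>p. cstar_seminorm alg p \<and> (\<forall>r\<in>R. p r = 0) \<longrightarrow> p (delta a) \<le> C"
  shows "cstar_rel alg R"
proof unfold_locales
  show "\<exists>C. \<forall>p. cstar_seminorm alg p \<and> (\<forall>r\<in>R. p r = 0) \<longrightarrow> p f \<le> C" if "f \<in> carrier alg" for f
    using that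
  proof (induction f rule: alg_induct')
    case (smult f c)
    then obtain C where C: "\<And>p. cstar_seminorm alg p \<and> (\<forall>r\<in>R. p r = 0) \<Longrightarrow> p f \<le> C"
      by blast
    have "p (c \<odot>\<^bsub>alg\<^esub> f) \<le> cmod c * C" if p: "cstar_seminorm alg p \<and> (\<forall>r\<in>R. p r = 0)" for p
    proof -
      have "p (c \<odot>\<^bsub>alg\<^esub> f) = cmod c * p f"
        using p smult(1) by (auto simp: cstar_seminorm_def)
      then show ?thesis
        using C[OF p] by (simp add: mult_left_mono)
    qed
    then show ?case by blast
  next
    case (add f g)
    obtain C where C: "\<And>p. cstar_seminorm alg p \<and> (\<forall>r\<in>R. p r = 0) \<Longrightarrow> p f \<le> C"
      using add by blast
    obtain D where D: "\<And>p. cstar_seminorm alg p \<and> (\<forall>r\<in>R. p r = 0) \<Longrightarrow> p g \<le> D"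
      using add by blast
    have "p (f \<oplus>\<^bsub>alg\<^esub> g) \<le> C + D" if p: "cstar_seminorm alg p \<and> (\<forall>r\<in>R. p r = 0)" for p
    proof -
      have "p (f \<oplus>\<^bsub>alg\<^esub> g) \<le> p f + p g"
        using p add(1,2) by (auto simp: cstar_seminorm_def)
      then show ?thesis
        using C[OF p] D[OF p] by linarith
    qed
    then show ?case by blast
  qed (rule bound)
qed (rule R)

interpretation words: star_mon words
proof unfold_locales
  show "invol words (a \<otimes>\<^bsub>words\<^esub> b) = invol words b \<otimes>\<^bsub>words\<^esub> invol words a" for a b
    by (simp add: words_def)
  show "invol words (invol words a) = a" for a
    by (simp add: words_def rev_map[symmetric] o_def cong: letter.case_cong)
      (induction a; simp split: letter.split)
qed (auto simp: words_def)

lemma words_simps [simp]: "carrier words = UNIV" "a \<otimes>\<^bsub>words\<^esub> b = a @ b" "\<one>\<^bsub>words\<^esub> = []"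
  "invol words [] = []" "invol words [Gen] = [Gen_adj]" "invol words [Gen_adj] = [Gen]"
  by (simp_all add: words_def)

abbreviation "word_alg \<equiv> monoid_algebra words"

lemma isometry_relator_eq:
  "isometry_relator = {delta [Gen_adj, Gen] \<ominus>\<^bsub>word_alg\<^esub> delta []}"
  by (simp add: isometry_relator_def words.alg.minus_smult_eq words.alg_simps)

text \<open>The relator gives \<open>p(z)^2 = p(star z z) \<le> p(1) \<le> 1\<close>, so every word
  in \<open>z\<close> and its adjoint has seminorm at most 1.\<close>

lemma cstar_rel_toeplitz: "cstar_rel word_alg isometry_relator"
proof (rule words.cstar_relI)
  show "isometry_relator \<subseteq> carrier word_alg"
    by (simp add: isometry_relator_eq)
  fix w :: "letter list"
  have "p (delta w) \<le> 1"
    if "cstar_seminorm word_alg p \<and> (\<forall>r\<in>isometry_relator. p r = 0)" for p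
  proof -
    interpret p: cstar_semi word_alg p
      using that by unfold_locales blast
    have "p (delta [Gen_adj, Gen]) \<le> p (delta [Gen_adj, Gen] \<ominus>\<^bsub>word_alg\<^esub> delta []) + p (delta [])"
      by (rule p.p_le_add_dist) auto
    also have "\<dots> \<le> 1"
      using that p.p_one_le by (simp add: isometry_relator_eq words.alg_simps)
    also have "p (delta [Gen_adj, Gen]) = (p (delta [Gen]))\<^sup>2"
      using p.p_star_mult[of "delta [Gen]"] by (simp add: words.delta_mult)
    finally have 1: "p (delta [Gen]) \<le> 1"
      by (metis one_power2 power2_le_imp_le zero_le_one)
    moreover have "p (delta [Gen_adj]) = p (delta [Gen])"
      using p.p_star[of "delta [Gen]"] by simp
    ultimately have x: "p (delta [x]) \<le> 1" for x
      by (cases x) auto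
    show ?thesis
    proof (induction w)
      case Nil
      show ?case
        using p.p_one_le by (simp add: words.alg_simps)
    next
      case (Cons x w)
      have "p (delta (x # w)) \<le> p (delta [x]) * p (delta w)"
        using p.p_mult[of "delta [x]" "delta w"] by (simp add: words.delta_mult)
      also have "\<dots> \<le> 1"
        using x Cons by (intro mult_le_one) auto
      finally show ?case .
    qed
  qed
  then show "\<exists>C. \<forall>p. cstar_seminorm word_alg p \<and> (\<forall>r\<in>isometry_relator. p r = 0) \<longrightarrow> p (delta w) \<le> C"
    by blast
qed

interpretation toeplitz_rel: cstar_rel word_alg isometry_relator
  by (rule cstar_rel_toeplitz)

lemma calg_toeplitz: "calg toeplitz"
  unfolding toeplitz_def by (rule toeplitz_rel.calg_env)

interpretation toeplitz: calg toeplitz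
  by (rule calg_toeplitz)

lemmas toeplitz_of = toeplitz_rel.env_of_star_hom[folded toeplitz_def]

lemma toeplitz_z_closed [simp]: "toeplitz_z \<in> carrier toeplitz"
  unfolding toeplitz_z_def by (rule star_hom_closed[OF toeplitz_of]) simp

lemma toeplitz_z_isometry: "star toeplitz toeplitz_z \<otimes>\<^bsub>toeplitz\<^esub> toeplitz_z = \<one>\<^bsub>toeplitz\<^esub>"
proof -
  let ?e = "env_of word_alg isometry_relator"
  have "?e (delta [Gen_adj, Gen]) \<ominus>\<^bsub>toeplitz\<^esub> ?e (delta []) = \<zero>\<^bsub>toeplitz\<^esub>"
    using toeplitz_rel.env_of_relator[folded toeplitz_def]
      star_hom_minus[OF words.alg.star_alg_axioms toeplitz.star_alg_axioms toeplitz_of]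
    by (simp add: isometry_relator_eq)
  then have "?e (delta [Gen_adj, Gen]) = ?e (delta [])"
    by (rule toeplitz.minus_eq_zeroD[rotated 2]) (auto intro: star_hom_closed[OF toeplitz_of])
  moreover have "?e (delta [Gen_adj, Gen]) = star toeplitz toeplitz_z \<otimes>\<^bsub>toeplitz\<^esub> toeplitz_z"
    unfolding toeplitz_z_def
    using star_hom_star[OF toeplitz_of, of "delta [Gen]"]
      star_hom_mult[OF toeplitz_of, of "delta [Gen_adj]" "delta [Gen]"] by (simp add: words.delta_mult)
  ultimately show ?thesis
    using star_hom_one[OF toeplitz_of] by (simp add: words.alg_simps)
qed

lemma generates_toeplitz: "generates toeplitz {toeplitz_z}"
  unfolding toeplitz_def
proof (rule toeplitz_rel.generates_envI)
  show "{toeplitz_z} \<subseteq> carrier (cstar_env word_alg isometry_relator)"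
    by (simp flip: toeplitz_def)
  fix S x
  let ?e = "env_of word_alg isometry_relator"
  assume S: "cstar_sub (cstar_env word_alg isometry_relator) S" and z: "{toeplitz_z} \<subseteq> S"
    and "x \<in> carrier word_alg"
  note S' = S[folded toeplitz_def]
  have one: "?e (delta [x]) \<in> S" for x
  proof (cases x)
    case Gen
    then show ?thesis
      using z by (simp add: toeplitz_z_def)
  next
    case Gen_adj
    have "?e (delta [Gen_adj]) = star toeplitz toeplitz_z"
      unfolding toeplitz_z_def using star_hom_star[OF toeplitz_of, of "delta [Gen]"] by simp
    then show ?thesis
      using z S' Gen_adj by (simp add: cstar_sub_def)
  qed
  have "?e (delta w) \<in> S" for w
  proof (induction w)
    case Nil
    then show ?case
      using star_hom_one[OF toeplitz_of] S' by (simp add: words.alg_simps cstar_sub_def)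
  next
    case (Cons x w)
    have "?e (delta (x # w)) = ?e (delta [x]) \<otimes>\<^bsub>toeplitz\<^esub> ?e (delta w)"
      using star_hom_mult[OF toeplitz_of, of "delta [x]" "delta w"] by (simp add: words.delta_mult)
    then show ?case
      using Cons one S' by (simp add: cstar_sub_def)
  qed
  with \<open>x \<in> carrier word_alg\<close> show "?e x \<in> S"
    using S' by (induction x rule: words.alg_induct') (auto simp: star_homD[OF toeplitz_of] cstar_sub_def)
qed

text \<open>The relator is annihilated because \<open>v\<close> is an isometry. The symbol map, the
  coaction and the shift representations are all obtained from here.\<close>

lemma toeplitz_universal:
  fixes B :: "'c cstar"
  assumes "calg B" and v: "v \<in> carrier B" "star B v \<otimes>\<^bsub>B\<^esub> v = \<one>\<^bsub>B\<^esub>"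
  obtains h where "h \<in> star_hom toeplitz B" "h toeplitz_z = v"
proof -
  interpret B: calg B by fact
  define g where "g x = (case x of Gen \<Rightarrow> v | Gen_adj \<Rightarrow> star B v)" for x
  define \<mu> where "\<mu> w = foldr (\<lambda>x b. g x \<otimes>\<^bsub>B\<^esub> b) w \<one>\<^bsub>B\<^esub>" for w
  have g: "g x \<in> carrier B" for x
    using v by (simp add: g_def split: letter.split)
  have \<mu>c: "\<mu> w \<in> carrier B" for w
    using g by (induction w) (simp_all add: \<mu>_def)
  have \<mu>app: "\<mu> (w @ w') = \<mu> w \<otimes>\<^bsub>B\<^esub> \<mu> w'" for w w'
    using \<mu>c[of w'] \<mu>c[unfolded \<mu>_def] g by (induction w) (simp_all add: \<mu>_def B.m_assoc)
  have \<mu>1: "\<mu> [x] = g x" for x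
    using g by (simp add: \<mu>_def)
  have \<mu>star: "\<mu> (invol words w) = star B (\<mu> w)" for w
  proof (induction w)
    case (Cons x w)
    have "\<mu> (invol words (x # w)) = \<mu> (invol words w) \<otimes>\<^bsub>B\<^esub> \<mu> (invol words [x])"
      by (simp add: words_def flip: \<mu>app)
    also have "\<mu> (invol words [x]) = star B (g x)"
      using v by (cases x) (simp_all add: \<mu>1 g_def)
    finally show ?case
      using Cons \<mu>c[of w] g[of x] by (simp add: \<mu>_def)
  qed (simp add: \<mu>_def)
  let ?f = "words.lift B \<mu>"
  have f: "?f \<in> star_hom word_alg B" "?f (delta w) = \<mu> w" for w
    using words.lift_star_hom[OF B.star_alg_axioms, of \<mu>] \<mu>c \<mu>app \<mu>star by (simp_all add: \<mu>_def)
  have "?f r = \<zero>\<^bsub>B\<^esub>" if "r \<in> isometry_relator" for r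
  proof -
    have "?f r = \<mu> [Gen_adj, Gen] \<ominus>\<^bsub>B\<^esub> \<mu> []"
      using that f(2) star_hom_minus[OF words.alg.star_alg_axioms B.star_alg_axioms f(1)]
      by (simp add: isometry_relator_eq)
    also have "\<mu> [Gen_adj, Gen] = \<mu> []"
      using v by (simp add: \<mu>_def g_def)
    finally show ?thesis
      using \<mu>c by simp
  qed
  from toeplitz_rel.env_extend[OF assms(1) f(1) this] obtain h where
    h: "h \<in> star_hom (cstar_env word_alg isometry_relator) B"
    "\<And>x. x \<in> carrier word_alg \<Longrightarrow> h (env_of word_alg isometry_relator x) = ?f x"
    by blast
  have "h toeplitz_z = v"
    using h(2)[of "delta [Gen]"] v by (simp add: toeplitz_z_def f(2) \<mu>1 g_def)
  then show thesis
    using that h(1) by (simp add: toeplitz_def)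
qed

section \<open>Continuous functions on the circle as a C*-algebra\<close>

lemma circle_algebra_simps:
  "f \<in> carrier circle_algebra \<longleftrightarrow> f \<in> extensional circle \<and> continuous_on circle f"
  "monoid.mult circle_algebra = (\<lambda>f g. \<lambda>x\<in>circle. f x * g x)" "one circle_algebra = (\<lambda>x\<in>circle. 1)"
  "zero circle_algebra = (\<lambda>x\<in>circle. 0)" "add circle_algebra = (\<lambda>f g. \<lambda>x\<in>circle. f x + g x)"
  "smult circle_algebra = (\<lambda>c f. \<lambda>x\<in>circle. c * f x)"
  "star circle_algebra = (\<lambda>f. \<lambda>x\<in>circle. cnj (f x))"
  by (auto simp: circle_algebra_def)

lemma continuous_on_restrict_circle:
  "continuous_on circle (restrict f circle) \<longleftrightarrow> continuous_on circle f"
  by (rule continuous_on_cong) auto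

lemma restrict_in_circle_algebra:
  "restrict f circle \<in> carrier circle_algebra \<longleftrightarrow> continuous_on circle f"
  by (simp only: circle_algebra_simps continuous_on_restrict_circle restrict_extensional simp_thms)

lemma extensional_circle_eqI:
  "\<lbrakk>f \<in> extensional circle; g \<in> extensional circle; \<And>x. x \<in> circle \<Longrightarrow> f x = g x\<rbrakk> \<Longrightarrow> f = g"
  by (rule extensionalityI)

lemma circle_closed:
  "\<lbrakk>f \<in> carrier circle_algebra; g \<in> carrier circle_algebra\<rbrakk> \<Longrightarrow> f \<oplus>\<^bsub>circle_algebra\<^esub> g \<in> carrier circle_algebra"
  "\<lbrakk>f \<in> carrier circle_algebra; g \<in> carrier circle_algebra\<rbrakk> \<Longrightarrow> f \<otimes>\<^bsub>circle_algebra\<^esub> g \<in> carrier circle_algebra"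
  "f \<in> carrier circle_algebra \<Longrightarrow> c \<odot>\<^bsub>circle_algebra\<^esub> f \<in> carrier circle_algebra"
  "f \<in> carrier circle_algebra \<Longrightarrow> star circle_algebra f \<in> carrier circle_algebra"
  "\<zero>\<^bsub>circle_algebra\<^esub> \<in> carrier circle_algebra" "\<one>\<^bsub>circle_algebra\<^esub> \<in> carrier circle_algebra"
  unfolding circle_algebra_simps(2-) restrict_in_circle_algebra
  by (intro continuous_intros; simp add: circle_algebra_simps(1))+

lemma star_alg_circle: "star_alg circle_algebra"
proof (rule star_alg.intro)
  show "ring circle_algebra"
  proof (intro ringI abelian_groupI monoidI)
    show "\<exists>y\<in>carrier circle_algebra. y \<oplus>\<^bsub>circle_algebra\<^esub> f = \<zero>\<^bsub>circle_algebra\<^esub>"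
      if "f \<in> carrier circle_algebra" for f
    proof
      show "(\<lambda>x\<in>circle. - f x) \<in> carrier circle_algebra"
        unfolding restrict_in_circle_algebra
        using that by (intro continuous_intros) (simp add: circle_algebra_simps)
      show "(\<lambda>x\<in>circle. - f x) \<oplus>\<^bsub>circle_algebra\<^esub> f = \<zero>\<^bsub>circle_algebra\<^esub>"
        by (auto simp: circle_algebra_simps(2-) intro: restrict_ext)
    qed
  qed (simp_all add: circle_closed,
      auto simp: circle_algebra_simps algebra_simps intro!: extensional_circle_eqI)
  show "star_alg_axioms circle_algebra"
    by unfold_locales
      (simp_all add: circle_closed,
        auto simp: circle_algebra_simps algebra_simps intro!: extensional_circle_eqI)
qed

interpretation circle: star_alg circle_algebra
  by (rule star_alg_circle)

lemma circle_minus: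
  "\<lbrakk>f \<in> carrier circle_algebra; g \<in> carrier circle_algebra; x \<in> circle\<rbrakk>
    \<Longrightarrow> (f \<ominus>\<^bsub>circle_algebra\<^esub> g) x = f x - g x"
  by (simp add: circle.minus_smult_eq) (simp add: circle_algebra_simps)

lemma circle_norm_le_iff:
  assumes "f \<in> carrier circle_algebra"
  shows "cnorm circle_algebra f \<le> c \<longleftrightarrow> (\<forall>x\<in>circle. cmod (f x) \<le> c)"
proof -
  have "compact (f ` circle)"
    using assms by (intro compact_continuous_image) (auto simp: circle_algebra_simps)
  then obtain B where "\<And>y. y \<in> f ` circle \<Longrightarrow> cmod y \<le> B"
    using compact_imp_bounded bounded_iff by metis
  then have "bdd_above ((\<lambda>x. cmod (f x)) ` circle)"
    by (auto simp: bdd_above_def)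
  moreover have "circle \<noteq> {}"
    by simp
  ultimately show ?thesis
    by (simp add: circle_algebra_def cSUP_le_iff)
qed

lemma circle_norm_ge: "\<lbrakk>f \<in> carrier circle_algebra; x \<in> circle\<rbrakk> \<Longrightarrow> cmod (f x) \<le> cnorm circle_algebra f"
  using circle_norm_le_iff[of f "cnorm circle_algebra f"] by simp

lemma one_in_circle: "1 \<in> circle"
  by simp

lemma circle_norm_nonneg: "f \<in> carrier circle_algebra \<Longrightarrow> 0 \<le> cnorm circle_algebra f"
  using circle_norm_ge[OF _ one_in_circle] norm_ge_zero order_trans by blast

lemma cstar_seminorm_circle: "cstar_seminorm circle_algebra (cnorm circle_algebra)"
  unfolding cstar_seminorm_def
proof (intro conjI ballI allI)
  let ?N = "cnorm circle_algebra"
  fix f assume f: "f \<in> carrier circle_algebra"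
  show "0 \<le> ?N f"
    using f by (rule circle_norm_nonneg)
  have le: "?N (c \<odot>\<^bsub>circle_algebra\<^esub> f) \<le> cmod c * ?N f" if f: "f \<in> carrier circle_algebra" for c f
  proof (subst circle_norm_le_iff)
    show "\<forall>x\<in>circle. cmod ((c \<odot>\<^bsub>circle_algebra\<^esub> f) x) \<le> cmod c * ?N f"
      using circle_norm_ge[OF f] by (auto simp: circle_algebra_simps norm_mult intro!: mult_left_mono)
  qed (use f in simp)
  show "?N (c \<odot>\<^bsub>circle_algebra\<^esub> f) = cmod c * ?N f" for c
  proof (cases "c = 0")
    case True
    have "?N \<zero>\<^bsub>circle_algebra\<^esub> \<le> 0"
      using le[OF f, of 0] f by simp
    then show ?thesis
      using True f circle_norm_nonneg[of "\<zero>\<^bsub>circle_algebra\<^esub>"] by simp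
  next
    case False
    have "?N f \<le> cmod (1 / c) * ?N (c \<odot>\<^bsub>circle_algebra\<^esub> f)"
      using le[of "c \<odot>\<^bsub>circle_algebra\<^esub> f" "1 / c"] f False by simp
    then show ?thesis
      using le[OF f, of c] False by (simp add: norm_divide field_simps)
  qed
  show "?N (star circle_algebra f \<otimes>\<^bsub>circle_algebra\<^esub> f) = (?N f)\<^sup>2"
  proof (rule antisym)
    have eq: "cmod ((star circle_algebra f \<otimes>\<^bsub>circle_algebra\<^esub> f) x) = (cmod (f x))\<^sup>2" if "x \<in> circle" for x
      using that by (simp add: circle_algebra_simps norm_mult power2_eq_square)
    then show "?N (star circle_algebra f \<otimes>\<^bsub>circle_algebra\<^esub> f) \<le> (?N f)\<^sup>2"
      using f circle_norm_ge[OF f] by (subst circle_norm_le_iff) (auto intro: power_mono)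
    have "cmod (f x) \<le> sqrt (?N (star circle_algebra f \<otimes>\<^bsub>circle_algebra\<^esub> f))" if "x \<in> circle" for x
      using circle_norm_ge[of "star circle_algebra f \<otimes>\<^bsub>circle_algebra\<^esub> f" x] f that eq[OF that]
      by (intro real_le_rsqrt) auto
    then have "?N f \<le> sqrt (?N (star circle_algebra f \<otimes>\<^bsub>circle_algebra\<^esub> f))"
      using f by (subst circle_norm_le_iff) auto
    then have "(?N f)\<^sup>2 \<le> (sqrt (?N (star circle_algebra f \<otimes>\<^bsub>circle_algebra\<^esub> f)))\<^sup>2"
      using circle_norm_nonneg[OF f] by (intro power_mono)
    then show "(?N f)\<^sup>2 \<le> ?N (star circle_algebra f \<otimes>\<^bsub>circle_algebra\<^esub> f)"
      using f by (simp add: circle_norm_nonneg)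
  qed
  fix g assume g: "g \<in> carrier circle_algebra"
  show "?N (f \<oplus>\<^bsub>circle_algebra\<^esub> g) \<le> ?N f + ?N g"
  proof (subst circle_norm_le_iff)
    show "\<forall>x\<in>circle. cmod ((f \<oplus>\<^bsub>circle_algebra\<^esub> g) x) \<le> ?N f + ?N g"
      using circle_norm_ge[OF f] circle_norm_ge[OF g]
      by (auto simp: circle_algebra_simps intro!: norm_triangle_le add_mono)
  qed (use f g in simp)
  show "?N (f \<otimes>\<^bsub>circle_algebra\<^esub> g) \<le> ?N f * ?N g"
  proof (subst circle_norm_le_iff)
    show "\<forall>x\<in>circle. cmod ((f \<otimes>\<^bsub>circle_algebra\<^esub> g) x) \<le> ?N f * ?N g"
      using circle_norm_ge[OF f] circle_norm_ge[OF g] circle_norm_nonneg[OF f]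
      by (auto simp: circle_algebra_simps norm_mult intro!: mult_mono)
  qed (use f g in simp)
qed

lemma calg_circle: "calg circle_algebra"
proof unfold_locales
  show "cstar_seminorm circle_algebra (cnorm circle_algebra)"
    by (rule cstar_seminorm_circle)
  show "f = \<zero>\<^bsub>circle_algebra\<^esub>" if "f \<in> carrier circle_algebra" "cnorm circle_algebra f = 0" for f
  proof (rule extensional_circle_eqI)
    show "f x = \<zero>\<^bsub>circle_algebra\<^esub> x" if "x \<in> circle" for x
      using circle_norm_ge[OF \<open>f \<in> carrier circle_algebra\<close> that] \<open>cnorm circle_algebra f = 0\<close> that
      by (simp add: circle_algebra_simps)
  qed (use that in \<open>simp_all add: circle_algebra_simps\<close>)
  fix s assume s: "\<And>n :: nat. s n \<in> carrier circle_algebra"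
    and cau: "\<And>e. e > 0 \<Longrightarrow> \<exists>K. \<forall>m\<ge>K. \<forall>n\<ge>K. cnorm circle_algebra (s m \<ominus>\<^bsub>circle_algebra\<^esub> s n) < e"
  have dist: "dist (s m x) (s n x) \<le> cnorm circle_algebra (s m \<ominus>\<^bsub>circle_algebra\<^esub> s n)"
    if "x \<in> circle" for m n x
    using circle_norm_ge[of "s m \<ominus>\<^bsub>circle_algebra\<^esub> s n" x] that s
    by (simp add: circle_minus dist_norm)
  have "uniformly_Cauchy_on circle s"
    unfolding uniformly_Cauchy_on_def using cau dist by (meson order_le_less_trans)
  then obtain l where l: "uniform_limit circle s l sequentially"
    using Cauchy_uniformly_convergent uniformly_convergent_on_def by blast
  have lc: "restrict l circle \<in> carrier circle_algebra"
    unfolding restrict_in_circle_algebra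
    using s by (intro uniform_limit_theorem[OF _ l]) (simp_all add: circle_algebra_simps(1))
  have "(\<lambda>n. cnorm circle_algebra (s n \<ominus>\<^bsub>circle_algebra\<^esub> restrict l circle)) \<longlonglongrightarrow> 0"
    unfolding LIMSEQ_iff
  proof (intro allI impI)
    fix e :: real assume e: "e > 0"
    have "\<forall>\<^sub>F n in sequentially. \<forall>x\<in>circle. dist (s n x) (l x) < e / 2"
      using e by (intro uniform_limitD[OF l]) simp
    then obtain K where K: "\<And>n x. \<lbrakk>n \<ge> K; x \<in> circle\<rbrakk> \<Longrightarrow> dist (s n x) (l x) < e / 2"
      unfolding eventually_sequentially by blast
    have "cnorm circle_algebra (s n \<ominus>\<^bsub>circle_algebra\<^esub> restrict l circle) \<le> e / 2" if "n \<ge> K" for n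
      using K[OF that] s lc
      by (subst circle_norm_le_iff) (auto simp: circle_minus dist_norm intro: less_imp_le)
    then show "\<exists>no. \<forall>n\<ge>no. norm (cnorm circle_algebra (s n \<ominus>\<^bsub>circle_algebra\<^esub> restrict l circle) - 0) < e"
      using e s lc circle_norm_nonneg by (intro exI[of _ K]) fastforce
  qed
  then show "\<exists>x\<in>carrier circle_algebra. (\<lambda>n. cnorm circle_algebra (s n \<ominus>\<^bsub>circle_algebra\<^esub> x)) \<longlonglongrightarrow> 0"
    using lc by blast
qed

interpretation circle: calg circle_algebra
  by (rule calg_circle)

lemma circle_u_closed [simp]: "circle_u \<in> carrier circle_algebra"
  unfolding circle_u_def restrict_in_circle_algebra by (rule continuous_on_id)

lemma circle_u_unitary:
  "star circle_algebra circle_u \<otimes>\<^bsub>circle_algebra\<^esub> circle_u = \<one>\<^bsub>circle_algebra\<^esub>"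
  "circle_u \<otimes>\<^bsub>circle_algebra\<^esub> star circle_algebra circle_u = \<one>\<^bsub>circle_algebra\<^esub>"
  by (auto simp: circle_u_def circle_algebra_simps fun_eq_iff restrict_def complex_norm_square[symmetric]
      mult.commute[of "cnj _"])

lemma circle_reflect_star_hom:
  "(\<lambda>f. \<lambda>x\<in>circle. f (inverse x)) \<in> star_hom circle_algebra circle_algebra"
proof (rule star_homI)
  show "(\<lambda>x\<in>circle. f (inverse x)) \<in> carrier circle_algebra" if "f \<in> carrier circle_algebra" for f
    unfolding restrict_in_circle_algebra
  proof (rule continuous_on_compose2[of circle f])
    show "continuous_on circle (inverse :: complex \<Rightarrow> complex)"
      by (intro continuous_on_inverse continuous_on_id) auto
  qed (use that in \<open>auto simp: circle_algebra_simps norm_inverse\<close>)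
qed (auto simp: circle_algebra_simps norm_inverse intro!: extensional_circle_eqI)

text \<open>The character at the point 1, followed by the scalars of \<open>B\<close>: its values
  commute with everything in \<open>B\<close>.\<close>

lemma circle_eval_star_hom:
  assumes "star_alg B"
  shows "(\<lambda>f. f 1 \<odot>\<^bsub>B\<^esub> \<one>\<^bsub>B\<^esub>) \<in> star_hom circle_algebra B"
proof -
  interpret B: star_alg B by fact
  show ?thesis
    by (rule star_homI) (auto simp: circle_algebra_simps B.add_smult mult.commute)
qed

subsection \<open>Copies along injections\<close>

locale copied = calg A for A :: "'a cstar" (structure) +
  fixes j :: "'a \<Rightarrow> 'b"
  assumes inj_j: "inj j"
begin

lemma copy_simps [simp]:
  "carrier (copy_along j A) = j ` carrier A"
  "j x \<otimes>\<^bsub>copy_along j A\<^esub> j y = j (x \<otimes>\<^bsub>A\<^esub> y)" "\<one>\<^bsub>copy_along j A\<^esub> = j \<one>\<^bsub>A\<^esub>" "\<zero>\<^bsub>copy_along j A\<^esub> = j \<zero>\<^bsub>A\<^esub>"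
  "j x \<oplus>\<^bsub>copy_along j A\<^esub> j y = j (x \<oplus>\<^bsub>A\<^esub> y)" "c \<odot>\<^bsub>copy_along j A\<^esub> j x = j (c \<odot>\<^bsub>A\<^esub> x)"
  "star (copy_along j A) (j x) = j (star A x)" "cnorm (copy_along j A) (j x) = cnorm A x"
  by (simp_all add: copy_along_def inv_f_f[OF inj_j])

lemma star_alg_copy: "star_alg (copy_along j A)"
proof (rule star_alg.intro)
  show "ring (copy_along j A)"
  proof (intro ringI abelian_groupI monoidI)
    show "\<exists>y\<in>carrier (copy_along j A). y \<oplus>\<^bsub>copy_along j A\<^esub> x = \<zero>\<^bsub>copy_along j A\<^esub>"
      if "x \<in> carrier (copy_along j A)" for x
    proof -
      obtain t where "t \<in> carrier A" "x = j t"
        using \<open>x \<in> carrier (copy_along j A)\<close> by auto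
      then show ?thesis
        by (intro bexI[of _ "j (\<ominus> t)"]) (simp_all add: l_neg)
    qed
  qed (auto simp: ring_simprules)
  show "star_alg_axioms (copy_along j A)"
    by unfold_locales (auto simp: smult_add add_smult)
qed

lemma copy_star_hom: "j \<in> star_hom A (copy_along j A)"
  by (rule star_homI) auto

lemma uncopy_star_hom: "inv_into UNIV j \<in> star_hom (copy_along j A) A"
  by (rule star_homI) (auto simp: inv_f_f[OF inj_j])

lemma copy_minus [simp]:
  "\<lbrakk>x \<in> carrier A; y \<in> carrier A\<rbrakk> \<Longrightarrow> j x \<ominus>\<^bsub>copy_along j A\<^esub> j y = j (x \<ominus> y)"
  using star_hom_minus[OF star_alg_axioms star_alg_copy copy_star_hom] by simp

lemma calg_copy: "calg (copy_along j A)"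
proof -
  interpret C: star_alg "copy_along j A" by (rule star_alg_copy)
  show ?thesis
  proof unfold_locales
    show "cstar_seminorm (copy_along j A) (cnorm (copy_along j A))"
      by (auto simp: cstar_seminorm_def p_triangle p_mult p_star_mult)
    show "x = \<zero>\<^bsub>copy_along j A\<^esub>" if "x \<in> carrier (copy_along j A)" "cnorm (copy_along j A) x = 0" for x
      using that definite by auto
    fix s assume s: "\<And>n :: nat. s n \<in> carrier (copy_along j A)"
      and cau: "\<And>e. e > 0 \<Longrightarrow> \<exists>K. \<forall>m\<ge>K. \<forall>n\<ge>K. cnorm (copy_along j A) (s m \<ominus>\<^bsub>copy_along j A\<^esub> s n) < e"
    have "\<forall>n. \<exists>t\<in>carrier A. s n = j t"
      using s by auto
    then obtain t where t: "\<And>n. t n \<in> carrier A" "\<And>n. s n = j (t n)"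
      by metis
    have "\<exists>x\<in>carrier A. (\<lambda>n. cnorm A (t n \<ominus> x)) \<longlonglongrightarrow> 0"
      by (rule complete[OF t(1)]) (use cau t in simp)
    then obtain x where "x \<in> carrier A" "(\<lambda>n. cnorm A (t n \<ominus> x)) \<longlonglongrightarrow> 0"
      by blast
    then show "\<exists>x\<in>carrier (copy_along j A). (\<lambda>n. cnorm (copy_along j A) (s n \<ominus>\<^bsub>copy_along j A\<^esub> x)) \<longlonglongrightarrow> 0"
      using t by (intro bexI[of _ "j x"]) auto
  qed
qed

end

interpretation Toep: copied toeplitz "Inl :: toep \<Rightarrow> factor"
  by unfold_locales simp

interpretation Circ: copied circle_algebra "Inr :: (complex \<Rightarrow> complex) \<Rightarrow> factor"
  by unfold_locales simp

lemma calg_Toep: "calg Toep" and calg_Circ: "calg Circ"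
  unfolding Toep_def Circ_def by (rule Toep.calg_copy, rule Circ.calg_copy)

section \<open>Completed tensor products\<close>

lemma prod_carrier_iff:
  "as \<in> carrier (prod_monoid As) \<longleftrightarrow> length as = length As \<and> (\<forall>i<length As. as ! i \<in> carrier (As ! i))"
  by (auto simp: prod_monoid_def list_all2_conv_all_nth)

lemma prod_monoid_simps:
  "as \<otimes>\<^bsub>prod_monoid As\<^esub> bs = map (\<lambda>i. as ! i \<otimes>\<^bsub>As ! i\<^esub> bs ! i) [0..<length As]"
  "\<one>\<^bsub>prod_monoid As\<^esub> = map (\<lambda>A. \<one>\<^bsub>A\<^esub>) As"
  "invol (prod_monoid As) as = map (\<lambda>i. star (As ! i) (as ! i)) [0..<length As]"
  by (simp_all add: prod_monoid_def)

lemma (in star_mon) alg_minus: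
  "\<lbrakk>f \<in> carrier alg; g \<in> carrier alg\<rbrakk> \<Longrightarrow> f \<ominus>\<^bsub>alg\<^esub> g = (\<lambda>m. f m - g m)"
  by (simp add: alg.minus_smult_eq alg_simps)

locale calg_list =
  fixes As :: "'a cstar list"
  assumes calgs: "A \<in> set As \<Longrightarrow> calg A"
begin

abbreviation "PM \<equiv> prod_monoid As"
abbreviation "PA \<equiv> monoid_algebra (prod_monoid As)"

lemma calg_nth: "i < length As \<Longrightarrow> calg (As ! i)"
  by (simp add: calgs)

lemma nth_star_alg: "i < length As \<Longrightarrow> star_alg (As ! i)"
  using calg_nth calg_def by blast

text \<open>The factor algebra varies with the index \<open>i\<close>, so its laws are collected
  here as rewrite rules instead of being interpreted anew for each \<open>i\<close>.\<close>

lemma nth_facts: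
  assumes "i < length As"
  shows "\<one>\<^bsub>As ! i\<^esub> \<in> carrier (As ! i)"
    and "x \<in> carrier (As ! i) \<Longrightarrow> star (As ! i) x \<in> carrier (As ! i)"
    and "x \<in> carrier (As ! i) \<Longrightarrow> star (As ! i) (star (As ! i) x) = x"
    and "x \<in> carrier (As ! i) \<Longrightarrow> c \<odot>\<^bsub>As ! i\<^esub> x \<in> carrier (As ! i)"
    and "x \<in> carrier (As ! i) \<Longrightarrow> \<one>\<^bsub>As ! i\<^esub> \<otimes>\<^bsub>As ! i\<^esub> x = x"
    and "x \<in> carrier (As ! i) \<Longrightarrow> x \<otimes>\<^bsub>As ! i\<^esub> \<one>\<^bsub>As ! i\<^esub> = x"
    and "star (As ! i) \<one>\<^bsub>As ! i\<^esub> = \<one>\<^bsub>As ! i\<^esub>"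
    and "\<lbrakk>x \<in> carrier (As ! i); y \<in> carrier (As ! i)\<rbrakk> \<Longrightarrow> x \<oplus>\<^bsub>As ! i\<^esub> y \<in> carrier (As ! i)"
    and "\<lbrakk>x \<in> carrier (As ! i); y \<in> carrier (As ! i)\<rbrakk> \<Longrightarrow> x \<otimes>\<^bsub>As ! i\<^esub> y \<in> carrier (As ! i)"
    and "\<lbrakk>x \<in> carrier (As ! i); y \<in> carrier (As ! i)\<rbrakk>
      \<Longrightarrow> star (As ! i) (x \<otimes>\<^bsub>As ! i\<^esub> y) = star (As ! i) y \<otimes>\<^bsub>As ! i\<^esub> star (As ! i) x"
    and "\<lbrakk>x \<in> carrier (As ! i); y \<in> carrier (As ! i); z \<in> carrier (As ! i)\<rbrakk>
      \<Longrightarrow> x \<otimes>\<^bsub>As ! i\<^esub> y \<otimes>\<^bsub>As ! i\<^esub> z = x \<otimes>\<^bsub>As ! i\<^esub> (y \<otimes>\<^bsub>As ! i\<^esub> z)"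
proof -
  interpret star_alg "As ! i"
    using assms by (rule nth_star_alg)
  show "\<lbrakk>x \<in> carrier (As ! i); y \<in> carrier (As ! i); z \<in> carrier (As ! i)\<rbrakk>
      \<Longrightarrow> x \<otimes>\<^bsub>As ! i\<^esub> y \<otimes>\<^bsub>As ! i\<^esub> z = x \<otimes>\<^bsub>As ! i\<^esub> (y \<otimes>\<^bsub>As ! i\<^esub> z)"
    by (rule m_assoc)
qed (use star_alg.axioms nth_star_alg[OF assms] in \<open>auto intro: star_alg.star_closed star_alg.star_star
    star_alg.smult_closed star_alg.star_mult star_alg.star_one ring.ring_simprules
    monoid.r_one[OF ring.is_monoid]\<close>)

lemma star_mon_prod: "star_mon PM"
proof unfold_locales
  show "\<lbrakk>x \<in> carrier PM; y \<in> carrier PM\<rbrakk> \<Longrightarrow> x \<otimes>\<^bsub>PM\<^esub> y \<in> carrier PM" for x y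
    by (simp add: prod_carrier_iff prod_monoid_simps nth_facts)
  show "\<lbrakk>x \<in> carrier PM; y \<in> carrier PM; z \<in> carrier PM\<rbrakk>
      \<Longrightarrow> x \<otimes>\<^bsub>PM\<^esub> y \<otimes>\<^bsub>PM\<^esub> z = x \<otimes>\<^bsub>PM\<^esub> (y \<otimes>\<^bsub>PM\<^esub> z)" for x y z
    by (simp add: prod_carrier_iff prod_monoid_simps nth_facts)
  show "\<one>\<^bsub>PM\<^esub> \<in> carrier PM"
    by (simp add: prod_carrier_iff prod_monoid_simps nth_facts)
  show "x \<in> carrier PM \<Longrightarrow> \<one>\<^bsub>PM\<^esub> \<otimes>\<^bsub>PM\<^esub> x = x" "x \<in> carrier PM \<Longrightarrow> x \<otimes>\<^bsub>PM\<^esub> \<one>\<^bsub>PM\<^esub> = x"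
    "x \<in> carrier PM \<Longrightarrow> invol PM (invol PM x) = x" for x
    by (rule nth_equalityI; simp add: prod_carrier_iff prod_monoid_simps nth_facts)+
  show "x \<in> carrier PM \<Longrightarrow> invol PM x \<in> carrier PM" for x
    by (simp add: prod_carrier_iff prod_monoid_simps nth_facts)
  show "\<lbrakk>x \<in> carrier PM; y \<in> carrier PM\<rbrakk> \<Longrightarrow> invol PM (x \<otimes>\<^bsub>PM\<^esub> y) = invol PM y \<otimes>\<^bsub>PM\<^esub> invol PM x" for x y
    by (simp add: prod_carrier_iff prod_monoid_simps nth_facts)
qed

sublocale M: star_mon PM
  by (rule star_mon_prod)

lemma update_closed:
  "\<lbrakk>as \<in> carrier PM; i < length As; x \<in> carrier (As ! i)\<rbrakk> \<Longrightarrow> as[i := x] \<in> carrier PM"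
  by (auto simp: prod_carrier_iff nth_list_update)

lemma length_carrier: "as \<in> carrier PM \<Longrightarrow> length as = length As"
  by (simp add: prod_carrier_iff)

text \<open>The relators are defined pointwise; in algebraic form a homomorphism can be applied to
  them.\<close>

lemma relator_add_eq:
  assumes "as \<in> carrier PM" "i < length As" "x \<in> carrier (As ! i)" "y \<in> carrier (As ! i)"
  shows "(\<lambda>m. delta (as[i := x \<oplus>\<^bsub>As ! i\<^esub> y]) m - delta (as[i := x]) m - delta (as[i := y]) m)
    = delta (as[i := x \<oplus>\<^bsub>As ! i\<^esub> y]) \<ominus>\<^bsub>PA\<^esub> (delta (as[i := x]) \<oplus>\<^bsub>PA\<^esub> delta (as[i := y]))"
proof -
  have "delta (as[i := x]) \<oplus>\<^bsub>PA\<^esub> delta (as[i := y]) \<in> carrier PA"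
    using assms by (simp add: update_closed)
  from M.alg_minus[OF _ this, of "delta (as[i := x \<oplus>\<^bsub>As ! i\<^esub> y])"] show ?thesis
    using assms by (simp add: update_closed nth_facts) (simp add: M.alg_simps algebra_simps)
qed

lemma relator_smult_eq:
  assumes "as \<in> carrier PM" "i < length As" "x \<in> carrier (As ! i)"
  shows "(\<lambda>m. delta (as[i := c \<odot>\<^bsub>As ! i\<^esub> x]) m - c * delta (as[i := x]) m)
    = delta (as[i := c \<odot>\<^bsub>As ! i\<^esub> x]) \<ominus>\<^bsub>PA\<^esub> c \<odot>\<^bsub>PA\<^esub> delta (as[i := x])"
proof -
  have "c \<odot>\<^bsub>PA\<^esub> delta (as[i := x]) \<in> carrier PA"
    using assms by (simp add: update_closed)
  from M.alg_minus[OF _ this, of "delta (as[i := c \<odot>\<^bsub>As ! i\<^esub> x])"] show ?thesis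
    using assms by (simp add: update_closed nth_facts) (simp add: M.alg_simps)
qed

lemma relator_add:
  assumes "as \<in> carrier PM" "i < length As" "x \<in> carrier (As ! i)" "y \<in> carrier (As ! i)"
  shows "delta (as[i := x \<oplus>\<^bsub>As ! i\<^esub> y]) \<ominus>\<^bsub>PA\<^esub> (delta (as[i := x]) \<oplus>\<^bsub>PA\<^esub> delta (as[i := y]))
    \<in> multilinear_relators As"
  unfolding relator_add_eq[OF assms, symmetric] multilinear_relators_def using assms by blast

lemma relator_smult:
  assumes "as \<in> carrier PM" "i < length As" "x \<in> carrier (As ! i)"
  shows "delta (as[i := c \<odot>\<^bsub>As ! i\<^esub> x]) \<ominus>\<^bsub>PA\<^esub> c \<odot>\<^bsub>PA\<^esub> delta (as[i := x]) \<in> multilinear_relators As"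
  unfolding relator_smult_eq[OF assms, symmetric] multilinear_relators_def using assms by blast

lemma relator_cases:
  assumes "r \<in> multilinear_relators As"
  obtains (add) as i x y where "as \<in> carrier PM" "i < length As" "x \<in> carrier (As ! i)" "y \<in> carrier (As ! i)"
      "r = delta (as[i := x \<oplus>\<^bsub>As ! i\<^esub> y]) \<ominus>\<^bsub>PA\<^esub> (delta (as[i := x]) \<oplus>\<^bsub>PA\<^esub> delta (as[i := y]))"
  | (smult) as i c x where "as \<in> carrier PM" "i < length As" "x \<in> carrier (As ! i)"
      "r = delta (as[i := c \<odot>\<^bsub>As ! i\<^esub> x]) \<ominus>\<^bsub>PA\<^esub> c \<odot>\<^bsub>PA\<^esub> delta (as[i := x])"
proof -
  from assms consider
    as i x y where "as \<in> carrier PM" "i < length As" "x \<in> carrier (As ! i)" "y \<in> carrier (As ! i)"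
      "r = (\<lambda>m. delta (as[i := x \<oplus>\<^bsub>As ! i\<^esub> y]) m - delta (as[i := x]) m - delta (as[i := y]) m)"
  | as i c x where "as \<in> carrier PM" "i < length As" "x \<in> carrier (As ! i)"
      "r = (\<lambda>m. delta (as[i := c \<odot>\<^bsub>As ! i\<^esub> x]) m - c * delta (as[i := x]) m)"
    unfolding multilinear_relators_def by blast
  then show thesis
    by cases (rule add, simp_all only: relator_add_eq, rule smult, simp_all only: relator_smult_eq)
qed

text \<open>A C*-seminorm respecting multilinearity restricts to a C*-seminorm on each tensor factor,
  hence is dominated by the norms of the factors.\<close>

lemma seminorm_slot_le:
  assumes p: "cstar_seminorm PA p" "\<forall>r\<in>multilinear_relators As. p r = 0"
    and i: "i < length As" and x: "x \<in> carrier (As ! i)"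
  shows "p (delta (\<one>\<^bsub>PM\<^esub>[i := x])) \<le> 2 * cnorm (As ! i) x"
proof -
  interpret p: cstar_semi PA p
    using p by unfold_locales
  interpret A: calg "As ! i"
    using i by (rule calg_nth)
  let ?s = "\<lambda>x. \<one>\<^bsub>PM\<^esub>[i := x]"
  have sc: "?s x \<in> carrier PM" if "x \<in> carrier (As ! i)" for x
    using that i by (simp add: update_closed)
  have smult: "?s x \<otimes>\<^bsub>PM\<^esub> ?s y = ?s (x \<otimes>\<^bsub>As ! i\<^esub> y)" if "x \<in> carrier (As ! i)" "y \<in> carrier (As ! i)" for x y
    using that i by (intro nth_equalityI) (auto simp: prod_monoid_simps nth_list_update nth_facts)
  have sstar: "invol PM (?s x) = ?s (star (As ! i) x)" if "x \<in> carrier (As ! i)" for x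
    using that i by (intro nth_equalityI) (auto simp: prod_monoid_simps nth_list_update nth_facts)
  \<comment> \<open>Relators have seminorm zero, so the two sides of a multilinearity relation get
    the same seminorm.\<close>
  have eq: "p f = p g" if "p (f \<ominus>\<^bsub>PA\<^esub> g) = 0" "f \<in> carrier PA" "g \<in> carrier PA" for f g
    using p.p_abs_diff[OF that(2,3)] that(1) by simp
  have "cstar_seminorm (As ! i) (\<lambda>x. p (delta (?s x)))"
    unfolding cstar_seminorm_def
  proof (intro conjI ballI allI)
    fix x assume x: "x \<in> carrier (As ! i)"
    show "0 \<le> p (delta (?s x))"
      using sc[OF x] by simp
    show "p (delta (?s (star (As ! i) x \<otimes>\<^bsub>As ! i\<^esub> x))) = (p (delta (?s x)))\<^sup>2"
      using p.p_star_mult[of "delta (?s x)"] x sc[OF x] by (simp add: sstar smult M.delta_mult)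
    show "p (delta (?s (c \<odot>\<^bsub>As ! i\<^esub> x))) = cmod c * p (delta (?s x))" for c
    proof -
      have "p (delta (?s (c \<odot>\<^bsub>As ! i\<^esub> x))) = p (c \<odot>\<^bsub>PA\<^esub> delta (?s x))"
        using p(2) relator_smult[OF M.one_closed i x] sc x by (intro eq) auto
      then show ?thesis
        using sc[OF x] by simp
    qed
    fix y assume y: "y \<in> carrier (As ! i)"
    show "p (delta (?s (x \<otimes>\<^bsub>As ! i\<^esub> y))) \<le> p (delta (?s x)) * p (delta (?s y))"
      using p.p_mult[of "delta (?s x)" "delta (?s y)"] sc x y by (simp add: smult M.delta_mult)
    have "p (delta (?s (x \<oplus>\<^bsub>As ! i\<^esub> y))) = p (delta (?s x) \<oplus>\<^bsub>PA\<^esub> delta (?s y))"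
      using p(2) relator_add[OF M.one_closed i x y] sc x y by (intro eq) auto
    then show "p (delta (?s (x \<oplus>\<^bsub>As ! i\<^esub> y))) \<le> p (delta (?s x)) + p (delta (?s y))"
      using p.p_triangle[of "delta (?s x)" "delta (?s y)"] sc x y by simp
  qed
  then show ?thesis
    using x by (rule A.seminorm_bounded)
qed

text \<open>A tuple is the product of the tuples that carry one of its entries and units elsewhere,
  and each of these is bounded by \<open>seminorm_slot_le\<close>.\<close>

lemma seminorm_delta_le:
  assumes p: "cstar_seminorm PA p" "\<forall>r\<in>multilinear_relators As. p r = 0"
    and as: "as \<in> carrier PM"
  shows "p (delta as) \<le> (\<Prod>i<length As. 2 * cnorm (As ! i) (as ! i))"
proof -
  interpret p: cstar_semi PA p
    using p by unfold_locales
  \<comment> \<open>The product of the first \<open>k\<close> of these one-slot tuples.\<close>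
  let ?b = "\<lambda>k. take k as @ drop k \<one>\<^bsub>PM\<^esub>"
  note len = length_carrier[OF as] length_carrier[OF M.one_closed]
  have nth_b: "?b k ! i = (if i < k then as ! i else \<one>\<^bsub>As ! i\<^esub>)" if "k \<le> length As" "i < length As" for k i
    using that len by (auto simp: nth_append prod_monoid_simps)
  have bc: "?b k \<in> carrier PM" if "k \<le> length As" for k
    using that as len nth_b[OF that] by (auto simp: prod_carrier_iff nth_facts)
  have "p (delta (?b k)) \<le> (\<Prod>i<k. 2 * cnorm (As ! i) (as ! i))" if "k \<le> length As" for k
    using that
  proof (induction k)
    case 0
    then show ?case
      using p.p_one_le by (simp add: M.alg_simps)
  next
    case (Suc k)
    have ak: "as ! k \<in> carrier (As ! k)" "k < length As"
      using as Suc by (auto simp: prod_carrier_iff)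
    interpret A: calg "As ! k"
      using ak by (intro calg_nth)
    let ?s = "\<one>\<^bsub>PM\<^esub>[k := as ! k]"
    have sc: "?s \<in> carrier PM"
      using ak by (simp add: update_closed)
    have bk: "?b (Suc k) = ?b k \<otimes>\<^bsub>PM\<^esub> ?s"
    proof (rule nth_equalityI)
      fix i assume "i < length (?b (Suc k))"
      then have i: "i < length As"
        using len Suc by simp
      have "as ! i \<in> carrier (As ! i)"
        using as i by (simp add: prod_carrier_iff)
      then show "?b (Suc k) ! i = (?b k \<otimes>\<^bsub>PM\<^esub> ?s) ! i"
        using i nth_b[of "Suc k" i] nth_b[of k i] Suc len
        by (auto simp: prod_monoid_simps nth_list_update nth_facts less_Suc_eq)
    qed (use len Suc in \<open>simp add: prod_monoid_simps\<close>)
    have "p (delta (?b (Suc k))) \<le> p (delta (?b k)) * p (delta ?s)"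
      using p.p_mult[of "delta (?b k)" "delta ?s"] bc[of k] sc Suc by (simp add: M.delta_mult bk)
    also have "\<dots> \<le> (\<Prod>i<k. 2 * cnorm (As ! i) (as ! i)) * (2 * cnorm (As ! k) (as ! k))"
    proof (rule mult_mono)
      show "p (delta ?s) \<le> 2 * cnorm (As ! k) (as ! k)"
        using ak by (intro seminorm_slot_le p)
      show "p (delta (?b k)) \<le> (\<Prod>i<k. 2 * cnorm (As ! i) (as ! i))"
        using Suc by simp
      then show "0 \<le> (\<Prod>i<k. 2 * cnorm (As ! i) (as ! i))"
        using bc[of k] Suc by (meson M.delta_closed Suc_leD order_trans p.p_nonneg)
    qed (use sc in simp)
    finally show ?case by simp
  qed
  from this[of "length As"] show ?thesis
    using len by simp
qed

lemma cstar_rel_prod: "cstar_rel PA (multilinear_relators As)"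
proof (rule M.cstar_relI)
  show "multilinear_relators As \<subseteq> carrier PA"
    by (auto elim!: relator_cases simp: update_closed nth_facts)
  show "\<exists>C. \<forall>p. cstar_seminorm PA p \<and> (\<forall>r\<in>multilinear_relators As. p r = 0) \<longrightarrow> p (delta as) \<le> C"
    if "as \<in> carrier PM" for as
    using seminorm_delta_le that by blast
qed

sublocale R: cstar_rel PA "multilinear_relators As"
  by (rule cstar_rel_prod)

lemma calg_tensor: "calg (tensor As)"
  unfolding tensor_def by (rule R.calg_env)

lemmas env_hom = R.env_of_star_hom[folded tensor_def]

lemma elem_closed [simp]: "as \<in> carrier PM \<Longrightarrow> elem_tensor As as \<in> carrier (tensor As)"
  by (simp add: elem_tensor_def star_hom_closed[OF env_hom])

lemma elem_mult:
  "\<lbrakk>as \<in> carrier PM; bs \<in> carrier PM\<rbrakk>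
    \<Longrightarrow> elem_tensor As as \<otimes>\<^bsub>tensor As\<^esub> elem_tensor As bs = elem_tensor As (as \<otimes>\<^bsub>PM\<^esub> bs)"
  by (simp add: elem_tensor_def M.delta_mult flip: star_hom_mult[OF env_hom])

lemma elem_one: "elem_tensor As \<one>\<^bsub>PM\<^esub> = \<one>\<^bsub>tensor As\<^esub>"
  using star_hom_one[OF env_hom] by (simp add: elem_tensor_def M.alg_simps)

lemma elem_star:
  "as \<in> carrier PM \<Longrightarrow> star (tensor As) (elem_tensor As as) = elem_tensor As (invol PM as)"
  by (simp add: elem_tensor_def flip: star_hom_star[OF env_hom])

lemma elem_add:
  assumes "as \<in> carrier PM" "i < length As" "x \<in> carrier (As ! i)" "y \<in> carrier (As ! i)"
  shows "elem_tensor As (as[i := x \<oplus>\<^bsub>As ! i\<^esub> y])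
    = elem_tensor As (as[i := x]) \<oplus>\<^bsub>tensor As\<^esub> elem_tensor As (as[i := y])"
proof -
  interpret T: calg "tensor As" by (rule calg_tensor)
  let ?e = "env_of PA (multilinear_relators As)"
  have c: "as[i := x] \<in> carrier PM" "as[i := y] \<in> carrier PM" "as[i := x \<oplus>\<^bsub>As ! i\<^esub> y] \<in> carrier PM"
    using assms by (auto simp: update_closed nth_facts)
  have "?e (delta (as[i := x \<oplus>\<^bsub>As ! i\<^esub> y]))
      \<ominus>\<^bsub>tensor As\<^esub> ?e (delta (as[i := x]) \<oplus>\<^bsub>PA\<^esub> delta (as[i := y])) = \<zero>\<^bsub>tensor As\<^esub>"
    using R.env_of_relator[OF relator_add[OF assms], folded tensor_def] c
      star_hom_minus[OF M.alg.star_alg_axioms T.star_alg_axioms env_hom] by simp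
  then have "?e (delta (as[i := x \<oplus>\<^bsub>As ! i\<^esub> y])) = ?e (delta (as[i := x]) \<oplus>\<^bsub>PA\<^esub> delta (as[i := y]))"
    by (rule T.minus_eq_zeroD[rotated 2]) (use c in \<open>auto simp: star_homD[OF env_hom]\<close>)
  then show ?thesis
    using c by (simp add: elem_tensor_def star_homD[OF env_hom])
qed

lemma elem_smult:
  assumes "as \<in> carrier PM" "i < length As" "x \<in> carrier (As ! i)"
  shows "elem_tensor As (as[i := c \<odot>\<^bsub>As ! i\<^esub> x]) = c \<odot>\<^bsub>tensor As\<^esub> elem_tensor As (as[i := x])"
proof -
  interpret T: calg "tensor As" by (rule calg_tensor)
  let ?e = "env_of PA (multilinear_relators As)"
  have c: "as[i := x] \<in> carrier PM" "as[i := c \<odot>\<^bsub>As ! i\<^esub> x] \<in> carrier PM"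
    using assms by (auto simp: update_closed nth_facts)
  have "?e (delta (as[i := c \<odot>\<^bsub>As ! i\<^esub> x])) \<ominus>\<^bsub>tensor As\<^esub> ?e (c \<odot>\<^bsub>PA\<^esub> delta (as[i := x])) = \<zero>\<^bsub>tensor As\<^esub>"
    using R.env_of_relator[OF relator_smult[OF assms, of c], folded tensor_def] c
      star_hom_minus[OF M.alg.star_alg_axioms T.star_alg_axioms env_hom] by simp
  then have "?e (delta (as[i := c \<odot>\<^bsub>As ! i\<^esub> x])) = ?e (c \<odot>\<^bsub>PA\<^esub> delta (as[i := x]))"
    by (rule T.minus_eq_zeroD[rotated 2]) (use c in \<open>auto simp: star_homD[OF env_hom]\<close>)
  then show ?thesis
    using c by (simp add: elem_tensor_def star_homD[OF env_hom])
qed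

lemma generates_tensor: "generates (tensor As) (elem_tensor As ` carrier PM)"
  using M.generates_env_delta[OF cstar_rel_prod] by (simp add: tensor_def elem_tensor_def)

lemma tensor_universal:
  fixes B :: "'c cstar"
  assumes "calg B" and \<mu>: "\<And>as. as \<in> carrier PM \<Longrightarrow> \<mu> as \<in> carrier B"
    "\<And>as bs. \<lbrakk>as \<in> carrier PM; bs \<in> carrier PM\<rbrakk> \<Longrightarrow> \<mu> (as \<otimes>\<^bsub>PM\<^esub> bs) = \<mu> as \<otimes>\<^bsub>B\<^esub> \<mu> bs"
    "\<mu> \<one>\<^bsub>PM\<^esub> = \<one>\<^bsub>B\<^esub>" "\<And>as. as \<in> carrier PM \<Longrightarrow> \<mu> (invol PM as) = star B (\<mu> as)"
    and add: "\<And>as i x y. \<lbrakk>as \<in> carrier PM; i < length As; x \<in> carrier (As ! i); y \<in> carrier (As ! i)\<rbrakk>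
      \<Longrightarrow> \<mu> (as[i := x \<oplus>\<^bsub>As ! i\<^esub> y]) = \<mu> (as[i := x]) \<oplus>\<^bsub>B\<^esub> \<mu> (as[i := y])"
    and smult: "\<And>as i c x. \<lbrakk>as \<in> carrier PM; i < length As; x \<in> carrier (As ! i)\<rbrakk>
      \<Longrightarrow> \<mu> (as[i := c \<odot>\<^bsub>As ! i\<^esub> x]) = c \<odot>\<^bsub>B\<^esub> \<mu> (as[i := x])"
  obtains h where "h \<in> star_hom (tensor As) B" "h \<in> extensional (carrier (tensor As))"
    "\<And>as. as \<in> carrier PM \<Longrightarrow> h (elem_tensor As as) = \<mu> as"
proof -
  interpret B: calg B by fact
  let ?f = "M.lift B \<mu>"
  have f: "?f \<in> star_hom PA B" "\<And>as. as \<in> carrier PM \<Longrightarrow> ?f (delta as) = \<mu> as"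
    using M.lift_star_hom[OF B.star_alg_axioms, of \<mu>] \<mu> by auto
  have f_minus: "?f (a \<ominus>\<^bsub>PA\<^esub> b) = ?f a \<ominus>\<^bsub>B\<^esub> ?f b" if "a \<in> carrier PA" "b \<in> carrier PA" for a b
    by (rule star_hom_minus[OF M.alg.star_alg_axioms B.star_alg_axioms f(1) that])
  have "?f r = \<zero>\<^bsub>B\<^esub>" if "r \<in> multilinear_relators As" for r
    using that
  proof (cases rule: relator_cases)
    case (add as i x y)
    then show ?thesis
      using assms(6)[OF add(1-4)] \<mu>(1)
      by (simp add: f_minus update_closed nth_facts star_homD[OF f(1)] f(2))
  next
    case (smult as i c x)
    then show ?thesis
      using assms(7)[OF smult(1-3)] \<mu>(1)
      by (simp add: f_minus update_closed nth_facts star_homD[OF f(1)] f(2))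
  qed
  from R.env_extend[OF assms(1) f(1) this] obtain h where
    "h \<in> star_hom (cstar_env PA (multilinear_relators As)) B"
    "h \<in> extensional (carrier (cstar_env PA (multilinear_relators As)))"
    "\<And>x. x \<in> carrier PA \<Longrightarrow> h (env_of PA (multilinear_relators As) x) = ?f x"
    by blast
  then show thesis
    using that by (simp add: tensor_def elem_tensor_def f(2))
qed

lemma tensor_hom_eqI:
  assumes "calg B" "f \<in> star_hom (tensor As) B" "g \<in> star_hom (tensor As) B"
    and "\<And>as. as \<in> carrier PM \<Longrightarrow> f (elem_tensor As as) = g (elem_tensor As as)" "x \<in> carrier (tensor As)"
  shows "f x = g x"
  by (rule star_hom_eqI[OF calg_tensor assms(1-3) generates_tensor _ assms(5)]) (use assms(4) in auto)

end

text \<open>Agreement on the carrier is what generation arguments give; extensionality upgrades it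
  to the equality of functions that the definite description needs.\<close>

lemma the_hom_eqI:
  assumes "h \<in> star_hom (tensor As) (tensor Bs)" "h \<in> extensional (carrier (tensor As))" "Q h"
    and "\<And>h' x. \<lbrakk>h' \<in> star_hom (tensor As) (tensor Bs); Q h'; x \<in> carrier (tensor As)\<rbrakk> \<Longrightarrow> h' x = h x"
  shows "the_hom As Bs Q = h"
  unfolding the_hom_def
  by (rule the_equality) (use assms in \<open>auto intro: extensionalityI\<close>)

lemma prod_append_mult:
  assumes "length as = length As" "length bs = length As"
  shows "(as @ as') \<otimes>\<^bsub>prod_monoid (As @ Bs)\<^esub> (bs @ bs') = (as \<otimes>\<^bsub>prod_monoid As\<^esub> bs) @ (as' \<otimes>\<^bsub>prod_monoid Bs\<^esub> bs')"
  by (rule nth_equalityI) (use assms in \<open>auto simp: prod_monoid_simps nth_append\<close>)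

lemma prod_append_one: "\<one>\<^bsub>prod_monoid (As @ Bs)\<^esub> = \<one>\<^bsub>prod_monoid As\<^esub> @ \<one>\<^bsub>prod_monoid Bs\<^esub>"
  by (simp add: prod_monoid_simps)

lemma prod_append_invol:
  assumes "length as = length As"
  shows "invol (prod_monoid (As @ Bs)) (as @ as') = invol (prod_monoid As) as @ invol (prod_monoid Bs) as'"
  by (rule nth_equalityI) (use assms in \<open>auto simp: prod_monoid_simps nth_append\<close>)

lemma prod_append_carrier:
  "\<lbrakk>as \<in> carrier (prod_monoid As); bs \<in> carrier (prod_monoid Bs)\<rbrakk> \<Longrightarrow> as @ bs \<in> carrier (prod_monoid (As @ Bs))"
  by (auto simp: prod_monoid_def list_all2_appendI)

lemma prod_append_cases:
  assumes "cs \<in> carrier (prod_monoid (As @ Bs))"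
  obtains as bs where "cs = as @ bs" "as \<in> carrier (prod_monoid As)" "bs \<in> carrier (prod_monoid Bs)"
  using assms by (auto simp: prod_monoid_def list_all2_append2)

lemma calg_list_append: "calg_list (As @ Bs) \<longleftrightarrow> calg_list As \<and> calg_list Bs"
  by (auto simp: calg_list_def)

lemma calg_list_Cons: "calg_list (A # As) \<longleftrightarrow> calg A \<and> calg_list As"
  by (auto simp: calg_list_def)

lemma calg_list_Nil: "calg_list []"
  by (auto simp: calg_list_def)

text \<open>The maximal tensor product of two lists classifies commuting pairs of homomorphisms.
  Words are cut at \<open>length As\<close>; commutation makes the product of the two values
  multiplicative and compatible with the involution, and multilinearity is inherited from the side
  in which the slot lies.\<close>

lemma tensor_pair:
  fixes C :: "'c cstar"
  assumes "calg_list As" "calg_list Bs" "calg C"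
    and F: "F \<in> star_hom (tensor As) C" and G: "G \<in> star_hom (tensor Bs) C"
    and comm: "\<And>as bs. \<lbrakk>as \<in> carrier (prod_monoid As); bs \<in> carrier (prod_monoid Bs)\<rbrakk>
      \<Longrightarrow> F (elem_tensor As as) \<otimes>\<^bsub>C\<^esub> G (elem_tensor Bs bs) = G (elem_tensor Bs bs) \<otimes>\<^bsub>C\<^esub> F (elem_tensor As as)"
  obtains h where "h \<in> star_hom (tensor (As @ Bs)) C" "h \<in> extensional (carrier (tensor (As @ Bs)))"
    "\<And>as bs. \<lbrakk>as \<in> carrier (prod_monoid As); bs \<in> carrier (prod_monoid Bs)\<rbrakk>
      \<Longrightarrow> h (elem_tensor (As @ Bs) (as @ bs)) = F (elem_tensor As as) \<otimes>\<^bsub>C\<^esub> G (elem_tensor Bs bs)"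
proof -
  interpret C: calg C by fact
  interpret A: calg_list As by fact
  interpret B: calg_list Bs by fact
  interpret AB: calg_list "As @ Bs" using assms by (simp add: calg_list_append)
  define n where "n = length As"
  define f where "f as = F (elem_tensor As as)" for as
  define g where "g bs = G (elem_tensor Bs bs)" for bs
  define \<mu> where "\<mu> cs = f (take n cs) \<otimes>\<^bsub>C\<^esub> g (drop n cs)" for cs
  have \<mu>: "\<mu> (as @ bs) = f as \<otimes>\<^bsub>C\<^esub> g bs" if "as \<in> carrier A.PM" for as bs
    using that by (simp add: \<mu>_def n_def A.length_carrier)
  have fc [simp]: "f as \<in> carrier C" if "as \<in> carrier A.PM" for as
    using that by (simp add: f_def star_homD[OF F])
  have gc [simp]: "g bs \<in> carrier C" if "bs \<in> carrier B.PM" for bs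
    using that by (simp add: g_def star_homD[OF G])
  have fmult: "f (as \<otimes>\<^bsub>A.PM\<^esub> as') = f as \<otimes>\<^bsub>C\<^esub> f as'" if "as \<in> carrier A.PM" "as' \<in> carrier A.PM" for as as'
    using that by (simp add: f_def star_homD[OF F] flip: A.elem_mult)
  have gmult: "g (bs \<otimes>\<^bsub>B.PM\<^esub> bs') = g bs \<otimes>\<^bsub>C\<^esub> g bs'" if "bs \<in> carrier B.PM" "bs' \<in> carrier B.PM" for bs bs'
    using that by (simp add: g_def star_homD[OF G] flip: B.elem_mult)
  have fg: "f as \<otimes>\<^bsub>C\<^esub> g bs = g bs \<otimes>\<^bsub>C\<^esub> f as" if "as \<in> carrier A.PM" "bs \<in> carrier B.PM" for as bs
    using comm that by (simp add: f_def g_def)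
  have fg': "f as \<otimes>\<^bsub>C\<^esub> (g bs \<otimes>\<^bsub>C\<^esub> x) = g bs \<otimes>\<^bsub>C\<^esub> (f as \<otimes>\<^bsub>C\<^esub> x)"
    if "as \<in> carrier A.PM" "bs \<in> carrier B.PM" "x \<in> carrier C" for as bs x
    using that by (simp add: fg flip: C.m_assoc)
  show thesis
  proof (rule AB.tensor_universal[OF assms(3), of \<mu>])
    show "\<mu> cs \<in> carrier C" if "cs \<in> carrier AB.PM" for cs
      using that by (auto elim!: prod_append_cases simp: \<mu>)
    show "\<mu> (cs \<otimes>\<^bsub>AB.PM\<^esub> ds) = \<mu> cs \<otimes>\<^bsub>C\<^esub> \<mu> ds" if "cs \<in> carrier AB.PM" "ds \<in> carrier AB.PM" for cs ds
    proof -
      obtain as bs where ab: "cs = as @ bs" "as \<in> carrier A.PM" "bs \<in> carrier B.PM"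
        using \<open>cs \<in> carrier AB.PM\<close> by (rule prod_append_cases)
      obtain as' bs' where ab': "ds = as' @ bs'" "as' \<in> carrier A.PM" "bs' \<in> carrier B.PM"
        using \<open>ds \<in> carrier AB.PM\<close> by (rule prod_append_cases)
      have "\<mu> (cs \<otimes>\<^bsub>AB.PM\<^esub> ds) = f as \<otimes>\<^bsub>C\<^esub> f as' \<otimes>\<^bsub>C\<^esub> (g bs \<otimes>\<^bsub>C\<^esub> g bs')"
        using ab ab' by (simp add: prod_append_mult A.length_carrier \<mu> fmult gmult)
      also have "\<dots> = f as \<otimes>\<^bsub>C\<^esub> g bs \<otimes>\<^bsub>C\<^esub> (f as' \<otimes>\<^bsub>C\<^esub> g bs')"
        using ab ab' fg'[of as' bs "g bs'"] by (simp add: C.m_assoc)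
      finally show ?thesis
        using ab ab' by (simp add: \<mu>)
    qed
    show "\<mu> \<one>\<^bsub>AB.PM\<^esub> = \<one>\<^bsub>C\<^esub>"
      by (simp add: prod_append_one \<mu> A.length_carrier f_def g_def A.elem_one B.elem_one star_homD[OF F] star_homD[OF G])
    show "\<mu> (invol AB.PM cs) = star C (\<mu> cs)" if "cs \<in> carrier AB.PM" for cs
      using that
    proof (rule prod_append_cases)
      fix as bs assume ab: "cs = as @ bs" "as \<in> carrier A.PM" "bs \<in> carrier B.PM"
      have "f (invol A.PM as) = star C (f as)" "g (invol B.PM bs) = star C (g bs)"
        using ab by (simp_all add: f_def g_def star_homD[OF F] star_homD[OF G] flip: A.elem_star B.elem_star)
      then show ?thesis
        using ab fg[of "invol A.PM as" "invol B.PM bs"] by (simp add: \<mu> prod_append_invol A.length_carrier)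
    qed
    show "\<mu> (cs[i := x \<oplus>\<^bsub>(As @ Bs) ! i\<^esub> y]) = \<mu> (cs[i := x]) \<oplus>\<^bsub>C\<^esub> \<mu> (cs[i := y])"
      if cs: "cs \<in> carrier AB.PM" and i: "i < length (As @ Bs)" and x: "x \<in> carrier ((As @ Bs) ! i)"
        and y: "y \<in> carrier ((As @ Bs) ! i)" for cs i x y
      using cs
    proof (rule prod_append_cases)
      fix as bs assume ab: "cs = as @ bs" "as \<in> carrier A.PM" "bs \<in> carrier B.PM"
      note len = A.length_carrier[OF ab(2)] B.length_carrier[OF ab(3)]
      show ?thesis
      proof (cases "i < length As")
        case True
        then have xA: "x \<in> carrier (As ! i)" "y \<in> carrier (As ! i)"
          using x y by (simp_all add: nth_append)
        then have "f (as[i := x \<oplus>\<^bsub>As ! i\<^esub> y]) = f (as[i := x]) \<oplus>\<^bsub>C\<^esub> f (as[i := y])"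
          using A.elem_add[OF ab(2) True xA] True ab by (simp add: f_def star_homD[OF F] A.update_closed)
        then show ?thesis
          using True ab xA len
          by (simp add: list_update_append \<mu> A.update_closed A.nth_facts nth_append C.l_distr)
      next
        case False
        then have j: "i - length As < length Bs"
          using i by simp
        have xB: "x \<in> carrier (Bs ! (i - length As))" "y \<in> carrier (Bs ! (i - length As))"
          using x y False by (simp_all add: nth_append)
        then have "g (bs[i - length As := x \<oplus>\<^bsub>Bs ! (i - length As)\<^esub> y])
            = g (bs[i - length As := x]) \<oplus>\<^bsub>C\<^esub> g (bs[i - length As := y])"
          using B.elem_add[OF ab(3) j xB] j ab by (simp add: g_def star_homD[OF G] B.update_closed)
        then show ?thesis
          using False j ab xB len
          by (simp add: list_update_append \<mu> B.update_closed B.nth_facts nth_append C.r_distr)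
      qed
    qed
    show "\<mu> (cs[i := c \<odot>\<^bsub>(As @ Bs) ! i\<^esub> x]) = c \<odot>\<^bsub>C\<^esub> \<mu> (cs[i := x])"
      if cs: "cs \<in> carrier AB.PM" and i: "i < length (As @ Bs)" and x: "x \<in> carrier ((As @ Bs) ! i)"
      for cs i c x
      using cs
    proof (rule prod_append_cases)
      fix as bs assume ab: "cs = as @ bs" "as \<in> carrier A.PM" "bs \<in> carrier B.PM"
      note len = A.length_carrier[OF ab(2)] B.length_carrier[OF ab(3)]
      show ?thesis
      proof (cases "i < length As")
        case True
        then have xA: "x \<in> carrier (As ! i)"
          using x by (simp add: nth_append)
        then have "f (as[i := c \<odot>\<^bsub>As ! i\<^esub> x]) = c \<odot>\<^bsub>C\<^esub> f (as[i := x])"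
          using A.elem_smult[OF ab(2) True xA] True ab by (simp add: f_def star_homD[OF F] A.update_closed)
        then show ?thesis
          using True ab xA len
          by (simp add: list_update_append \<mu> A.update_closed A.nth_facts nth_append)
      next
        case False
        then have j: "i - length As < length Bs"
          using i by simp
        have xB: "x \<in> carrier (Bs ! (i - length As))"
          using x False by (simp add: nth_append)
        then have "g (bs[i - length As := c \<odot>\<^bsub>Bs ! (i - length As)\<^esub> x]) = c \<odot>\<^bsub>C\<^esub> g (bs[i - length As := x])"
          using B.elem_smult[OF ab(3) j xB] j ab by (simp add: g_def star_homD[OF G] B.update_closed)
        then show ?thesis
          using False j ab xB len
          by (simp add: list_update_append \<mu> B.update_closed B.nth_facts nth_append)
      qed
    qed
    fix h assume hom: "h \<in> star_hom (tensor (As @ Bs)) C"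
      and ext: "h \<in> extensional (carrier (tensor (As @ Bs)))"
      and h: "\<And>as. as \<in> carrier AB.PM \<Longrightarrow> h (elem_tensor (As @ Bs) as) = \<mu> as"
    have "h (elem_tensor (As @ Bs) (as @ bs)) = F (elem_tensor As as) \<otimes>\<^bsub>C\<^esub> G (elem_tensor Bs bs)"
      if "as \<in> carrier A.PM" "bs \<in> carrier B.PM" for as bs
      using h[OF prod_append_carrier[OF that]] \<mu>[OF that(1)] by (simp add: f_def g_def)
    with hom ext show thesis
      by (rule that)
  qed
qed

section \<open>Maps between tensor products\<close>

text \<open>\<open>left_incl\<close> and \<open>right_incl\<close> name the two homomorphisms hidden
  in \<open>tensor_join\<close>, so that their properties can be stated separately.\<close>

definition left_incl :: "'a cstar list \<Rightarrow> 'a cstar list \<Rightarrow> 'a tens \<Rightarrow> 'a tens" where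
  "left_incl As Bs = the_hom As (As @ Bs) (\<lambda>h. \<forall>as\<in>carrier (prod_monoid As).
     h (elem_tensor As as) = elem_tensor (As @ Bs) (as @ \<one>\<^bsub>prod_monoid Bs\<^esub>))"

definition right_incl :: "'a cstar list \<Rightarrow> 'a cstar list \<Rightarrow> 'a tens \<Rightarrow> 'a tens" where
  "right_incl As Bs = the_hom Bs (As @ Bs) (\<lambda>h. \<forall>bs\<in>carrier (prod_monoid Bs).
     h (elem_tensor Bs bs) = elem_tensor (As @ Bs) (\<one>\<^bsub>prod_monoid As\<^esub> @ bs))"

lemma tensor_join_eq: "tensor_join As Bs x y = left_incl As Bs x \<otimes>\<^bsub>tensor (As @ Bs)\<^esub> right_incl As Bs y"
  by (simp add: tensor_join_def left_incl_def right_incl_def)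

locale two_calg_lists = A: calg_list As + B: calg_list Bs for As Bs :: "'a cstar list"
begin

sublocale AB: calg_list "As @ Bs"
  by (simp add: calg_list_append A.calg_list_axioms B.calg_list_axioms)

lemma append_mult:
  "\<lbrakk>as \<in> carrier A.PM; as' \<in> carrier A.PM\<rbrakk>
    \<Longrightarrow> (as @ bs) \<otimes>\<^bsub>AB.PM\<^esub> (as' @ bs') = (as \<otimes>\<^bsub>A.PM\<^esub> as') @ (bs \<otimes>\<^bsub>B.PM\<^esub> bs')"
  by (simp add: prod_append_mult A.length_carrier)

lemma append_invol:
  "as \<in> carrier A.PM \<Longrightarrow> invol AB.PM (as @ bs) = invol A.PM as @ invol B.PM bs"
  by (simp add: prod_append_invol A.length_carrier)

lemma append_carrier [simp]:
  "\<lbrakk>as \<in> carrier A.PM; bs \<in> carrier B.PM\<rbrakk> \<Longrightarrow> as @ bs \<in> carrier AB.PM"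
  by (rule prod_append_carrier)

lemma invol_one: "invol B.PM \<one>\<^bsub>B.PM\<^esub> = \<one>\<^bsub>B.PM\<^esub>" "invol A.PM \<one>\<^bsub>A.PM\<^esub> = \<one>\<^bsub>A.PM\<^esub>"
proof -
  show "invol B.PM \<one>\<^bsub>B.PM\<^esub> = \<one>\<^bsub>B.PM\<^esub>"
    by (rule nth_equalityI) (simp_all add: prod_monoid_simps B.nth_facts)
  show "invol A.PM \<one>\<^bsub>A.PM\<^esub> = \<one>\<^bsub>A.PM\<^esub>"
    by (rule nth_equalityI) (simp_all add: prod_monoid_simps A.nth_facts)
qed

lemma left_incl_hom: "left_incl As Bs \<in> star_hom (tensor As) (tensor (As @ Bs))"
  and left_incl_elem: "as \<in> carrier A.PM
    \<Longrightarrow> left_incl As Bs (elem_tensor As as) = elem_tensor (As @ Bs) (as @ \<one>\<^bsub>B.PM\<^esub>)"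
proof -
  obtain h where h: "h \<in> star_hom (tensor As) (tensor (As @ Bs))" "h \<in> extensional (carrier (tensor As))"
    "\<And>as. as \<in> carrier A.PM \<Longrightarrow> h (elem_tensor As as) = elem_tensor (As @ Bs) (as @ \<one>\<^bsub>B.PM\<^esub>)"
  proof (rule A.tensor_universal[OF AB.calg_tensor, of "\<lambda>as. elem_tensor (As @ Bs) (as @ \<one>\<^bsub>B.PM\<^esub>)"])
    show "elem_tensor (As @ Bs) (as[i := x \<oplus>\<^bsub>As ! i\<^esub> y] @ \<one>\<^bsub>B.PM\<^esub>) =
        elem_tensor (As @ Bs) (as[i := x] @ \<one>\<^bsub>B.PM\<^esub>)
        \<oplus>\<^bsub>tensor (As @ Bs)\<^esub> elem_tensor (As @ Bs) (as[i := y] @ \<one>\<^bsub>B.PM\<^esub>)"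
      if "as \<in> carrier A.PM" "i < length As" "x \<in> carrier (As ! i)" "y \<in> carrier (As ! i)" for as i x y
      using AB.elem_add[of "as @ \<one>\<^bsub>B.PM\<^esub>" i x y] that
      by (simp add: nth_append list_update_append A.length_carrier)
    show "elem_tensor (As @ Bs) (as[i := c \<odot>\<^bsub>As ! i\<^esub> x] @ \<one>\<^bsub>B.PM\<^esub>) =
        c \<odot>\<^bsub>tensor (As @ Bs)\<^esub> elem_tensor (As @ Bs) (as[i := x] @ \<one>\<^bsub>B.PM\<^esub>)"
      if "as \<in> carrier A.PM" "i < length As" "x \<in> carrier (As ! i)" for as i c x
      using AB.elem_smult[of "as @ \<one>\<^bsub>B.PM\<^esub>" i x c] that
      by (simp add: nth_append list_update_append A.length_carrier)
  qed (auto simp: AB.elem_mult AB.elem_star append_mult append_invol invol_one AB.elem_one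
      simp flip: prod_append_one)
  have "left_incl As Bs = h"
    unfolding left_incl_def
  proof (rule the_hom_eqI[OF h(1,2)])
    fix h' x assume h': "h' \<in> star_hom (tensor As) (tensor (As @ Bs))" and x: "x \<in> carrier (tensor As)"
      and "\<forall>as\<in>carrier A.PM. h' (elem_tensor As as) = elem_tensor (As @ Bs) (as @ \<one>\<^bsub>B.PM\<^esub>)"
    then show "h' x = h x"
      by (intro A.tensor_hom_eqI[OF AB.calg_tensor h' h(1) _ x]) (simp add: h(3))
  qed (use h(3) in simp)
  then show "left_incl As Bs \<in> star_hom (tensor As) (tensor (As @ Bs))"
    "as \<in> carrier A.PM \<Longrightarrow> left_incl As Bs (elem_tensor As as) = elem_tensor (As @ Bs) (as @ \<one>\<^bsub>B.PM\<^esub>)"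
    using h by auto
qed

lemma right_incl_hom: "right_incl As Bs \<in> star_hom (tensor Bs) (tensor (As @ Bs))"
  and right_incl_elem: "bs \<in> carrier B.PM
    \<Longrightarrow> right_incl As Bs (elem_tensor Bs bs) = elem_tensor (As @ Bs) (\<one>\<^bsub>A.PM\<^esub> @ bs)"
proof -
  obtain h where h: "h \<in> star_hom (tensor Bs) (tensor (As @ Bs))" "h \<in> extensional (carrier (tensor Bs))"
    "\<And>bs. bs \<in> carrier B.PM \<Longrightarrow> h (elem_tensor Bs bs) = elem_tensor (As @ Bs) (\<one>\<^bsub>A.PM\<^esub> @ bs)"
  proof (rule B.tensor_universal[OF AB.calg_tensor, of "\<lambda>bs. elem_tensor (As @ Bs) (\<one>\<^bsub>A.PM\<^esub> @ bs)"])
    note len = A.length_carrier[OF A.M.one_closed]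
    show "elem_tensor (As @ Bs) (\<one>\<^bsub>A.PM\<^esub> @ bs[i := x \<oplus>\<^bsub>Bs ! i\<^esub> y]) =
        elem_tensor (As @ Bs) (\<one>\<^bsub>A.PM\<^esub> @ bs[i := x])
        \<oplus>\<^bsub>tensor (As @ Bs)\<^esub> elem_tensor (As @ Bs) (\<one>\<^bsub>A.PM\<^esub> @ bs[i := y])"
      if "bs \<in> carrier B.PM" "i < length Bs" "x \<in> carrier (Bs ! i)" "y \<in> carrier (Bs ! i)" for bs i x y
      using AB.elem_add[of "\<one>\<^bsub>A.PM\<^esub> @ bs" "length As + i" x y] that
      by (simp add: nth_append list_update_append len)
    show "elem_tensor (As @ Bs) (\<one>\<^bsub>A.PM\<^esub> @ bs[i := c \<odot>\<^bsub>Bs ! i\<^esub> x]) =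
        c \<odot>\<^bsub>tensor (As @ Bs)\<^esub> elem_tensor (As @ Bs) (\<one>\<^bsub>A.PM\<^esub> @ bs[i := x])"
      if "bs \<in> carrier B.PM" "i < length Bs" "x \<in> carrier (Bs ! i)" for bs i c x
      using AB.elem_smult[of "\<one>\<^bsub>A.PM\<^esub> @ bs" "length As + i" x c] that
      by (simp add: nth_append list_update_append len)
  qed (auto simp: AB.elem_mult AB.elem_star append_mult append_invol invol_one AB.elem_one
      simp flip: prod_append_one)
  have "right_incl As Bs = h"
    unfolding right_incl_def
  proof (rule the_hom_eqI[OF h(1,2)])
    fix h' x assume h': "h' \<in> star_hom (tensor Bs) (tensor (As @ Bs))" and x: "x \<in> carrier (tensor Bs)"
      and "\<forall>bs\<in>carrier B.PM. h' (elem_tensor Bs bs) = elem_tensor (As @ Bs) (\<one>\<^bsub>A.PM\<^esub> @ bs)"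
    then show "h' x = h x"
      by (intro B.tensor_hom_eqI[OF AB.calg_tensor h' h(1) _ x]) (simp add: h(3))
  qed (use h(3) in simp)
  then show "right_incl As Bs \<in> star_hom (tensor Bs) (tensor (As @ Bs))"
    "bs \<in> carrier B.PM \<Longrightarrow> right_incl As Bs (elem_tensor Bs bs) = elem_tensor (As @ Bs) (\<one>\<^bsub>A.PM\<^esub> @ bs)"
    using h by auto
qed

lemma incl_elem_commute:
  assumes "as \<in> carrier A.PM" "bs \<in> carrier B.PM"
  shows "left_incl As Bs (elem_tensor As as) \<otimes>\<^bsub>tensor (As @ Bs)\<^esub> right_incl As Bs (elem_tensor Bs bs)
      = elem_tensor (As @ Bs) (as @ bs)"
    and "right_incl As Bs (elem_tensor Bs bs) \<otimes>\<^bsub>tensor (As @ Bs)\<^esub> left_incl As Bs (elem_tensor As as)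
      = elem_tensor (As @ Bs) (as @ bs)"
  using assms by (simp_all add: left_incl_elem right_incl_elem AB.elem_mult append_mult)

lemma incl_commute:
  assumes "x \<in> carrier (tensor As)" "y \<in> carrier (tensor Bs)"
  shows "left_incl As Bs x \<otimes>\<^bsub>tensor (As @ Bs)\<^esub> right_incl As Bs y
    = right_incl As Bs y \<otimes>\<^bsub>tensor (As @ Bs)\<^esub> left_incl As Bs x"
proof (rule star_homs_commute[OF A.calg_tensor A.generates_tensor left_incl_hom
      B.calg_tensor B.generates_tensor right_incl_hom AB.calg_tensor _ assms])
  fix x y assume "x \<in> elem_tensor As ` carrier A.PM" "y \<in> elem_tensor Bs ` carrier B.PM"
  then obtain as bs where ab: "as \<in> carrier A.PM" "x = elem_tensor As as"
      "bs \<in> carrier B.PM" "y = elem_tensor Bs bs"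
    by blast
  have "star (tensor (As @ Bs)) (right_incl As Bs y) = right_incl As Bs (elem_tensor Bs (invol B.PM bs))"
    using ab by (simp add: B.elem_star flip: star_hom_star[OF right_incl_hom])
  then show "left_incl As Bs x \<otimes>\<^bsub>tensor (As @ Bs)\<^esub> right_incl As Bs y
        = right_incl As Bs y \<otimes>\<^bsub>tensor (As @ Bs)\<^esub> left_incl As Bs x
      \<and> left_incl As Bs x \<otimes>\<^bsub>tensor (As @ Bs)\<^esub> star (tensor (As @ Bs)) (right_incl As Bs y)
        = star (tensor (As @ Bs)) (right_incl As Bs y) \<otimes>\<^bsub>tensor (As @ Bs)\<^esub> left_incl As Bs x"
    using ab by (simp add: incl_elem_commute)
qed

lemma join_elem:
  "\<lbrakk>as \<in> carrier A.PM; bs \<in> carrier B.PM\<rbrakk>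
    \<Longrightarrow> tensor_join As Bs (elem_tensor As as) (elem_tensor Bs bs) = elem_tensor (As @ Bs) (as @ bs)"
  by (simp add: tensor_join_eq incl_elem_commute)

end

section \<open>Morphisms typed by lists of factors\<close>

definition tmorphism :: "'a tmor \<Rightarrow> bool" where
  "tmorphism f \<longleftrightarrow> calg_list (src f) \<and> calg_list (tgt f)
     \<and> app f \<in> star_hom (tensor (src f)) (tensor (tgt f)) \<and> app f \<in> extensional (carrier (tensor (src f)))"

text \<open>A relation on words: composites and tensor products of maps can be followed on a single
  elementary tensor, with the carrier conditions carried along.\<close>

definition maps :: "'a tmor \<Rightarrow> 'a list \<Rightarrow> 'a list \<Rightarrow> bool" where
  "maps f as bs \<longleftrightarrow> as \<in> carrier (prod_monoid (src f)) \<and> bs \<in> carrier (prod_monoid (tgt f))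
     \<and> app f (elem_tensor (src f) as) = elem_tensor (tgt f) bs"

lemma src_tgt_simps [simp]:
  "src (hom_where As Bs Q) = As" "tgt (hom_where As Bs Q) = Bs" "app (hom_where As Bs Q) = the_hom As Bs Q"
  "src (tid As) = As" "tgt (tid As) = As"
  "src (g \<bullet>\<^sub>t f) = src f" "tgt (g \<bullet>\<^sub>t f) = tgt g"
  "src (f \<otimes>\<^sub>t g) = src f @ src g" "tgt (f \<otimes>\<^sub>t g) = tgt f @ tgt g"
  "src (tinv f) = tgt f" "tgt (tinv f) = src f"
  by (simp_all add: hom_where_def tid_def tcomp_def tmap_def tinv_def)

text \<open>Existence is the given \<open>h\<close>; uniqueness follows because \<open>Q\<close>
  fixes the values on a generating set. This opens the definite description of each structure
  map.\<close>

lemma tmorphism_hom_where: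
  assumes "calg_list As" "calg_list Bs"
    and h: "h \<in> star_hom (tensor As) (tensor Bs)" "h \<in> extensional (carrier (tensor As))" "Q h"
    and D: "generates (tensor As) D" "\<forall>h'\<in>star_hom (tensor As) (tensor Bs). Q h' \<longrightarrow> (\<forall>x\<in>D. h' x = h x)"
  shows "tmorphism (hom_where As Bs Q)" and "the_hom As Bs Q = h"
proof -
  interpret A: calg_list As by fact
  interpret B: calg_list Bs by fact
  show "the_hom As Bs Q = h"
  proof (rule the_hom_eqI[of h As Bs Q, OF h])
    fix h' x assume h': "h' \<in> star_hom (tensor As) (tensor Bs)" and "Q h'" and x: "x \<in> carrier (tensor As)"
    then show "h' x = h x"
      using D(2) by (intro star_hom_eqI[OF A.calg_tensor B.calg_tensor h' h(1) D(1) _ x]) blast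
  qed
  then show "tmorphism (hom_where As Bs Q)"
    using assms by (simp add: tmorphism_def)
qed

lemma tmorphism_tid: "calg_list As \<Longrightarrow> tmorphism (tid As)"
proof -
  assume "calg_list As"
  then interpret A: calg_list As .
  interpret T: calg "tensor As" by (rule A.calg_tensor)
  show ?thesis
    unfolding tmorphism_def tid_def
    using star_hom_cong[OF T.star_alg_axioms star_hom_id] A.calg_list_axioms by auto
qed

lemma app_tid [simp]: "x \<in> carrier (tensor As) \<Longrightarrow> app (tid As) x = x"
  by (simp add: tid_def)

lemma maps_tid:
  assumes "calg_list As" "as \<in> carrier (prod_monoid As)"
  shows "maps (tid As) as as"
proof -
  interpret A: calg_list As by fact
  show ?thesis
    using assms by (simp add: maps_def)
qed

lemma app_tcomp: "x \<in> carrier (tensor (src f)) \<Longrightarrow> app (g \<bullet>\<^sub>t f) x = app g (app f x)"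
  by (simp add: tcomp_def compose_def)

lemma tmorphism_tcomp:
  assumes f: "tmorphism f" and g: "tmorphism g" and fg: "tgt f = src g"
  shows "tmorphism (g \<bullet>\<^sub>t f)"
proof -
  interpret A: calg_list "src f" using f by (simp add: tmorphism_def)
  interpret T: calg "tensor (src f)" by (rule A.calg_tensor)
  have "(\<lambda>x. app g (app f x)) \<in> star_hom (tensor (src f)) (tensor (tgt g))"
    using f g fg star_hom_comp unfolding tmorphism_def by metis
  then have "app (g \<bullet>\<^sub>t f) \<in> star_hom (tensor (src f)) (tensor (tgt g))"
    by (rule star_hom_cong[OF T.star_alg_axioms]) (simp add: app_tcomp)
  then show ?thesis
    using f g by (simp add: tmorphism_def) (simp add: tcomp_def)
qed

lemma maps_tcomp:
  assumes "maps f as bs" "maps g bs cs" "tgt f = src g" "tmorphism f"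
  shows "maps (g \<bullet>\<^sub>t f) as cs"
proof -
  interpret A: calg_list "src f" using assms by (simp add: tmorphism_def)
  show ?thesis
    using assms by (simp add: maps_def app_tcomp)
qed

text \<open>The homomorphism pairs \<open>left_incl\<close> after \<open>f\<close> with
  \<open>right_incl\<close> after \<open>g\<close>, whose ranges commute. The defining condition
  concerns all \<open>x\<close> and \<open>y\<close>, not only elementary tensors, so agreement with
  the two inclusions is first extended by generation (\<open>hl\<close>, \<open>hr\<close>).\<close>

lemma
  assumes f: "tmorphism f" and g: "tmorphism g"
  shows tmorphism_tmap: "tmorphism (f \<otimes>\<^sub>t g)"
    and app_tmap_join: "\<lbrakk>x \<in> carrier (tensor (src f)); y \<in> carrier (tensor (src g))\<rbrakk>
      \<Longrightarrow> app (f \<otimes>\<^sub>t g) (tensor_join (src f) (src g) x y) = tensor_join (tgt f) (tgt g) (app f x) (app g y)"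
proof -
  interpret S: two_calg_lists "src f" "src g"
    using f g by (simp add: tmorphism_def two_calg_lists_def)
  interpret T: two_calg_lists "tgt f" "tgt g"
    using f g by (simp add: tmorphism_def two_calg_lists_def)
  have fh: "app f \<in> star_hom (tensor (src f)) (tensor (tgt f))"
    and gh: "app g \<in> star_hom (tensor (src g)) (tensor (tgt g))"
    using f g by (auto simp: tmorphism_def)
  define Q where "Q h \<longleftrightarrow> (\<forall>x\<in>carrier (tensor (src f)). \<forall>y\<in>carrier (tensor (src g)).
      h (tensor_join (src f) (src g) x y) = tensor_join (tgt f) (tgt g) (app f x) (app g y))" for h
  interpret TT: calg "tensor (tgt f @ tgt g)" by (rule T.AB.calg_tensor)
  interpret SA: calg "tensor (src f)" by (rule S.A.calg_tensor)
  interpret SB: calg "tensor (src g)" by (rule S.B.calg_tensor)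
  define F where "F = (\<lambda>x. left_incl (tgt f) (tgt g) (app f x))"
  define G where "G = (\<lambda>y. right_incl (tgt f) (tgt g) (app g y))"
  have F: "F \<in> star_hom (tensor (src f)) (tensor (tgt f @ tgt g))"
    unfolding F_def by (rule star_hom_comp[OF fh T.left_incl_hom])
  have G: "G \<in> star_hom (tensor (src g)) (tensor (tgt f @ tgt g))"
    unfolding G_def by (rule star_hom_comp[OF gh T.right_incl_hom])
  have FG: "F x \<otimes>\<^bsub>tensor (tgt f @ tgt g)\<^esub> G y = G y \<otimes>\<^bsub>tensor (tgt f @ tgt g)\<^esub> F x"
    if "x \<in> carrier (tensor (src f))" "y \<in> carrier (tensor (src g))" for x y
    using that by (simp add: F_def G_def T.incl_commute star_homD[OF fh] star_homD[OF gh])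
  obtain h where h: "h \<in> star_hom (tensor (src f @ src g)) (tensor (tgt f @ tgt g))"
      "h \<in> extensional (carrier (tensor (src f @ src g)))"
      "\<And>as bs. \<lbrakk>as \<in> carrier S.A.PM; bs \<in> carrier S.B.PM\<rbrakk> \<Longrightarrow> h (elem_tensor (src f @ src g) (as @ bs))
        = F (elem_tensor (src f) as) \<otimes>\<^bsub>tensor (tgt f @ tgt g)\<^esub> G (elem_tensor (src g) bs)"
    using tensor_pair[OF S.A.calg_list_axioms S.B.calg_list_axioms T.AB.calg_tensor F G] FG by auto
  have hl: "h (left_incl (src f) (src g) x) = F x" if "x \<in> carrier (tensor (src f))" for x
  proof (rule S.A.tensor_hom_eqI[OF T.AB.calg_tensor star_hom_comp[OF S.left_incl_hom h(1)] F _ that])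
    fix as assume as: "as \<in> carrier S.A.PM"
    then show "h (left_incl (src f) (src g) (elem_tensor (src f) as)) = F (elem_tensor (src f) as)"
      by (simp add: S.left_incl_elem h(3) S.B.elem_one star_homD[OF G] star_hom_closed[OF F])
  qed
  have hr: "h (right_incl (src f) (src g) y) = G y" if "y \<in> carrier (tensor (src g))" for y
  proof (rule S.B.tensor_hom_eqI[OF T.AB.calg_tensor star_hom_comp[OF S.right_incl_hom h(1)] G _ that])
    fix bs assume bs: "bs \<in> carrier S.B.PM"
    then show "h (right_incl (src f) (src g) (elem_tensor (src g) bs)) = G (elem_tensor (src g) bs)"
      by (simp add: S.right_incl_elem h(3) S.A.elem_one star_homD[OF F] star_hom_closed[OF G])
  qed
  have Qh: "Q h"
    unfolding Q_def
    by (simp add: tensor_join_eq star_hom_mult[OF h(1)] star_hom_closed[OF S.left_incl_hom]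
        star_hom_closed[OF S.right_incl_hom] hl hr) (simp add: F_def G_def)
  have un: "h' x = h x" if "h' \<in> star_hom (tensor (src f @ src g)) (tensor (tgt f @ tgt g))" "Q h'"
    "x \<in> elem_tensor (src f @ src g) ` carrier S.AB.PM" for h' x
  proof -
    obtain as bs where ab: "as \<in> carrier S.A.PM" "bs \<in> carrier S.B.PM" "x = elem_tensor (src f @ src g) (as @ bs)"
      using \<open>x \<in> elem_tensor (src f @ src g) ` carrier S.AB.PM\<close> by (auto elim!: prod_append_cases)
    then show ?thesis
      using \<open>Q h'\<close> Qh unfolding Q_def by (simp flip: S.join_elem)
  qed
  have eq: "f \<otimes>\<^sub>t g = hom_where (src f @ src g) (tgt f @ tgt g) Q"
    by (simp add: tmap_def Q_def[abs_def])
  have "\<forall>h'\<in>star_hom (tensor (src f @ src g)) (tensor (tgt f @ tgt g)). Q h'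
      \<longrightarrow> (\<forall>x\<in>elem_tensor (src f @ src g) ` carrier S.AB.PM. h' x = h x)"
    using un by blast
  note th = tmorphism_hom_where[of "src f @ src g" "tgt f @ tgt g" h Q,
      OF S.AB.calg_list_axioms T.AB.calg_list_axioms h(1,2) Qh S.AB.generates_tensor this]
  show "tmorphism (f \<otimes>\<^sub>t g)"
    unfolding eq by (rule th(1))
  show "\<lbrakk>x \<in> carrier (tensor (src f)); y \<in> carrier (tensor (src g))\<rbrakk>
      \<Longrightarrow> app (f \<otimes>\<^sub>t g) (tensor_join (src f) (src g) x y) = tensor_join (tgt f) (tgt g) (app f x) (app g y)"
    unfolding eq src_tgt_simps th(2) using Qh by (simp add: Q_def)
qed

lemma maps_tmap:
  assumes "tmorphism f" "tmorphism g" "maps f as as'" "maps g bs bs'"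
  shows "maps (f \<otimes>\<^sub>t g) (as @ bs) (as' @ bs')"
proof -
  interpret S: two_calg_lists "src f" "src g"
    using assms by (simp add: tmorphism_def two_calg_lists_def)
  interpret T: two_calg_lists "tgt f" "tgt g"
    using assms by (simp add: tmorphism_def two_calg_lists_def)
  show ?thesis
    using assms app_tmap_join[OF assms(1,2), of "elem_tensor (src f) as" "elem_tensor (src g) bs"]
    by (simp add: maps_def S.join_elem T.join_elem)
qed

text \<open>\<open>tinv\<close> is a bare set-theoretic inverse. Carrying the inverse along as a
  morphism shows that \<open>tinv\<close> is a homomorphism and that inversion respects tensor
  products.\<close>

definition tiso :: "'a tmor \<Rightarrow> 'a tmor \<Rightarrow> bool" where
  "tiso f g \<longleftrightarrow> tmorphism f \<and> tmorphism g \<and> src g = tgt f \<and> tgt g = src f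
     \<and> (\<forall>x\<in>carrier (tensor (src f)). app g (app f x) = x)
     \<and> (\<forall>y\<in>carrier (tensor (tgt f)). app f (app g y) = y)"

lemma tiso_sym: "tiso f g \<Longrightarrow> tiso g f"
  by (auto simp: tiso_def)

lemma tiso_tinv: "tiso f g \<Longrightarrow> tinv f = g"
proof -
  assume fg: "tiso f g"
  have c: "app g y \<in> carrier (tensor (src f))" if "y \<in> carrier (tensor (tgt f))" for y
    using fg that star_hom_closed[of "app g" "tensor (src g)" "tensor (tgt g)"]
    by (auto simp: tiso_def tmorphism_def)
  have "inv_into (carrier (tensor (src f))) (app f) y = app g y" if y: "y \<in> carrier (tensor (tgt f))" for y
  proof (rule inv_into_f_eq)
    show "inj_on (app f) (carrier (tensor (src f)))"
      using fg by (intro inj_on_inverseI[of _ "app g"]) (simp add: tiso_def)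
  qed (use fg y c in \<open>auto simp: tiso_def\<close>)
  then have "app (tinv f) = app g"
    using fg by (intro extensionalityI[of _ "carrier (tensor (tgt f))"]) (auto simp: tinv_def tiso_def tmorphism_def)
  then show ?thesis
    using fg by (intro tmor.equality) (auto simp: tiso_def)
qed

lemma tiso_tmap:
  assumes "tiso f f'" "tiso g g'"
  shows "tiso (f \<otimes>\<^sub>t g) (f' \<otimes>\<^sub>t g')"
proof -
  have *: "app (f' \<otimes>\<^sub>t g') (app (f \<otimes>\<^sub>t g) x) = x"
    if "tiso f f'" "tiso g g'" "x \<in> carrier (tensor (src f @ src g))" for f f' g g' :: "'a tmor" and x
  proof -
    have t: "tmorphism f" "tmorphism g" "tmorphism f'" "tmorphism g'"
      "src f' = tgt f" "src g' = tgt g" "tgt f' = src f" "tgt g' = src g"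
      using that by (auto simp: tiso_def)
    interpret S: two_calg_lists "src f" "src g"
      using t by (simp add: tmorphism_def two_calg_lists_def)
    have fh: "app (f \<otimes>\<^sub>t g) \<in> star_hom (tensor (src f @ src g)) (tensor (tgt f @ tgt g))"
      and fh': "app (f' \<otimes>\<^sub>t g') \<in> star_hom (tensor (tgt f @ tgt g)) (tensor (src f @ src g))"
      using tmorphism_tmap[OF t(1,2)] tmorphism_tmap[OF t(3,4)] t by (auto simp: tmorphism_def)
    have c: "x \<in> carrier (tensor (src f)) \<Longrightarrow> app f x \<in> carrier (tensor (tgt f))"
      "y \<in> carrier (tensor (src g)) \<Longrightarrow> app g y \<in> carrier (tensor (tgt g))" for x y
      using t by (auto simp: tmorphism_def star_homD)
    show ?thesis
    proof (rule S.AB.tensor_hom_eqI[OF S.AB.calg_tensor star_hom_comp[OF fh fh'] star_hom_id _ that(3)])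
      fix cs assume "cs \<in> carrier S.AB.PM"
      then obtain as bs where ab: "as \<in> carrier S.A.PM" "bs \<in> carrier S.B.PM" "cs = as @ bs"
        by (auto elim!: prod_append_cases)
      have "app (f' \<otimes>\<^sub>t g') (app (f \<otimes>\<^sub>t g) (tensor_join (src f) (src g) (elem_tensor (src f) as) (elem_tensor (src g) bs)))
        = tensor_join (src f) (src g) (elem_tensor (src f) as) (elem_tensor (src g) bs)"
        using ab that(1,2) app_tmap_join[OF t(1,2), of "elem_tensor (src f) as" "elem_tensor (src g) bs"]
          app_tmap_join[OF t(3,4), of "app f (elem_tensor (src f) as)" "app g (elem_tensor (src g) bs)"]
        by (simp add: t c tiso_def)
      then show "app (f' \<otimes>\<^sub>t g') (app (f \<otimes>\<^sub>t g) (elem_tensor (src f @ src g) cs)) = elem_tensor (src f @ src g) cs"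
        using ab by (simp add: S.join_elem)
    qed
  qed
  show ?thesis
    using assms *[OF assms] *[OF assms[THEN tiso_sym]]
    by (auto simp: tiso_def intro: tmorphism_tmap)
qed

lemma tiso_tid:
  assumes "calg_list As"
  shows "tiso (tid As) (tid As)"
  using tmorphism_tid[OF assms] by (simp add: tiso_def)

text \<open>Generalises \<open>tau\<close> to two arbitrary lists, so that the inverse of a flip is
  again a flip.\<close>

definition flip :: "'a cstar list \<Rightarrow> 'a cstar list \<Rightarrow> 'a tmor" where
  "flip As Bs = hom_where (As @ Bs) (Bs @ As) (\<lambda>h. \<forall>as\<in>carrier (prod_monoid As). \<forall>bs\<in>carrier (prod_monoid Bs).
     h (elem_tensor (As @ Bs) (as @ bs)) = elem_tensor (Bs @ As) (bs @ as))"

lemma flip_src_tgt [simp]: "src (flip As Bs) = As @ Bs" "tgt (flip As Bs) = Bs @ As"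
  by (simp_all add: flip_def)

lemma
  assumes "calg_list As" "calg_list Bs"
  shows tmorphism_flip: "tmorphism (flip As Bs)"
    and maps_flip: "\<lbrakk>as \<in> carrier (prod_monoid As); bs \<in> carrier (prod_monoid Bs)\<rbrakk>
      \<Longrightarrow> maps (flip As Bs) (as @ bs) (bs @ as)"
proof -
  interpret S: two_calg_lists As Bs
    using assms by (simp add: two_calg_lists_def)
  interpret T: two_calg_lists Bs As
    using assms by (simp add: two_calg_lists_def)
  define Q where "Q h \<longleftrightarrow> (\<forall>as\<in>carrier S.A.PM. \<forall>bs\<in>carrier S.B.PM.
     h (elem_tensor (As @ Bs) (as @ bs)) = elem_tensor (Bs @ As) (bs @ as))" for h
  obtain h where h: "h \<in> star_hom (tensor (As @ Bs)) (tensor (Bs @ As))" "h \<in> extensional (carrier (tensor (As @ Bs)))"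
    "Q h"
    by (rule tensor_pair[OF assms T.AB.calg_tensor T.right_incl_hom T.left_incl_hom])
      (auto simp: T.incl_elem_commute Q_def)
  have un: "h' x = h x" if "h' \<in> star_hom (tensor (As @ Bs)) (tensor (Bs @ As))" "Q h'"
    "x \<in> elem_tensor (As @ Bs) ` carrier S.AB.PM" for h' x
    using that h(3) unfolding Q_def by (auto elim!: prod_append_cases)
  have eq: "flip As Bs = hom_where (As @ Bs) (Bs @ As) Q"
    by (simp add: flip_def Q_def[abs_def])
  have "\<forall>h'\<in>star_hom (tensor (As @ Bs)) (tensor (Bs @ As)). Q h'
      \<longrightarrow> (\<forall>x\<in>elem_tensor (As @ Bs) ` carrier S.AB.PM. h' x = h x)"
    using un by blast
  note th = tmorphism_hom_where[of "As @ Bs" "Bs @ As" h Q,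
      OF S.AB.calg_list_axioms T.AB.calg_list_axioms h S.AB.generates_tensor this]
  show "tmorphism (flip As Bs)"
    unfolding eq by (rule th(1))
  show "\<lbrakk>as \<in> carrier (prod_monoid As); bs \<in> carrier (prod_monoid Bs)\<rbrakk>
      \<Longrightarrow> maps (flip As Bs) (as @ bs) (bs @ as)"
    unfolding eq maps_def src_tgt_simps th(2) using h(3) by (simp add: Q_def)
qed

lemma tiso_flip:
  assumes "calg_list As" "calg_list Bs"
  shows "tiso (flip As Bs) (flip Bs As)"
proof -
  have *: "app (flip Bs As) (app (flip As Bs) x) = x"
    if "calg_list As" "calg_list Bs" "x \<in> carrier (tensor (As @ Bs))" for As Bs :: "'a cstar list" and x
  proof -
    interpret S: two_calg_lists As Bs
      using that by (simp add: two_calg_lists_def)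
    have fh: "app (flip As Bs) \<in> star_hom (tensor (As @ Bs)) (tensor (Bs @ As))"
      and fh': "app (flip Bs As) \<in> star_hom (tensor (Bs @ As)) (tensor (As @ Bs))"
      using tmorphism_flip[OF that(1,2)] tmorphism_flip[OF that(2,1)] by (simp_all add: tmorphism_def)
    show ?thesis
    proof (rule S.AB.tensor_hom_eqI[OF S.AB.calg_tensor star_hom_comp[OF fh fh'] star_hom_id _ that(3)])
      fix cs assume "cs \<in> carrier S.AB.PM"
      then obtain as bs where ab: "as \<in> carrier S.A.PM" "bs \<in> carrier S.B.PM" "cs = as @ bs"
        by (auto elim!: prod_append_cases)
      then show "app (flip Bs As) (app (flip As Bs) (elem_tensor (As @ Bs) cs)) = elem_tensor (As @ Bs) cs"
        using maps_flip[OF that(1,2) ab(1,2)] maps_flip[OF that(2,1) ab(2,1)] by (simp add: maps_def)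
    qed
  qed
  show ?thesis
    using tmorphism_flip[OF assms] tmorphism_flip[OF assms(2,1)] *[OF assms] *[OF assms(2,1)]
    by (simp add: tiso_def)
qed

section \<open>The structure maps\<close>

lemma cstar_sub_vimage:
  assumes "calg A" "calg B" and f: "f \<in> star_hom A B" and S: "cstar_sub B S"
  shows "cstar_sub A {x \<in> carrier A. f x \<in> S}"
proof -
  interpret A: calg A by fact
  interpret B: calg B by fact
  have "limit_closed A {x \<in> carrier A. f x \<in> S}"
    unfolding limit_closed_def
  proof (intro allI ballI impI, elim conjE)
    fix s x assume x: "x \<in> carrier A" and s: "\<forall>n. s n \<in> {x \<in> carrier A. f x \<in> S}"
      and lim: "(\<lambda>n. cnorm A (s n \<ominus>\<^bsub>A\<^esub> x)) \<longlonglongrightarrow> 0"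
    have fx: "f x \<in> carrier B"
      using x by (rule star_hom_closed[OF f])
    have "tends B (\<lambda>n. f (s n)) (f x)"
    proof (rule B.tendsI)
      show "(\<lambda>n. 2 * cnorm A (s n \<ominus>\<^bsub>A\<^esub> x)) \<longlonglongrightarrow> 0"
        using tendsto_mult_right_zero[OF lim] .
      show "cnorm B (f (s n) \<ominus>\<^bsub>B\<^esub> f x) \<le> 2 * cnorm A (s n \<ominus>\<^bsub>A\<^esub> x)" for n
        using s x by (intro star_hom_dist[OF assms(1,2) f]) auto
    qed (use s fx star_hom_closed[OF f] in auto)
    moreover have "limit_closed B S"
      using S by (simp add: cstar_sub_def)
    ultimately have "f x \<in> S"
      using limit_closedD[OF _ fx, of S "\<lambda>n. f (s n)"] s by (simp add: tends_def)
    then show "x \<in> {x \<in> carrier A. f x \<in> S}"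
      using x by simp
  qed
  then show ?thesis
    using S unfolding cstar_sub_def by (auto simp: star_homD[OF f])
qed

text \<open>Preimages of C*-subalgebras are C*-subalgebras, so the images of the generators of
  \<open>A\<close> reach all of the range of \<open>f\<close>, and that range generates
  \<open>B\<close>.\<close>

lemma generates_image:
  assumes "calg A" "calg B" and f: "f \<in> star_hom A B" and A: "generates A D"
    and B: "generates B (f ` carrier A)"
  shows "generates B (f ` D)"
  unfolding generates_def
proof (intro conjI allI impI)
  show "f ` D \<subseteq> carrier B"
    using A star_hom_closed[OF f] by (auto simp: generates_def)
  fix S assume "cstar_sub B S \<and> f ` D \<subseteq> S"
  then have S: "cstar_sub B S" and D: "f ` D \<subseteq> S"
    by auto
  have "f x \<in> S" if "x \<in> carrier A" for x
    by (rule generates_induct[OF A cstar_sub_vimage[OF assms(1,2) f S] _ that]) (use D in auto)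
  then show "S = carrier B"
    using S B unfolding generates_def by blast
qed

lemma generates_carrier: "generates A (carrier A)"
  by (auto simp: generates_def cstar_sub_def)

lemma (in copied) generates_copy: "generates A D \<Longrightarrow> generates (copy_along j A) (j ` D)"
  using generates_carrier[of "copy_along j A"]
  by (rule_tac generates_image[OF calg_axioms calg_copy copy_star_hom]) simp_all

lemma carrier_single: "carrier (prod_monoid [A]) = (\<lambda>a. [a]) ` carrier A"
  by (auto simp: prod_monoid_def list_all2_Cons2)

lemma calg_list_single: "calg A \<Longrightarrow> calg_list [A]"
  by (simp add: calg_list_def)

lemma single_star_hom:
  assumes "calg A"
  shows "(\<lambda>a. elem_tensor [A] [a]) \<in> star_hom A (tensor [A])"
proof -
  interpret A: calg A by fact
  interpret L: calg_list "[A]" using assms by (rule calg_list_single)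
  show ?thesis
  proof (rule star_homI)
    show "elem_tensor [A] [x \<oplus>\<^bsub>A\<^esub> y] = elem_tensor [A] [x] \<oplus>\<^bsub>tensor [A]\<^esub> elem_tensor [A] [y]"
      if "x \<in> carrier A" "y \<in> carrier A" for x y
      using L.elem_add[of "[x]" 0 x y] that by (simp add: carrier_single)
    show "elem_tensor [A] [c \<odot>\<^bsub>A\<^esub> x] = c \<odot>\<^bsub>tensor [A]\<^esub> elem_tensor [A] [x]" if "x \<in> carrier A" for c x
      using L.elem_smult[of "[x]" 0 x c] that by (simp add: carrier_single)
    show "elem_tensor [A] [\<one>\<^bsub>A\<^esub>] = \<one>\<^bsub>tensor [A]\<^esub>"
      using L.elem_one by (simp add: prod_monoid_simps)
  qed (auto simp: L.elem_mult L.elem_star carrier_single prod_monoid_simps)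
qed

lemma generates_single:
  assumes "calg A" "generates A D"
  shows "generates (tensor [A]) ((\<lambda>a. elem_tensor [A] [a]) ` D)"
proof -
  interpret L: calg_list "[A]" using assms(1) by (rule calg_list_single)
  show ?thesis
    using L.generates_tensor
    by (rule_tac generates_image[OF assms(1) L.calg_tensor single_star_hom assms(2)])
      (simp_all add: assms carrier_single image_image)
qed

lemma single_lift:
  assumes "calg A" "calg B" and f: "f \<in> star_hom A B"
  obtains h where "h \<in> star_hom (tensor [A]) B" "h \<in> extensional (carrier (tensor [A]))"
    "\<And>a. a \<in> carrier A \<Longrightarrow> h (elem_tensor [A] [a]) = f a"
proof -
  interpret L: calg_list "[A]" using assms(1) by (rule calg_list_single)
  show thesis
  proof (rule L.tensor_universal[OF assms(2), of "\<lambda>as. f (hd as)"])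
    fix h assume "h \<in> star_hom (tensor [A]) B" "h \<in> extensional (carrier (tensor [A]))"
      "\<And>as. as \<in> carrier (prod_monoid [A]) \<Longrightarrow> h (elem_tensor [A] as) = f (hd as)"
    then show thesis
      by (intro that) (auto simp: carrier_single)
  qed (auto simp: carrier_single prod_monoid_simps star_homD[OF f])
qed

lemma (in calg_list) elem_zero:
  assumes "as \<in> carrier PM" "i < length As" "as ! i = \<zero>\<^bsub>As ! i\<^esub>"
  shows "elem_tensor As as = \<zero>\<^bsub>tensor As\<^esub>"
proof -
  interpret A: calg "As ! i" using assms(2) by (rule calg_nth)
  interpret T: calg "tensor As" by (rule calg_tensor)
  have "as[i := 0 \<odot>\<^bsub>As ! i\<^esub> \<zero>\<^bsub>As ! i\<^esub>] = as" "as[i := \<zero>\<^bsub>As ! i\<^esub>] = as"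
    using assms list_update_id[of as i] by auto
  then show ?thesis
    using elem_smult[OF assms(1,2) A.zero_closed, of 0] assms(1) by simp
qed

lemma calg_list_Toeps: "calg_list (Toeps n)"
  by (auto simp: calg_list_def calg_Toep)

lemmas calg_list_simps = calg_list_append calg_list_Cons calg_list_Nil calg_list_Toeps calg_Toep calg_Circ

lemmas Toep_simps [simp] = Toep.copy_simps[folded Toep_def]
lemmas Circ_simps [simp] = Circ.copy_simps[folded Circ_def]
lemmas of_Toep = Toep.uncopy_star_hom[folded Toep_def]
lemmas to_Circ = Circ.copy_star_hom[folded Circ_def]
lemmas of_Circ = Circ.uncopy_star_hom[folded Circ_def]

lemma generates_Toep: "generates Toep {Inl toeplitz_z}"
  using Toep.generates_copy[OF generates_toeplitz] by (simp add: Toep_def)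

lemma generates_tensor_Toep: "generates (tensor [Toep]) {elem_tensor [Toep] [Inl toeplitz_z]}"
  using generates_single[OF calg_Toep generates_Toep] by simp

lemma inv_Inl [simp]: "inv_into UNIV Inl (Inl x) = x" and inv_Inr [simp]: "inv_into UNIV Inr (Inr y) = y"
  by (simp_all add: inv_f_f)

text \<open>The symbol map on \<open>toeplitz\<close> itself, before copying and passing to one-fold
  tensor products. The value at \<open>z\<close> determines it on the carrier, so an arbitrary
  choice is harmless.\<close>

definition symbol :: "toep \<Rightarrow> complex \<Rightarrow> complex" where
  "symbol = (SOME h. h \<in> star_hom toeplitz circle_algebra \<and> h toeplitz_z = circle_u)"

lemma symbol_hom: "symbol \<in> star_hom toeplitz circle_algebra" and symbol_z: "symbol toeplitz_z = circle_u"
proof -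
  have "\<exists>h. h \<in> star_hom toeplitz circle_algebra \<and> h toeplitz_z = circle_u"
    using toeplitz_universal[OF calg_circle circle_u_closed circle_u_unitary(1)] by blast
  from someI_ex[OF this] show "symbol \<in> star_hom toeplitz circle_algebra" "symbol toeplitz_z = circle_u"
    by (simp_all add: symbol_def)
qed

definition toeplitz_e :: toep where
  "toeplitz_e = \<one>\<^bsub>toeplitz\<^esub> \<ominus>\<^bsub>toeplitz\<^esub> toeplitz_z \<otimes>\<^bsub>toeplitz\<^esub> star toeplitz toeplitz_z"

lemma toeplitz_e_closed [simp]: "toeplitz_e \<in> carrier toeplitz"
  by (simp add: toeplitz_e_def)

lemma symbol_e: "symbol toeplitz_e = \<zero>\<^bsub>circle_algebra\<^esub>"
proof -
  have "symbol toeplitz_e = \<one>\<^bsub>circle_algebra\<^esub>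
      \<ominus>\<^bsub>circle_algebra\<^esub> circle_u \<otimes>\<^bsub>circle_algebra\<^esub> star circle_algebra circle_u"
    unfolding toeplitz_e_def
    by (subst star_hom_minus[OF toeplitz.star_alg_axioms circle.star_alg_axioms symbol_hom])
      (simp_all add: star_homD[OF symbol_hom] symbol_z)
  then show ?thesis
    by (simp add: circle_u_unitary)
qed

lemma tmorphism_sigma: "tmorphism sigma"
  and maps_sigma: "a \<in> carrier toeplitz \<Longrightarrow> maps sigma [Inl a] [Inr (symbol a)]"
proof -
  interpret C: calg_list "[Circ]" by (simp add: calg_list_simps)
  interpret T: calg_list "[Toep]" by (simp add: calg_list_simps)
  have f: "(\<lambda>x. elem_tensor [Circ] [Inr (symbol (inv_into UNIV Inl x))]) \<in> star_hom Toep (tensor [Circ])"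
    using star_hom_comp[OF star_hom_comp[OF star_hom_comp[OF of_Toep symbol_hom] to_Circ] single_star_hom[OF calg_Circ]] .
  obtain h where h: "h \<in> star_hom (tensor [Toep]) (tensor [Circ])" "h \<in> extensional (carrier (tensor [Toep]))"
    "\<And>a. a \<in> carrier Toep \<Longrightarrow> h (elem_tensor [Toep] [a]) = elem_tensor [Circ] [Inr (symbol (inv_into UNIV Inl a))]"
    using single_lift[OF calg_Toep C.calg_tensor f] by blast
  define Q where "Q h \<longleftrightarrow> h (elem_tensor [Toep] [Inl toeplitz_z]) = elem_tensor [Circ] [Inr circle_u]"
    for h :: "factor tens \<Rightarrow> factor tens"
  have Qh: "Q h"
    using h(3)[of "Inl toeplitz_z"] by (simp add: Q_def symbol_z)
  have "\<forall>h'\<in>star_hom (tensor [Toep]) (tensor [Circ]). Q h'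
      \<longrightarrow> (\<forall>x\<in>{elem_tensor [Toep] [Inl toeplitz_z]}. h' x = h x)"
    using Qh by (simp add: Q_def)
  note th = tmorphism_hom_where[of "[Toep]" "[Circ]" h Q, OF T.calg_list_axioms C.calg_list_axioms
      h(1,2) Qh generates_tensor_Toep this]
  have eq: "sigma = hom_where [Toep] [Circ] Q"
    by (simp add: sigma_def Q_def[abs_def])
  show "tmorphism sigma"
    unfolding eq by (rule th(1))
  show "maps sigma [Inl a] [Inr (symbol a)]" if "a \<in> carrier toeplitz"
    unfolding eq maps_def src_tgt_simps th(2)
    using h(3)[of "Inl a"] that by (simp add: carrier_single star_hom_closed[OF symbol_hom])
qed

lemma sigma_src_tgt [simp]: "src sigma = [Toep]" "tgt sigma = [Circ]"
  by (simp_all add: sigma_def)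

lemma coaction_src_tgt [simp]: "src coaction = [Toep]" "tgt coaction = [Toep, Circ]"
  by (simp_all add: coaction_def)

text \<open>The isometry \<open>v = z \<otimes> u\<close> has
  \<open>v star v = z star z \<otimes> 1\<close>, because \<open>u\<close> is unitary. Hence
  \<open>1 - z star z\<close> is sent to itself tensored with 1: this is the gauge invariance of
  \<open>toeplitz_e\<close>.\<close>

lemma tmorphism_coaction: "tmorphism coaction"
  and maps_coaction: "maps coaction [Inl \<one>\<^bsub>toeplitz\<^esub>] [Inl \<one>\<^bsub>toeplitz\<^esub>, Inr \<one>\<^bsub>circle_algebra\<^esub>]"
    "maps coaction [Inl toeplitz_e] [Inl toeplitz_e, Inr \<one>\<^bsub>circle_algebra\<^esub>]"
proof -
  interpret TC: calg_list "[Toep, Circ]" by (simp add: calg_list_simps)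
  interpret T: calg_list "[Toep]" by (simp add: calg_list_simps)
  interpret X: calg "tensor [Toep, Circ]" by (rule TC.calg_tensor)
  have c: "[Inl t, Inr g] \<in> carrier TC.PM" if "t \<in> carrier toeplitz" "g \<in> carrier circle_algebra" for t g
    using that by (simp add: prod_monoid_def)
  let ?E = "elem_tensor [Toep, Circ]"
  define v where "v = ?E [Inl toeplitz_z, Inr circle_u]"
  have v: "v \<in> carrier (tensor [Toep, Circ])"
    unfolding v_def by (intro TC.elem_closed c) auto
  have sv: "star (tensor [Toep, Circ]) v = ?E [Inl (star toeplitz toeplitz_z), Inr (star circle_algebra circle_u)]"
    unfolding v_def by (simp add: TC.elem_star c prod_monoid_simps)
  have one: "?E [Inl \<one>\<^bsub>toeplitz\<^esub>, Inr \<one>\<^bsub>circle_algebra\<^esub>] = \<one>\<^bsub>tensor [Toep, Circ]\<^esub>"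
    using TC.elem_one by (simp add: prod_monoid_simps)
  have iso: "star (tensor [Toep, Circ]) v \<otimes>\<^bsub>tensor [Toep, Circ]\<^esub> v = \<one>\<^bsub>tensor [Toep, Circ]\<^esub>"
    unfolding sv unfolding v_def
    by (simp add: TC.elem_mult c prod_monoid_simps toeplitz_z_isometry circle_u_unitary one)
  have vv: "v \<otimes>\<^bsub>tensor [Toep, Circ]\<^esub> star (tensor [Toep, Circ]) v
      = ?E [Inl (toeplitz_z \<otimes>\<^bsub>toeplitz\<^esub> star toeplitz toeplitz_z), Inr \<one>\<^bsub>circle_algebra\<^esub>]"
    unfolding sv unfolding v_def
    by (simp add: TC.elem_mult c prod_monoid_simps circle_u_unitary)
  obtain g where g: "g \<in> star_hom toeplitz (tensor [Toep, Circ])" "g toeplitz_z = v"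
    using toeplitz_universal[OF TC.calg_tensor v iso] by blast
  have ge: "g toeplitz_e = ?E [Inl toeplitz_e, Inr \<one>\<^bsub>circle_algebra\<^esub>]"
  proof -
    have "g toeplitz_e = \<one>\<^bsub>tensor [Toep, Circ]\<^esub> \<ominus>\<^bsub>tensor [Toep, Circ]\<^esub> (v \<otimes>\<^bsub>tensor [Toep, Circ]\<^esub> star (tensor [Toep, Circ]) v)"
      unfolding toeplitz_e_def
      by (subst star_hom_minus[OF toeplitz.star_alg_axioms X.star_alg_axioms g(1)])
        (simp_all add: star_homD[OF g(1)] g(2))
    moreover have "(\<lambda>a. ?E [Inl a, Inr \<one>\<^bsub>circle_algebra\<^esub>]) (x \<ominus>\<^bsub>toeplitz\<^esub> y)
        = ?E [Inl x, Inr \<one>\<^bsub>circle_algebra\<^esub>] \<ominus>\<^bsub>tensor [Toep, Circ]\<^esub> ?E [Inl y, Inr \<one>\<^bsub>circle_algebra\<^esub>]"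
      if "x \<in> carrier toeplitz" "y \<in> carrier toeplitz" for x y
      using TC.elem_add[of "[Inl x, Inr \<one>\<^bsub>circle_algebra\<^esub>]" 0 "Inl x" "Inl ((-1) \<odot>\<^bsub>toeplitz\<^esub> y)"]
        TC.elem_smult[of "[Inl y, Inr \<one>\<^bsub>circle_algebra\<^esub>]" 0 "Inl y" "-1"] that
      by (simp add: toeplitz.minus_smult_eq X.minus_smult_eq c)
    ultimately show ?thesis
      unfolding toeplitz_e_def by (simp add: one vv)
  qed
  have f: "(\<lambda>x. g (inv_into UNIV Inl x)) \<in> star_hom Toep (tensor [Toep, Circ])"
    by (rule star_hom_comp[OF of_Toep g(1)])
  obtain h where h: "h \<in> star_hom (tensor [Toep]) (tensor [Toep, Circ])" "h \<in> extensional (carrier (tensor [Toep]))"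
    "\<And>a. a \<in> carrier Toep \<Longrightarrow> h (elem_tensor [Toep] [a]) = g (inv_into UNIV Inl a)"
    using single_lift[OF calg_Toep TC.calg_tensor f] by blast
  define Q where "Q h \<longleftrightarrow> h (elem_tensor [Toep] [Inl toeplitz_z]) = ?E [Inl toeplitz_z, Inr circle_u]"
    for h :: "factor tens \<Rightarrow> factor tens"
  have Qh: "Q h"
    using h(3)[of "Inl toeplitz_z"] by (simp add: Q_def g v_def)
  have "\<forall>h'\<in>star_hom (tensor [Toep]) (tensor [Toep, Circ]). Q h'
      \<longrightarrow> (\<forall>x\<in>{elem_tensor [Toep] [Inl toeplitz_z]}. h' x = h x)"
    using Qh by (simp add: Q_def)
  note th = tmorphism_hom_where[of "[Toep]" "[Toep, Circ]" h Q, OF T.calg_list_axioms TC.calg_list_axioms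
      h(1,2) Qh generates_tensor_Toep this]
  have eq: "coaction = hom_where [Toep] [Toep, Circ] Q"
    by (simp add: coaction_def Q_def[abs_def])
  show "tmorphism coaction"
    unfolding eq by (rule th(1))
  show "maps coaction [Inl \<one>\<^bsub>toeplitz\<^esub>] [Inl \<one>\<^bsub>toeplitz\<^esub>, Inr \<one>\<^bsub>circle_algebra\<^esub>]"
    unfolding eq maps_def src_tgt_simps th(2)
    using h(3)[of "Inl \<one>\<^bsub>toeplitz\<^esub>"] by (simp add: carrier_single c star_homD[OF g(1)] one)
  show "maps coaction [Inl toeplitz_e] [Inl toeplitz_e, Inr \<one>\<^bsub>circle_algebra\<^esub>]"
    unfolding eq maps_def src_tgt_simps th(2)
    using h(3)[of "Inl toeplitz_e"] by (simp add: carrier_single c ge)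
qed

lemma antipode_src_tgt [simp]: "src antipode = [Circ]" "tgt antipode = [Circ]"
  by (simp_all add: antipode_def)

lemma tmorphism_antipode: "tmorphism antipode"
  and maps_antipode: "maps antipode [Inr \<one>\<^bsub>circle_algebra\<^esub>] [Inr \<one>\<^bsub>circle_algebra\<^esub>]"
proof -
  interpret C: calg_list "[Circ]" by (simp add: calg_list_simps)
  let ?r = "\<lambda>f. \<lambda>x\<in>circle. f (inverse x)"
  have f: "(\<lambda>x. elem_tensor [Circ] [Inr (?r (inv_into UNIV Inr x))]) \<in> star_hom Circ (tensor [Circ])"
    using star_hom_comp[OF star_hom_comp[OF star_hom_comp[OF of_Circ circle_reflect_star_hom] to_Circ]
        single_star_hom[OF calg_Circ]] .
  obtain h where h: "h \<in> star_hom (tensor [Circ]) (tensor [Circ])" "h \<in> extensional (carrier (tensor [Circ]))"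
    "\<And>a. a \<in> carrier Circ \<Longrightarrow> h (elem_tensor [Circ] [a]) = elem_tensor [Circ] [Inr (?r (inv_into UNIV Inr a))]"
    using single_lift[OF calg_Circ C.calg_tensor f] by blast
  define Q where "Q h \<longleftrightarrow> (\<forall>f\<in>carrier circle_algebra.
      h (elem_tensor [Circ] [Inr f]) = elem_tensor [Circ] [Inr (?r f)])" for h :: "factor tens \<Rightarrow> factor tens"
  have Qh: "Q h"
    using h(3) by (simp add: Q_def)
  have "\<forall>h'\<in>star_hom (tensor [Circ]) (tensor [Circ]). Q h'
      \<longrightarrow> (\<forall>x\<in>elem_tensor [Circ] ` carrier C.PM. h' x = h x)"
    using Qh by (auto simp: Q_def carrier_single)
  note th = tmorphism_hom_where[of "[Circ]" "[Circ]" h Q, OF C.calg_list_axioms C.calg_list_axioms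
      h(1,2) Qh C.generates_tensor this]
  have eq: "antipode = hom_where [Circ] [Circ] Q"
    by (simp add: antipode_def Q_def[abs_def])
  show "tmorphism antipode"
    unfolding eq by (rule th(1))
  show "maps antipode [Inr \<one>\<^bsub>circle_algebra\<^esub>] [Inr \<one>\<^bsub>circle_algebra\<^esub>]"
    unfolding eq maps_def src_tgt_simps th(2)
    using h(3)[of "Inr \<one>\<^bsub>circle_algebra\<^esub>"] star_hom_one[OF circle_reflect_star_hom] by (simp add: carrier_single)
qed

lemma circ_mult_src_tgt [simp]: "src circ_mult = [Circ, Circ]" "tgt circ_mult = [Circ]"
  by (simp_all add: circ_mult_def)

lemma carrier_pair: "carrier (prod_monoid [A, B]) = (\<lambda>(a, b). [a, b]) ` (carrier A \<times> carrier B)"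
  by (auto simp: prod_monoid_def list_all2_Cons2)

lemma pair_carrier: "[a, b] \<in> carrier (prod_monoid [A, B]) \<longleftrightarrow> a \<in> carrier A \<and> b \<in> carrier B"
  by (simp add: prod_monoid_def)

lemma tmorphism_circ_mult: "tmorphism circ_mult"
  and maps_circ_mult: "maps circ_mult [Inr \<one>\<^bsub>circle_algebra\<^esub>, Inr \<one>\<^bsub>circle_algebra\<^esub>] [Inr \<one>\<^bsub>circle_algebra\<^esub>]"
proof -
  interpret C: calg_list "[Circ]" by (simp add: calg_list_simps)
  interpret CC: calg_list "[Circ, Circ]" by (simp add: calg_list_simps)
  have mult: "elem_tensor [Circ] [Inr f] \<otimes>\<^bsub>tensor [Circ]\<^esub> elem_tensor [Circ] [Inr g]
      = elem_tensor [Circ] [Inr (f \<otimes>\<^bsub>circle_algebra\<^esub> g)]"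
    if "f \<in> carrier circle_algebra" "g \<in> carrier circle_algebra" for f g
    using that by (simp add: C.elem_mult carrier_single prod_monoid_simps)
  have comm: "f \<otimes>\<^bsub>circle_algebra\<^esub> g = g \<otimes>\<^bsub>circle_algebra\<^esub> f" for f g
    by (auto simp: circle_algebra_simps mult.commute)
  obtain h where h: "h \<in> star_hom (tensor ([Circ] @ [Circ])) (tensor [Circ])"
    "h \<in> extensional (carrier (tensor ([Circ] @ [Circ])))"
    "\<And>as bs. \<lbrakk>as \<in> carrier (prod_monoid [Circ]); bs \<in> carrier (prod_monoid [Circ])\<rbrakk>
      \<Longrightarrow> h (elem_tensor ([Circ] @ [Circ]) (as @ bs)) = elem_tensor [Circ] as \<otimes>\<^bsub>tensor [Circ]\<^esub> elem_tensor [Circ] bs"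
  proof (rule tensor_pair[OF C.calg_list_axioms C.calg_list_axioms C.calg_tensor star_hom_id star_hom_id])
    show "elem_tensor [Circ] as \<otimes>\<^bsub>tensor [Circ]\<^esub> elem_tensor [Circ] bs
        = elem_tensor [Circ] bs \<otimes>\<^bsub>tensor [Circ]\<^esub> elem_tensor [Circ] as"
      if "as \<in> carrier C.PM" "bs \<in> carrier C.PM" for as bs
      using that comm by (auto simp: carrier_single mult)
  qed blast
  have h3: "h (elem_tensor [Circ, Circ] [Inr f, Inr g]) = elem_tensor [Circ] [Inr (f \<otimes>\<^bsub>circle_algebra\<^esub> g)]"
    if "f \<in> carrier circle_algebra" "g \<in> carrier circle_algebra" for f g
    using h(3)[of "[Inr f]" "[Inr g]"] that by (simp add: carrier_single mult)
  define Q where "Q h \<longleftrightarrow> (\<forall>f\<in>carrier circle_algebra. \<forall>g\<in>carrier circle_algebra.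
        h (elem_tensor [Circ, Circ] [Inr f, Inr g]) =
        elem_tensor [Circ] [Inr (f \<otimes>\<^bsub>circle_algebra\<^esub> g)])" for h :: "factor tens \<Rightarrow> factor tens"
  have Qh: "Q h"
    using h3 by (simp add: Q_def)
  have "\<forall>h'\<in>star_hom (tensor [Circ, Circ]) (tensor [Circ]). Q h'
      \<longrightarrow> (\<forall>x\<in>elem_tensor [Circ, Circ] ` carrier CC.PM. h' x = h x)"
    using Qh by (auto simp: Q_def carrier_pair)
  note th = tmorphism_hom_where[of "[Circ, Circ]" "[Circ]" h Q, OF CC.calg_list_axioms C.calg_list_axioms
      h(1,2)[simplified] Qh CC.generates_tensor this]
  have eq: "circ_mult = hom_where [Circ, Circ] [Circ] Q"
    by (simp add: circ_mult_def Q_def[abs_def])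
  show "tmorphism circ_mult"
    unfolding eq by (rule th(1))
  show "maps circ_mult [Inr \<one>\<^bsub>circle_algebra\<^esub>, Inr \<one>\<^bsub>circle_algebra\<^esub>] [Inr \<one>\<^bsub>circle_algebra\<^esub>]"
    unfolding eq maps_def src_tgt_simps th(2)
    using h3[of "\<one>\<^bsub>circle_algebra\<^esub>" "\<one>\<^bsub>circle_algebra\<^esub>"] by (simp add: carrier_single pair_carrier)
qed

lemma tau_eq_flip: "tau n = flip [Circ] (Toeps n)"
  by (simp add: tau_def flip_def carrier_single)

lemma tmorphism_tau: "tmorphism (tau n)"
  unfolding tau_eq_flip by (intro tmorphism_flip) (simp_all add: calg_list_simps)

section \<open>Gauge invariant words under the structure maps\<close>

definition invariant :: "factor list \<Rightarrow> bool" where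
  "invariant w \<longleftrightarrow> set w \<subseteq> {Inl \<one>\<^bsub>toeplitz\<^esub>, Inl toeplitz_e}"

lemma invariant_carrier: "invariant w \<Longrightarrow> w \<in> carrier (prod_monoid (Toeps (length w)))"
  by (auto simp: prod_carrier_iff invariant_def) (metis (no_types, lifting) Toep_simps(1) image_eqI insertE
      nth_mem singletonD subset_iff toeplitz.one_closed toeplitz_e_closed)

lemma rho_src_tgt [simp]: "src (rho n) = Toeps n" "tgt (rho n) = Toeps n @ [Circ]"
  by (induction n rule: rho.induct) (simp_all add: tau_eq_flip)

abbreviation "circ_one \<equiv> Inr \<one>\<^bsub>circle_algebra\<^esub> :: factor"

lemma circ_one_carrier: "[circ_one] \<in> carrier (prod_monoid [Circ])"
  by (simp add: carrier_single)

text \<open>Enters for \<open>N = 1\<close>, where \<open>Psi\<close> is built on the coaction of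
  the empty tensor product.\<close>

lemma rho_0: "tmorphism (rho 0)" "maps (rho 0) [] [circ_one]"
proof -
  interpret C: calg_list "[Circ]" by (simp add: calg_list_simps)
  interpret E: calg_list "[] :: factor cstar list" by (simp add: calg_list_simps)
  interpret TC: calg "tensor [Circ]" by (rule C.calg_tensor)
  have car: "carrier E.PM = {[]}" and one: "\<one>\<^bsub>E.PM\<^esub> = []"
    by (auto simp: prod_monoid_def)
  obtain h where h: "h \<in> star_hom (tensor []) (tensor [Circ])"
    "h \<in> extensional (carrier (tensor ([] :: factor cstar list)))"
    "\<And>as. as \<in> carrier E.PM \<Longrightarrow> h (elem_tensor [] as) = \<one>\<^bsub>tensor [Circ]\<^esub>"
    by (rule E.tensor_universal[OF C.calg_tensor, of "\<lambda>as. \<one>\<^bsub>tensor [Circ]\<^esub>"]) auto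
  define Q where "Q h \<longleftrightarrow> h \<one>\<^bsub>tensor []\<^esub> = \<one>\<^bsub>tensor [Circ]\<^esub>" for h :: "factor tens \<Rightarrow> factor tens"
  have e1: "elem_tensor [] [] = \<one>\<^bsub>tensor ([] :: factor cstar list)\<^esub>"
    using E.elem_one one by simp
  have Qh: "Q h"
    using star_hom_one[OF h(1)] by (simp add: Q_def)
  have "\<forall>h'\<in>star_hom (tensor []) (tensor [Circ]). Q h'
      \<longrightarrow> (\<forall>x\<in>elem_tensor [] ` carrier E.PM. h' x = h x)"
    using Qh by (auto simp: Q_def car e1)
  note th = tmorphism_hom_where[of "[]" "[Circ]" h Q, OF E.calg_list_axioms C.calg_list_axioms
      h(1,2) Qh E.generates_tensor this]
  have eq: "rho 0 = hom_where [] [Circ] Q"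
    by (simp add: Q_def[abs_def])
  show "tmorphism (rho 0)"
    unfolding eq by (rule th(1))
  have "elem_tensor [Circ] [circ_one] = \<one>\<^bsub>tensor [Circ]\<^esub>"
    using C.elem_one by (simp add: prod_monoid_simps)
  then show "maps (rho 0) [] [circ_one]"
    unfolding eq maps_def src_tgt_simps th(2) using h(3) by (simp add: car carrier_single)
qed

lemma maps_coaction_invariant: "invariant [a] \<Longrightarrow> maps coaction [a] [a, circ_one]"
  using maps_coaction by (auto simp: invariant_def)

lemma maps_tau:
  assumes "ts \<in> carrier (prod_monoid (Toeps n))"
  shows "maps (tau n) (circ_one # ts) (ts @ [circ_one])"
  using maps_flip[of "[Circ]" "Toeps n" "[circ_one]" ts] assms circ_one_carrier
  by (simp add: tau_eq_flip calg_list_simps)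

text \<open>Typing and values follow the same recursion and are proved together. On invariant words
  all circle slots carry the unit, so flipping and multiplying them leaves one unit at the
  end.\<close>

lemma rho_props:
  "tmorphism (rho n) \<and> (\<forall>w. invariant w \<and> length w = n \<longrightarrow> maps (rho n) w (w @ [circ_one]))"
proof (induction n rule: rho.induct)
  case 1
  then show ?case
    using rho_0 by simp
next
  case 2
  have "maps coaction w (w @ [circ_one])" if "invariant w" "length w = 1" for w
    using that maps_coaction_invariant by (cases w) auto
  then show ?case
    using tmorphism_coaction by simp
next
  case (3 n)
  note t = tmorphism_coaction tmorphism_circ_mult tmorphism_tau
  have t1: "tmorphism (coaction \<otimes>\<^sub>t rho (Suc n))"
    using 3 by (intro tmorphism_tmap t) simp
  have t2: "tmorphism (tid (Toeps 1) \<otimes>\<^sub>t tau (Suc n) \<otimes>\<^sub>t tid [Circ])"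
    by (intro tmorphism_tmap t tmorphism_tid) (simp_all add: calg_list_simps)
  have t3: "tmorphism (tid (Toeps (Suc (Suc n))) \<otimes>\<^sub>t circ_mult)"
    by (intro tmorphism_tmap t tmorphism_tid) (simp_all add: calg_list_simps)
  have rep: "Toep # replicate n Toep @ [Circ, Circ] = Toeps (Suc n) @ [Circ] @ [Circ]"
    by simp
  have ts: "tmorphism (rho (Suc (Suc n)))"
    unfolding rho.simps by (intro tmorphism_tcomp t1 t2 t3) (simp_all add: tau_eq_flip)
  have "maps (rho (Suc (Suc n))) w (w @ [circ_one])" if w: "invariant w" "length w = Suc (Suc n)" for w
  proof -
    obtain a v where av: "w = a # v" "length v = Suc n" "invariant [a]" "invariant v"
      using w by (cases w) (auto simp: invariant_def)
    have vc: "v \<in> carrier (prod_monoid (Toeps (Suc n)))" "[a] \<in> carrier (prod_monoid (Toeps 1))"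
      "w \<in> carrier (prod_monoid (Toeps (Suc (Suc n))))"
      using invariant_carrier[OF av(4)] invariant_carrier[OF av(3)] invariant_carrier[OF w(1)] av(2) w(2) by auto
    have "maps (coaction \<otimes>\<^sub>t rho (Suc n)) ([a] @ v) ([a, circ_one] @ v @ [circ_one])"
      using 3 av by (intro maps_tmap t maps_coaction_invariant) auto
    \<comment> \<open>The input is the previous output, regrouped so that the circle slot to be
      flipped stands in front of \<open>v\<close>.\<close>
    moreover have "maps (tid (Toeps 1) \<otimes>\<^sub>t tau (Suc n) \<otimes>\<^sub>t tid [Circ])
        ([a] @ (circ_one # v) @ [circ_one]) ([a] @ (v @ [circ_one]) @ [circ_one])"
      using vc circ_one_carrier
      by (intro maps_tmap t tmorphism_tmap tmorphism_tid maps_tid maps_tau) (simp_all add: calg_list_simps)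
    moreover have "maps (tid (Toeps (Suc (Suc n))) \<otimes>\<^sub>t circ_mult) (w @ [circ_one, circ_one]) (w @ [circ_one])"
      using vc
      by (intro maps_tmap t tmorphism_tid maps_tid maps_circ_mult) (simp_all add: calg_list_simps)
    ultimately show ?thesis
      unfolding rho.simps using av
      by (intro maps_tcomp[where bs = "w @ [circ_one, circ_one]"] maps_tcomp[where bs = "[a, circ_one] @ v @ [circ_one]"]
          tmorphism_tcomp t1 t2) (simp_all add: tau_eq_flip)
  qed
  then show ?case
    using ts by blast
qed

lemma Psi_src_tgt [simp]: "src (Psi N) = Toeps (N - 1) @ [Circ]" "tgt (Psi N) = Toeps (N - 1) @ [Circ]"
  by (simp_all add: Psi_def)

lemma tmorphism_Psi: "tmorphism (Psi N)"
  unfolding Psi_def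
  by (intro tmorphism_tcomp tmorphism_tmap tmorphism_tid tmorphism_antipode tmorphism_circ_mult)
    (simp_all add: calg_list_simps rho_props)

text \<open>Multiplication and antipode both preserve the unit of the circle, so \<open>Psi\<close>
  fixes invariant words that end in it.\<close>

lemma maps_Psi:
  assumes "invariant w" "length w = N - 1"
  shows "maps (Psi N) (w @ [circ_one]) (w @ [circ_one])"
proof -
  have wc: "w \<in> carrier (prod_monoid (Toeps (N - 1)))"
    using invariant_carrier assms by metis
  have t: "tmorphism (antipode \<bullet>\<^sub>t circ_mult)"
    by (intro tmorphism_tcomp tmorphism_antipode tmorphism_circ_mult) simp
  have "maps (rho (N - 1) \<otimes>\<^sub>t tid [Circ]) (w @ [circ_one]) ((w @ [circ_one]) @ [circ_one])"
    using assms circ_one_carrier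
    by (intro maps_tmap tmorphism_tid maps_tid) (simp_all add: calg_list_simps rho_props)
  moreover have "maps (tid (Toeps (N - 1)) \<otimes>\<^sub>t (antipode \<bullet>\<^sub>t circ_mult)) (w @ [circ_one, circ_one]) (w @ [circ_one])"
    using wc by (intro maps_tmap t tmorphism_tid maps_tid maps_tcomp[OF maps_circ_mult maps_antipode] tmorphism_circ_mult)
      (simp_all add: calg_list_simps)
  ultimately show ?thesis
    unfolding Psi_def
    by (intro maps_tcomp[where bs = "w @ [circ_one, circ_one]"] tmorphism_tmap tmorphism_tid)
      (simp_all add: calg_list_simps rho_props)
qed

definition chi_inv :: "nat \<Rightarrow> nat \<Rightarrow> factor tmor" where
  "chi_inv N j = tid (Toeps (j - 1)) \<otimes>\<^sub>t tau (N - j)"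

lemma tiso_chi: "tiso (chi N j) (chi_inv N j)"
proof -
  have "tiso (tau (N - j)) (flip (Toeps (N - j)) [Circ])"
    unfolding tau_eq_flip by (intro tiso_flip) (simp_all add: calg_list_simps)
  then have "tiso (tinv (tau (N - j))) (tau (N - j))"
    using tiso_tinv tiso_sym by metis
  then show ?thesis
    unfolding chi_def chi_inv_def by (intro tiso_tmap tiso_tid) (simp_all add: calg_list_simps)
qed

lemma chi_src_tgt [simp]:
  "src (chi N j) = Toeps (j - 1) @ Toeps (N - j) @ [Circ]" "tgt (chi N j) = Toeps (j - 1) @ Circ # Toeps (N - j)"
  by (simp_all add: chi_def tau_eq_flip)

lemma tinv_chi: "tinv (chi N j) = chi_inv N j"
  by (rule tiso_tinv[OF tiso_chi])

lemma maps_chi_inv: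
  assumes "ts \<in> carrier (prod_monoid (Toeps (j - 1)))" "us \<in> carrier (prod_monoid (Toeps (N - j)))"
  shows "maps (chi_inv N j) (ts @ circ_one # us) (ts @ us @ [circ_one])"
  unfolding chi_inv_def
  using assms by (intro maps_tmap tmorphism_tid maps_tid maps_tau tmorphism_tau) (simp_all add: calg_list_simps)

lemma maps_tiso:
  assumes "tiso f g" "maps g bs as"
  shows "maps f as bs"
proof -
  interpret calg_list "src g"
    using assms by (simp add: tiso_def tmorphism_def)
  show ?thesis
    using assms elem_closed[of bs] by (auto simp: maps_def tiso_def)
qed

lemma Psi_ij_src_tgt [simp]:
  "src (Psi_ij N i j) = Toeps i @ Circ # Toeps (N - (i + 1))" "tgt (Psi_ij N i j) = Toeps (j - 1) @ Circ # Toeps (N - j)"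
  by (simp_all add: Psi_ij_def)

text \<open>Composability of \<open>chi\<close> and \<open>Psi\<close> is an equality of lists;
  \<open>1 \<le> j\<close> guards the truncated difference \<open>j - 1\<close>.\<close>

lemma Toeps_split: "\<lbrakk>1 \<le> j; j \<le> N\<rbrakk> \<Longrightarrow> Toeps (j - 1) @ Toeps (N - j) @ [Circ] = Toeps (N - 1) @ [Circ]"
  by (simp flip: append_assoc replicate_add)

lemma tmorphism_Psi_ij:
  assumes "i < j" "j \<le> N"
  shows "tmorphism (Psi_ij N i j)"
  unfolding Psi_ij_def tinv_chi
  using tiso_chi[of N j] tiso_chi[of N "i + 1"] Toeps_split[of j N] Toeps_split[of "i + 1" N] assms
  by (intro tmorphism_tcomp tmorphism_Psi) (auto simp: tiso_def)

text \<open>Both words become the same invariant word once the circle slot is moved to the end, and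
  \<open>Psi\<close> fixes the result. Only the position of the circle slot changes.\<close>

lemma maps_Psi_ij:
  assumes ij: "i < j" "j \<le> N" and w: "invariant (ts @ us)" "length ts = i" "length us = N - i - 1"
    and eq: "ts @ us = ts' @ us'" "length ts' = j - 1"
  shows "maps (Psi_ij N i j) (ts @ circ_one # us) (ts' @ circ_one # us')"
proof -
  have i: "invariant ts" "invariant us" "invariant ts'" "invariant us'"
    using w(1) w(1)[unfolded eq(1)] by (auto simp: invariant_def)
  have len: "length us' = N - j"
    using arg_cong[OF eq(1), of length] w eq(2) ij by simp
  have c: "ts \<in> carrier (prod_monoid (Toeps ((i + 1) - 1)))" "us \<in> carrier (prod_monoid (Toeps (N - (i + 1))))"
    "ts' \<in> carrier (prod_monoid (Toeps (j - 1)))" "us' \<in> carrier (prod_monoid (Toeps (N - j)))"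
    using invariant_carrier[OF i(1)] invariant_carrier[OF i(2)] invariant_carrier[OF i(3)]
      invariant_carrier[OF i(4)] w eq(2) len by auto
  have "maps (tinv (chi N (i + 1))) (ts @ circ_one # us) ((ts @ us) @ [circ_one])"
    unfolding tinv_chi using maps_chi_inv[OF c(1,2)] by simp
  moreover have "maps (Psi N) ((ts @ us) @ [circ_one]) ((ts @ us) @ [circ_one])"
    using w ij by (intro maps_Psi) auto
  moreover have "maps (chi N j) ((ts @ us) @ [circ_one]) (ts' @ circ_one # us')"
    unfolding eq(1) using maps_tiso[OF tiso_chi maps_chi_inv[OF c(3,4)]] by simp
  ultimately show ?thesis
    unfolding Psi_ij_def
    using Toeps_split[of j N] Toeps_split[of "i + 1" N] ij tiso_chi[of N "i + 1"]
    by (intro maps_tcomp[where bs = "(ts @ us) @ [circ_one]"] tmorphism_tcomp tmorphism_Psi)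
      (auto simp: tinv_chi tiso_def)
qed

lemma sigma_k_src_tgt [simp]:
  "src (sigma_k N k) = Toeps (k - 1) @ Toep # Toeps (N - k)" "tgt (sigma_k N k) = Toeps (k - 1) @ Circ # Toeps (N - k)"
  by (simp_all add: sigma_k_def)

lemma tmorphism_sigma_k: "tmorphism (sigma_k N k)"
  unfolding sigma_k_def
  by (intro tmorphism_tmap tmorphism_tid tmorphism_sigma) (simp_all add: calg_list_simps)

lemma maps_sigma_k:
  assumes "ts \<in> carrier (prod_monoid (Toeps (k - 1)))" "us \<in> carrier (prod_monoid (Toeps (N - k)))"
    "a \<in> carrier toeplitz"
  shows "maps (sigma_k N k) (ts @ Inl a # us) (ts @ Inr (symbol a) # us)"
proof -
  have "maps (sigma_k N k) (ts @ [Inl a] @ us) (ts @ [Inr (symbol a)] @ us)"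
    unfolding sigma_k_def using assms
    by (intro maps_tmap tmorphism_tmap tmorphism_tid maps_tid tmorphism_sigma maps_sigma) (simp_all add: calg_list_simps)
  then show ?thesis by simp
qed

section \<open>The algebra of the quantum projective space\<close>

lemma (in calg) star_alg_sub:
  assumes S: "cstar_sub A S"
  shows "star_alg (A\<lparr>carrier := S\<rparr>)"
proof -
  have c: "x \<in> carrier A" if "x \<in> S" for x
    using S that by (auto simp: cstar_sub_def)
  have z: "\<zero> \<in> S"
    using S zero_smult[OF one_closed] by (metis cstar_sub_def)
  show ?thesis
  proof (rule star_alg.intro)
    show "ring (A\<lparr>carrier := S\<rparr>)"
    proof (intro ringI abelian_groupI monoidI)
      show "\<exists>y\<in>carrier (A\<lparr>carrier := S\<rparr>). y \<oplus>\<^bsub>A\<lparr>carrier := S\<rparr>\<^esub> x = \<zero>\<^bsub>A\<lparr>carrier := S\<rparr>\<^esub>"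
        if "x \<in> carrier (A\<lparr>carrier := S\<rparr>)" for x
      proof
        show "(-1) \<odot> x \<in> carrier (A\<lparr>carrier := S\<rparr>)"
          using that S by (simp add: cstar_sub_def)
        show "(-1) \<odot> x \<oplus>\<^bsub>A\<lparr>carrier := S\<rparr>\<^esub> x = \<zero>\<^bsub>A\<lparr>carrier := S\<rparr>\<^esub>"
          using that c[of x] by (simp add: l_neg flip: a_inv_smult)
      qed
    qed (use S c z in \<open>auto simp: cstar_sub_def ring_simprules\<close>)
    show "star_alg_axioms (A\<lparr>carrier := S\<rparr>)"
      by unfold_locales (use S c in \<open>auto simp: cstar_sub_def smult_add add_smult\<close>)
  qed
qed

lemma (in calg) sub_minus:
  assumes S: "cstar_sub A S" and "x \<in> S" "y \<in> S"
  shows "x \<ominus>\<^bsub>A\<lparr>carrier := S\<rparr>\<^esub> y = x \<ominus> y"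
proof -
  interpret B: star_alg "A\<lparr>carrier := S\<rparr>" using S by (rule star_alg_sub)
  have "x \<in> carrier A" "y \<in> carrier A"
    using assms by (auto simp: cstar_sub_def)
  then show ?thesis
    using B.minus_smult_eq[of x y] assms by (simp add: minus_smult_eq)
qed

lemma (in calg) calg_sub:
  assumes S: "cstar_sub A S"
  shows "calg (A\<lparr>carrier := S\<rparr>)"
proof -
  interpret B: star_alg "A\<lparr>carrier := S\<rparr>" using S by (rule star_alg_sub)
  have c: "x \<in> carrier A" if "x \<in> S" for x
    using S that by (auto simp: cstar_sub_def)
  show ?thesis
  proof unfold_locales
    show "cstar_seminorm (A\<lparr>carrier := S\<rparr>) (cnorm (A\<lparr>carrier := S\<rparr>))"
      using c by (auto simp: cstar_seminorm_def p_triangle p_mult p_star_mult)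
    show "x = \<zero>\<^bsub>A\<lparr>carrier := S\<rparr>\<^esub>" if "x \<in> carrier (A\<lparr>carrier := S\<rparr>)" "cnorm (A\<lparr>carrier := S\<rparr>) x = 0" for x
      using that c definite by simp
    fix s assume s: "\<And>n :: nat. s n \<in> carrier (A\<lparr>carrier := S\<rparr>)"
      and cau: "\<And>e. e > 0 \<Longrightarrow> \<exists>K. \<forall>m\<ge>K. \<forall>n\<ge>K. cnorm (A\<lparr>carrier := S\<rparr>) (s m \<ominus>\<^bsub>A\<lparr>carrier := S\<rparr>\<^esub> s n) < e"
    have sS: "s n \<in> S" for n
      using s by simp
    have "\<exists>x\<in>carrier A. (\<lambda>n. cnorm A (s n \<ominus> x)) \<longlonglongrightarrow> 0"
      by (rule complete) (use cau sS c in \<open>auto simp: sub_minus[OF S]\<close>)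
    then obtain x where x: "x \<in> carrier A" "(\<lambda>n. cnorm A (s n \<ominus> x)) \<longlonglongrightarrow> 0"
      by blast
    have "limit_closed A S"
      using S by (simp add: cstar_sub_def)
    then have "x \<in> S"
      using x sS by (auto intro: limit_closedD)
    then show "\<exists>x\<in>carrier (A\<lparr>carrier := S\<rparr>). (\<lambda>n. cnorm (A\<lparr>carrier := S\<rparr>) (s n \<ominus>\<^bsub>A\<lparr>carrier := S\<rparr>\<^esub> x)) \<longlonglongrightarrow> 0"
      using x sS by (intro bexI[of _ x]) (simp_all add: sub_minus[OF S])
  qed
qed

lemma (in calg) cstar_sub_INT:
  assumes "\<And>k. k \<in> K \<Longrightarrow> cstar_sub A {x \<in> carrier A. Q k x}"
  shows "cstar_sub A {x \<in> carrier A. \<forall>k\<in>K. Q k x}"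
proof -
  have "limit_closed A {x \<in> carrier A. \<forall>k\<in>K. Q k x}"
    unfolding limit_closed_def
  proof (intro allI ballI impI, elim conjE)
    fix s x assume x: "x \<in> carrier A" and s: "\<forall>n. s n \<in> {x \<in> carrier A. \<forall>k\<in>K. Q k x}"
      and lim: "(\<lambda>n. cnorm A (s n \<ominus> x)) \<longlonglongrightarrow> 0"
    have "x \<in> {x \<in> carrier A. Q k x}" if "k \<in> K" for k
    proof (rule limit_closedD[OF _ x _ lim])
      show "limit_closed A {x \<in> carrier A. Q k x}"
        using assms[OF that] by (simp add: cstar_sub_def)
    qed (use s that in blast)
    then show "x \<in> {x \<in> carrier A. \<forall>k\<in>K. Q k x}"
      using x by blast
  qed
  then show ?thesis
    using assms unfolding cstar_sub_def by auto
qed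

lemma finite_product_simps [simp]:
  "carrier (finite_product I A) = I \<rightarrow>\<^sub>E carrier A"
  "monoid.mult (finite_product I A) = (\<lambda>s t. \<lambda>i\<in>I. s i \<otimes>\<^bsub>A\<^esub> t i)"
  "one (finite_product I A) = (\<lambda>i\<in>I. \<one>\<^bsub>A\<^esub>)" "zero (finite_product I A) = (\<lambda>i\<in>I. \<zero>\<^bsub>A\<^esub>)"
  "add (finite_product I A) = (\<lambda>s t. \<lambda>i\<in>I. s i \<oplus>\<^bsub>A\<^esub> t i)"
  "smult (finite_product I A) = (\<lambda>c s. \<lambda>i\<in>I. c \<odot>\<^bsub>A\<^esub> s i)"
  "star (finite_product I A) = (\<lambda>s. \<lambda>i\<in>I. star A (s i))"
  "cnorm (finite_product I A) = (\<lambda>s. MAX i\<in>I. cnorm A (s i))"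
  by (simp_all add: finite_product_def)

context calg
begin

lemma star_alg_product: "star_alg (finite_product I A)"
proof (rule star_alg.intro)
  show "ring (finite_product I A)"
  proof (intro ringI abelian_groupI monoidI)
    show "\<exists>y\<in>carrier (finite_product I A). y \<oplus>\<^bsub>finite_product I A\<^esub> x = \<zero>\<^bsub>finite_product I A\<^esub>"
      if "x \<in> carrier (finite_product I A)" for x
    proof
      show "(\<lambda>i\<in>I. \<ominus> x i) \<in> carrier (finite_product I A)"
        using that by auto
      show "(\<lambda>i\<in>I. \<ominus> x i) \<oplus>\<^bsub>finite_product I A\<^esub> x = \<zero>\<^bsub>finite_product I A\<^esub>"
        using that by (auto intro!: restrict_ext l_neg)
    qed
  qed (auto simp: PiE_iff ring_simprules intro!: extensionalityI[of _ I])
  show "star_alg_axioms (finite_product I A)"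
    by unfold_locales (auto simp: PiE_iff smult_add add_smult intro!: extensionalityI[of _ I])
qed

lemma product_minus:
  assumes "x \<in> I \<rightarrow>\<^sub>E carrier A" "y \<in> I \<rightarrow>\<^sub>E carrier A"
  shows "x \<ominus>\<^bsub>finite_product I A\<^esub> y = (\<lambda>i\<in>I. x i \<ominus> y i)"
proof -
  interpret P: star_alg "finite_product I A" by (rule star_alg_product)
  show ?thesis
    using P.minus_smult_eq[of x y] assms by (auto simp: minus_smult_eq PiE_iff intro!: restrict_ext)
qed

text \<open>Over a finite non-empty index set the maximum is attained, so the C*-identity is that of
  a single component.\<close>

lemma calg_product:
  assumes I: "finite I" "I \<noteq> {}"
  shows "calg (finite_product I A)"
proof -
  interpret P: star_alg "finite_product I A" by (rule star_alg_product)
  let ?N = "\<lambda>s. MAX i\<in>I. cnorm A (s i)"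
  have le: "?N s \<le> c \<longleftrightarrow> (\<forall>i\<in>I. cnorm A (s i) \<le> c)" for s c
    using I by simp
  have ge: "cnorm A (s i) \<le> ?N s" if "i \<in> I" for s i
    using I that by simp
  have ex: "\<exists>i\<in>I. ?N s = cnorm A (s i)" for s
  proof -
    have "?N s \<in> (\<lambda>i. cnorm A (s i)) ` I"
      using I by (intro Max_in) auto
    then show ?thesis by blast
  qed
  have nn: "0 \<le> ?N s" if "s \<in> I \<rightarrow>\<^sub>E carrier A" for s
    using ex[of s] that p_nonneg by (fastforce simp: PiE_iff)
  have cong: "(MAX i\<in>I. cnorm A ((\<lambda>i\<in>I. f i) i)) = (MAX i\<in>I. cnorm A (f i))" for f
    by (rule arg_cong[of _ _ Max]) auto
  show ?thesis
  proof unfold_locales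
    show "cstar_seminorm (finite_product I A) (cnorm (finite_product I A))"
      unfolding cstar_seminorm_def finite_product_simps cong
    proof (intro conjI ballI allI)
      fix x assume x: "x \<in> I \<rightarrow>\<^sub>E carrier A"
      then have xi: "x i \<in> carrier A" if "i \<in> I" for i
        using that by auto
      show "0 \<le> ?N x"
        using x by (rule nn)
      show "?N (\<lambda>i. c \<odot> x i) = cmod c * ?N x" for c
      proof (rule antisym)
        show "?N (\<lambda>i. c \<odot> x i) \<le> cmod c * ?N x"
          unfolding le using xi ge by (auto intro: mult_left_mono)
        obtain i where i: "i \<in> I" "?N x = cnorm A (x i)"
          using ex by blast
        then have "cmod c * ?N x = cnorm A (c \<odot> x i)"
          using xi by simp
        also have "\<dots> \<le> ?N (\<lambda>i. c \<odot> x i)"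
          using ge[OF i(1), of "\<lambda>i. c \<odot> x i"] .
        finally show "cmod c * ?N x \<le> ?N (\<lambda>i. c \<odot> x i)" .
      qed
      show "?N (\<lambda>i. (\<lambda>i\<in>I. star A (x i)) i \<otimes> x i) = (?N x)\<^sup>2"
      proof (rule antisym)
        show "?N (\<lambda>i. (\<lambda>i\<in>I. star A (x i)) i \<otimes> x i) \<le> (?N x)\<^sup>2"
          unfolding le using xi ge[of _ x] p_nonneg by (auto simp: p_star_mult intro!: power_mono)
        obtain i where i: "i \<in> I" "?N x = cnorm A (x i)"
          using ex by blast
        then have "(?N x)\<^sup>2 = cnorm A (star A (x i) \<otimes> x i)"
          using xi by (simp add: p_star_mult)
        also have "\<dots> \<le> ?N (\<lambda>i. (\<lambda>i\<in>I. star A (x i)) i \<otimes> x i)"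
          using ge[OF i(1), of "\<lambda>i. (\<lambda>i\<in>I. star A (x i)) i \<otimes> x i"] i by simp
        finally show "(?N x)\<^sup>2 \<le> ?N (\<lambda>i. (\<lambda>i\<in>I. star A (x i)) i \<otimes> x i)" .
      qed
      fix y assume y: "y \<in> I \<rightarrow>\<^sub>E carrier A"
      then have yi: "y i \<in> carrier A" if "i \<in> I" for i
        using that by auto
      show "?N (\<lambda>i. x i \<oplus> y i) \<le> ?N x + ?N y"
        unfolding le using xi yi ge[of _ x] ge[of _ y] by (auto intro!: order_trans[OF p_triangle] add_mono)
      show "?N (\<lambda>i. x i \<otimes> y i) \<le> ?N x * ?N y"
        unfolding le using xi yi ge[of _ x] ge[of _ y] nn[OF x]
        by (auto intro!: order_trans[OF p_mult] mult_mono)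
    qed
    show "x = \<zero>\<^bsub>finite_product I A\<^esub>" if "x \<in> carrier (finite_product I A)" "cnorm (finite_product I A) x = 0" for x
    proof (rule extensionalityI[of _ I])
      show "x i = \<zero>\<^bsub>finite_product I A\<^esub> i" if "i \<in> I" for i
      proof -
        have xi: "x i \<in> carrier A"
          using that \<open>x \<in> carrier (finite_product I A)\<close> by auto
        have "cnorm A (x i) \<le> 0"
          using ge[OF that, of x] \<open>cnorm (finite_product I A) x = 0\<close> by simp
        then have "cnorm A (x i) = 0"
          using p_nonneg[OF xi] by linarith
        then show ?thesis
          using definite[OF xi] that by simp
      qed
    qed (use that in \<open>auto simp: PiE_iff\<close>)
    fix s assume s: "\<And>n :: nat. s n \<in> carrier (finite_product I A)"
      and cau: "\<And>e. e > 0 \<Longrightarrow> \<exists>K. \<forall>m\<ge>K. \<forall>n\<ge>K. cnorm (finite_product I A) (s m \<ominus>\<^bsub>finite_product I A\<^esub> s n) < e"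
    have si: "s n i \<in> carrier A" if "i \<in> I" for n i
      using s[of n] that by auto
    have d: "cnorm A (s m i \<ominus> s n i) \<le> cnorm (finite_product I A) (s m \<ominus>\<^bsub>finite_product I A\<^esub> s n)" if "i \<in> I" for i m n
      using ge[OF that, of "\<lambda>i\<in>I. s m i \<ominus> s n i"] that s[of m] s[of n] by (simp add: product_minus)
    have "\<exists>x\<in>carrier A. (\<lambda>n. cnorm A (s n i \<ominus> x)) \<longlonglongrightarrow> 0" if "i \<in> I" for i
    proof (rule complete)
      show "\<exists>K. \<forall>m\<ge>K. \<forall>n\<ge>K. cnorm A (s m i \<ominus> s n i) < e" if "e > 0" for e
        using cau[OF that] d[OF \<open>i \<in> I\<close>] by (meson le_less_trans)
    qed (use si that in auto)
    then obtain x where x: "\<And>i. i \<in> I \<Longrightarrow> x i \<in> carrier A" "\<And>i. i \<in> I \<Longrightarrow> (\<lambda>n. cnorm A (s n i \<ominus> x i)) \<longlonglongrightarrow> 0"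
      by metis
    let ?x = "restrict x I"
    have xc: "?x \<in> I \<rightarrow>\<^sub>E carrier A"
      using x by auto
    \<comment> \<open>The finite sum dominates the maximum norm and tends to 0 termwise.\<close>
    have "(\<lambda>n. \<Sum>i\<in>I. cnorm A (s n i \<ominus> x i)) \<longlonglongrightarrow> 0"
      using tendsto_sum[of I "\<lambda>i n. cnorm A (s n i \<ominus> x i)" "\<lambda>i. 0"] x by simp
    then have "(\<lambda>n. cnorm (finite_product I A) (s n \<ominus>\<^bsub>finite_product I A\<^esub> ?x)) \<longlonglongrightarrow> 0"
    proof (rule Lim_null_comparison[rotated], intro always_eventually allI)
      fix n
      have eq: "s n \<ominus>\<^bsub>finite_product I A\<^esub> ?x = (\<lambda>i\<in>I. s n i \<ominus> x i)"
        using s[of n] xc by (auto simp: product_minus intro: restrict_ext)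
      have "?N (\<lambda>i\<in>I. s n i \<ominus> x i) \<le> (\<Sum>i\<in>I. cnorm A (s n i \<ominus> x i))"
        unfolding le using si x I by (auto intro!: member_le_sum)
      moreover have "0 \<le> ?N (\<lambda>i\<in>I. s n i \<ominus> x i)"
        using si x by (intro nn) auto
      ultimately show "norm (cnorm (finite_product I A) (s n \<ominus>\<^bsub>finite_product I A\<^esub> ?x)) \<le> (\<Sum>i\<in>I. cnorm A (s n i \<ominus> x i))"
        by (simp only: eq finite_product_simps) simp
    qed
    then show "\<exists>x\<in>carrier (finite_product I A).
        (\<lambda>n. cnorm (finite_product I A) (s n \<ominus>\<^bsub>finite_product I A\<^esub> x)) \<longlonglongrightarrow> 0"
      by (rule bexI[of _ ?x]) (use x in auto)
  qed
qed

lemma product_proj_star_hom: "i \<in> I \<Longrightarrow> (\<lambda>t. t i) \<in> star_hom (finite_product I A) A"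
  by (rule star_homI) auto

end

lemma kernel_closed_ideal:
  assumes "calg A" "calg B" and f: "f \<in> star_hom A B"
  shows "a_kernel A B f \<in> closed_ideals A"
proof -
  interpret A: calg A by fact
  interpret B: calg B by fact
  interpret ring_hom_ring A B f
    using f by (intro ring_hom_ringI2 A.ring_axioms B.ring_axioms) (simp add: star_hom_def)
  have "limit_closed A {x \<in> carrier A. f x = \<zero>\<^bsub>B\<^esub>}"
    by (rule limit_closed_eq[OF assms(1,2), of f _ 2])
      (use star_hom_dist[OF assms] star_hom_closed[OF f] in auto)
  then have "limit_closed A (a_kernel A B f)"
    by (simp only: a_kernel_def')
  with kernel_is_ideal show ?thesis
    by (simp only: closed_ideals_iff simp_thms)
qed

text \<open>The conditions are indexed by a set of pairs, which displays the carrier as an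
  intersection of equalizers of star-homomorphisms and hence as a C*-subalgebra.\<close>

definition gluing :: "nat \<Rightarrow> (nat \<Rightarrow> factor tens) set" where
  "gluing N = {t \<in> {0..N} \<rightarrow>\<^sub>E carrier (tensor (Toeps N)). \<forall>(i, j)\<in>{(i, j). i < j \<and> j \<le> N}.
     app (sigma_k N j) (t i) = app (Psi_ij N i j) (app (sigma_k N (i + 1)) (t j))}"

lemma CP_eq: "CP N = (finite_product {0..N} (tensor (Toeps N)))\<lparr>carrier := gluing N\<rparr>"
  by (auto simp: CP_def gluing_def intro!: arg_cong[where f = "\<lambda>C. (finite_product {0..N} (tensor (Toeps N)))\<lparr>carrier := C\<rparr>"])

lemma calg_Toeps: "calg (tensor (Toeps N))"
  by (rule calg_list.calg_tensor) (rule calg_list_Toeps)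

lemma Toeps_insert:
  assumes "1 \<le> k" "k \<le> N"
  shows "Toeps (k - 1) @ Toep # Toeps (N - k) = Toeps N"
proof -
  have "Toeps (k - 1) @ Toep # Toeps (N - k) = Toeps (k - 1 + Suc (N - k))"
    by (simp only: replicate_add replicate_Suc)
  also have "k - 1 + Suc (N - k) = N"
    using assms by simp
  finally show ?thesis .
qed

lemma sigma_k_hom:
  assumes "1 \<le> k" "k \<le> N"
  shows "app (sigma_k N k) \<in> star_hom (tensor (Toeps N)) (tensor (Toeps (k - 1) @ Circ # Toeps (N - k)))"
  using tmorphism_sigma_k[of N k] Toeps_insert[OF assms] by (simp add: tmorphism_def)

lemma Psi_ij_hom:
  assumes "i < j" "j \<le> N"
  shows "app (Psi_ij N i j) \<in> star_hom (tensor (Toeps i @ Circ # Toeps (N - (i + 1))))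
    (tensor (Toeps (j - 1) @ Circ # Toeps (N - j)))"
  using tmorphism_Psi_ij[OF assms] by (simp add: tmorphism_def)

lemma calg_mixed: "calg (tensor (Toeps m @ Circ # Toeps n))"
  by (rule calg_list.calg_tensor) (simp add: calg_list_simps)

lemma cstar_sub_gluing: "cstar_sub (finite_product {0..N} (tensor (Toeps N))) (gluing N)"
proof -
  interpret T: calg "tensor (Toeps N)" by (rule calg_Toeps)
  have P: "calg (finite_product {0..N} (tensor (Toeps N)))"
    by (rule T.calg_product) auto
  interpret P: calg "finite_product {0..N} (tensor (Toeps N))" by (rule P)
  have "cstar_sub (finite_product {0..N} (tensor (Toeps N)))
      {t \<in> carrier (finite_product {0..N} (tensor (Toeps N))). \<forall>k\<in>{(i, j). i < j \<and> j \<le> N}.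
        app (sigma_k N (snd k)) (t (fst k))
        = app (Psi_ij N (fst k) (snd k)) (app (sigma_k N (fst k + 1)) (t (snd k)))}"
  proof (rule P.cstar_sub_INT)
    fix k :: "nat \<times> nat" assume k: "k \<in> {(i, j). i < j \<and> j \<le> N}"
    define i j where "i = fst k" and "j = snd k"
    have ij: "i < j" "j \<le> N" "i \<in> {0..N}" "j \<in> {0..N}" "1 \<le> j" "1 \<le> i + 1" "i + 1 \<le> N"
      using k by (auto simp: i_def j_def)
    have s: "app (sigma_k N (i + 1)) \<in> star_hom (tensor (Toeps N)) (tensor (Toeps i @ Circ # Toeps (N - (i + 1))))"
      using sigma_k_hom[of "i + 1" N] ij by simp
    show "cstar_sub (finite_product {0..N} (tensor (Toeps N)))
      {t \<in> carrier (finite_product {0..N} (tensor (Toeps N))).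
        app (sigma_k N (snd k)) (t (fst k))
        = app (Psi_ij N (fst k) (snd k)) (app (sigma_k N (fst k + 1)) (t (snd k)))}"
      unfolding i_def[symmetric] j_def[symmetric]
      by (rule cstar_sub_equalizer[OF P calg_mixed
            star_hom_comp[OF T.product_proj_star_hom[OF ij(3)] sigma_k_hom[OF ij(5,2)]]
            star_hom_comp[OF star_hom_comp[OF T.product_proj_star_hom[OF ij(4)] s] Psi_ij_hom[OF ij(1,2)]]])
  qed
  also have "{t \<in> carrier (finite_product {0..N} (tensor (Toeps N))). \<forall>k\<in>{(i, j). i < j \<and> j \<le> N}.
        app (sigma_k N (snd k)) (t (fst k))
        = app (Psi_ij N (fst k) (snd k)) (app (sigma_k N (fst k + 1)) (t (snd k)))} = gluing N"
    by (auto simp: gluing_def)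
  finally show ?thesis .
qed

lemma calg_CP: "calg (CP N)"
proof -
  interpret T: calg "tensor (Toeps N)" by (rule calg_Toeps)
  interpret P: calg "finite_product {0..N} (tensor (Toeps N))"
    by (rule T.calg_product) auto
  show ?thesis
    unfolding CP_eq by (rule P.calg_sub[OF cstar_sub_gluing])
qed

lemma CP_proj_hom:
  assumes "i \<le> N"
  shows "(\<lambda>t. t i) \<in> star_hom (CP N) (tensor (Toeps N))"
  using assms by (intro star_homI) (auto simp: CP_eq gluing_def)

lemma CP_proj_star_hom:
  assumes "i \<le> N"
  shows "CP_proj N i \<in> star_hom (CP N) (tensor (Toeps N))"
proof -
  interpret C: calg "CP N" by (rule calg_CP)
  show ?thesis
    by (rule star_hom_cong[OF C.star_alg_axioms CP_proj_hom[OF assms]]) (simp add: CP_proj_def)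
qed

lemma ker_proj_eq: "ker_proj N i = {t \<in> carrier (CP N). t i = \<zero>\<^bsub>tensor (Toeps N)\<^esub>}"
  by (auto simp: ker_proj_def a_kernel_def' CP_proj_def)

lemma ker_proj_closed_ideal: "i \<le> N \<Longrightarrow> ker_proj N i \<in> closed_ideals (CP N)"
  unfolding ker_proj_def by (intro kernel_closed_ideal calg_CP calg_Toeps CP_proj_star_hom)

section \<open>A C*-algebra with doubly commuting proper isometries\<close>

text \<open>Finitely supported vectors form the inner product space on which the operators act; the
  completion is taken later, for the algebra of operators, in place of a completion of the
  space.\<close>

definition fsupp :: "('x \<Rightarrow> complex) \<Rightarrow> bool" where
  "fsupp v \<longleftrightarrow> finite {x. v x \<noteq> 0}"

definition vnorm :: "('x \<Rightarrow> complex) \<Rightarrow> real" where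
  "vnorm v = L2_set (\<lambda>x. cmod (v x)) {x. v x \<noteq> 0}"

text \<open>Linear in the first and conjugate linear in the second argument. Summing over the
  support of the first vector alone makes the rules for the second argument free of support
  conditions.\<close>

definition ip :: "('x \<Rightarrow> complex) \<Rightarrow> ('x \<Rightarrow> complex) \<Rightarrow> complex" where
  "ip v w = (\<Sum>x | v x \<noteq> 0. v x * cnj (w x))"

lemma vnorm_superset:
  assumes "finite F" "{x. v x \<noteq> 0} \<subseteq> F"
  shows "vnorm v = L2_set (\<lambda>x. cmod (v x)) F"
  unfolding vnorm_def L2_set_def
  by (rule arg_cong[of _ _ sqrt], rule sum.mono_neutral_left) (use assms in auto)

lemma ip_superset:
  assumes "finite F" "{x. v x \<noteq> 0} \<subseteq> F"
  shows "ip v w = (\<Sum>x\<in>F. v x * cnj (w x))"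
  unfolding ip_def by (rule sum.mono_neutral_left) (use assms in auto)

lemma vnorm_nonneg [simp]: "0 \<le> vnorm v"
  by (simp add: vnorm_def)

lemma fsupp_zero [simp]: "fsupp (\<lambda>x. 0)"
  by (simp add: fsupp_def)

lemma fsupp_add [simp]: "\<lbrakk>fsupp v; fsupp w\<rbrakk> \<Longrightarrow> fsupp (\<lambda>x. v x + w x)"
  unfolding fsupp_def by (rule finite_subset[of _ "{x. v x \<noteq> 0} \<union> {x. w x \<noteq> 0}"]) auto

lemma fsupp_smult [simp]: "fsupp v \<Longrightarrow> fsupp (\<lambda>x. c * v x)"
  unfolding fsupp_def by (rule finite_subset[of _ "{x. v x \<noteq> 0}"]) auto

lemma vnorm_zero [simp]: "vnorm (\<lambda>x. 0) = 0"
  by (simp add: vnorm_def)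

lemma vnorm_add:
  assumes "fsupp v" "fsupp w"
  shows "vnorm (\<lambda>x. v x + w x) \<le> vnorm v + vnorm w"
proof -
  let ?F = "{x. v x \<noteq> 0} \<union> {x. w x \<noteq> 0}"
  have F: "finite ?F"
    using assms by (simp add: fsupp_def)
  have "vnorm (\<lambda>x. v x + w x) = L2_set (\<lambda>x. cmod (v x + w x)) ?F"
    using F by (rule vnorm_superset) auto
  also have "\<dots> \<le> L2_set (\<lambda>x. cmod (v x) + cmod (w x)) ?F"
    by (rule L2_set_mono) (auto intro: norm_triangle_ineq)
  also have "\<dots> \<le> L2_set (\<lambda>x. cmod (v x)) ?F + L2_set (\<lambda>x. cmod (w x)) ?F"
    by (rule L2_set_triangle_ineq)
  also have "\<dots> = vnorm v + vnorm w"
    using vnorm_superset[OF F, of v] vnorm_superset[OF F, of w] by auto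
  finally show ?thesis .
qed

lemma vnorm_smult:
  assumes "fsupp v"
  shows "vnorm (\<lambda>x. c * v x) = cmod c * vnorm v"
proof -
  have "vnorm (\<lambda>x. c * v x) = L2_set (\<lambda>x. cmod (c * v x)) {x. v x \<noteq> 0}"
    using assms by (intro vnorm_superset) (auto simp: fsupp_def)
  also have "\<dots> = cmod c * vnorm v"
    by (simp add: vnorm_def norm_mult L2_set_right_distrib)
  finally show ?thesis .
qed

lemma ip_add_left:
  assumes "fsupp v" "fsupp v'"
  shows "ip (\<lambda>x. v x + v' x) w = ip v w + ip v' w"
proof -
  let ?F = "{x. v x \<noteq> 0} \<union> {x. v' x \<noteq> 0}"
  have F: "finite ?F"
    using assms by (simp add: fsupp_def)
  have "{x. v x + v' x \<noteq> 0} \<subseteq> ?F"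
    by auto
  from ip_superset[OF F this, of w] show ?thesis
    using ip_superset[OF F, of v w] ip_superset[OF F, of v' w] by (auto simp: distrib_right sum.distrib)
qed

lemma ip_smult_left: "fsupp v \<Longrightarrow> ip (\<lambda>x. c * v x) w = c * ip v w"
  using ip_superset[of "{x. v x \<noteq> 0}" "\<lambda>x. c * v x" w]
  by (auto simp: fsupp_def ip_def sum_distrib_left mult.assoc)

lemma ip_add_right: "ip v (\<lambda>x. w x + w' x) = ip v w + ip v w'"
  by (simp add: ip_def distrib_left sum.distrib)

lemma ip_smult_right: "ip v (\<lambda>x. c * w x) = cnj c * ip v w"
  by (simp add: ip_def sum_distrib_left mult_ac)

lemma ip_cnj:
  assumes "fsupp v" "fsupp w"
  shows "ip w v = cnj (ip v w)"
proof -
  let ?F = "{x. v x \<noteq> 0} \<union> {x. w x \<noteq> 0}"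
  have F: "finite ?F"
    using assms by (simp add: fsupp_def)
  show ?thesis
    using ip_superset[OF F, of v w] ip_superset[OF F, of w v] by (auto simp: mult.commute)
qed

lemma ip_self: "cmod (ip v v) = (vnorm v)\<^sup>2"
proof -
  define r where "r = (\<Sum>x | v x \<noteq> 0. (cmod (v x))\<^sup>2)"
  have "ip v v = complex_of_real r"
    unfolding ip_def r_def of_real_sum by (intro sum.cong refl) (simp only: complex_norm_square)
  moreover have "0 \<le> r"
    unfolding r_def by (simp add: sum_nonneg)
  ultimately show ?thesis
    by (simp add: vnorm_def L2_set_def r_def[symmetric])
qed

lemma ip_cauchy_schwarz:
  assumes "fsupp v" "fsupp w"
  shows "cmod (ip v w) \<le> vnorm v * vnorm w"
proof -
  let ?F = "{x. v x \<noteq> 0} \<union> {x. w x \<noteq> 0}"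
  have F: "finite ?F"
    using assms by (simp add: fsupp_def)
  have "cmod (ip v w) = cmod (\<Sum>x\<in>?F. v x * cnj (w x))"
    using ip_superset[OF F, of v w] by auto
  also have "\<dots> \<le> (\<Sum>x\<in>?F. \<bar>cmod (v x)\<bar> * \<bar>cmod (w x)\<bar>)"
    by (rule order_trans[OF norm_sum]) (simp add: norm_mult)
  also have "\<dots> \<le> L2_set (\<lambda>x. cmod (v x)) ?F * L2_set (\<lambda>x. cmod (w x)) ?F"
    by (rule L2_set_mult_ineq)
  also have "\<dots> = vnorm v * vnorm w"
    using vnorm_superset[OF F, of v] vnorm_superset[OF F, of w] by auto
  finally show ?thesis .
qed

section \<open>Bounded operators paired with their adjoints\<close>

type_synonym 'x operator = "('x \<Rightarrow> complex) \<Rightarrow> ('x \<Rightarrow> complex)"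

text \<open>The normalisation on vectors of infinite support makes equality of functions coincide
  with equality on the inner product space, as the ring laws require.\<close>

definition lin_op :: "'x operator \<Rightarrow> bool" where
  "lin_op T \<longleftrightarrow> (\<forall>v. fsupp (T v)) \<and> (\<forall>v. \<not> fsupp v \<longrightarrow> T v = (\<lambda>x. 0))
     \<and> (\<forall>v w. fsupp v \<longrightarrow> fsupp w \<longrightarrow> T (\<lambda>x. v x + w x) = (\<lambda>x. T v x + T w x))
     \<and> (\<forall>c v. fsupp v \<longrightarrow> T (\<lambda>x. c * v x) = (\<lambda>x. c * T v x))
     \<and> (\<exists>C. \<forall>v. fsupp v \<longrightarrow> vnorm (T v) \<le> C * vnorm v)"

definition adjoint_op :: "'x operator \<Rightarrow> 'x operator \<Rightarrow> bool" where
  "adjoint_op T S \<longleftrightarrow> (\<forall>v w. fsupp v \<longrightarrow> fsupp w \<longrightarrow> ip (T v) w = ip v (S w))"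

definition id_op :: "'x operator" where
  "id_op v = (if fsupp v then v else (\<lambda>x. 0))"

text \<open>An operator on the finitely supported vectors is paired with its adjoint; operators vanish on
  vectors of infinite support.\<close>

definition op_algebra :: "('x operator \<times> 'x operator) star_algebra" where
  "op_algebra =
     \<lparr>carrier = {(T, S). lin_op T \<and> lin_op S \<and> adjoint_op T S},
      monoid.mult = (\<lambda>(T, S) (T', S'). (\<lambda>v. T (T' v), \<lambda>v. S' (S v))), one = (id_op, id_op),
      zero = (\<lambda>v x. 0, \<lambda>v x. 0), add = (\<lambda>(T, S) (T', S'). (\<lambda>v x. T v x + T' v x, \<lambda>v x. S v x + S' v x)),
      smult = (\<lambda>c (T, S). (\<lambda>v x. c * T v x, \<lambda>v x. cnj c * S v x)), star = (\<lambda>(T, S). (S, T))\<rparr>"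

lemma op_simps [simp]:
  "(T, S) \<in> carrier op_algebra \<longleftrightarrow> lin_op T \<and> lin_op S \<and> adjoint_op T S"
  "(T, S) \<otimes>\<^bsub>op_algebra\<^esub> (T', S') = (\<lambda>v. T (T' v), \<lambda>v. S' (S v))" "\<one>\<^bsub>op_algebra\<^esub> = (id_op, id_op)"
  "\<zero>\<^bsub>op_algebra\<^esub> = (\<lambda>v x. 0, \<lambda>v x. 0)"
  "(T, S) \<oplus>\<^bsub>op_algebra\<^esub> (T', S') = (\<lambda>v x. T v x + T' v x, \<lambda>v x. S v x + S' v x)"
  "c \<odot>\<^bsub>op_algebra\<^esub> (T, S) = (\<lambda>v x. c * T v x, \<lambda>v x. cnj c * S v x)"
  "star op_algebra (T, S) = (S, T)"
  by (simp_all add: op_algebra_def)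

lemma lin_opD:
  assumes "lin_op T"
  shows "fsupp (T v)" and "\<not> fsupp v \<Longrightarrow> T v = (\<lambda>x. 0)"
    and "\<lbrakk>fsupp v; fsupp w\<rbrakk> \<Longrightarrow> T (\<lambda>x. v x + w x) = (\<lambda>x. T v x + T w x)"
    and "fsupp v \<Longrightarrow> T (\<lambda>x. c * v x) = (\<lambda>x. c * T v x)"
    and "T (\<lambda>x. 0) = (\<lambda>x. 0)"
proof -
  have "\<forall>c v. fsupp v \<longrightarrow> T (\<lambda>x. c * v x) = (\<lambda>x. c * T v x)"
    using assms by (simp add: lin_op_def)
  from this[rule_format, OF fsupp_zero, of 0] show "T (\<lambda>x. 0) = (\<lambda>x. 0)"
    by simp
qed (use assms in \<open>auto simp: lin_op_def\<close>)

lemma lin_op_bounded: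
  assumes "lin_op T"
  obtains C where "C \<ge> 0" "\<And>v. fsupp v \<Longrightarrow> vnorm (T v) \<le> C * vnorm v"
proof -
  obtain C where C: "\<And>v. fsupp v \<Longrightarrow> vnorm (T v) \<le> C * vnorm v"
    using assms by (auto simp: lin_op_def)
  have "vnorm (T v) \<le> \<bar>C\<bar> * vnorm v" if "fsupp v" for v
    using order_trans[OF C[OF that] mult_right_mono[OF abs_ge_self vnorm_nonneg]] .
  then show thesis
    using that[of "\<bar>C\<bar>"] by simp
qed

lemma lin_op_id: "lin_op id_op"
  unfolding lin_op_def by (auto simp: id_op_def intro!: exI[of _ 1])

lemma lin_op_zero: "lin_op (\<lambda>v x. 0)"
  unfolding lin_op_def by (auto intro!: exI[of _ 0])

lemma lin_op_comp:
  assumes T: "lin_op T" and S: "lin_op S"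
  shows "lin_op (\<lambda>v. T (S v))"
proof -
  obtain C where C: "C \<ge> 0" "\<And>v. fsupp v \<Longrightarrow> vnorm (T v) \<le> C * vnorm v"
    using lin_op_bounded[OF T] by blast
  obtain D where D: "D \<ge> 0" "\<And>v. fsupp v \<Longrightarrow> vnorm (S v) \<le> D * vnorm v"
    using lin_op_bounded[OF S] by blast
  have "vnorm (T (S v)) \<le> (C * D) * vnorm v" if "fsupp v" for v
    using order_trans[OF C(2)[OF lin_opD(1)[OF S]] mult_left_mono[OF D(2)[OF that] C(1)]]
    by (simp add: mult.assoc)
  then show ?thesis
    unfolding lin_op_def by (auto simp: lin_opD[OF T] lin_opD[OF S])
qed

lemma lin_op_add:
  assumes T: "lin_op T" and S: "lin_op S"
  shows "lin_op (\<lambda>v x. T v x + S v x)"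
proof -
  obtain C where C: "C \<ge> 0" "\<And>v. fsupp v \<Longrightarrow> vnorm (T v) \<le> C * vnorm v"
    using lin_op_bounded[OF T] by blast
  obtain D where D: "D \<ge> 0" "\<And>v. fsupp v \<Longrightarrow> vnorm (S v) \<le> D * vnorm v"
    using lin_op_bounded[OF S] by blast
  have "vnorm (\<lambda>x. T v x + S v x) \<le> (C + D) * vnorm v" if "fsupp v" for v
    using vnorm_add[OF lin_opD(1)[OF T] lin_opD(1)[OF S], of v v] C(2)[OF that] D(2)[OF that]
    by (simp add: distrib_right)
  then have "\<exists>C. \<forall>v. fsupp v \<longrightarrow> vnorm (\<lambda>x. T v x + S v x) \<le> C * vnorm v"
    by blast
  then show ?thesis
    unfolding lin_op_def
    by (auto simp: lin_opD[OF T] lin_opD[OF S] algebra_simps fun_eq_iff)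
qed

lemma lin_op_smult:
  assumes T: "lin_op T"
  shows "lin_op (\<lambda>v x. c * T v x)"
proof -
  obtain C where C: "C \<ge> 0" "\<And>v. fsupp v \<Longrightarrow> vnorm (T v) \<le> C * vnorm v"
    using lin_op_bounded[OF T] by blast
  have "vnorm (\<lambda>x. c * T v x) \<le> (cmod c * C) * vnorm v" if "fsupp v" for v
    using mult_left_mono[OF C(2)[OF that], of "cmod c"] by (simp add: vnorm_smult lin_opD[OF T] mult.assoc)
  then have "\<exists>C. \<forall>v. fsupp v \<longrightarrow> vnorm (\<lambda>x. c * T v x) \<le> C * vnorm v"
    by blast
  then show ?thesis
    unfolding lin_op_def by (auto simp: lin_opD[OF T] algebra_simps fun_eq_iff)
qed

lemma adjoint_op_sym: "\<lbrakk>lin_op T; lin_op S; adjoint_op T S\<rbrakk> \<Longrightarrow> adjoint_op S T"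
  unfolding adjoint_op_def by (metis complex_cnj_cnj ip_cnj lin_opD(1))

lemma op_closed:
  "adjoint_op id_op id_op" "adjoint_op (\<lambda>v x. 0) (\<lambda>v x. 0)"
  "\<lbrakk>lin_op T; lin_op S; lin_op T'; lin_op S'; adjoint_op T S; adjoint_op T' S'\<rbrakk>
    \<Longrightarrow> adjoint_op (\<lambda>v. T (T' v)) (\<lambda>v. S' (S v))"
  "\<lbrakk>lin_op T; lin_op S; lin_op T'; lin_op S'; adjoint_op T S; adjoint_op T' S'\<rbrakk>
    \<Longrightarrow> adjoint_op (\<lambda>v x. T v x + T' v x) (\<lambda>v x. S v x + S' v x)"
  "\<lbrakk>lin_op T; lin_op S; adjoint_op T S\<rbrakk> \<Longrightarrow> adjoint_op (\<lambda>v x. c * T v x) (\<lambda>v x. cnj c * S v x)"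
  by (auto simp: adjoint_op_def id_op_def lin_opD ip_add_left ip_add_right ip_smult_left ip_smult_right)
    (simp add: ip_def)

lemma lin_op_eqs:
  assumes T: "lin_op T"
  shows "T (id_op v) = T v" "id_op (T v) = T v"
    and "\<lbrakk>lin_op S; lin_op S'\<rbrakk> \<Longrightarrow> T (\<lambda>x. S v x + S' v x) = (\<lambda>x. T (S v) x + T (S' v) x)"
    and "lin_op S \<Longrightarrow> T (\<lambda>x. c * S v x) = (\<lambda>x. c * T (S v) x)"
proof -
  show "T (id_op v) = T v" "id_op (T v) = T v"
    using lin_opD[OF T] by (auto simp: id_op_def)
  show "T (\<lambda>x. S v x + S' v x) = (\<lambda>x. T (S v) x + T (S' v) x)" if "lin_op S" "lin_op S'"
    using that by (intro lin_opD(3)[OF T] lin_opD(1))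
  show "T (\<lambda>x. c * S v x) = (\<lambda>x. c * T (S v) x)" if "lin_op S"
    using that by (intro lin_opD(4)[OF T] lin_opD(1))
qed

lemma star_alg_op: "star_alg (op_algebra :: ('x operator \<times> 'x operator) star_algebra)"
proof (rule star_alg.intro)
  let ?A = "op_algebra :: ('x operator \<times> 'x operator) star_algebra"
  note lin = lin_op_id lin_op_zero lin_op_comp lin_op_add lin_op_smult op_closed lin_op_eqs
  show "ring ?A"
  proof (intro ringI abelian_groupI monoidI)
    show "\<exists>y\<in>carrier ?A. y \<oplus>\<^bsub>?A\<^esub> a = \<zero>\<^bsub>?A\<^esub>" if a: "a \<in> carrier ?A" for a
    proof -
      obtain T S where [simp]: "a = (T, S)" by (cases a)
      have "(-1) \<odot>\<^bsub>?A\<^esub> a \<in> carrier ?A"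
        using a op_closed(5)[of T S "-1"] lin_op_smult[of T "-1"] lin_op_smult[of S "-1"] by simp
      moreover have "(-1) \<odot>\<^bsub>?A\<^esub> a \<oplus>\<^bsub>?A\<^esub> a = \<zero>\<^bsub>?A\<^esub>"
        by simp
      ultimately show ?thesis by blast
    qed
  qed (auto simp: lin add_ac)
  show "star_alg_axioms ?A"
    by unfold_locales (auto simp: lin adjoint_op_sym algebra_simps)
qed

interpretation opa: star_alg "op_algebra :: ('x operator \<times> 'x operator) star_algebra"
  by (rule star_alg_op)

text \<open>Measuring the first component suffices, as an operator and its adjoint have the same
  norm.\<close>

definition op_norm :: "'x operator \<times> 'x operator \<Rightarrow> real" where
  "op_norm a = (SUP v\<in>{v. fsupp v \<and> vnorm v \<le> 1}. vnorm (fst a v))"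

lemma op_norm_upper:
  assumes T: "lin_op T" and v: "fsupp v"
  shows "vnorm (T v) \<le> op_norm (T, S) * vnorm v"
proof -
  obtain C where C: "C \<ge> 0" "\<And>v. fsupp v \<Longrightarrow> vnorm (T v) \<le> C * vnorm v"
    using lin_op_bounded[OF T] by blast
  show ?thesis
  proof (cases "vnorm v = 0")
    case True
    then show ?thesis
      using C(2)[OF v] by simp
  next
    case False
    then have p: "vnorm v > 0"
      using vnorm_nonneg[of v] by linarith
    have "vnorm (T w) \<le> C" if "fsupp w" "vnorm w \<le> 1" for w
      using C(2)[OF that(1)] mult_left_mono[OF that(2) C(1)] by simp
    then have bdd: "bdd_above ((\<lambda>v. vnorm (T v)) ` {v. fsupp v \<and> vnorm v \<le> 1})"
      by (auto simp: bdd_above_def)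
    define w where "w = (\<lambda>x. complex_of_real (1 / vnorm v) * v x)"
    have "vnorm w = \<bar>1 / vnorm v\<bar> * vnorm v"
      unfolding w_def by (simp only: vnorm_smult[OF v] norm_of_real)
    moreover have "fsupp w"
      unfolding w_def using v by (rule fsupp_smult)
    ultimately have w: "fsupp w" "vnorm w \<le> 1"
      using p by auto
    have "T w = (\<lambda>x. complex_of_real (1 / vnorm v) * T v x)"
      unfolding w_def by (rule lin_opD(4)[OF T v])
    then have "vnorm (T w) = vnorm (T v) / vnorm v"
      using p lin_opD(1)[OF T, of v] by (simp add: vnorm_smult norm_divide del: of_real_divide)
    moreover have "vnorm (T w) \<le> op_norm (T, S)"
      unfolding op_norm_def fst_conv using w bdd by (intro cSUP_upper) auto
    ultimately have "vnorm (T v) / vnorm v \<le> op_norm (T, S)"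
      by simp
    then show ?thesis
      using p by (simp add: pos_divide_le_eq)
  qed
qed

lemma op_norm_least:
  assumes "c \<ge> 0" "\<And>v. fsupp v \<Longrightarrow> vnorm (T v) \<le> c * vnorm v"
  shows "op_norm (T, S) \<le> c"
  unfolding op_norm_def fst_conv
proof (rule cSUP_least)
  have "(\<lambda>x. 0) \<in> {v :: 'a \<Rightarrow> complex. fsupp v \<and> vnorm v \<le> 1}"
    by simp
  then show "{v :: 'a \<Rightarrow> complex. fsupp v \<and> vnorm v \<le> 1} \<noteq> {}"
    by blast
  show "vnorm (T v) \<le> c" if "v \<in> {v. fsupp v \<and> vnorm v \<le> 1}" for v
    using assms(2)[of v] mult_left_mono[of "vnorm v" 1 c] that assms(1) by simp
qed

lemma op_norm_nonneg:
  assumes T: "lin_op T"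
  shows "0 \<le> op_norm (T, S)"
proof -
  obtain C where C: "C \<ge> 0" "\<And>v. fsupp v \<Longrightarrow> vnorm (T v) \<le> C * vnorm v"
    using lin_op_bounded[OF T] by blast
  have "vnorm (T w) \<le> C" if "fsupp w" "vnorm w \<le> 1" for w
    using C(2)[OF that(1)] mult_left_mono[OF that(2) C(1)] by simp
  then have "bdd_above ((\<lambda>v. vnorm (T v)) ` {v. fsupp v \<and> vnorm v \<le> 1})"
    by (auto simp: bdd_above_def)
  then have "vnorm (T (\<lambda>x. 0)) \<le> op_norm (T, S)"
    unfolding op_norm_def fst_conv by (intro cSUP_upper) auto
  then show ?thesis
    using vnorm_nonneg[of "T (\<lambda>x. 0)"] by linarith
qed

lemma op_norm_comp:
  assumes "lin_op T" "lin_op T'"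
  shows "op_norm (\<lambda>v. T (T' v), S) \<le> op_norm (T, S1) * op_norm (T', S2)"
proof (rule op_norm_least)
  fix v :: "'a \<Rightarrow> complex" assume v: "fsupp v"
  have "vnorm (T (T' v)) \<le> op_norm (T, S1) * vnorm (T' v)"
    using assms by (intro op_norm_upper lin_opD)
  also have "\<dots> \<le> op_norm (T, S1) * (op_norm (T', S2) * vnorm v)"
    using assms v by (intro mult_left_mono op_norm_upper op_norm_nonneg)
  finally show "vnorm (T (T' v)) \<le> op_norm (T, S1) * op_norm (T', S2) * vnorm v"
    by (simp add: mult.assoc)
next
  show "0 \<le> op_norm (T, S1) * op_norm (T', S2)"
    using assms by (intro mult_nonneg_nonneg op_norm_nonneg)
qed

text \<open>\<open>||T v||^2\<close> is the modulus of the inner product of \<open>v\<close> with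
  \<open>S (T v)\<close>, to which Cauchy-Schwarz applies. It gives one half of the C*-identity and,
  applied to the adjoint, the equality of the two norms.\<close>

lemma op_norm_square_le:
  assumes "lin_op T" "lin_op S" "adjoint_op T S"
  shows "(op_norm (T, S1))\<^sup>2 \<le> op_norm (\<lambda>v. S (T v), S2)"
proof -
  let ?q = "op_norm (\<lambda>v. S (T v), S2)"
  have ST: "lin_op (\<lambda>v. S (T v))"
    using assms by (rule_tac lin_op_comp)
  then have q: "0 \<le> ?q"
    by (rule op_norm_nonneg)
  have "op_norm (T, S1) \<le> sqrt ?q"
  proof (rule op_norm_least)
    fix v :: "'a \<Rightarrow> complex" assume v: "fsupp v"
    note f = lin_opD(1)[OF assms(1)] lin_opD(1)[OF assms(2)]
    have "(vnorm (T v))\<^sup>2 = cmod (ip v (S (T v)))"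
      using assms(3) v f by (simp add: adjoint_op_def flip: ip_self)
    also have "\<dots> \<le> vnorm v * vnorm (S (T v))"
      using v f by (intro ip_cauchy_schwarz)
    also have "\<dots> \<le> vnorm v * (?q * vnorm v)"
      by (intro mult_left_mono op_norm_upper[OF ST v]) simp
    also have "\<dots> = (sqrt ?q * vnorm v)\<^sup>2"
      using q by (simp add: power_mult_distrib power2_eq_square)
    finally show "vnorm (T v) \<le> sqrt ?q * vnorm v"
      using q by (intro power2_le_imp_le[of "vnorm (T v)"]) auto
  qed (use q in simp)
  then have "(op_norm (T, S1))\<^sup>2 \<le> (sqrt ?q)\<^sup>2"
    using assms by (intro power_mono op_norm_nonneg)
  then show ?thesis
    using q by simp
qed

lemma cstar_seminorm_op: "cstar_seminorm op_algebra (op_norm :: 'x operator \<times> 'x operator \<Rightarrow> real)"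
  unfolding cstar_seminorm_def
proof (intro conjI ballI allI)
  fix a :: "'x operator \<times> 'x operator" assume a: "a \<in> carrier op_algebra"
  obtain T S where aTS: "a = (T, S)" by (cases a)
  then have T: "lin_op T" "lin_op S" "adjoint_op T S"
    using a by auto
  show "0 \<le> op_norm a"
    using T aTS op_norm_nonneg by auto
  have le: "op_norm (c \<odot>\<^bsub>op_algebra\<^esub> (T, S)) \<le> cmod c * op_norm (T, S)" if "lin_op T"
    for c and T S :: "'x operator"
    unfolding op_simps
    using that mult_left_mono[OF op_norm_upper[OF that]]
    by (intro op_norm_least) (simp_all add: op_norm_nonneg vnorm_smult lin_opD mult.assoc)
  show "op_norm (c \<odot>\<^bsub>op_algebra\<^esub> a) = cmod c * op_norm a" for c
  proof (cases "c = 0")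
    case True
    have "op_norm (c \<odot>\<^bsub>op_algebra\<^esub> a) \<le> 0"
      using le[OF T(1), of c S] True by (simp only: aTS) simp
    moreover have "0 \<le> op_norm (c \<odot>\<^bsub>op_algebra\<^esub> a)"
      unfolding aTS op_simps using T by (intro op_norm_nonneg lin_op_smult)
    ultimately show ?thesis
      using True by simp
  next
    case False
    have "(1 / c) \<odot>\<^bsub>op_algebra\<^esub> (c \<odot>\<^bsub>op_algebra\<^esub> a) = a"
      using a False by simp
    then have "op_norm a \<le> cmod (1 / c) * op_norm (c \<odot>\<^bsub>op_algebra\<^esub> a)"
      using le[OF lin_op_smult[OF T(1), of c], of "1 / c" "\<lambda>v x. cnj c * S v x"] by (simp only: aTS op_simps)
    then have "cmod c * op_norm a \<le> op_norm (c \<odot>\<^bsub>op_algebra\<^esub> a)"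
      using False by (simp add: norm_divide field_simps)
    then show ?thesis
      using le[OF T(1), of c S] aTS by simp
  qed
  show "op_norm (star op_algebra a \<otimes>\<^bsub>op_algebra\<^esub> a) = (op_norm a)\<^sup>2"
  proof -
    \<comment> \<open>The inequality for squares, applied to \<open>S\<close>, bounds
      \<open>||S||^2\<close> by \<open>||T|| ||S||\<close>; one factor cancels.\<close>
    have "op_norm (S, T) \<le> op_norm (T, S)"
    proof (cases "op_norm (S, T) = 0")
      case False
      have "(op_norm (S, T))\<^sup>2 \<le> op_norm (\<lambda>v. T (S v), S)"
        using T adjoint_op_sym[OF T] by (intro op_norm_square_le)
      also have "\<dots> \<le> op_norm (T, S) * op_norm (S, T)"
        using T by (intro op_norm_comp)
      finally show ?thesis
        using False op_norm_nonneg[OF T(2), of T] by (simp add: power2_eq_square)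
    qed (use op_norm_nonneg[OF T(1)] in simp)
    then have "op_norm (S, T) * op_norm (T, S) \<le> (op_norm (T, S))\<^sup>2"
      using op_norm_nonneg[OF T(1), of S] by (simp add: power2_eq_square mult_right_mono)
    then have "op_norm (\<lambda>v. S (T v), \<lambda>v. S (T v)) \<le> (op_norm (T, S))\<^sup>2"
      using op_norm_comp[OF T(2,1), of "\<lambda>v. S (T v)" T S] by linarith
    moreover have "(op_norm (T, S))\<^sup>2 \<le> op_norm (\<lambda>v. S (T v), \<lambda>v. S (T v))"
      using T by (intro op_norm_square_le)
    ultimately show ?thesis
      by (simp add: aTS)
  qed
  fix b :: "'x operator \<times> 'x operator" assume b: "b \<in> carrier op_algebra"
  obtain T' S' where bTS: "b = (T', S')" by (cases b)
  then have T': "lin_op T'" "lin_op S'" "adjoint_op T' S'"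
    using b by auto
  show "op_norm (a \<otimes>\<^bsub>op_algebra\<^esub> b) \<le> op_norm a * op_norm b"
    unfolding aTS bTS op_simps by (rule op_norm_comp[OF T(1) T'(1)])
  show "op_norm (a \<oplus>\<^bsub>op_algebra\<^esub> b) \<le> op_norm a + op_norm b"
    unfolding aTS bTS op_simps
  proof (rule op_norm_least)
    fix v :: "'x \<Rightarrow> complex" assume v: "fsupp v"
    have "vnorm (\<lambda>x. T v x + T' v x) \<le> vnorm (T v) + vnorm (T' v)"
      using T T' by (intro vnorm_add lin_opD)
    then show "vnorm (\<lambda>x. T v x + T' v x) \<le> (op_norm (T, S) + op_norm (T', S')) * vnorm v"
      using op_norm_upper[OF T(1) v, of S] op_norm_upper[OF T'(1) v, of S'] by (simp add: distrib_right)
  qed (use op_norm_nonneg[OF T(1)] op_norm_nonneg[OF T'(1)] in simp)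
qed

interpretation opa: cstar_semi "op_algebra :: ('x operator \<times> 'x operator) star_algebra" op_norm
  by unfold_locales (rule cstar_seminorm_op)

subsection \<open>The shifts on multi-indices\<close>

definition up :: "nat \<Rightarrow> (nat \<Rightarrow> nat) \<Rightarrow> nat \<Rightarrow> nat" where
  "up i x = x(i := Suc (x i))"

definition down :: "nat \<Rightarrow> (nat \<Rightarrow> nat) \<Rightarrow> nat \<Rightarrow> nat" where
  "down i x = x(i := x i - 1)"

lemma up_down: "down i (up i x) = x" "x i \<noteq> 0 \<Longrightarrow> up i (down i x) = x" "up i x i \<noteq> 0"
  by (auto simp: up_def down_def)

lemma inj_up: "inj (up i)"
  by (rule inj_on_inverseI[of _ "down i"]) (simp add: up_down)

text \<open>The shift of the \<open>i\<close>-th tensor slot. All slots live on one space indexed by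
  multi-indices, which replaces a tensor product of representation spaces.\<close>

definition shift :: "nat \<Rightarrow> (nat \<Rightarrow> nat) operator" where
  "shift i v = (if fsupp v then (\<lambda>x. if x i = 0 then 0 else v (down i x)) else (\<lambda>x. 0))"

definition unshift :: "nat \<Rightarrow> (nat \<Rightarrow> nat) operator" where
  "unshift i v = (if fsupp v then (\<lambda>x. v (up i x)) else (\<lambda>x. 0))"

lemma supp_shift: "fsupp v \<Longrightarrow> {x. shift i v x \<noteq> 0} = up i ` {x. v x \<noteq> 0}"
proof -
  assume v: "fsupp v"
  have "x \<in> up i ` {x. v x \<noteq> 0}" if "shift i v x \<noteq> 0" for x
    using that v up_down(2)[of x i] by (intro image_eqI[of _ _ "down i x"]) (auto simp: shift_def split: if_splits)
  moreover have "shift i v (up i x) \<noteq> 0" if "v x \<noteq> 0" for x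
    using that v by (simp add: shift_def up_down)
  ultimately show ?thesis by auto
qed

lemma supp_unshift: "fsupp v \<Longrightarrow> up i ` {x. unshift i v x \<noteq> 0} \<subseteq> {x. v x \<noteq> 0}"
  by (auto simp: unshift_def)

lemma fsupp_shift [simp]: "fsupp (shift i v)"
proof (cases "fsupp v")
  case True
  then show ?thesis
    using supp_shift[OF True, of i] by (simp add: fsupp_def)
qed (simp add: shift_def)

lemma fsupp_unshift [simp]: "fsupp (unshift i v)"
proof (cases "fsupp v")
  case True
  then have "finite (up i ` {x. unshift i v x \<noteq> 0})"
    using supp_unshift[OF True, of i] finite_subset by (auto simp: fsupp_def)
  then show ?thesis
    unfolding fsupp_def by (rule finite_imageD) (rule inj_on_subset[OF inj_up subset_UNIV])
qed (simp add: unshift_def)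

lemma vnorm_shift: "fsupp v \<Longrightarrow> vnorm (shift i v) = vnorm v"
proof -
  assume v: "fsupp v"
  have "(\<Sum>x\<in>up i ` {x. v x \<noteq> 0}. (cmod (shift i v x))\<^sup>2) = (\<Sum>x | v x \<noteq> 0. (cmod (v x))\<^sup>2)"
    using v by (subst sum.reindex) (auto intro: inj_on_subset[OF inj_up] simp: shift_def up_down)
  then show ?thesis
    using v by (simp add: vnorm_def L2_set_def supp_shift)
qed

lemma vnorm_unshift: "fsupp v \<Longrightarrow> vnorm (unshift i v) \<le> vnorm v"
proof -
  assume v: "fsupp v"
  have "(\<Sum>x | unshift i v x \<noteq> 0. (cmod (unshift i v x))\<^sup>2) = (\<Sum>x\<in>up i ` {x. unshift i v x \<noteq> 0}. (cmod (v x))\<^sup>2)"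
    using v by (subst sum.reindex) (auto intro: inj_on_subset[OF inj_up] simp: unshift_def)
  also have "\<dots> \<le> (\<Sum>x | v x \<noteq> 0. (cmod (v x))\<^sup>2)"
    using v supp_unshift[OF v, of i] by (intro sum_mono2) (auto simp: fsupp_def)
  finally show ?thesis
    by (simp add: vnorm_def L2_set_def)
qed

lemma lin_op_shift: "lin_op (shift i)"
  unfolding lin_op_def
proof (intro conjI allI impI)
  show "\<exists>C. \<forall>v. fsupp v \<longrightarrow> vnorm (shift i v) \<le> C * vnorm v"
    by (intro exI[of _ 1]) (simp add: vnorm_shift)
  show "fsupp (shift i v)" for v
    by simp
qed (auto simp: shift_def)

lemma lin_op_unshift: "lin_op (unshift i)"
  unfolding lin_op_def
proof (intro conjI allI impI)
  show "\<exists>C. \<forall>v. fsupp v \<longrightarrow> vnorm (unshift i v) \<le> C * vnorm v"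
    by (intro exI[of _ 1]) (simp add: vnorm_unshift)
  show "fsupp (unshift i v)" for v
    by simp
qed (auto simp: unshift_def)

lemma adjoint_shift: "adjoint_op (shift i) (unshift i)"
  unfolding adjoint_op_def
proof (intro allI impI)
  fix v w :: "(nat \<Rightarrow> nat) \<Rightarrow> complex" assume v: "fsupp v" and w: "fsupp w"
  have "ip (shift i v) w = (\<Sum>x\<in>up i ` {x. v x \<noteq> 0}. shift i v x * cnj (w x))"
    by (simp add: ip_def supp_shift v)
  also have "\<dots> = ip v (unshift i w)"
    unfolding ip_def using v w
    by (subst sum.reindex) (auto intro: inj_on_subset[OF inj_up] simp: shift_def unshift_def up_down)
  finally show "ip (shift i v) w = ip v (unshift i w)" .
qed

lemma shift_apply: "shift i v x = (if fsupp v \<and> x i \<noteq> 0 then v (down i x) else 0)"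
  and unshift_apply: "unshift i v x = (if fsupp v then v (up i x) else 0)"
  by (auto simp: shift_def unshift_def)

definition shift_op :: "nat \<Rightarrow> (nat \<Rightarrow> nat) operator \<times> (nat \<Rightarrow> nat) operator" where
  "shift_op i = (shift i, unshift i)"

lemma shift_op_closed [simp]: "shift_op i \<in> carrier op_algebra"
  by (simp add: shift_op_def lin_op_shift lin_op_unshift adjoint_shift)

lemma shift_op_isometry: "star op_algebra (shift_op i) \<otimes>\<^bsub>op_algebra\<^esub> shift_op i = \<one>\<^bsub>op_algebra\<^esub>"
proof -
  have "unshift i (shift i v) = id_op v" for v
    by (rule ext) (simp add: unshift_apply shift_apply id_op_def up_down)
  then show ?thesis
    by (simp add: shift_op_def id_op_def[abs_def])
qed

lemma up_commute: "i \<noteq> k \<Longrightarrow> up i (up k x) = up k (up i x)" "i \<noteq> k \<Longrightarrow> down i (up k x) = up k (down i x)"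
  "i \<noteq> k \<Longrightarrow> down i (down k x) = down k (down i x)" "i \<noteq> k \<Longrightarrow> up i x k = x k" "i \<noteq> k \<Longrightarrow> down i x k = x k"
  by (auto simp: up_def down_def fun_upd_twist)

text \<open>Different coordinates do not interact. The mixed relation between a shift and an adjoint
  is included since \<open>star_homs_commute\<close> asks for it.\<close>

lemma shift_commute:
  assumes "i \<noteq> k"
  shows "shift i (shift k v) = shift k (shift i v)" "unshift i (unshift k v) = unshift k (unshift i v)"
    "shift i (unshift k v) = unshift k (shift i v)"
proof -
  note c = up_commute[OF assms] up_commute(4,5)[OF assms[symmetric]]
  show "shift i (shift k v) = shift k (shift i v)"
    by (rule ext) (simp add: shift_apply c)
  show "unshift i (unshift k v) = unshift k (unshift i v)"
    by (rule ext) (simp add: unshift_apply c)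
  show "shift i (unshift k v) = unshift k (shift i v)"
    by (rule ext) (simp add: shift_apply unshift_apply c)
qed

lemma shift_op_commute:
  assumes "i \<noteq> k"
  shows "shift_op i \<otimes>\<^bsub>op_algebra\<^esub> shift_op k = shift_op k \<otimes>\<^bsub>op_algebra\<^esub> shift_op i"
    "shift_op i \<otimes>\<^bsub>op_algebra\<^esub> star op_algebra (shift_op k) = star op_algebra (shift_op k) \<otimes>\<^bsub>op_algebra\<^esub> shift_op i"
  using shift_commute[OF assms] shift_commute[of k i] assms by (auto simp: shift_op_def)

text \<open>The basis vector at the zero multi-index. Every \<open>unshift i\<close> kills it, so
  each projection \<open>1 - shift i (unshift i)\<close> fixes it.\<close>

definition vacuum :: "(nat \<Rightarrow> nat) \<Rightarrow> complex" where
  "vacuum x = (if x = (\<lambda>i. 0) then 1 else 0)"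

lemma fsupp_vacuum [simp]: "fsupp vacuum"
  unfolding fsupp_def by (rule finite_subset[of _ "{\<lambda>i. 0}"]) (auto simp: vacuum_def)

lemma vnorm_vacuum: "vnorm vacuum = 1"
proof -
  have "{x. vacuum x \<noteq> 0} = {\<lambda>i. 0}"
    by (auto simp: vacuum_def)
  then show ?thesis
    by (simp add: vnorm_def L2_set_def vacuum_def)
qed

lemma unshift_vacuum: "unshift i vacuum = (\<lambda>x. 0)"
  by (rule ext) (auto simp: unshift_def vacuum_def up_def dest: fun_cong[of _ _ i])

section \<open>The completed operator algebra and the vacuum vector\<close>

definition shift_alg :: "(nat \<Rightarrow> (nat \<Rightarrow> nat) operator \<times> (nat \<Rightarrow> nat) operator) set cstar" where
  "shift_alg = completion op_algebra op_norm"

definition to_shift_alg where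
  "to_shift_alg = completion_of (op_algebra :: ((nat \<Rightarrow> nat) operator \<times> (nat \<Rightarrow> nat) operator) star_algebra) op_norm"

lemma calg_shift_alg: "calg shift_alg"
  unfolding shift_alg_def by (rule opa.calg_completion)

lemma to_shift_alg: "to_shift_alg \<in> star_hom op_algebra shift_alg"
  unfolding shift_alg_def to_shift_alg_def by (rule opa.completion_of_star_hom)

text \<open>No operator fixing the vacuum vector is zero; this is how the separating homomorphisms are seen
  not to vanish on the elements \<open>bump N S\<close>.\<close>

definition vacuum_fixing where
  "vacuum_fixing = {to_shift_alg (T, S) | T S. (T, S) \<in> carrier op_algebra \<and> T vacuum = vacuum}"

lemma vacuum_fixing_mult:
  assumes "b \<in> vacuum_fixing" "c \<in> vacuum_fixing"
  shows "b \<otimes>\<^bsub>shift_alg\<^esub> c \<in> vacuum_fixing"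
proof -
  obtain T S T' S' where b: "b = to_shift_alg (T, S)" "(T, S) \<in> carrier op_algebra" "T vacuum = vacuum"
    and c: "c = to_shift_alg (T', S')" "(T', S') \<in> carrier op_algebra" "T' vacuum = vacuum"
    using assms by (auto simp: vacuum_fixing_def)
  have "(T, S) \<otimes>\<^bsub>op_algebra\<^esub> (T', S') \<in> carrier op_algebra"
    using b(2) c(2) by (rule opa.m_closed)
  then have "(\<lambda>v. T (T' v), \<lambda>v. S' (S v)) \<in> carrier op_algebra"
    by (simp only: op_simps(2))
  moreover have "b \<otimes>\<^bsub>shift_alg\<^esub> c = to_shift_alg (\<lambda>v. T (T' v), \<lambda>v. S' (S v))"
    using star_hom_mult[OF to_shift_alg b(2) c(2)] by (simp only: b(1) c(1) op_simps(2))
  ultimately show ?thesis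
    unfolding vacuum_fixing_def using b(3) c(3)
    by (intro CollectI exI[of _ "\<lambda>v. T (T' v)"] exI[of _ "\<lambda>v. S' (S v)"] conjI) (simp_all only:)
qed

lemma vacuum_fixing_one: "\<one>\<^bsub>shift_alg\<^esub> \<in> vacuum_fixing"
proof -
  have "(id_op, id_op) \<in> carrier (op_algebra :: ((nat \<Rightarrow> nat) operator \<times> (nat \<Rightarrow> nat) operator) star_algebra)"
    using opa.one_closed by simp
  moreover have "\<one>\<^bsub>shift_alg\<^esub> = to_shift_alg (id_op, id_op)"
    using star_hom_one[OF to_shift_alg] by simp
  ultimately show ?thesis
    unfolding vacuum_fixing_def
    by (intro CollectI exI[of _ id_op] conjI) (simp_all add: id_op_def[of vacuum])
qed

text \<open>The map into the completion preserves \<open>op_norm\<close>, so an operator that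
  becomes zero has norm zero, whereas the vacuum has norm 1 and would be fixed by it.\<close>

lemma vacuum_fixing_zero: "\<zero>\<^bsub>shift_alg\<^esub> \<notin> vacuum_fixing"
proof
  interpret B: calg shift_alg by (rule calg_shift_alg)
  assume "\<zero>\<^bsub>shift_alg\<^esub> \<in> vacuum_fixing"
  then obtain T S where TS: "\<zero>\<^bsub>shift_alg\<^esub> = to_shift_alg (T, S)" "(T, S) \<in> carrier op_algebra" "T vacuum = vacuum"
    by (auto simp: vacuum_fixing_def)
  have "op_norm (T, S) = cnorm shift_alg (to_shift_alg (T, S))"
    using opa.cnorm_completion_of[OF TS(2)] by (simp add: shift_alg_def to_shift_alg_def)
  also have "\<dots> = 0"
    by (simp flip: TS(1))
  finally have "vnorm (T vacuum) \<le> 0 * vnorm vacuum"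
    using op_norm_upper[of T vacuum S] TS(2) by simp
  then show False
    using TS(3) by (simp add: vnorm_vacuum)
qed

definition zeta where "zeta i = to_shift_alg (shift_op i)"

lemma zeta_closed [simp]: "zeta i \<in> carrier shift_alg"
  unfolding zeta_def by (rule star_hom_closed[OF to_shift_alg]) simp

lemma zeta_isometry: "star shift_alg (zeta i) \<otimes>\<^bsub>shift_alg\<^esub> zeta i = \<one>\<^bsub>shift_alg\<^esub>"
  unfolding zeta_def
  using arg_cong[OF shift_op_isometry, of to_shift_alg i]
  by (simp only: star_homD[OF to_shift_alg] shift_op_closed opa.star_closed)

lemma zeta_commute:
  assumes "i \<noteq> k"
  shows "zeta i \<otimes>\<^bsub>shift_alg\<^esub> zeta k = zeta k \<otimes>\<^bsub>shift_alg\<^esub> zeta i"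
    "zeta i \<otimes>\<^bsub>shift_alg\<^esub> star shift_alg (zeta k) = star shift_alg (zeta k) \<otimes>\<^bsub>shift_alg\<^esub> zeta i"
  unfolding zeta_def
  using arg_cong[OF shift_op_commute(1)[OF assms], of to_shift_alg]
    arg_cong[OF shift_op_commute(2)[OF assms], of to_shift_alg]
  by (simp_all only: star_homD[OF to_shift_alg] shift_op_closed opa.star_closed)

lemma zeta_vacuum:
  "\<one>\<^bsub>shift_alg\<^esub> \<ominus>\<^bsub>shift_alg\<^esub> zeta i \<otimes>\<^bsub>shift_alg\<^esub> star shift_alg (zeta i) \<in> vacuum_fixing"
proof -
  interpret B: calg shift_alg by (rule calg_shift_alg)
  let ?a = "\<one>\<^bsub>op_algebra\<^esub> \<ominus>\<^bsub>op_algebra\<^esub> shift_op i \<otimes>\<^bsub>op_algebra\<^esub> star op_algebra (shift_op i)"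
  have ac: "?a \<in> carrier op_algebra"
    by (intro opa.minus_closed opa.m_closed opa.one_closed opa.star_closed shift_op_closed)
  obtain T S where TS: "?a = (T, S)" by (cases ?a)
  have "T = (\<lambda>v x. id_op v x + (-1) * shift i (unshift i v) x)"
  proof -
    have "?a = \<one>\<^bsub>op_algebra\<^esub> \<oplus>\<^bsub>op_algebra\<^esub> (-1) \<odot>\<^bsub>op_algebra\<^esub> (shift_op i \<otimes>\<^bsub>op_algebra\<^esub> star op_algebra (shift_op i))"
      by (intro opa.minus_smult_eq opa.one_closed opa.m_closed opa.star_closed shift_op_closed)
    then show ?thesis
      using TS by (simp add: shift_op_def)
  qed
  then have "T vacuum = vacuum"
    using lin_opD(5)[OF lin_op_shift] by (simp add: unshift_vacuum id_op_def)
  then have "to_shift_alg ?a \<in> vacuum_fixing"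
    using ac unfolding TS vacuum_fixing_def by blast
  moreover have "to_shift_alg ?a = \<one>\<^bsub>shift_alg\<^esub> \<ominus>\<^bsub>shift_alg\<^esub> zeta i \<otimes>\<^bsub>shift_alg\<^esub> star shift_alg (zeta i)"
    unfolding zeta_def
    by (subst star_hom_minus[OF opa.star_alg_axioms B.star_alg_axioms to_shift_alg])
      (simp_all only: star_homD[OF to_shift_alg] shift_op_closed opa.star_closed opa.one_closed opa.m_closed)
  ultimately show ?thesis
    by simp
qed

section \<open>Separating homomorphisms\<close>

text \<open>An ordered product, so that it makes sense before the values of the slot maps are known
  to commute.\<close>

definition fprod :: "('b, 'm) star_algebra_scheme \<Rightarrow> ('a \<Rightarrow> 'b) list \<Rightarrow> 'a list \<Rightarrow> 'b" where
  "fprod B fs as = foldr (\<lambda>(f, a) b. f a \<otimes>\<^bsub>B\<^esub> b) (zip fs as) \<one>\<^bsub>B\<^esub>"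

lemma fprod_simps [simp]:
  "fprod B [] [] = \<one>\<^bsub>B\<^esub>" "fprod B (f # fs) (a # as) = f a \<otimes>\<^bsub>B\<^esub> fprod B fs as"
  by (simp_all add: fprod_def)

lemma fprod_append:
  fixes B :: "('b, 'm) star_algebra_scheme" and fs gs :: "('a \<Rightarrow> 'b) list"
  assumes "star_alg B" "length fs = length as" "length gs = length bs"
    "list_all2 (\<lambda>f a. f a \<in> carrier B) fs as" "list_all2 (\<lambda>f a. f a \<in> carrier B) gs bs"
  shows "fprod B (fs @ gs) (as @ bs) = fprod B fs as \<otimes>\<^bsub>B\<^esub> fprod B gs bs"
    and "fprod B gs bs \<in> carrier B"
proof -
  interpret B: star_alg B by fact
  have c: "fprod B gs bs \<in> carrier B" if "list_all2 (\<lambda>f a. f a \<in> carrier B) gs bs"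
    for gs :: "('a \<Rightarrow> 'b) list" and bs
    using that by (induction rule: list_all2_induct) auto
  show "fprod B gs bs \<in> carrier B"
    using assms(5) by (rule c)
  show "fprod B (fs @ gs) (as @ bs) = fprod B fs as \<otimes>\<^bsub>B\<^esub> fprod B gs bs"
    using assms(4) c[OF assms(5)] c by (induction rule: list_all2_induct) (auto simp: B.m_assoc)
qed

lemma fprod_commute:
  assumes "star_alg B" "list_all2 (\<lambda>f a. f a \<in> carrier B \<and> x \<otimes>\<^bsub>B\<^esub> f a = f a \<otimes>\<^bsub>B\<^esub> x) fs as" "x \<in> carrier B"
  shows "fprod B fs as \<in> carrier B \<and> x \<otimes>\<^bsub>B\<^esub> fprod B fs as = fprod B fs as \<otimes>\<^bsub>B\<^esub> x"
proof -
  interpret B: star_alg B by fact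
  show ?thesis
    using assms(2)
  proof (induction rule: list_all2_induct)
    case (Cons f fs a as)
    then have c: "f a \<in> carrier B" "x \<otimes>\<^bsub>B\<^esub> f a = f a \<otimes>\<^bsub>B\<^esub> x" "fprod B fs as \<in> carrier B"
      by auto
    have "x \<otimes>\<^bsub>B\<^esub> (f a \<otimes>\<^bsub>B\<^esub> fprod B fs as) = f a \<otimes>\<^bsub>B\<^esub> (x \<otimes>\<^bsub>B\<^esub> fprod B fs as)"
      using c assms(3) by (simp flip: B.m_assoc)
    then show ?case
      using Cons assms(3) by (simp add: B.m_assoc)
  qed (use assms(3) in simp)
qed

text \<open>The universal property for several factors with pairwise commuting images:
  \<open>tensor_pair\<close> splits off the first factor, whose values commute with the product of
  the others by \<open>fprod_commute\<close>.\<close>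

lemma tensor_lift:
  fixes B :: "'c cstar" and As :: "'a cstar list"
  assumes "calg B" "calg_list As" "length fs = length As"
    and "\<And>i. i < length As \<Longrightarrow> fs ! i \<in> star_hom (As ! i) B"
    and "\<And>i k x y. \<lbrakk>i < length As; k < length As; i \<noteq> k; x \<in> carrier (As ! i); y \<in> carrier (As ! k)\<rbrakk>
      \<Longrightarrow> (fs ! i) x \<otimes>\<^bsub>B\<^esub> (fs ! k) y = (fs ! k) y \<otimes>\<^bsub>B\<^esub> (fs ! i) x"
  shows "\<exists>h\<in>star_hom (tensor As) B. \<forall>as\<in>carrier (prod_monoid As). h (elem_tensor As as) = fprod B fs as"
  using assms(2-)
proof (induction As arbitrary: fs)
  case Nil
  interpret B: calg B by fact
  interpret E: calg_list "[] :: 'a cstar list" by (rule calg_list_Nil)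
  obtain h where h: "h \<in> star_hom (tensor ([] :: 'a cstar list)) B"
    "\<And>as. as \<in> carrier E.PM \<Longrightarrow> h (elem_tensor [] as) = \<one>\<^bsub>B\<^esub>"
    by (rule E.tensor_universal[OF assms(1), of "\<lambda>as. \<one>\<^bsub>B\<^esub>"]) auto
  have "fprod B fs as = \<one>\<^bsub>B\<^esub>" for as
    using Nil by (simp add: fprod_def)
  then show ?case
    using h by (intro bexI[of _ h]) auto
next
  case (Cons A As)
  interpret B: calg B by fact
  obtain f fs' where fs: "fs = f # fs'" "length fs' = length As"
    using Cons.prems(2) by (cases fs) auto
  have A: "calg A" and As: "calg_list As"
    using Cons.prems(1) by (auto simp: calg_list_Cons)
  interpret A: calg A by (rule A)
  interpret L: calg_list As by (rule As)
  have f: "f \<in> star_hom A B"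
    using Cons.prems(3)[of 0] fs by simp
  have hom': "fs' ! i \<in> star_hom (As ! i) B" if "i < length As" for i
    using Cons.prems(3)[of "Suc i"] that fs by simp
  obtain G where G: "G \<in> star_hom (tensor As) B"
    "\<And>as. as \<in> carrier L.PM \<Longrightarrow> G (elem_tensor As as) = fprod B fs' as"
    using Cons.IH[OF As fs(2) hom'] Cons.prems(4)[of "Suc _" "Suc _"] fs by auto
  obtain F where F: "F \<in> star_hom (tensor [A]) B" "\<And>a. a \<in> carrier A \<Longrightarrow> F (elem_tensor [A] [a]) = f a"
    using single_lift[OF A assms(1) f] by blast
  have comm: "f a \<otimes>\<^bsub>B\<^esub> fprod B fs' bs = fprod B fs' bs \<otimes>\<^bsub>B\<^esub> f a"
    if a: "a \<in> carrier A" and bs: "bs \<in> carrier L.PM" for a bs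
  proof -
    have "list_all2 (\<lambda>g b. g b \<in> carrier B \<and> f a \<otimes>\<^bsub>B\<^esub> g b = g b \<otimes>\<^bsub>B\<^esub> f a) fs' bs"
      unfolding list_all2_conv_all_nth
    proof (intro conjI allI impI)
      show "length fs' = length bs"
        using bs fs by (simp add: prod_carrier_iff)
      fix i assume "i < length fs'"
      then have i: "i < length As" "bs ! i \<in> carrier (As ! i)"
        using bs fs by (auto simp: prod_carrier_iff)
      show "(fs' ! i) (bs ! i) \<in> carrier B"
        using star_hom_closed[OF hom'[OF i(1)] i(2)] .
      show "f a \<otimes>\<^bsub>B\<^esub> (fs' ! i) (bs ! i) = (fs' ! i) (bs ! i) \<otimes>\<^bsub>B\<^esub> f a"
        using Cons.prems(4)[of 0 "Suc i" a "bs ! i"] i a fs by simp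
    qed
    then show ?thesis
      using fprod_commute[OF B.star_alg_axioms] star_hom_closed[OF f a] by blast
  qed
  obtain h where h: "h \<in> star_hom (tensor ([A] @ As)) B"
    "\<And>as bs. \<lbrakk>as \<in> carrier (prod_monoid [A]); bs \<in> carrier L.PM\<rbrakk>
      \<Longrightarrow> h (elem_tensor ([A] @ As) (as @ bs)) = F (elem_tensor [A] as) \<otimes>\<^bsub>B\<^esub> G (elem_tensor As bs)"
  proof (rule tensor_pair[OF calg_list_single[OF A] As assms(1) F(1) G(1)])
    show "F (elem_tensor [A] as) \<otimes>\<^bsub>B\<^esub> G (elem_tensor As bs) = G (elem_tensor As bs) \<otimes>\<^bsub>B\<^esub> F (elem_tensor [A] as)"
      if "as \<in> carrier (prod_monoid [A])" "bs \<in> carrier L.PM" for as bs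
      using that comm by (auto simp: carrier_single F(2) G(2))
  qed blast
  have "h (elem_tensor (A # As) cs) = fprod B fs cs" if cs: "cs \<in> carrier (prod_monoid (A # As))" for cs
  proof -
    have "cs \<in> carrier (prod_monoid ([A] @ As))"
      using cs by simp
    then obtain as bs where ab: "cs = as @ bs" "as \<in> carrier (prod_monoid [A])" "bs \<in> carrier L.PM"
      by (rule prod_append_cases)
    then obtain a where a: "as = [a]" "a \<in> carrier A"
      by (auto simp: carrier_single)
    show ?thesis
      using h(2)[OF ab(2,3)] ab a fs by (simp add: F(2) G(2))
  qed
  then show ?case
    using h(1) by auto
qed

definition tz_rep :: "nat \<Rightarrow> toep \<Rightarrow> (nat \<Rightarrow> (nat \<Rightarrow> nat) operator \<times> (nat \<Rightarrow> nat) operator) set" where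
  "tz_rep l = (SOME h. h \<in> star_hom toeplitz shift_alg \<and> h toeplitz_z = zeta l)"

lemma tz_rep: "tz_rep l \<in> star_hom toeplitz shift_alg" "tz_rep l toeplitz_z = zeta l"
proof -
  have "\<exists>h. h \<in> star_hom toeplitz shift_alg \<and> h toeplitz_z = zeta l"
    using toeplitz_universal[OF calg_shift_alg zeta_closed zeta_isometry] by blast
  from someI_ex[OF this] show "tz_rep l \<in> star_hom toeplitz shift_alg" "tz_rep l toeplitz_z = zeta l"
    by (simp_all add: tz_rep_def)
qed

text \<open>Slots labelled by \<open>S\<close> become scalars that see only the symbol, so such a
  slot can be traded for a circle slot of the same value. Other slots use the shift of their own
  coordinate, so slots with different labels commute.\<close>

definition slot_rep where
  "slot_rep S l = (\<lambda>x :: factor. if l \<in> S then symbol (inv_into UNIV Inl x) 1 \<odot>\<^bsub>shift_alg\<^esub> \<one>\<^bsub>shift_alg\<^esub>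
     else tz_rep l (inv_into UNIV Inl x))"

text \<open>What is left of a slot in \<open>S\<close> after the symbol map has been applied to
  it.\<close>

definition eval_rep where
  "eval_rep = (\<lambda>x :: factor. (inv_into UNIV Inr x :: complex \<Rightarrow> complex) 1 \<odot>\<^bsub>shift_alg\<^esub> \<one>\<^bsub>shift_alg\<^esub>)"

interpretation shift_alg: calg shift_alg
  by (rule calg_shift_alg)

lemma slot_rep_hom: "slot_rep S l \<in> star_hom Toep shift_alg"
proof (cases "l \<in> S")
  case True
  then have "slot_rep S l = (\<lambda>x :: factor. symbol (inv_into UNIV Inl x) 1 \<odot>\<^bsub>shift_alg\<^esub> \<one>\<^bsub>shift_alg\<^esub>)"
    by (simp add: slot_rep_def)
  then show ?thesis
    using star_hom_comp[OF star_hom_comp[OF of_Toep symbol_hom] circle_eval_star_hom[OF shift_alg.star_alg_axioms]]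
    by (simp only:)
next
  case False
  then have "slot_rep S l = (\<lambda>x :: factor. tz_rep l (inv_into UNIV Inl x))"
    by (simp add: slot_rep_def)
  then show ?thesis
    using star_hom_comp[OF of_Toep tz_rep(1)] by (simp only:)
qed

lemma eval_rep_hom: "eval_rep \<in> star_hom Circ shift_alg"
  unfolding eval_rep_def
  using star_hom_comp[OF of_Circ circle_eval_star_hom[OF shift_alg.star_alg_axioms]] .

lemma scalar_commute:
  "b \<in> carrier shift_alg \<Longrightarrow> (c \<odot>\<^bsub>shift_alg\<^esub> \<one>\<^bsub>shift_alg\<^esub>) \<otimes>\<^bsub>shift_alg\<^esub> b = b \<otimes>\<^bsub>shift_alg\<^esub> (c \<odot>\<^bsub>shift_alg\<^esub> \<one>\<^bsub>shift_alg\<^esub>)"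
  by simp

lemma slot_rep_commute:
  assumes "l \<noteq> k" "x \<in> carrier Toep" "y \<in> carrier Toep"
  shows "slot_rep S l x \<otimes>\<^bsub>shift_alg\<^esub> slot_rep S k y = slot_rep S k y \<otimes>\<^bsub>shift_alg\<^esub> slot_rep S l x"
proof -
  note c = star_hom_closed[OF slot_rep_hom assms(2), of S l] star_hom_closed[OF slot_rep_hom assms(3), of S k]
  consider "l \<in> S" | "k \<in> S" | "l \<notin> S" "k \<notin> S"
    by blast
  then show ?thesis
  proof cases
    case 1
    then show ?thesis
      using scalar_commute[OF c(2)] by (simp add: slot_rep_def)
  next
    case 2
    then show ?thesis
      using scalar_commute[OF c(1), symmetric] by (simp add: slot_rep_def)
  next
    case 3
    obtain a b where ab: "x = Inl a" "a \<in> carrier toeplitz" "y = Inl b" "b \<in> carrier toeplitz"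
      using assms by auto
    have "tz_rep l a \<otimes>\<^bsub>shift_alg\<^esub> tz_rep k b = tz_rep k b \<otimes>\<^bsub>shift_alg\<^esub> tz_rep l a"
      by (rule star_homs_commute[OF calg_toeplitz generates_toeplitz tz_rep(1) calg_toeplitz generates_toeplitz
            tz_rep(1) calg_shift_alg _ ab(2,4)])
        (use zeta_commute[OF assms(1)] in \<open>simp add: tz_rep(2)\<close>)
    then show ?thesis
      using 3 ab by (simp add: slot_rep_def)
  qed
qed

lemma eval_rep_commute:
  assumes "b \<in> carrier shift_alg"
  shows "eval_rep y \<otimes>\<^bsub>shift_alg\<^esub> b = b \<otimes>\<^bsub>shift_alg\<^esub> eval_rep y"
  unfolding eval_rep_def using assms by (rule scalar_commute)

text \<open>Position \<open>k\<close> (counted from \<open>0\<close>) of the \<open>j\<close>-th chart carries the coordinate \<open>label j k\<close>.\<close>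

definition label :: "nat \<Rightarrow> nat \<Rightarrow> nat" where
  "label j k = (if k < j then k else Suc k)"

lemma inj_label: "label j k = label j k' \<longleftrightarrow> k = k'"
  by (auto simp: label_def split: if_splits)

section \<open>Chart-wise elementary tensors and the gluing conditions\<close>

definition slot_elem :: "nat set \<Rightarrow> nat \<Rightarrow> factor" where
  "slot_elem S l = (if l \<in> S then Inl \<one>\<^bsub>toeplitz\<^esub> else Inl toeplitz_e)"

definition chart_word :: "nat \<Rightarrow> nat set \<Rightarrow> nat \<Rightarrow> factor list" where
  "chart_word N S j = map (\<lambda>k. slot_elem S (label j k)) [0..<N]"

lemma invariant_chart_word: "invariant (chart_word N S j)"
  by (auto simp: invariant_def chart_word_def slot_elem_def)

lemma chart_word_carrier: "chart_word N S j \<in> carrier (prod_monoid (Toeps N))"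
  using invariant_carrier[OF invariant_chart_word, of N S j] by (simp add: chart_word_def)

definition bump :: "nat \<Rightarrow> nat set \<Rightarrow> nat \<Rightarrow> factor tens" where
  "bump N S = (\<lambda>j\<in>{0..N}. if j \<in> S then elem_tensor (Toeps N) (chart_word N S j) else \<zero>\<^bsub>tensor (Toeps N)\<^esub>)"

lemma split_at:
  assumes "k < length w"
  shows "w = take k w @ w ! k # drop (Suc k) w"
  using assms by (rule id_take_nth_drop)

lemma sigma_k_elem:
  assumes w: "w \<in> carrier (prod_monoid (Toeps N))" and k: "1 \<le> k" "k \<le> N" and a: "w ! (k - 1) = Inl a"
  shows "a \<in> carrier toeplitz"
    and "maps (sigma_k N k) w (take (k - 1) w @ Inr (symbol a) # drop k w)"
    and "src (sigma_k N k) = Toeps N"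
proof -
  have len: "length w = N" and wi: "\<And>i. i < N \<Longrightarrow> w ! i \<in> carrier Toep"
    using w by (auto simp: prod_carrier_iff)
  show ac: "a \<in> carrier toeplitz"
  proof -
    have "k - 1 < N"
      using k by simp
    from wi[OF this, unfolded a] show ?thesis
      by auto
  qed
  have "take (k - 1) w \<in> carrier (prod_monoid (Toeps (k - 1)))" "drop k w \<in> carrier (prod_monoid (Toeps (N - k)))"
    using wi k len by (auto simp: prod_carrier_iff)
  from maps_sigma_k[OF this ac] show "maps (sigma_k N k) w (take (k - 1) w @ Inr (symbol a) # drop k w)"
    using split_at[of "k - 1" w] k len a by simp
  show "src (sigma_k N k) = Toeps N"
    using Toeps_insert[OF k] by simp
qed

lemma sigma_k_zero:
  assumes "1 \<le> k" "k \<le> N"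
  shows "app (sigma_k N k) \<zero>\<^bsub>tensor (Toeps N)\<^esub> = \<zero>\<^bsub>tensor (Toeps (k - 1) @ Circ # Toeps (N - k))\<^esub>"
  using star_hom_zero[OF _ _ sigma_k_hom[OF assms]] calg_Toeps calg_mixed by (auto simp: calg_def)

lemma Psi_ij_zero:
  assumes "i < j" "j \<le> N"
  shows "app (Psi_ij N i j) \<zero>\<^bsub>tensor (Toeps i @ Circ # Toeps (N - (i + 1)))\<^esub>
    = \<zero>\<^bsub>tensor (Toeps (j - 1) @ Circ # Toeps (N - j))\<^esub>"
  using star_hom_zero[OF _ _ Psi_ij_hom[OF assms]] calg_mixed by (auto simp: calg_def)

text \<open>The symbol sends 1 to 1 and \<open>toeplitz_e\<close> to 0, and a zero entry annihilates
  an elementary tensor. Slots of \<open>sigma_k\<close> are counted from 1 but positions in a word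
  from 0, hence \<open>k - 1\<close>.\<close>

lemma sigma_k_chart_word:
  assumes k: "1 \<le> k" "k \<le> N"
  shows "label j (k - 1) \<in> S \<Longrightarrow> app (sigma_k N k) (elem_tensor (Toeps N) (chart_word N S j))
      = elem_tensor (Toeps (k - 1) @ Circ # Toeps (N - k))
        (take (k - 1) (chart_word N S j) @ circ_one # drop k (chart_word N S j))"
    and "label j (k - 1) \<notin> S \<Longrightarrow> app (sigma_k N k) (elem_tensor (Toeps N) (chart_word N S j))
      = \<zero>\<^bsub>tensor (Toeps (k - 1) @ Circ # Toeps (N - k))\<^esub>"
proof -
  let ?w = "chart_word N S j"
  have nth: "?w ! (k - 1) = slot_elem S (label j (k - 1))"
    using nth_map[of "k - 1" "[0..<N]"] k by (simp add: chart_word_def)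
  show "app (sigma_k N k) (elem_tensor (Toeps N) ?w)
      = elem_tensor (Toeps (k - 1) @ Circ # Toeps (N - k)) (take (k - 1) ?w @ circ_one # drop k ?w)"
    if "label j (k - 1) \<in> S"
    using sigma_k_elem(2,3)[OF chart_word_carrier k, of S j "\<one>\<^bsub>toeplitz\<^esub>"] nth that star_hom_one[OF symbol_hom]
    by (simp add: maps_def slot_elem_def)
  show "app (sigma_k N k) (elem_tensor (Toeps N) ?w) = \<zero>\<^bsub>tensor (Toeps (k - 1) @ Circ # Toeps (N - k))\<^esub>"
    if "label j (k - 1) \<notin> S"
  proof -
    let ?L = "Toeps (k - 1) @ Circ # Toeps (N - k)"
    interpret L: calg_list ?L by (simp add: calg_list_simps)
    let ?u = "take (k - 1) ?w @ Inr \<zero>\<^bsub>circle_algebra\<^esub> # drop k ?w"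
    have m: "maps (sigma_k N k) ?w ?u" and s: "src (sigma_k N k) = Toeps N"
      using sigma_k_elem(2,3)[OF chart_word_carrier k, of S j toeplitz_e] nth that
      by (simp_all add: slot_elem_def symbol_e)
    have "length (take (k - 1) ?w) = k - 1"
      using k by (simp add: chart_word_def)
    then have "elem_tensor ?L ?u = \<zero>\<^bsub>tensor ?L\<^esub>"
      using m k by (intro L.elem_zero[of _ "k - 1"]) (simp_all add: maps_def nth_append)
    then show ?thesis
      using m s by (simp add: maps_def)
  qed
qed

text \<open>Chart \<open>j\<close> omits the coordinate \<open>j\<close> and chart \<open>i\<close>
  omits \<open>i\<close>; dropping the other of the two coordinates leaves the same coordinates in
  the same order.\<close>

lemma chart_words_agree:
  assumes "i < j" "j \<le> N"
  shows "take i (chart_word N S j) @ drop (i + 1) (chart_word N S j)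
    = take (j - 1) (chart_word N S i) @ drop j (chart_word N S i)"
proof (rule nth_equalityI)
  fix k assume "k < length (take i (chart_word N S j) @ drop (i + 1) (chart_word N S j))"
  then have k: "k < N - 1"
    using assms by (simp add: chart_word_def)
  have "(take i (chart_word N S j) @ drop (i + 1) (chart_word N S j)) ! k
      = slot_elem S (label j (if k < i then k else k + 1))"
    using assms k by (auto simp: chart_word_def nth_append)
  also have "label j (if k < i then k else k + 1) = label i (if k < j - 1 then k else k + 1)"
    using assms by (auto simp: label_def)
  also have "slot_elem S (label i (if k < j - 1 then k else k + 1))
      = (take (j - 1) (chart_word N S i) @ drop j (chart_word N S i)) ! k"
    using assms k by (auto simp: chart_word_def nth_append)
  finally show "(take i (chart_word N S j) @ drop (i + 1) (chart_word N S j)) ! k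
      = (take (j - 1) (chart_word N S i) @ drop j (chart_word N S i)) ! k" .
qed (use assms in \<open>simp add: chart_word_def\<close>)

text \<open>If \<open>i\<close> and \<open>j\<close> are both in \<open>S\<close>, the two sides are
  one invariant word with its circle slot in the same place. Otherwise both vanish: each component
  is either zero or has \<open>toeplitz_e\<close> in the slot whose symbol is taken.\<close>

lemma bump_closed: "bump N S \<in> carrier (CP N)"
proof -
  interpret T: calg "tensor (Toeps N)" by (rule calg_Toeps)
  interpret L: calg_list "Toeps N" by (rule calg_list_Toeps)
  have "app (sigma_k N j) (bump N S i) = app (Psi_ij N i j) (app (sigma_k N (i + 1)) (bump N S j))"
    if ij: "i < j" "j \<le> N" for i j
  proof -
    have b: "bump N S l = (if l \<in> S then elem_tensor (Toeps N) (chart_word N S l) else \<zero>\<^bsub>tensor (Toeps N)\<^esub>)"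
      if "l \<le> N" for l
      using that by (simp add: bump_def)
    have k: "1 \<le> j" "j \<le> N" "1 \<le> i + 1" "i + 1 \<le> N"
      using ij by auto
    \<comment> \<open>The slot whose symbol is taken in chart \<open>i\<close> carries the
      coordinate of chart \<open>j\<close>, and conversely; because \<open>i < j\<close>, the
      positions are \<open>j - 1\<close> and \<open>i\<close>.\<close>
    have lab: "label i (j - 1) = j" "label j (i + 1 - 1) = i"
      using ij by (auto simp: label_def)
    show ?thesis
    proof (cases "i \<in> S \<and> j \<in> S")
      case True
      let ?ts = "take i (chart_word N S j)" and ?us = "drop (i + 1) (chart_word N S j)"
      have "invariant (?ts @ ?us)"
        using invariant_chart_word[of N S j] set_take_subset[of i "chart_word N S j"]
          set_drop_subset[of "i + 1" "chart_word N S j"] by (auto simp: invariant_def)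
      then have "maps (Psi_ij N i j) (?ts @ circ_one # ?us)
          (take (j - 1) (chart_word N S i) @ circ_one # drop j (chart_word N S i))"
        using ij by (intro maps_Psi_ij chart_words_agree) (simp_all add: chart_word_def)
      then show ?thesis
        using True ij sigma_k_chart_word(1)[OF k(1,2), of i S] sigma_k_chart_word(1)[OF k(3,4), of j S] lab
        by (simp add: b maps_def)
    next
      case False
      have "app (sigma_k N j) (bump N S i) = \<zero>\<^bsub>tensor (Toeps (j - 1) @ Circ # Toeps (N - j))\<^esub>"
        using False ij lab sigma_k_chart_word(2)[OF k(1,2), of i S] sigma_k_zero[OF k(1,2)] by (auto simp: b)
      moreover have "app (sigma_k N (i + 1)) (bump N S j) = \<zero>\<^bsub>tensor (Toeps i @ Circ # Toeps (N - (i + 1)))\<^esub>"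
        using False ij lab sigma_k_chart_word(2)[OF k(3,4), of j S] sigma_k_zero[OF k(3,4)] by (auto simp: b)
      ultimately show ?thesis
        using Psi_ij_zero[OF ij] by simp
    qed
  qed
  moreover have "bump N S \<in> {0..N} \<rightarrow>\<^sub>E carrier (tensor (Toeps N))"
    by (auto simp: bump_def chart_word_carrier)
  ultimately show ?thesis
    by (auto simp: CP_eq gluing_def)
qed

text \<open>The slot of chart \<open>m\<close> carrying the coordinate \<open>j\<close> is read only
  through its symbol, so \<open>h\<close> factors as \<open>g\<close> after
  \<open>sigma_k N j\<close>, and gluing computes the argument of \<open>g\<close> from
  \<open>t j\<close>. Taking \<open>m\<close> least in \<open>S\<close> ensures \<open>m < j\<close>
  for every other \<open>j\<close> in \<open>S\<close>.\<close>

lemma separating_hom: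
  assumes S: "S \<subseteq> {0..N}" "S \<noteq> {}"
  shows "\<exists>\<phi>\<in>star_hom (CP N) shift_alg. \<phi> (bump N S) \<noteq> \<zero>\<^bsub>shift_alg\<^esub>
    \<and> (\<forall>j\<in>S. \<forall>t\<in>ker_proj N j. \<phi> t = \<zero>\<^bsub>shift_alg\<^esub>)"
proof -
  interpret L: calg_list "Toeps N" by (rule calg_list_Toeps)
  define m where "m = Min S"
  have fin: "finite S"
    using S finite_subset by blast
  have m: "m \<in> S" "\<And>j. j \<in> S \<Longrightarrow> m \<le> j" "m \<le> N"
    using S(1) Min_in[OF fin S(2)] Min_le[OF fin] unfolding m_def[symmetric] by auto
  define fs where "fs = map (\<lambda>k. slot_rep S (label m k)) [0..<N]"
  have lfs: "length fs = N" "\<And>i. i < N \<Longrightarrow> fs ! i = slot_rep S (label m i)"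
    by (simp_all add: fs_def)
  have "\<exists>h\<in>star_hom (tensor (Toeps N)) shift_alg.
      \<forall>as\<in>carrier L.PM. h (elem_tensor (Toeps N) as) = fprod shift_alg fs as"
    using lfs by (intro tensor_lift calg_shift_alg calg_list_Toeps)
      (simp_all add: slot_rep_hom slot_rep_commute inj_label)
  then obtain h where h: "h \<in> star_hom (tensor (Toeps N)) shift_alg"
    "\<And>as. as \<in> carrier L.PM \<Longrightarrow> h (elem_tensor (Toeps N) as) = fprod shift_alg fs as"
    by blast
  have "(\<lambda>t. h (t m)) \<in> star_hom (CP N) shift_alg"
    by (rule star_hom_comp[OF CP_proj_hom[OF m(3)] h(1)])
  moreover have "h (bump N S m) \<noteq> \<zero>\<^bsub>shift_alg\<^esub>"
  proof -
    \<comment> \<open>For \<open>l\<close> in \<open>S\<close> the value is the unit, otherwise it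
      is \<open>1 - zeta l star (zeta l)\<close>. Products of such elements stay vacuum fixing,
      hence nonzero.\<close>
    have el: "slot_rep S l (slot_elem S l) \<in> vacuum_fixing" for l
    proof (cases "l \<in> S")
      case True
      then show ?thesis
        using vacuum_fixing_one star_hom_one[OF symbol_hom]
        by (simp add: slot_rep_def slot_elem_def circle_algebra_simps)
    next
      case False
      have "tz_rep l toeplitz_e = \<one>\<^bsub>shift_alg\<^esub> \<ominus>\<^bsub>shift_alg\<^esub> zeta l \<otimes>\<^bsub>shift_alg\<^esub> star shift_alg (zeta l)"
        unfolding toeplitz_e_def
        by (subst star_hom_minus[OF toeplitz.star_alg_axioms shift_alg.star_alg_axioms tz_rep(1)])
          (simp_all add: star_homD[OF tz_rep(1)] tz_rep(2))
      then show ?thesis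
        using zeta_vacuum[of l] False by (simp add: slot_rep_def slot_elem_def)
    qed
    have "fprod shift_alg (map (slot_rep S) ls) (map (slot_elem S) ls) \<in> vacuum_fixing" for ls
      by (induction ls) (simp_all add: vacuum_fixing_one vacuum_fixing_mult el)
    from this[of "map (label m) [0..<N]"] have "fprod shift_alg fs (chart_word N S m) \<in> vacuum_fixing"
      by (simp add: fs_def chart_word_def o_def)
    then show ?thesis
      using vacuum_fixing_zero m h(2)[OF chart_word_carrier] by (auto simp: bump_def)
  qed
  moreover have "h (t m) = \<zero>\<^bsub>shift_alg\<^esub>" if j: "j \<in> S" and t: "t \<in> ker_proj N j" for j t
  proof (cases "j = m")
    case True
    then show ?thesis
      using t star_hom_zero[OF _ _ h(1)] calg_Toeps calg_shift_alg by (auto simp: ker_proj_eq calg_def)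
  next
    case False
    then have jm: "m < j" "j \<le> N" "1 \<le> j"
      using m j S by fastforce+
    let ?L = "Toeps (j - 1) @ Circ # Toeps (N - j)"
    have Lup: "?L = (Toeps N)[j - 1 := Circ]"
      unfolding Toeps_insert[OF jm(3,2), symmetric] by (simp add: list_update_append)
    \<comment> \<open>In chart \<open>m\<close> the coordinate \<open>j > m\<close> sits at position
      \<open>j - 1\<close>; only that slot map changes.\<close>
    define fs' where "fs' = fs[j - 1 := eval_rep]"
    have nth': "?L ! i = (if i = j - 1 then Circ else Toep)" "fs' ! i = (if i = j - 1 then eval_rep else fs ! i)"
      if "i < N" for i
      using that lfs jm unfolding Lup fs'_def by (auto simp: nth_list_update)
    have len: "length ?L = N" "length fs' = N"
      using jm lfs by (simp_all add: fs'_def)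
    have "\<exists>g\<in>star_hom (tensor ?L) shift_alg.
        \<forall>as\<in>carrier (prod_monoid ?L). g (elem_tensor ?L as) = fprod shift_alg fs' as"
    proof (rule tensor_lift[OF calg_shift_alg])
      show "calg_list ?L"
        by (simp add: calg_list_simps)
      show "length fs' = length ?L"
        using len by simp
      show "fs' ! i \<in> star_hom (?L ! i) shift_alg" if "i < length ?L" for i
        using that nth'[of i] unfolding len by (simp add: eval_rep_hom slot_rep_hom lfs)
      show "(fs' ! i) x \<otimes>\<^bsub>shift_alg\<^esub> (fs' ! k) y = (fs' ! k) y \<otimes>\<^bsub>shift_alg\<^esub> (fs' ! i) x"
        if "i < length ?L" "k < length ?L" "i \<noteq> k" "x \<in> carrier (?L ! i)" "y \<in> carrier (?L ! k)" for i k x y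
      proof -
        have ik: "i < N" "k < N"
          using that(1,2) unfolding len by auto
        have "eval_rep z \<otimes>\<^bsub>shift_alg\<^esub> slot_rep S l u = slot_rep S l u \<otimes>\<^bsub>shift_alg\<^esub> eval_rep z"
          if "u \<in> carrier Toep" for z l u
          by (rule eval_rep_commute[OF star_hom_closed[OF slot_rep_hom that]])
        then show ?thesis
          using that(3-5) ik unfolding nth'[OF ik(1)] nth'[OF ik(2)]
          by (auto simp: lfs slot_rep_commute inj_label simp del: Toep_simps Circ_simps split: if_splits)
      qed
    qed
    then obtain g where g: "g \<in> star_hom (tensor ?L) shift_alg"
      "\<And>as. as \<in> carrier (prod_monoid ?L) \<Longrightarrow> g (elem_tensor ?L as) = fprod shift_alg fs' as"
      by blast
    \<comment> \<open>On elementary tensors the two ordered products differ only at position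
      \<open>j - 1\<close>, where both give the value of the symbol at 1.\<close>
    have gh: "g (app (sigma_k N j) x) = h x" if "x \<in> carrier (tensor (Toeps N))" for x
    proof (rule L.tensor_hom_eqI[OF calg_shift_alg star_hom_comp[OF sigma_k_hom[OF jm(3,2)] g(1)] h(1) _ that])
      fix as assume as: "as \<in> carrier L.PM"
      then have la: "length as = N" and asi: "\<And>i. i < N \<Longrightarrow> as ! i \<in> carrier Toep"
        by (auto simp: prod_carrier_iff)
      have "j - 1 < N"
        using jm by simp
      from asi[OF this] obtain a where a: "as ! (j - 1) = Inl a"
        by auto
      note sg = sigma_k_elem[OF as jm(3,2) a]
      let ?ts = "take (j - 1) as" and ?us = "drop j as"
      have lab: "label m (j - 1) = j"
        using jm by (auto simp: label_def)
      have fseq: "fs = take (j - 1) fs @ slot_rep S j # drop j fs"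
        using split_at[of "j - 1" fs] lfs jm lab by simp
      have fs'eq: "fs' = take (j - 1) fs @ eval_rep # drop j fs"
        using upd_conv_take_nth_drop[of "j - 1" fs eval_rep] lfs jm by (simp add: fs'_def)
      have aseq: "as = ?ts @ Inl a # ?us"
        using split_at[of "j - 1" as] la jm a by simp
      have all: "list_all2 (\<lambda>f a. f a \<in> carrier shift_alg) fs as"
        using lfs la asi star_hom_closed[OF slot_rep_hom] by (auto simp: list_all2_conv_all_nth)
      have l1: "list_all2 (\<lambda>f a. f a \<in> carrier shift_alg) (take (j - 1) fs) ?ts"
        and l2: "list_all2 (\<lambda>f a. f a \<in> carrier shift_alg) (drop j fs) ?us"
        using all by (auto intro: list_all2_takeI list_all2_dropI)
      have val: "slot_rep S j (Inl a) = eval_rep (Inr (symbol a))"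
        using j by (simp add: slot_rep_def eval_rep_def)
      have vc: "eval_rep (Inr (symbol a)) \<in> carrier shift_alg"
        by (simp add: eval_rep_def)
      have lens: "length (take (j - 1) fs) = length ?ts" "length (drop j fs) = length ?us"
        using lfs la by auto
      have "fprod shift_alg fs' (?ts @ Inr (symbol a) # ?us)
          = fprod shift_alg (take (j - 1) fs) ?ts \<otimes>\<^bsub>shift_alg\<^esub> (eval_rep (Inr (symbol a)) \<otimes>\<^bsub>shift_alg\<^esub> fprod shift_alg (drop j fs) ?us)"
        unfolding fs'eq using lens l1 l2 vc by (subst fprod_append(1)[OF shift_alg.star_alg_axioms]) auto
      also have "\<dots> = fprod shift_alg (take (j - 1) fs @ slot_rep S j # drop j fs) (?ts @ Inl a # ?us)"
        using lens l1 l2 vc val by (subst fprod_append(1)[OF shift_alg.star_alg_axioms]) auto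
      finally have "fprod shift_alg fs' (?ts @ Inr (symbol a) # ?us) = fprod shift_alg fs as"
        by (simp only: flip: fseq aseq)
      moreover have "app (sigma_k N j) (elem_tensor (Toeps N) as) = elem_tensor ?L (?ts @ Inr (symbol a) # ?us)"
        "?ts @ Inr (symbol a) # ?us \<in> carrier (prod_monoid ?L)"
        using sg(2,3) by (simp_all add: maps_def)
      ultimately show "g (app (sigma_k N j) (elem_tensor (Toeps N) as)) = h (elem_tensor (Toeps N) as)"
        using g(2) h(2)[OF as] by simp
    qed
    have tc: "t \<in> carrier (CP N)" "t j = \<zero>\<^bsub>tensor (Toeps N)\<^esub>"
      using t by (auto simp: ker_proj_eq)
    \<comment> \<open>The gluing condition is available in this direction because
      \<open>m < j\<close>.\<close>
    then have "app (sigma_k N j) (t m) = app (Psi_ij N m j) (app (sigma_k N (m + 1)) (t j))"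
      using jm by (auto simp: CP_eq gluing_def)
    also have "\<dots> = \<zero>\<^bsub>tensor ?L\<^esub>"
      using tc jm sigma_k_zero[of "m + 1" N] Psi_ij_zero[OF jm(1,2)] by simp
    finally have "g (app (sigma_k N j) (t m)) = \<zero>\<^bsub>shift_alg\<^esub>"
      using star_hom_zero[OF _ _ g(1)] calg_mixed calg_shift_alg by (auto simp: calg_def)
    moreover have "t m \<in> carrier (tensor (Toeps N))"
      using tc m by (auto simp: CP_eq gluing_def)
    ultimately show ?thesis
      using gh by simp
  qed
  ultimately show ?thesis
    by (intro bexI[of _ "\<lambda>t. h (t m)"]) auto
qed

section \<open>Freeness of distributive lattices\<close>

locale dlattice =
  fixes L :: "'l set" and j m :: "'l \<Rightarrow> 'l \<Rightarrow> 'l"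
  assumes dl: "distrib_lattice_on L j m"
begin

definition le (infix "\<sqsubseteq>" 50) where
  "x \<sqsubseteq> y \<longleftrightarrow> j x y = y"

lemma closed [simp]: "x \<in> L \<Longrightarrow> y \<in> L \<Longrightarrow> j x y \<in> L" "x \<in> L \<Longrightarrow> y \<in> L \<Longrightarrow> m x y \<in> L"
  using dl by (simp_all add: distrib_lattice_on_def)

lemma comm: "x \<in> L \<Longrightarrow> y \<in> L \<Longrightarrow> j x y = j y x" "x \<in> L \<Longrightarrow> y \<in> L \<Longrightarrow> m x y = m y x"
  using dl unfolding distrib_lattice_on_def by blast+

lemma assoc: "x \<in> L \<Longrightarrow> y \<in> L \<Longrightarrow> z \<in> L \<Longrightarrow> j (j x y) z = j x (j y z)"
  "x \<in> L \<Longrightarrow> y \<in> L \<Longrightarrow> z \<in> L \<Longrightarrow> m (m x y) z = m x (m y z)"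
  using dl unfolding distrib_lattice_on_def by blast+

lemma absorb: "x \<in> L \<Longrightarrow> y \<in> L \<Longrightarrow> j x (m x y) = x" "x \<in> L \<Longrightarrow> y \<in> L \<Longrightarrow> m x (j x y) = x"
  using dl unfolding distrib_lattice_on_def by blast+

lemma distrib: "x \<in> L \<Longrightarrow> y \<in> L \<Longrightarrow> z \<in> L \<Longrightarrow> m x (j y z) = j (m x y) (m x z)"
  using dl unfolding distrib_lattice_on_def by blast

lemma le_refl: "x \<in> L \<Longrightarrow> x \<sqsubseteq> x"
  using absorb(1)[of x "j x x"] absorb(2)[of x x] by (simp add: le_def)

lemma le_antisym: "x \<in> L \<Longrightarrow> y \<in> L \<Longrightarrow> x \<sqsubseteq> y \<Longrightarrow> y \<sqsubseteq> x \<Longrightarrow> x = y"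
  using comm(1)[of x y] by (simp add: le_def)

lemma le_trans: "x \<in> L \<Longrightarrow> y \<in> L \<Longrightarrow> z \<in> L \<Longrightarrow> x \<sqsubseteq> y \<Longrightarrow> y \<sqsubseteq> z \<Longrightarrow> x \<sqsubseteq> z"
  using assoc(1)[of x y z] by (simp add: le_def)

lemma le_meet_eq: "x \<in> L \<Longrightarrow> y \<in> L \<Longrightarrow> x \<sqsubseteq> y \<longleftrightarrow> m x y = x"
  using absorb(2)[of x y] absorb(1)[of y x] comm(1)[of x y] comm(2)[of x y] unfolding le_def by auto

lemma join_le: "x \<in> L \<Longrightarrow> y \<in> L \<Longrightarrow> z \<in> L \<Longrightarrow> j x y \<sqsubseteq> z \<longleftrightarrow> x \<sqsubseteq> z \<and> y \<sqsubseteq> z"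
proof -
  assume a: "x \<in> L" "y \<in> L" "z \<in> L"
  have "x \<sqsubseteq> j x y" "y \<sqsubseteq> j x y"
    using a le_refl[of x] le_refl[of y] comm(1)[of x y] assoc(1)[of x x y, symmetric] assoc(1)[of y y x, symmetric]
    by (simp_all add: le_def)
  moreover have "j x y \<sqsubseteq> z" if "x \<sqsubseteq> z" "y \<sqsubseteq> z"
    using that a by (simp add: le_def assoc)
  ultimately show ?thesis
    using a le_trans[of x "j x y" z] le_trans[of y "j x y" z] by auto
qed

lemma le_meet: "x \<in> L \<Longrightarrow> y \<in> L \<Longrightarrow> z \<in> L \<Longrightarrow> z \<sqsubseteq> m x y \<longleftrightarrow> z \<sqsubseteq> x \<and> z \<sqsubseteq> y"
proof -
  assume a: "x \<in> L" "y \<in> L" "z \<in> L"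
  have "m x y \<sqsubseteq> x" "m x y \<sqsubseteq> y"
    using a absorb(1)[of x y] absorb(1)[of y x] comm by (simp_all add: le_def)
  moreover have "z \<sqsubseteq> m x y" if "z \<sqsubseteq> x" "z \<sqsubseteq> y"
    using that a by (simp add: le_meet_eq flip: assoc)
  ultimately show ?thesis
    using a le_trans[of z "m x y" x] le_trans[of z "m x y" y] by auto
qed

lemma eqI_below:
  assumes "x \<in> L" "y \<in> L" "\<And>z. z \<in> L \<Longrightarrow> z \<sqsubseteq> x \<longleftrightarrow> z \<sqsubseteq> y"
  shows "x = y"
  using assms le_refl le_antisym by blast

lemma eqI_above:
  assumes "x \<in> L" "y \<in> L" "\<And>z. z \<in> L \<Longrightarrow> x \<sqsubseteq> z \<longleftrightarrow> y \<sqsubseteq> z"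
  shows "x = y"
  using assms le_refl le_antisym by blast

text \<open>Finite meets and joins are described by their lower and upper bounds instead of folds,
  so equations between them reduce to \<open>eqI_below\<close> and \<open>eqI_above\<close>.\<close>

lemma finite_meet:
  assumes "finite S" "S \<noteq> {}" "f ` S \<subseteq> L"
  shows "\<exists>u\<in>L. \<forall>z\<in>L. z \<sqsubseteq> u \<longleftrightarrow> (\<forall>i\<in>S. z \<sqsubseteq> f i)"
  using assms
proof (induction rule: finite_ne_induct)
  case (insert i S)
  then obtain u where "u \<in> L" "\<forall>z\<in>L. z \<sqsubseteq> u \<longleftrightarrow> (\<forall>i\<in>S. z \<sqsubseteq> f i)"
    by auto
  then show ?case
    using insert.prems by (intro bexI[of _ "m (f i) u"]) (auto simp: le_meet)
qed auto

text \<open>The last clause records that meeting with \<open>c\<close> distributes over this join;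
  it is established together with existence, so no separate finite distributive law is needed
  later.\<close>

definition is_sup :: "'l \<Rightarrow> 'a set \<Rightarrow> ('a \<Rightarrow> 'l) \<Rightarrow> bool" where
  "is_sup u S f \<longleftrightarrow> u \<in> L \<and> (\<forall>z\<in>L. u \<sqsubseteq> z \<longleftrightarrow> (\<forall>i\<in>S. f i \<sqsubseteq> z))
     \<and> (\<forall>c\<in>L. \<forall>z\<in>L. m c u \<sqsubseteq> z \<longleftrightarrow> (\<forall>i\<in>S. m c (f i) \<sqsubseteq> z))"

lemma finite_sup:
  assumes "finite S" "S \<noteq> {}" "f ` S \<subseteq> L"
  shows "\<exists>u. is_sup u S f"
  using assms
proof (induction rule: finite_ne_induct)
  case (insert i S)
  then obtain u where "is_sup u S f"
    by auto
  then show ?case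
    using insert.prems by (intro exI[of _ "j (f i) u"]) (auto simp: is_sup_def join_le distrib)
qed (auto simp: is_sup_def)

end

text \<open>In the free lattice every element is the join, over the sets \<open>S\<close> of generators that it
  satisfies, of the meet of \<open>S\<close>; the predicates \<open>P S\<close> detect these sets, and the homomorphism is the
  same join of meets computed in the target.\<close>

lemma free_distrib_lattice_onI:
  fixes g :: "'i \<Rightarrow> 'a"
  assumes dl: "distrib_lattice_on L j m" and g: "g ` I \<subseteq> L"
    and gen: "\<And>M. \<lbrakk>M \<subseteq> L; g ` I \<subseteq> M; \<And>x y. x \<in> M \<Longrightarrow> y \<in> M \<Longrightarrow> j x y \<in> M \<and> m x y \<in> M\<rbrakk> \<Longrightarrow> M = L"
    and I: "finite I" "I \<noteq> {}"
    and P: "\<And>S. \<lbrakk>S \<subseteq> I; S \<noteq> {}; S \<noteq> I\<rbrakk> \<Longrightarrow> \<exists>P. (\<forall>x\<in>L. \<forall>y\<in>L. (P (j x y) \<longleftrightarrow> P x \<or> P y) \<and> (P (m x y) \<longleftrightarrow> P x \<and> P y))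
        \<and> (\<forall>i\<in>I. P (g i) \<longleftrightarrow> i \<in> S)"
  shows "free_distrib_lattice_on TYPE('l) L j m I g"
proof -
  interpret L: dlattice L j m
    by unfold_locales (fact dl)
  have "\<exists>P. (\<forall>x\<in>L. \<forall>y\<in>L. (P (j x y) \<longleftrightarrow> P x \<or> P y) \<and> (P (m x y) \<longleftrightarrow> P x \<and> P y)) \<and> (\<forall>i\<in>I. P (g i) \<longleftrightarrow> i \<in> S)"
    if "S \<subseteq> I" "S \<noteq> {}" for S
  proof (cases "S = I")
    \<comment> \<open>For the full set the constantly true predicate has all required
      properties.\<close>
    case True
    then show ?thesis
      by (intro exI[of _ "\<lambda>_. True"]) auto
  qed (use P that in blast)
  then have "\<forall>S. \<exists>P. S \<subseteq> I \<and> S \<noteq> {} \<longrightarrow> (\<forall>x\<in>L. \<forall>y\<in>L. (P (j x y) \<longleftrightarrow> P x \<or> P y) \<and> (P (m x y) \<longleftrightarrow> P x \<and> P y))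
      \<and> (\<forall>i\<in>I. P (g i) \<longleftrightarrow> i \<in> S)"
    by simp
  from choice[OF this] obtain P where PS: "\<And>S. S \<subseteq> I \<and> S \<noteq> {} \<longrightarrow>
      (\<forall>x\<in>L. \<forall>y\<in>L. (P S (j x y) \<longleftrightarrow> P S x \<or> P S y) \<and> (P S (m x y) \<longleftrightarrow> P S x \<and> P S y))
      \<and> (\<forall>i\<in>I. P S (g i) \<longleftrightarrow> i \<in> S)"
    by auto
  define F where "F = {S. S \<subseteq> I \<and> S \<noteq> {}}"
  have FP: "P S (j x y) \<longleftrightarrow> P S x \<or> P S y" "P S (m x y) \<longleftrightarrow> P S x \<and> P S y"
    if "S \<in> F" "x \<in> L" "y \<in> L" for S x y
    using PS[of S] that by (simp_all add: F_def)
  have Fg: "P S (g i) \<longleftrightarrow> i \<in> S" if "S \<in> F" "i \<in> I" for S i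
    using PS[of S] that by (simp add: F_def)
  \<comment> \<open>The upper set of non-empty subsets that represents \<open>x\<close>;
    \<open>mono\<close> below shows that it is upward closed.\<close>
  define A where "A x = {S \<in> F. P S x}" for x
  have gen_induct: "Q x"
    if "x \<in> L" "\<And>i. i \<in> I \<Longrightarrow> Q (g i)" "\<And>x y. \<lbrakk>x \<in> L; y \<in> L; Q x; Q y\<rbrakk> \<Longrightarrow> Q (j x y) \<and> Q (m x y)" for Q x
  proof -
    have "{x \<in> L. Q x} = L"
      by (rule gen) (use that g in auto)
    then show "Q x"
      using that(1) by blast
  qed
  have mono: "P S x \<longrightarrow> P T x" if "x \<in> L" "S \<in> F" "T \<in> F" "S \<subseteq> T" for x S T
    by (rule gen_induct[OF that(1)]) (use that(2-) in \<open>auto simp: Fg FP\<close>)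
  have IF: "I \<in> F"
    using I by (simp add: F_def)
  \<comment> \<open>Puts \<open>I\<close> into every \<open>A x\<close>. As there is no bottom
    element, the join defining \<open>h x\<close> has to range over a non-empty family.\<close>
  have top: "P I x" if "x \<in> L" for x
    by (rule gen_induct[OF that]) (simp_all add: Fg FP IF)
  have A: "finite (A x)" "A x \<noteq> {}" if "x \<in> L" for x
  proof -
    have "A x \<subseteq> Pow I"
      by (auto simp: A_def F_def)
    then show "finite (A x)"
      using I finite_subset by blast
    show "A x \<noteq> {}"
      using top[OF that] IF by (auto simp: A_def)
  qed
  have "\<exists>h. lattice_hom_on L j m L' j' m' h \<and> (\<forall>i\<in>I. h (g i) = l i)"
    if dl': "distrib_lattice_on L' j' m'" and l: "l ` I \<subseteq> L'" for L' :: "'l set" and j' m' l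
  proof -
    interpret T: dlattice L' j' m'
      by unfold_locales (fact dl')
    have "\<exists>u\<in>L'. \<forall>z\<in>L'. T.le z u \<longleftrightarrow> (\<forall>i\<in>S. T.le z (l i))" if "S \<in> F" for S
      using that l I by (intro T.finite_meet) (auto simp: F_def dest: finite_subset)
    then obtain Mt where Mt: "\<And>S. S \<in> F \<Longrightarrow> Mt S \<in> L'"
      "\<And>S z. S \<in> F \<Longrightarrow> z \<in> L' \<Longrightarrow> T.le z (Mt S) \<longleftrightarrow> (\<forall>i\<in>S. T.le z (l i))"
      by metis
    have AF: "Mt ` A x \<subseteq> L'" for x
      using Mt(1) by (auto simp: A_def)
    have "\<exists>u. T.is_sup u (A x) Mt" if "x \<in> L" for x
      using A[OF that] AF by (intro T.finite_sup)
    then obtain h where h: "\<And>x. x \<in> L \<Longrightarrow> T.is_sup (h x) (A x) Mt"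
      by metis
    have hL: "h x \<in> L'" if "x \<in> L" for x
      using h[OF that] by (simp add: T.is_sup_def)
    have hle: "T.le (h x) z \<longleftrightarrow> (\<forall>S\<in>A x. T.le (Mt S) z)" if "x \<in> L" "z \<in> L'" for x z
      using h[OF that(1)] that(2) by (simp add: T.is_sup_def)
    have hmeet: "T.le (m' c (h x)) z \<longleftrightarrow> (\<forall>S\<in>A x. T.le (m' c (Mt S)) z)" if "x \<in> L" "c \<in> L'" "z \<in> L'" for x c z
      using h[OF that(1)] that(2,3) by (simp add: T.is_sup_def)
    have FU: "S \<union> S' \<in> F" if "S \<in> F" "S' \<in> F" for S S'
      using that by (auto simp: F_def)
    have MtU: "m' (Mt S) (Mt S') = Mt (S \<union> S')" if "S \<in> F" "S' \<in> F" for S S'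
      using that FU[OF that] by (intro T.eqI_below) (auto simp: Mt T.le_meet)
    have hj: "h (j x y) = j' (h x) (h y)" if "x \<in> L" "y \<in> L" for x y
    proof (rule T.eqI_above)
      fix z assume "z \<in> L'"
      moreover have "A (j x y) = A x \<union> A y"
        using that FP(1) by (auto simp: A_def)
      ultimately show "T.le (h (j x y)) z \<longleftrightarrow> T.le (j' (h x) (h y)) z"
        using that by (auto simp: hL hle T.join_le)
    qed (use that in \<open>auto simp: hL\<close>)
    have hm: "h (m x y) = m' (h x) (h y)" if xy: "x \<in> L" "y \<in> L" for x y
    proof (rule T.eqI_above)
      fix z assume z: "z \<in> L'"
      have Am: "A (m x y) = A x \<inter> A y"
        using that FP(2) by (auto simp: A_def)
      have AL: "S \<in> F" "Mt S \<in> L'" if "S \<in> A x" for S x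
        using that Mt(1) by (auto simp: A_def)
      \<comment> \<open>Distributivity produces meets over unions \<open>S \<union> S'\<close>.
        Upward closure places these unions in \<open>A x \<inter> A y\<close>; conversely, a common
        set is the union of itself with itself.\<close>
      have up: "S \<union> S' \<in> A x" "S' \<union> S \<in> A x" if "S \<in> A x" "S' \<in> F" "x \<in> L" for S S' x
        using that mono[OF that(3), of S "S \<union> S'"] FU[of S S'] by (auto simp: A_def Un_commute)
      have "T.le (m' (h x) (h y)) z \<longleftrightarrow> (\<forall>S'\<in>A y. T.le (m' (h x) (Mt S')) z)"
        by (rule hmeet[OF xy(2) hL[OF xy(1)] z])
      also have "\<dots> \<longleftrightarrow> (\<forall>S'\<in>A y. T.le (m' (Mt S') (h x)) z)"
        using AL xy by (simp add: T.comm(2)[of "h x"] hL)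
      also have "\<dots> \<longleftrightarrow> (\<forall>S'\<in>A y. \<forall>S\<in>A x. T.le (m' (Mt S') (Mt S)) z)"
        using AL by (simp add: hmeet[OF xy(1) _ z])
      also have "\<dots> \<longleftrightarrow> (\<forall>S'\<in>A y. \<forall>S\<in>A x. T.le (Mt (S' \<union> S)) z)"
        using AL(1) by (simp add: MtU)
      also have "\<dots> \<longleftrightarrow> (\<forall>S\<in>A x \<inter> A y. T.le (Mt S) z)"
        using up AL(1) xy by (metis IntD1 IntD2 IntI Un_absorb)
      also have "\<dots> \<longleftrightarrow> T.le (h (m x y)) z"
        using xy z by (simp add: hle Am)
      finally show "T.le (h (m x y)) z \<longleftrightarrow> T.le (m' (h x) (h y)) z" ..
    qed (use that in \<open>auto simp: hL\<close>)
    have "h (g i) = l i" if i: "i \<in> I" for i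
    proof (rule T.eqI_above)
      have gi: "g i \<in> L" and li: "l i \<in> L'"
        using i g l by auto
      have si: "{i} \<in> F"
        using i by (auto simp: F_def)
      have Ag: "A (g i) = {S \<in> F. i \<in> S}"
        using Fg i by (auto simp: A_def)
      have Ms: "Mt {i} = l i"
        using Mt[OF si] li by (intro T.eqI_below) auto
      show "h (g i) \<in> L'" "l i \<in> L'"
        using hL[OF gi] li by auto
      fix z assume z: "z \<in> L'"
      \<comment> \<open>Among the sets containing \<open>i\<close> the singleton has the greatest
        meet, so the join over \<open>A (g i)\<close> collapses to \<open>l i\<close>.\<close>
      have "T.le (Mt S) z" if "S \<in> F" "i \<in> S" "T.le (l i) z" for S
        using that Mt[OF that(1)] T.le_refl[of "Mt S"] li z T.le_trans[of "Mt S" "l i" z] by auto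
      then show "T.le (h (g i)) z \<longleftrightarrow> T.le (l i) z"
        using si Ms by (auto simp: hle[OF gi z] Ag)
    qed
    then show ?thesis
      using hL hj hm by (intro exI[of _ h]) (auto simp: lattice_hom_on_def)
  qed
  then show ?thesis
    unfolding free_distrib_lattice_on_def
  proof (intro conjI allI impI)
    show "M = L" if "M \<subseteq> L" "g ` I \<subseteq> M \<and> (\<forall>x\<in>M. \<forall>y\<in>M. j x y \<in> M \<and> m x y \<in> M)" for M
      by (rule gen) (use that in auto)
  qed (use dl g in auto)
qed

section \<open>The lattice of the ideals \<open>ker \<pi>\<^sub>i\<close>\<close>

text \<open>The closed ideals themselves form one of the intersected families, because their sums
  are closed; this keeps the generated lattice inside them.\<close>

lemma (in calg) ideal_lattice:
  assumes "G \<subseteq> closed_ideals A"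
  shows "G \<subseteq> ideal_lattice A G" "ideal_lattice A G \<subseteq> closed_ideals A"
    and "\<And>K J. \<lbrakk>K \<in> ideal_lattice A G; J \<in> ideal_lattice A G\<rbrakk> \<Longrightarrow> K <+>\<^bsub>A\<^esub> J \<in> ideal_lattice A G \<and> K \<inter> J \<in> ideal_lattice A G"
    and "\<And>M. \<lbrakk>M \<subseteq> ideal_lattice A G; G \<subseteq> M; \<And>K J. K \<in> M \<Longrightarrow> J \<in> M \<Longrightarrow> K <+>\<^bsub>A\<^esub> J \<in> M \<and> K \<inter> J \<in> M\<rbrakk>
      \<Longrightarrow> M = ideal_lattice A G"
proof -
  show sub: "ideal_lattice A G \<subseteq> closed_ideals A"
    unfolding ideal_lattice_def
    by (rule Inter_lower) (use assms closed_ideals_set_add closed_ideals_Int in auto)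
  show "G \<subseteq> ideal_lattice A G"
    by (auto simp: ideal_lattice_def)
  show "K <+>\<^bsub>A\<^esub> J \<in> ideal_lattice A G \<and> K \<inter> J \<in> ideal_lattice A G"
    if "K \<in> ideal_lattice A G" "J \<in> ideal_lattice A G" for K J
    using that unfolding ideal_lattice_def by blast
  show "M = ideal_lattice A G"
    if "M \<subseteq> ideal_lattice A G" "G \<subseteq> M" "\<And>K J. K \<in> M \<Longrightarrow> J \<in> M \<Longrightarrow> K <+>\<^bsub>A\<^esub> J \<in> M \<and> K \<inter> J \<in> M" for M
  proof (rule antisym)
    show "ideal_lattice A G \<subseteq> M"
      unfolding ideal_lattice_def by (rule Inter_lower) (use that sub in auto)
  qed fact
qed

text \<open>Intersection acts as the join and sum as the meet: the order is reverse
  inclusion.\<close>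

lemma (in calg) distrib_lattice_ideal_lattice:
  assumes "G \<subseteq> closed_ideals A"
  shows "distrib_lattice_on (ideal_lattice A G) (\<inter>) (\<lambda>K J. K <+>\<^bsub>A\<^esub> J)"
proof -
  note L = ideal_lattice[OF assms]
  have c: "K \<in> closed_ideals A" if "K \<in> ideal_lattice A G" for K
    using L(2) that by auto
  show ?thesis
    unfolding distrib_lattice_on_def
  proof (intro conjI ballI)
    fix K J I assume K: "K \<in> ideal_lattice A G" and J: "J \<in> ideal_lattice A G" and I: "I \<in> ideal_lattice A G"
    note cl = c[OF K] c[OF J] c[OF I]
    show "(K <+>\<^bsub>A\<^esub> J) <+>\<^bsub>A\<^esub> I = K <+>\<^bsub>A\<^esub> (J <+>\<^bsub>A\<^esub> I)"
      by (rule closed_ideals_set_add_assoc[OF cl])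
    show "K <+>\<^bsub>A\<^esub> (J \<inter> I) = (K <+>\<^bsub>A\<^esub> J) \<inter> (K <+>\<^bsub>A\<^esub> I)"
      by (rule closed_ideals_set_add_distrib[OF cl])
    show "K \<inter> (J <+>\<^bsub>A\<^esub> I) = (K \<inter> J) <+>\<^bsub>A\<^esub> (K \<inter> I)"
      by (rule closed_ideals_Int_distrib[OF cl])
  next
    fix K J assume K: "K \<in> ideal_lattice A G" and J: "J \<in> ideal_lattice A G"
    show "K <+>\<^bsub>A\<^esub> J \<in> ideal_lattice A G" "K \<inter> J \<in> ideal_lattice A G"
      using L(3)[OF K J] by auto
    show "K <+>\<^bsub>A\<^esub> J = J <+>\<^bsub>A\<^esub> K"
      by (rule closed_ideals_set_add_commute[OF c[OF K] c[OF J]])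
    show "K \<inter> (K <+>\<^bsub>A\<^esub> J) = K" "K <+>\<^bsub>A\<^esub> (K \<inter> J) = K"
      by (rule closed_ideals_absorb[OF c[OF K] c[OF J]])+
  qed (rule Int_commute Int_assoc)+
qed

theorem theorem3p5:
  fixes N :: nat
  shows "free_distrib_lattice_on TYPE('l)
           (ideal_lattice (CP N) (ker_proj N ` {0..N}))
           (\<inter>) (\<lambda>I J. I <+>\<^bsub>CP N\<^esub> J)
           {0..N} (ker_proj N)"
proof -
  interpret C: calg "CP N" by (rule calg_CP)
  let ?L = "ideal_lattice (CP N) (ker_proj N ` {0..N})"
  have G: "ker_proj N ` {0..N} \<subseteq> closed_ideals (CP N)"
    using ker_proj_closed_ideal by auto
  note L = C.ideal_lattice[OF G]
  show ?thesis
  proof (rule free_distrib_lattice_onI)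
    show "distrib_lattice_on ?L (\<inter>) (\<lambda>I J. I <+>\<^bsub>CP N\<^esub> J)"
      by (rule C.distrib_lattice_ideal_lattice[OF G])
    show "M = ?L" if "M \<subseteq> ?L" "ker_proj N ` {0..N} \<subseteq> M"
      "\<And>x y. x \<in> M \<Longrightarrow> y \<in> M \<Longrightarrow> x \<inter> y \<in> M \<and> x <+>\<^bsub>CP N\<^esub> y \<in> M" for M
      using L(4)[of M] that by blast
    fix S assume S: "S \<subseteq> {0..N}" "S \<noteq> {}" "S \<noteq> {0..N}"
    let ?v = "bump N S"
    obtain \<phi> where phi: "\<phi> \<in> star_hom (CP N) shift_alg" "\<phi> ?v \<noteq> \<zero>\<^bsub>shift_alg\<^esub>"
      "\<And>j t. j \<in> S \<Longrightarrow> t \<in> ker_proj N j \<Longrightarrow> \<phi> t = \<zero>\<^bsub>shift_alg\<^esub>"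
      using separating_hom[OF S(1,2)] by blast
    define P where "P K \<longleftrightarrow> (\<forall>t\<in>K. \<phi> t = \<zero>\<^bsub>shift_alg\<^esub>)" for K
    have Pker: "P (ker_proj N i)" if "i \<in> S" for i
      using phi(3)[OF that] by (simp add: P_def)
    have ideal: "K \<subseteq> carrier (CP N)" "\<zero>\<^bsub>CP N\<^esub> \<in> K" if "K \<in> ?L" for K
    proof -
      have "ideal K (CP N)"
        using that L(2) by (auto simp: closed_ideals_def)
      then interpret K: ideal K "CP N" .
      show "K \<subseteq> carrier (CP N)" "\<zero>\<^bsub>CP N\<^esub> \<in> K"
        by (auto simp: K.a_subset)
    qed
    have v: "?v \<in> carrier (CP N)"
      by (rule bump_closed)
    have vker: "?v \<in> ker_proj N i" if "i \<in> {0..N}" "i \<notin> S" for i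
      using that v by (auto simp: ker_proj_eq bump_def)
    have add_subset: "K \<subseteq> K <+>\<^bsub>CP N\<^esub> J" "J \<subseteq> K <+>\<^bsub>CP N\<^esub> J" if "K \<in> ?L" "J \<in> ?L" for K J
    proof -
      have "x \<in> K <+>\<^bsub>CP N\<^esub> J" if "x \<in> K" for x
      proof -
        have "x = x \<oplus>\<^bsub>CP N\<^esub> \<zero>\<^bsub>CP N\<^esub>"
          using that ideal(1)[OF \<open>K \<in> ?L\<close>] by (simp add: subset_iff)
        then show ?thesis
          using that ideal(2)[OF \<open>J \<in> ?L\<close>] unfolding set_add_iff by (intro bexI)
      qed
      moreover have "x \<in> K <+>\<^bsub>CP N\<^esub> J" if "x \<in> J" for x
      proof -
        have "x = \<zero>\<^bsub>CP N\<^esub> \<oplus>\<^bsub>CP N\<^esub> x"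
          using that ideal(1)[OF \<open>J \<in> ?L\<close>] by (simp add: subset_iff)
        then show ?thesis
          using that ideal(2)[OF \<open>K \<in> ?L\<close>] unfolding set_add_iff by (intro bexI)
      qed
      ultimately show "K \<subseteq> K <+>\<^bsub>CP N\<^esub> J" "J \<subseteq> K <+>\<^bsub>CP N\<^esub> J"
        by auto
    qed
    have Padd: "P (K <+>\<^bsub>CP N\<^esub> J) \<longleftrightarrow> P K \<and> P J" if K: "K \<in> ?L" and J: "J \<in> ?L" for K J
    proof
      assume "P (K <+>\<^bsub>CP N\<^esub> J)"
      then show "P K \<and> P J"
        using add_subset[OF that] by (auto simp: P_def)
    next
      assume PK: "P K \<and> P J"
      have "\<phi> (x \<oplus>\<^bsub>CP N\<^esub> y) = \<zero>\<^bsub>shift_alg\<^esub>" if "x \<in> K" "y \<in> J" for x y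
      proof -
        have "x \<in> carrier (CP N)" "y \<in> carrier (CP N)"
          using that ideal(1) K J by auto
        then show ?thesis
          using star_hom_add[OF phi(1)] PK that by (simp add: P_def)
      qed
      then show "P (K <+>\<^bsub>CP N\<^esub> J)"
        by (auto simp: P_def set_add_iff)
    qed
    \<comment> \<open>Minimality of the generated lattice acts as induction. For an intersection,
      one annihilated ideal suffices; for a sum, one ideal containing \<open>?v\<close>
      suffices.\<close>
    have "{K \<in> ?L. P K \<or> ?v \<in> K} = ?L"
    proof (rule L(4))
      show "ker_proj N ` {0..N} \<subseteq> {K \<in> ?L. P K \<or> ?v \<in> K}"
        using L(1) vker Pker by blast
      fix K J assume "K \<in> {K \<in> ?L. P K \<or> ?v \<in> K}" "J \<in> {K \<in> ?L. P K \<or> ?v \<in> K}"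
      then have KJ: "K \<in> ?L" "J \<in> ?L" "P K \<or> ?v \<in> K" "P J \<or> ?v \<in> J"
        by auto
      have "P (K <+>\<^bsub>CP N\<^esub> J) \<or> ?v \<in> K <+>\<^bsub>CP N\<^esub> J"
        using Padd[OF KJ(1,2)] add_subset[OF KJ(1,2)] KJ(3,4) by blast
      moreover have "P (K \<inter> J) \<or> ?v \<in> K \<inter> J"
        using KJ(3,4) by (auto simp: P_def)
      ultimately show "K <+>\<^bsub>CP N\<^esub> J \<in> {K \<in> ?L. P K \<or> ?v \<in> K} \<and> K \<inter> J \<in> {K \<in> ?L. P K \<or> ?v \<in> K}"
        using L(3)[OF KJ(1,2)] by simp
    qed auto
    then have dich: "P K \<longleftrightarrow> ?v \<notin> K" if "K \<in> ?L" for K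
      using that phi(2) by (auto simp: P_def)
    \<comment> \<open>Read through \<open>dich\<close>: the intersection misses \<open>?v\<close>
      exactly when one of the two ideals does.\<close>
    have "P (K \<inter> J) \<longleftrightarrow> P K \<or> P J" if "K \<in> ?L" "J \<in> ?L" for K J
      using that L(3)[OF that] by (simp add: dich)
    moreover have "P (ker_proj N i) \<longleftrightarrow> i \<in> S" if "i \<in> {0..N}" for i
      using that L(1) dich[of "ker_proj N i"] vker[OF that] Pker[of i] by blast
    ultimately show "\<exists>P. (\<forall>x\<in>?L. \<forall>y\<in>?L. (P (x \<inter> y) \<longleftrightarrow> P x \<or> P y) \<and> (P (x <+>\<^bsub>CP N\<^esub> y) \<longleftrightarrow> P x \<and> P y))
        \<and> (\<forall>i\<in>{0..N}. P (ker_proj N i) \<longleftrightarrow> i \<in> S)"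
      using Padd by (intro exI[of _ P]) blast
  qed (use L(1) in auto)
qed

end
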